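(* Let $r\ge 2$ be an integer. (1) Let $G=SL_{2r}(\mathbb{C})$ and $K=S(GL_2^r)$. For any $n\in\mathbb{N}^r$, let $z\in\mathbb{Z}^{r-1}$ have components $z_i=n_i-n_{i-1}-n_r+n_{r-1}$ for $i\in[r-1]$. Then the multigraded component $\mathcal{H}_n$ of the $K$-harmonic polynomials on $V$ decomposes into irreducible representations of $K$ as $$\mathcal{H}_n\;\cong\;\bigoplus_{m\in\partial\Lambda_n}\ \bigoplus_{s\in\partial\lambda_m}F_{z,s}.$$ (2) Let instead $G=GL_{2r}(\mathbb{C})$ and $K=GL_2^r$. For any $n\in\mathbb{N}^r$, let $z\in\mathbb{Z}^r$ have components $z_i=n_i-n_{i-1}$ for $i\in[r]$. Then again $$\mathcal{H}_n\;\cong\;\bigoplus_{m\in\partial\Lambda_n}\ \bigoplus_{s\in\partial\lambda_m}F_{z,s}$$ is the decomposition of $\mathcal{H}_n$ into irreducible representations of $K$.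
   Context: The ground field is $\mathbb{C}$, $\mathbb{N}=\{0,1,2,\dots\}$, $[r]=\{1,\dots,r\}$, indices of elements of $\mathbb{N}^r$ and of the $r$-tuples below are read mod $r$ with representatives in $[r]$ (so $n_0=n_r$, $g_{r+1}=g_1$). Let $e=(1,\dots,1)\in\mathbb{N}^r$. For $k\in\mathbb{Z}$, $[k]_2=0$ if $k$ is even and $1$ if $k$ is odd. Groups: $GL_2=GL_2(\mathbb{C})$, $SL_2=SL_2(\mathbb{C})$; $S(GL_2^r)=\{(g_1,\dots,g_r)\in GL_2^r:\prod_j\det g_j=1\}$. These are the block-diagonal subgroups $K=G^\theta$ of $G$, where $\theta$ is conjugation by the diagonal matrix whose eigenvalues are the $r$th roots of unity, each with multiplicity 2. Action: $V=\bigoplus_{i\in[r]}M_i$ with $M_i=\mathrm{Hom}(V_i,V_{i+1})$, each $V_i=\mathbb{C}^2$ (this is the $e^{2\pi i/r}$-eigenspace of $d\theta$ on $\mathrm{Lie}(G)$). The element $g=(g_1,\dots,g_r)\in K$ acts on $(X_1,\dots,X_r)\in V$ by $X_i\mapsto g_{i+1}X_ig_i^{-1}$. $K$ acts on the polynomial ring $\mathbb{C}[V]$ by $(gf)(x)=f(g^{-1}x)$. For $n\in\mathbb{N}^r$, $\mathbb{C}[V]_n$ is the space of polynomials that are homogeneous of degree $n_i$ in the coordinates of $M_i$ for each $i$. Harmonics: identify $\mathrm{Sym}(V)$ with the constant-coefficient differential operators on $\mathbb{C}[V]$. $\mathcal{H}=\{f\in\mathbb{C}[V]:\Delta f=0$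 for every $K$-invariant constant-coefficient differential operator $\Delta$ without constant term$\}$, and $\mathcal{H}_n=\mathcal{H}\cap\mathbb{C}[V]_n$. Representations: $\mathbb{C}_k$ ($k\in\mathbb{Z}$) is the one-dimensional representation of $\mathbb{C}^\times$ with $w$ acting by $w^k$; $F_k=\mathrm{Sym}^k(\mathbb{C}^2)$ ($k\in\mathbb{N}$) is the irreducible $SL_2$-representation of dimension $k+1$. For $z\in\mathbb{Z}^\ell$, $s\in\mathbb{N}^r$, $F_{z,s}=\mathbb{C}_{z_1}\otimes\cdots\otimes\mathbb{C}_{z_\ell}\otimes F_{s_1}\otimes\cdots\otimes F_{s_r}$ is the outer tensor product representation of $\widetilde K=(\mathbb{C}^\times)^\ell\times SL_2^r$. For $K=GL_2^r$ take $\ell=r$ and the surjection $\varphi:\widetilde K\to K$, $(w_1,\dots,w_r,g_1,\dots,g_r)\mapsto(w_1g_1,\dots,w_rg_r)$; for $K=S(GL_2^r)$ take $\ell=r-1$ and the surjection $\varphi(w_1,\dots,w_{r-1},g_1,\dots,g_r)=(w_1g_1,\dots,w_{r-1}g_{r-1},w_1^{-1}\cdots w_{r-1}^{-1}g_r)$. When $\ker\varphi$ acts trivially on $F_{z,s}$, it is regarded as a representation of $K\cong\widetilde K/\ker\varphi$. Index sets: for $n,m\in\mathbb{N}^r$, $\Lambda_n=\prod_{i\in[r]}\{n_i,n_i-2,\dots,[n_i]_2\}\subset\mathbb{N}^r$, $\lambda_m=\prod_{i\in[r]}\{m_i+m_{i-1},\,m_i+m_{i-1}-2,\dots,|m_i-m_{i-1}|\}\subset\mathbb{N}^r$,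 $\partial\Lambda_n=\{x\in\Lambda_n:x+2e\notin\Lambda_n\}$, $\partial\lambda_m=\{x\in\lambda_m:x+2e\notin\lambda_m\}$. *)

theory Defs
  imports
    "HOL-Analysis.Determinants"
    "HOL-Library.Poly_Mapping"
    "HOL-Computational_Algebra.Polynomial"
    "HOL-Algebra.Product_Groups"
begin

abbreviation lookup :: "('a \<Rightarrow>\<^sub>0 'b::zero) \<Rightarrow> 'a \<Rightarrow> 'b" where
  "lookup \<equiv> Poly_Mapping.lookup"

abbreviation keys :: "('a \<Rightarrow>\<^sub>0 'b::zero) \<Rightarrow> 'a set" where
  "keys \<equiv> Poly_Mapping.keys"


section \<open>Complex vector spaces and representations\<close>

text \<open>The type \<open>'a \<Rightarrow>\<^sub>0 complex\<close> is the complex vector space with basis \<open>'a\<close>; all representation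
  spaces below are subspaces of such spaces.\<close>

definition scale :: "complex \<Rightarrow> ('a \<Rightarrow>\<^sub>0 complex) \<Rightarrow> ('a \<Rightarrow>\<^sub>0 complex)" where
  "scale c p = Poly_Mapping.map ((*) c) p"

lemma lookup_scale [simp]: "lookup (scale c p) k = c * lookup p k"
  by (simp add: scale_def map.rep_eq when_def)

global_interpretation cvec: vector_space "scale :: complex \<Rightarrow> ('a \<Rightarrow>\<^sub>0 complex) \<Rightarrow> _"
  by standard (auto intro!: poly_mapping_eqI simp: lookup_add algebra_simps)

definition linear_on ::
  "('a \<Rightarrow>\<^sub>0 complex) set \<Rightarrow> (('a \<Rightarrow>\<^sub>0 complex) \<Rightarrow> ('b \<Rightarrow>\<^sub>0 complex)) \<Rightarrow> bool" where
  "linear_on W f \<longleftrightarrow>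
     (\<forall>u\<in>W. \<forall>v\<in>W. f (u + v) = f u + f v) \<and> (\<forall>c. \<forall>v\<in>W. f (scale c v) = scale c (f v))"

definition representation ::
  "('g, 'x) monoid_scheme \<Rightarrow> ('a \<Rightarrow>\<^sub>0 complex) set \<Rightarrow>
   ('g \<Rightarrow> ('a \<Rightarrow>\<^sub>0 complex) \<Rightarrow> ('a \<Rightarrow>\<^sub>0 complex)) \<Rightarrow> bool" where
  "representation G W \<rho> \<longleftrightarrow>
     group G \<and> cvec.subspace W \<and>
     (\<forall>g\<in>carrier G. \<rho> g ` W \<subseteq> W \<and> linear_on W (\<rho> g)) \<and>
     (\<forall>v\<in>W. \<rho> \<one>\<^bsub>G\<^esub> v = v) \<and>
     (\<forall>g\<in>carrier G. \<forall>h\<in>carrier G. \<forall>v\<in>W. \<rho> (g \<otimes>\<^bsub>G\<^esub> h) v = \<rho> g (\<rho> h v))"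

definition irreducible_representation ::
  "('g, 'x) monoid_scheme \<Rightarrow> ('a \<Rightarrow>\<^sub>0 complex) set \<Rightarrow>
   ('g \<Rightarrow> ('a \<Rightarrow>\<^sub>0 complex) \<Rightarrow> ('a \<Rightarrow>\<^sub>0 complex)) \<Rightarrow> bool" where
  "irreducible_representation G W \<rho> \<longleftrightarrow>
     representation G W \<rho> \<and> W \<noteq> {0} \<and>
     (\<forall>U. cvec.subspace U \<and> U \<subseteq> W \<and> (\<forall>g\<in>carrier G. \<rho> g ` U \<subseteq> U) \<longrightarrow> U = {0} \<or> U = W)"

text \<open>The (external) direct sum of a finite family \<open>U i\<close> consists of the families in
  \<open>\<Pi>\<^sub>E i\<in>I. U i\<close>, with componentwise operations and action; an isomorphism onto it is given by its
  components \<open>T i\<close>.\<close>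

definition isomorphic_to_direct_sum ::
  "('g, 'x) monoid_scheme \<Rightarrow> ('a \<Rightarrow>\<^sub>0 complex) set \<Rightarrow>
   ('g \<Rightarrow> ('a \<Rightarrow>\<^sub>0 complex) \<Rightarrow> ('a \<Rightarrow>\<^sub>0 complex)) \<Rightarrow> 'i set \<Rightarrow>
   ('i \<Rightarrow> ('b \<Rightarrow>\<^sub>0 complex) set) \<Rightarrow> ('i \<Rightarrow> 'g \<Rightarrow> ('b \<Rightarrow>\<^sub>0 complex) \<Rightarrow> ('b \<Rightarrow>\<^sub>0 complex)) \<Rightarrow> bool" where
  "isomorphic_to_direct_sum G W \<rho> I U \<sigma> \<longleftrightarrow>
     finite I \<and>
     (\<exists>T. (\<forall>i\<in>I. linear_on W (T i) \<and>
                 (\<forall>g\<in>carrier G. \<forall>v\<in>W. T i (\<rho> g v) = \<sigma> i g (T i v))) \<and>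
          bij_betw (\<lambda>v. \<lambda>i\<in>I. T i v) W (\<Pi>\<^sub>E i\<in>I. U i))"

definition irreducible_decomposition ::
  "('g, 'x) monoid_scheme \<Rightarrow> ('a \<Rightarrow>\<^sub>0 complex) set \<Rightarrow>
   ('g \<Rightarrow> ('a \<Rightarrow>\<^sub>0 complex) \<Rightarrow> ('a \<Rightarrow>\<^sub>0 complex)) \<Rightarrow> 'i set \<Rightarrow>
   ('i \<Rightarrow> ('b \<Rightarrow>\<^sub>0 complex) set) \<Rightarrow> ('i \<Rightarrow> 'g \<Rightarrow> ('b \<Rightarrow>\<^sub>0 complex) \<Rightarrow> ('b \<Rightarrow>\<^sub>0 complex)) \<Rightarrow> bool" where
  "irreducible_decomposition G W \<rho> I U \<sigma> \<longleftrightarrow>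
     representation G W \<rho> \<and>
     (\<forall>i\<in>I. irreducible_representation G (U i) (\<sigma> i)) \<and>
     isomorphic_to_direct_sum G W \<rho> I U \<sigma>"

text \<open>Given a surjective homomorphism \<open>\<phi>\<close> from \<open>G\<close> to \<open>H\<close> whose kernel acts trivially under \<open>\<rho>\<close>,
  this is the induced action of \<open>H\<close>; the choice of preimage is then irrelevant. It is used with the
  maps \<open>phi_GL\<close> and \<open>phi_S\<close>, shown below to be surjective homomorphisms (\<open>phi_GL_hom\<close>,
  \<open>phi_GL_surj\<close>, \<open>phi_S_hom\<close>, \<open>phi_S_surj\<close>).\<close>

definition descend :: "('g, 'x) monoid_scheme \<Rightarrow> ('g \<Rightarrow> 'h) \<Rightarrow> ('g \<Rightarrow> 'v) \<Rightarrow> 'h \<Rightarrow> 'v" where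
  "descend G \<phi> \<rho> h = \<rho> (inv_into (carrier G) \<phi> h)"


section \<open>The groups\<close>

type_synonym mat2 = "complex^2^2"

definition GL2 :: "mat2 monoid" where
  "GL2 = \<lparr>carrier = {A. invertible A}, monoid.mult = (**), one = mat 1\<rparr>"

definition SL2 :: "mat2 monoid" where
  "SL2 = \<lparr>carrier = {A. det A = 1}, monoid.mult = (**), one = mat 1\<rparr>"

definition Cstar :: "complex monoid" where
  "Cstar = \<lparr>carrier = UNIV - {0}, monoid.mult = (*), one = 1\<rparr>"

text \<open>Tuples indexed by \<open>[r]\<close> are functions on \<open>{1..r}\<close>, extended by \<open>undefined\<close>.\<close>

definition GL2_pow :: "nat \<Rightarrow> (nat \<Rightarrow> mat2) monoid" where
  "GL2_pow r = product_group {1..r} (\<lambda>_. GL2)"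

definition S_GL2_pow :: "nat \<Rightarrow> (nat \<Rightarrow> mat2) monoid" where
  "S_GL2_pow r = (GL2_pow r)
     \<lparr>carrier := {g \<in> carrier (GL2_pow r). (\<Prod>j\<in>{1..r}. det (g j)) = 1}\<rparr>"

definition K_tilde :: "nat \<Rightarrow> nat \<Rightarrow> ((nat \<Rightarrow> complex) \<times> (nat \<Rightarrow> mat2)) monoid" where
  "K_tilde l r = product_group {1..l} (\<lambda>_. Cstar) \<times>\<times> product_group {1..r} (\<lambda>_. SL2)"

text \<open>\<open>mat c\<close> is the scalar matrix \<open>c\<close>.\<close>

definition phi_GL :: "nat \<Rightarrow> (nat \<Rightarrow> complex) \<times> (nat \<Rightarrow> mat2) \<Rightarrow> (nat \<Rightarrow> mat2)" where
  "phi_GL r = (\<lambda>(w, g). \<lambda>i\<in>{1..r}. mat (w i) ** g i)"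

definition phi_S :: "nat \<Rightarrow> (nat \<Rightarrow> complex) \<times> (nat \<Rightarrow> mat2) \<Rightarrow> (nat \<Rightarrow> mat2)" where
  "phi_S r = (\<lambda>(w, g). \<lambda>i\<in>{1..r}.
     mat (if i < r then w i else (\<Prod>j\<in>{1..r-1}. inverse (w j))) ** g i)"


section \<open>Polynomials on V and the action of K\<close>

text \<open>Cyclic successor and predecessor on \<open>[r]\<close>.\<close>

definition nxt :: "nat \<Rightarrow> nat \<Rightarrow> nat" where
  "nxt r i = (if i = r then 1 else i + 1)"

definition prv :: "nat \<Rightarrow> nat \<Rightarrow> nat" where
  "prv r i = (if i = 1 then r else i - 1)"

text \<open>The variable \<open>(i, a, b)\<close> is the coordinate function \<open>X \<mapsto> X i $ a $ b\<close> on \<open>V\<close>, so a polynomial is a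
  finitely supported function from monomials to coefficients.\<close>

type_synonym var = "nat \<times> 2 \<times> 2"
type_synonym mpoly = "(var \<Rightarrow>\<^sub>0 nat) \<Rightarrow>\<^sub>0 complex"

definition CV :: "nat \<Rightarrow> mpoly set" where
  "CV r = {f. \<forall>\<alpha>\<in>keys f. \<forall>(i, a, b)\<in>keys \<alpha>. i \<in> {1..r}}"

definition CV_graded :: "nat \<Rightarrow> (nat \<Rightarrow> nat) \<Rightarrow> mpoly set" where
  "CV_graded r n =
     {f \<in> CV r. \<forall>\<alpha>\<in>keys f. \<forall>i\<in>{1..r}. (\<Sum>a\<in>UNIV. \<Sum>b\<in>UNIV. lookup \<alpha> (i, a, b)) = n i}"

definition const_poly :: "complex \<Rightarrow> mpoly" where
  "const_poly c = Poly_Mapping.single 0 c"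

definition var_poly :: "var \<Rightarrow> mpoly" where
  "var_poly v = Poly_Mapping.single (Poly_Mapping.single v 1) 1"

definition subst :: "(var \<Rightarrow> mpoly) \<Rightarrow> mpoly \<Rightarrow> mpoly" where
  "subst \<sigma> f = (\<Sum>\<alpha>\<in>keys f. const_poly (lookup f \<alpha>) * (\<Prod>v\<in>keys \<alpha>. \<sigma> v ^ lookup \<alpha> v))"

definition const_mat :: "mat2 \<Rightarrow> mpoly^2^2" where
  "const_mat A = (\<chi> a b. const_poly (A $ a $ b))"

definition generic_mat :: "nat \<Rightarrow> mpoly^2^2" where
  "generic_mat i = (\<chi> a b. var_poly (i, a, b))"

definition V_act :: "nat \<Rightarrow> (nat \<Rightarrow> mat2) \<Rightarrow> (nat \<Rightarrow> mat2) \<Rightarrow> (nat \<Rightarrow> mat2)" where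
  "V_act r g X = (\<lambda>i\<in>{1..r}. g (nxt r i) ** X i ** matrix_inv (g i))"

text \<open>\<open>(g f)(X) = f (g\<inverse> X)\<close>: substitute the entries of the matrix \<open>(g\<inverse> X)\<^sub>i = g\<^sub>i\<^sub>+\<^sub>1\<inverse> X\<^sub>i g\<^sub>i\<close>.
  See \<open>poly_eval_poly_act\<close> below for the pointwise form.\<close>

definition poly_act :: "nat \<Rightarrow> (nat \<Rightarrow> mat2) \<Rightarrow> mpoly \<Rightarrow> mpoly" where
  "poly_act r g = subst (\<lambda>(i, a, b).
     (const_mat (matrix_inv (g (nxt r i))) ** generic_mat i ** const_mat (g i)) $ a $ b)"

definition poly_eval :: "(nat \<Rightarrow> mat2) \<Rightarrow> mpoly \<Rightarrow> complex" where
  "poly_eval X f = (\<Sum>\<alpha>\<in>keys f. lookup f \<alpha> * (\<Prod>(i, a, b)\<in>keys \<alpha>. (X i $ a $ b) ^ lookup \<alpha> (i, a, b)))"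


section \<open>Harmonic polynomials\<close>

text \<open>A polynomial \<open>D\<close> is read as the constant-coefficient operator \<open>\<Sum>\<^sub>\<beta> D\<^sub>\<beta> \<partial>\<^sup>\<beta>\<close> (an element of
  \<open>Sym(V)\<close>), where \<open>\<partial>\<^sup>\<beta> x\<^sup>\<alpha> = (\<Prod>\<^sub>v \<alpha>\<^sub>v (\<alpha>\<^sub>v - 1) \<dots> (\<alpha>\<^sub>v - \<beta>\<^sub>v + 1)) x\<^sup>\<alpha>\<^sup>-\<^sup>\<beta>\<close>; the coefficient
  vanishes unless \<open>\<beta> \<le> \<alpha>\<close>.\<close>

definition diffop :: "mpoly \<Rightarrow> mpoly \<Rightarrow> mpoly" where
  "diffop D f = (\<Sum>\<beta>\<in>keys D. \<Sum>\<alpha>\<in>keys f. Poly_Mapping.single (\<alpha> - \<beta>)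
     (lookup D \<beta> * lookup f \<alpha> *
      of_nat (\<Prod>v\<in>keys \<beta>. fact (lookup \<beta> v) * (lookup \<alpha> v choose lookup \<beta> v))))"

definition invariant_diffop :: "(nat \<Rightarrow> mat2) monoid \<Rightarrow> nat \<Rightarrow> mpoly \<Rightarrow> bool" where
  "invariant_diffop K r D \<longleftrightarrow>
     (\<forall>g\<in>carrier K. \<forall>f\<in>CV r. diffop D (poly_act r g f) = poly_act r g (diffop D f))"

text \<open>\<open>lookup D 0\<close> is the constant term of \<open>D\<close>.\<close>

definition harmonic :: "(nat \<Rightarrow> mat2) monoid \<Rightarrow> nat \<Rightarrow> mpoly set" where
  "harmonic K r =
     {f \<in> CV r. \<forall>D\<in>CV r. invariant_diffop K r D \<and> lookup D 0 = 0 \<longrightarrow> diffop D f = 0}"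

definition harmonic_graded :: "(nat \<Rightarrow> mat2) monoid \<Rightarrow> nat \<Rightarrow> (nat \<Rightarrow> nat) \<Rightarrow> mpoly set" where
  "harmonic_graded K r n = harmonic K r \<inter> CV_graded r n"


section \<open>The representations F\<close>

text \<open>Matrix entry in row \<open>a\<close>, column \<open>b\<close> of \<open>Sym\<^sup>k(A)\<close> in the basis \<open>e\<^sub>1\<^sup>k\<^sup>-\<^sup>b e\<^sub>2\<^sup>b\<close> (\<open>0 \<le> b \<le> k\<close>) of
  \<open>Sym\<^sup>k(\<complex>\<^sup>2)\<close>: writing \<open>1\<close> for \<open>e\<^sub>1\<close> and \<open>t\<close> for \<open>e\<^sub>2\<close>, the \<open>b\<close>-th basis vector is sent to
  \<open>(A e\<^sub>1)\<^sup>k\<^sup>-\<^sup>b (A e\<^sub>2)\<^sup>b = (A\<^sub>1\<^sub>1 + A\<^sub>2\<^sub>1 t)\<^sup>k\<^sup>-\<^sup>b (A\<^sub>1\<^sub>2 + A\<^sub>2\<^sub>2 t)\<^sup>b\<close>.\<close>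

definition sym_power_entry :: "nat \<Rightarrow> mat2 \<Rightarrow> nat \<Rightarrow> nat \<Rightarrow> complex" where
  "sym_power_entry k A a b =
     poly.coeff ([:A $ 1 $ 1, A $ 2 $ 1:] ^ (k - b) * [:A $ 1 $ 2, A $ 2 $ 2:] ^ b) a"

text \<open>The outer tensor product has as basis the tuples \<open>b\<close> of basis indices, standing for
  \<open>e\<^sub>b\<^sub>1 \<otimes> \<dots> \<otimes> e\<^sub>b\<^sub>r\<close>; a group element acts by the Kronecker product of the matrices of the factors,
  the one-dimensional factors contributing \<open>w\<^sub>j\<close> to the power \<open>z\<^sub>j\<close>.\<close>

definition F_basis :: "nat \<Rightarrow> (nat \<Rightarrow> nat) \<Rightarrow> (nat \<Rightarrow> nat) set" where
  "F_basis r s = (\<Pi>\<^sub>E i\<in>{1..r}. {0..s i})"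

definition F_space :: "nat \<Rightarrow> (nat \<Rightarrow> nat) \<Rightarrow> ((nat \<Rightarrow> nat) \<Rightarrow>\<^sub>0 complex) set" where
  "F_space r s = {v. keys v \<subseteq> F_basis r s}"

definition F_act :: "nat \<Rightarrow> nat \<Rightarrow> (nat \<Rightarrow> int) \<Rightarrow> (nat \<Rightarrow> nat) \<Rightarrow> (nat \<Rightarrow> complex) \<times> (nat \<Rightarrow> mat2) \<Rightarrow>
    ((nat \<Rightarrow> nat) \<Rightarrow>\<^sub>0 complex) \<Rightarrow> ((nat \<Rightarrow> nat) \<Rightarrow>\<^sub>0 complex)" where
  "F_act l r z s = (\<lambda>(w, g) v. \<Sum>a\<in>F_basis r s. Poly_Mapping.single a
     ((\<Prod>j\<in>{1..l}. w j powi z j) *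
      (\<Sum>b\<in>F_basis r s. (\<Prod>i\<in>{1..r}. sym_power_entry (s i) (g i) (a i) (b i)) * lookup v b)))"


section \<open>The index sets\<close>

text \<open>\<open>{hi, hi - 2, \<dots>, lo}\<close>, for \<open>lo \<le> hi\<close> of equal parity.\<close>

definition steps_by_2 :: "nat \<Rightarrow> nat \<Rightarrow> nat set" where
  "steps_by_2 hi lo = {x \<in> {lo..hi}. even (hi - x)}"

definition Lambda_big :: "nat \<Rightarrow> (nat \<Rightarrow> nat) \<Rightarrow> (nat \<Rightarrow> nat) set" where
  "Lambda_big r n = (\<Pi>\<^sub>E i\<in>{1..r}. steps_by_2 (n i) (n i mod 2))"

definition lambda_small :: "nat \<Rightarrow> (nat \<Rightarrow> nat) \<Rightarrow> (nat \<Rightarrow> nat) set" where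
  "lambda_small r m = (\<Pi>\<^sub>E i\<in>{1..r}.
     steps_by_2 (m i + m (prv r i)) (nat \<bar>int (m i) - int (m (prv r i))\<bar>))"

definition boundary :: "nat \<Rightarrow> (nat \<Rightarrow> nat) set \<Rightarrow> (nat \<Rightarrow> nat) set" where
  "boundary r S = {x \<in> S. (\<lambda>i\<in>{1..r}. x i + 2) \<notin> S}"


section \<open>Pointwise description of the action, and surjectivity of the coverings\<close>

lemma matrix_inv_unique':
  fixes A B :: mat2
  assumes "A ** B = mat 1" "B ** A = mat 1"
  shows "matrix_inv A = B"
proof -
  have "A ** matrix_inv A = mat 1 \<and> matrix_inv A ** A = mat 1"
    unfolding matrix_inv_def by (rule someI[of _ B]) (use assms in auto)
  then show ?thesis
    using assms(2) by (metis matrix_mul_assoc matrix_mul_lid matrix_mul_rid)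
qed

lemma matrix_inv_right: "invertible A \<Longrightarrow> A ** matrix_inv A = mat 1"
  and matrix_inv_left: "invertible A \<Longrightarrow> matrix_inv A ** A = mat 1" for A :: mat2
  unfolding invertible_def by (metis matrix_inv_unique')+

lemma group_GL2: "group GL2"
proof (rule groupI)
  fix A assume "A \<in> carrier GL2"
  then have A: "invertible A" by (simp add: GL2_def)
  then have "invertible (matrix_inv A)"
    unfolding invertible_def[of "matrix_inv A"] using matrix_inv_left matrix_inv_right by blast
  with A show "\<exists>B\<in>carrier GL2. B \<otimes>\<^bsub>GL2\<^esub> A = \<one>\<^bsub>GL2\<^esub>"
    by (auto simp: GL2_def matrix_inv_left intro!: bexI[of _ "matrix_inv A"])
qed (auto simp: GL2_def matrix_mul_assoc invertible_det_nz det_mul)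

lemma inv_GL2: "A \<in> carrier GL2 \<Longrightarrow> inv\<^bsub>GL2\<^esub> A = matrix_inv A"
  by (rule group.inv_equality[OF group_GL2])
    (auto simp: GL2_def matrix_inv_left invertible_def, metis matrix_inv_left matrix_inv_right invertible_def)

lemma poly_eval_altdef:
  assumes "finite S" "keys f \<subseteq> S"
  shows "poly_eval X f =
    (\<Sum>\<alpha>\<in>S. lookup f \<alpha> * (\<Prod>v\<in>keys \<alpha>. (case v of (i, a, b) \<Rightarrow> X i $ a $ b) ^ lookup \<alpha> v))"
  unfolding poly_eval_def
  by (rule sum.mono_neutral_cong_left)
    (use assms in \<open>auto simp: in_keys_iff case_prod_beta intro!: prod.cong\<close>)

lemma poly_eval_0 [simp]: "poly_eval X 0 = 0"
  by (simp add: poly_eval_def)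

lemma poly_eval_single:
  "poly_eval X (Poly_Mapping.single \<alpha> c) =
     c * (\<Prod>v\<in>keys \<alpha>. (case v of (i, a, b) \<Rightarrow> X i $ a $ b) ^ lookup \<alpha> v)"
  by (subst poly_eval_altdef[of "{\<alpha>}"]) auto

lemma poly_eval_const [simp]: "poly_eval X (const_poly c) = c"
  by (simp add: const_poly_def poly_eval_single)

lemma poly_eval_var [simp]: "poly_eval X (var_poly (i, a, b)) = X i $ a $ b"
  by (simp add: var_poly_def poly_eval_single)

lemma poly_eval_add [simp]: "poly_eval X (f + g) = poly_eval X f + poly_eval X g"
proof -
  let ?S = "keys f \<union> keys g"
  show ?thesis
    using keys_add[of f g]
    by (simp add: poly_eval_altdef[of ?S] lookup_add sum.distrib[symmetric] distrib_right)
qed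

lemma poly_eval_sum [simp]: "poly_eval X (sum h A) = (\<Sum>a\<in>A. poly_eval X (h a))"
  by (induction A rule: infinite_finite_induct) auto

lemma poly_eq_sum_single: "f = (\<Sum>\<alpha>\<in>keys f. Poly_Mapping.single \<alpha> (lookup f \<alpha>))"
  by (rule poly_mapping_eqI)
    (simp add: lookup_sum lookup_single when_def sum.delta in_keys_iff)

lemma poly_eval_mult_single:
  "poly_eval X (Poly_Mapping.single \<alpha> c * Poly_Mapping.single \<beta> d) =
   poly_eval X (Poly_Mapping.single \<alpha> c) * poly_eval X (Poly_Mapping.single \<beta> d)"
proof -
  let ?S = "keys \<alpha> \<union> keys \<beta>" and ?x = "\<lambda>v. case v of (i, a, b) \<Rightarrow> X i $ a $ b"
  have *: "(\<Prod>v\<in>keys \<gamma>. ?x v ^ lookup \<gamma> v) = (\<Prod>v\<in>?S. ?x v ^ lookup \<gamma> v)"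
    if "keys \<gamma> \<subseteq> ?S" for \<gamma>
    by (rule prod.mono_neutral_left) (use that in \<open>auto simp: in_keys_iff\<close>)
  have "(\<Prod>v\<in>keys (\<alpha> + \<beta>). ?x v ^ lookup (\<alpha> + \<beta>) v) =
      (\<Prod>v\<in>keys \<alpha>. ?x v ^ lookup \<alpha> v) * (\<Prod>v\<in>keys \<beta>. ?x v ^ lookup \<beta> v)"
    unfolding *[OF keys_add] *[OF Un_upper1] *[OF Un_upper2]
    by (simp add: lookup_add power_add prod.distrib)
  then show ?thesis
    by (simp add: mult_single poly_eval_single)
qed

lemma poly_eval_mult [simp]: "poly_eval X (f * g) = poly_eval X f * poly_eval X g"
proof -
  have "f * g = (\<Sum>\<alpha>\<in>keys f. Poly_Mapping.single \<alpha> (lookup f \<alpha>)) *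
      (\<Sum>\<beta>\<in>keys g. Poly_Mapping.single \<beta> (lookup g \<beta>))"
    by (simp flip: poly_eq_sum_single)
  also have "poly_eval X \<dots> =
      poly_eval X (\<Sum>\<alpha>\<in>keys f. Poly_Mapping.single \<alpha> (lookup f \<alpha>)) *
      poly_eval X (\<Sum>\<beta>\<in>keys g. Poly_Mapping.single \<beta> (lookup g \<beta>))"
    by (simp add: sum_product poly_eval_mult_single)
  also have "\<dots> = poly_eval X f * poly_eval X g"
    by (simp flip: poly_eq_sum_single)
  finally show ?thesis .
qed

lemma poly_eval_1 [simp]: "poly_eval X 1 = 1"
  using poly_eval_const[of X 1] by (simp add: const_poly_def)

lemma poly_eval_power [simp]: "poly_eval X (f ^ k) = poly_eval X f ^ k"
  by (induction k) auto

lemma poly_eval_prod [simp]: "poly_eval X (prod h A) = (\<Prod>a\<in>A. poly_eval X (h a))"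
  by (induction A rule: infinite_finite_induct) auto

lemma poly_eval_poly_act:
  assumes g: "g \<in> carrier (GL2_pow r)" and f: "f \<in> CV r"
  shows "poly_eval X (poly_act r g f) = poly_eval (V_act r (inv\<^bsub>GL2_pow r\<^esub> g) X) f"
proof -
  have gi: "g i \<in> carrier GL2" if "i \<in> {1..r}" for i
    using g that by (auto simp: GL2_pow_def)
  have inv_g: "inv\<^bsub>GL2_pow r\<^esub> g = (\<lambda>i\<in>{1..r}. matrix_inv (g i))"
    using g by (auto simp: GL2_pow_def inv_product_group group_GL2 inv_GL2 gi intro!: restrict_ext)
  have inv_inv: "matrix_inv (matrix_inv (g i)) = g i" if "i \<in> {1..r}" for i
    using gi[OF that] by (intro matrix_inv_unique') (auto simp: GL2_def matrix_inv_left matrix_inv_right)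
  have V: "V_act r (inv\<^bsub>GL2_pow r\<^esub> g) X i = matrix_inv (g (nxt r i)) ** X i ** g i"
    if "i \<in> {1..r}" for i
    using that by (auto simp: V_act_def inv_g inv_inv nxt_def)
  have entry: "poly_eval X ((const_mat A ** generic_mat i ** const_mat B) $ a $ b) =
      (A ** X i ** B) $ a $ b" for A B i a b
    by (simp add: matrix_matrix_mult_def const_mat_def generic_mat_def)
  let ?\<sigma> = "\<lambda>(i, a, b).
    (const_mat (matrix_inv (g (nxt r i))) ** generic_mat i ** const_mat (g i)) $ a $ b"
  let ?Y = "V_act r (inv\<^bsub>GL2_pow r\<^esub> g) X"
  have "poly_eval X (poly_act r g f) =
      (\<Sum>\<alpha>\<in>keys f. lookup f \<alpha> * (\<Prod>v\<in>keys \<alpha>. poly_eval X (?\<sigma> v) ^ lookup \<alpha> v))"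
    by (simp only: poly_act_def subst_def poly_eval_sum poly_eval_mult poly_eval_const
        poly_eval_prod poly_eval_power)
  also have "\<dots> =
      (\<Sum>\<alpha>\<in>keys f. lookup f \<alpha> * (\<Prod>(i, a, b)\<in>keys \<alpha>. (?Y i $ a $ b) ^ lookup \<alpha> (i, a, b)))"
  proof (rule sum.cong[OF refl], rule arg_cong[where f = "(*) _"], rule prod.cong[OF refl])
    fix \<alpha> v assume \<alpha>: "\<alpha> \<in> keys f" and v: "v \<in> keys \<alpha>"
    obtain i a b where iab: "v = (i, a, b)" by (metis prod_cases3)
    have "i \<in> {1..r}"
      using f \<alpha> v unfolding CV_def iab by fast
    then show "poly_eval X (?\<sigma> v) ^ lookup \<alpha> v =
        (case v of (i, a, b) \<Rightarrow> (?Y i $ a $ b) ^ lookup \<alpha> (i, a, b))"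
      unfolding iab case_prod_conv entry V[OF \<open>i \<in> {1..r}\<close>] by (intro refl)
  qed
  finally show ?thesis by (simp only: poly_eval_def)
qed

lemma det_scalar_mult: "det (mat c ** A) = c\<^sup>2 * det A" for A :: mat2
  by (simp add: det_2 matrix_matrix_mult_def sum_2 mat_def power2_eq_square algebra_simps)

lemma scalar_commute: "A ** mat c = mat c ** A" for A :: mat2
  by (simp add: matrix_matrix_mult_def mat_def vec_eq_iff forall_2 sum_2 mult.commute)

lemma mat_mult_mat: "mat c ** mat d = (mat (c * d) :: mat2)"
  by (simp add: matrix_matrix_mult_def mat_def vec_eq_iff forall_2 sum_2)

lemma scalar_mult_mult: "(mat c ** A) ** (mat d ** B) = mat (c * d) ** (A ** B)" for A B :: mat2
proof -
  have "(mat c ** A) ** (mat d ** B) = mat c ** (A ** mat d) ** B"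
    by (simp only: matrix_mul_assoc)
  also have "\<dots> = (mat c ** mat d) ** (A ** B)"
    unfolding scalar_commute[of A d] by (simp only: matrix_mul_assoc)
  finally show ?thesis by (simp only: mat_mult_mat)
qed

lemma phi_GL_hom: "phi_GL r \<in> hom (K_tilde r r) (GL2_pow r)"
proof (rule homI)
  fix x assume x: "x \<in> carrier (K_tilde r r)"
  obtain w g where wg: "x = (w, g)" by fastforce
  have "det (g i) = 1" "w i \<noteq> 0" if "i \<in> {1..r}" for i
    using x that by (auto simp: wg K_tilde_def SL2_def Cstar_def PiE_iff)
  then show "phi_GL r x \<in> carrier (GL2_pow r)"
    by (simp add: wg GL2_pow_def GL2_def phi_GL_def invertible_det_nz det_scalar_mult)
next
  fix x y :: "(nat \<Rightarrow> complex) \<times> (nat \<Rightarrow> mat2)"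
  obtain w g v h where xy: "x = (w, g)" "y = (v, h)" by fastforce
  show "phi_GL r (x \<otimes>\<^bsub>K_tilde r r\<^esub> y) = phi_GL r x \<otimes>\<^bsub>GL2_pow r\<^esub> phi_GL r y"
    unfolding xy
    by (simp add: K_tilde_def phi_GL_def GL2_pow_def GL2_def SL2_def Cstar_def DirProd_def
      scalar_mult_mult cong: restrict_cong)
qed

lemma phi_GL_surj:
  "phi_GL r ` carrier (K_tilde r r) = carrier (GL2_pow r)"
proof
  show "phi_GL r ` carrier (K_tilde r r) \<subseteq> carrier (GL2_pow r)"
    by (intro image_subsetI hom_in_carrier[OF phi_GL_hom])
  show "carrier (GL2_pow r) \<subseteq> phi_GL r ` carrier (K_tilde r r)"
  proof
    fix g assume g: "g \<in> carrier (GL2_pow r)"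
    define w where "w = (\<lambda>i\<in>{1..r}. csqrt (det (g i)))"
    define h where "h = (\<lambda>i\<in>{1..r}. mat (inverse (w i)) ** g i)"
    have nz: "w i \<noteq> 0" and sq: "(w i)\<^sup>2 = det (g i)" if "i \<in> {1..r}" for i
    proof -
      have "det (g i) \<noteq> 0"
        using g that by (auto simp: GL2_pow_def GL2_def invertible_det_nz)
      then show "w i \<noteq> 0" "(w i)\<^sup>2 = det (g i)"
        using that by (simp_all add: w_def)
    qed
    have "det (h i) = 1" if "i \<in> {1..r}" for i
    proof -
      have "det (h i) = (inverse (w i))\<^sup>2 * (w i)\<^sup>2"
        using that by (simp add: h_def det_scalar_mult sq)
      also have "\<dots> = 1" using nz[OF that] by (simp add: power_inverse)
      finally show ?thesis .
    qed
    moreover have "h \<in> extensional {1..r}" "w \<in> extensional {1..r}"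
      by (simp_all add: h_def w_def)
    ultimately have "(w, h) \<in> carrier (K_tilde r r)"
      using nz by (simp add: K_tilde_def Cstar_def SL2_def PiE_iff)
    moreover have "phi_GL r (w, h) = g"
    proof
      fix i
      show "phi_GL r (w, h) i = g i"
      proof (cases "i \<in> {1..r}")
        case True
        then show ?thesis
          using nz[OF True] by (simp add: phi_GL_def h_def matrix_mul_assoc mat_mult_mat)
      next
        case False
        moreover have "g i = undefined"
          using g False unfolding GL2_pow_def carrier_product_group by (rule PiE_arb)
        ultimately show ?thesis by (simp only: phi_GL_def case_prod_conv restrict_apply if_False)
      qed
    qed
    ultimately show "g \<in> phi_GL r ` carrier (K_tilde r r)"
      by (metis imageI)
  qed
qed

lemma S_GL2_pow_simps [simp]:
  "monoid.mult (S_GL2_pow r) = monoid.mult (GL2_pow r)" "\<one>\<^bsub>S_GL2_pow r\<^esub> = \<one>\<^bsub>GL2_pow r\<^esub>"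
  by (simp_all add: S_GL2_pow_def)

lemma prod_split_last: "r \<ge> 1 \<Longrightarrow> (\<Prod>j\<in>{1..r}. f j) = f r * (\<Prod>j\<in>{1..r-1}. f j)"
  for f :: "nat \<Rightarrow> complex"
  by (cases r) (simp_all add: mult.commute)

lemma phi_S_hom:
  assumes r: "r \<ge> 1"
  shows "phi_S r \<in> hom (K_tilde (r - 1) r) (S_GL2_pow r)"
proof (rule homI)
  fix x assume x: "x \<in> carrier (K_tilde (r - 1) r)"
  obtain w g where wg: "x = (w, g)" by fastforce
  have g: "det (g i) = 1" if "i \<in> {1..r}" for i
    using x that by (auto simp: wg K_tilde_def SL2_def PiE_iff)
  have w: "w j \<noteq> 0" if "j \<in> {1..r-1}" for j
    using x that by (auto simp: wg K_tilde_def Cstar_def PiE_iff)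
  have lt: "j < r" if "j \<in> {1..r-1}" for j
    using that r by auto
  have "(\<Prod>i\<in>{1..r}. det (phi_S r x i)) = det (phi_S r x r) * (\<Prod>i\<in>{1..r-1}. det (phi_S r x i))"
    by (rule prod_split_last[OF r])
  also have "(\<Prod>i\<in>{1..r-1}. det (phi_S r x i)) = (\<Prod>i\<in>{1..r-1}. (w i)\<^sup>2)"
    using lt by (intro prod.cong) (auto simp: wg phi_S_def det_scalar_mult g)
  also have "det (phi_S r x r) = (\<Prod>i\<in>{1..r-1}. inverse (w i))\<^sup>2"
    using r by (simp add: wg phi_S_def det_scalar_mult g)
  also have "\<dots> * (\<Prod>i\<in>{1..r-1}. (w i)\<^sup>2) = (\<Prod>i\<in>{1..r-1}. (inverse (w i))\<^sup>2 * (w i)\<^sup>2)"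
    by (simp only: prod_power_distrib prod.distrib)
  also have "\<dots> = 1"
    using w by (intro prod.neutral) (auto simp: power_inverse)
  finally have "(\<Prod>i\<in>{1..r}. det (phi_S r x i)) = 1" .
  moreover have "phi_S r x \<in> carrier (GL2_pow r)"
    using g w lt by (auto simp: wg GL2_pow_def GL2_def phi_S_def invertible_det_nz det_scalar_mult)
  ultimately show "phi_S r x \<in> carrier (S_GL2_pow r)"
    by (simp add: S_GL2_pow_def)
next
  fix x y :: "(nat \<Rightarrow> complex) \<times> (nat \<Rightarrow> mat2)"
  obtain w g v h where xy: "x = (w, g)" "y = (v, h)" by fastforce
  let ?w = "\<lambda>j\<in>{1..r-1}. w j * v j"
  let ?u = "\<lambda>w i. if i < r then w i else (\<Prod>j\<in>{1..r-1}. inverse (w j))"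
  have u: "?u ?w i = ?u w i * ?u v i" if "i \<in> {1..r}" for i
    using that by (auto simp: prod.distrib)
  have "x \<otimes>\<^bsub>K_tilde (r - 1) r\<^esub> y = (?w, \<lambda>i\<in>{1..r}. g i ** h i)"
    unfolding xy by (simp add: K_tilde_def SL2_def Cstar_def DirProd_def)
  then have "phi_S r (x \<otimes>\<^bsub>K_tilde (r - 1) r\<^esub> y) = (\<lambda>i\<in>{1..r}. mat (?u ?w i) ** (g i ** h i))"
    unfolding phi_S_def case_prod_conv
    by (auto intro!: restrict_ext)
  also have "\<dots> = (\<lambda>i\<in>{1..r}. (mat (?u w i) ** g i) ** (mat (?u v i) ** h i))"
    by (rule restrict_ext) (simp only: u scalar_mult_mult)
  also have "\<dots> = phi_S r x \<otimes>\<^bsub>S_GL2_pow r\<^esub> phi_S r y"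
    unfolding xy S_GL2_pow_simps phi_S_def case_prod_conv GL2_pow_def GL2_def mult_product_group
      monoid.simps
    by (auto intro!: restrict_ext)
  finally show "phi_S r (x \<otimes>\<^bsub>K_tilde (r - 1) r\<^esub> y) = phi_S r x \<otimes>\<^bsub>S_GL2_pow r\<^esub> phi_S r y" .
qed

lemma phi_S_surj:
  assumes r: "r \<ge> 1"
  shows "phi_S r ` carrier (K_tilde (r - 1) r) = carrier (S_GL2_pow r)"
proof
  show "phi_S r ` carrier (K_tilde (r - 1) r) \<subseteq> carrier (S_GL2_pow r)"
    by (intro image_subsetI hom_in_carrier[OF phi_S_hom[OF r]])
  show "carrier (S_GL2_pow r) \<subseteq> phi_S r ` carrier (K_tilde (r - 1) r)"
  proof
    fix g assume g: "g \<in> carrier (S_GL2_pow r)"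
    then have gl: "g \<in> carrier (GL2_pow r)" and det1: "(\<Prod>j\<in>{1..r}. det (g j)) = 1"
      by (auto simp: S_GL2_pow_def)
    define w where "w = (\<lambda>i\<in>{1..r-1}. csqrt (det (g i)))"
    define u where "u = (\<lambda>i. if i < r then w i else (\<Prod>j\<in>{1..r-1}. inverse (w j)))"
    define h where "h = (\<lambda>i\<in>{1..r}. mat (inverse (u i)) ** g i)"
    have nzd: "det (g i) \<noteq> 0" if "i \<in> {1..r}" for i
      using gl that by (auto simp: GL2_pow_def GL2_def invertible_det_nz)
    have nzw: "w i \<noteq> 0" and sqw: "(w i)\<^sup>2 = det (g i)" if "i \<in> {1..r-1}" for i
    proof -
      have "det (g i) \<noteq> 0" using that by (intro nzd) auto
      then show "w i \<noteq> 0" "(w i)\<^sup>2 = det (g i)"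
        using that by (simp_all add: w_def)
    qed
    have nz: "u i \<noteq> 0" if "i \<in> {1..r}" for i
    proof (cases "i < r")
      case True
      then show ?thesis using that by (simp add: u_def nzw)
    next
      case False
      then show ?thesis using nzw by (simp add: u_def)
    qed
    have "(u r)\<^sup>2 = (\<Prod>j\<in>{1..r-1}. (inverse (w j))\<^sup>2)"
      by (simp only: u_def prod_power_distrib less_irrefl if_False)
    also have "\<dots> = (\<Prod>j\<in>{1..r-1}. inverse (det (g j)))"
    proof (rule prod.cong[OF refl])
      fix j assume "j \<in> {1..r-1}"
      from sqw[OF this] show "(inverse (w j))\<^sup>2 = inverse (det (g j))"
        by (simp add: power_inverse)
    qed
    also have "\<dots> = inverse (\<Prod>j\<in>{1..r-1}. det (g j))"
      by (simp add: prod_inversef[symmetric] o_def)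
    also have "\<dots> = det (g r)"
      using det1 unfolding prod_split_last[OF r] by (metis inverse_unique mult.commute)
    finally have sqr: "(u r)\<^sup>2 = det (g r)" .
    have sq: "(u i)\<^sup>2 = det (g i)" if "i \<in> {1..r}" for i
    proof (cases "i < r")
      case True
      then show ?thesis using that by (simp add: u_def sqw)
    next
      case False
      then show ?thesis using that sqr by (metis atLeastAtMost_iff nle_le not_less)
    qed
    have "det (h i) = 1" if "i \<in> {1..r}" for i
    proof -
      have "det (h i) = (inverse (u i))\<^sup>2 * (u i)\<^sup>2"
        using that by (simp add: h_def det_scalar_mult sq)
      also have "\<dots> = 1" using nz[OF that] by (simp add: power_inverse)
      finally show ?thesis .
    qed
    moreover have "h \<in> extensional {1..r}" "w \<in> extensional {1..r-1}"
      by (simp_all add: h_def w_def)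
    ultimately have "(w, h) \<in> carrier (K_tilde (r - 1) r)"
      using nzw by (simp add: K_tilde_def Cstar_def SL2_def PiE_iff)
    moreover have "phi_S r (w, h) = g"
    proof
      fix i
      have *: "phi_S r (w, h) = (\<lambda>i\<in>{1..r}. mat (u i) ** h i)"
        by (simp only: phi_S_def u_def case_prod_conv)
      show "phi_S r (w, h) i = g i"
      proof (cases "i \<in> {1..r}")
        case True
        then show ?thesis
          using nz[OF True] unfolding * by (simp add: h_def matrix_mul_assoc mat_mult_mat)
      next
        case False
        moreover have "g i = undefined"
          using gl False unfolding GL2_pow_def carrier_product_group by (rule PiE_arb)
        ultimately show ?thesis unfolding * by (simp only: restrict_apply if_False)
      qed
    qed
    ultimately show "g \<in> phi_S r ` carrier (K_tilde (r - 1) r)"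
      by (metis imageI)
  qed
qed

end

theory Submission
  imports Defs
begin

text \<open>For the Fischer inner product, multiplication by a polynomial is adjoint to the corresponding
  constant-coefficient differential operator. So the polynomials annihilated by the operators of the
  trace and the determinant of the monodromy \<open>X\<^sub>r \<dots> X\<^sub>1\<close> form the orthogonal complement \<open>Harm\<close> of the
  ideal generated by these two invariants. For a suitable weight of the variables the invariants have
  coprime leading monomials, so the dimension of a weight space of \<open>Harm\<close> is the number of monomials
  divisible by neither of them. A Cauchy and Clebsch-Gordan type bijection matches these monomials
  with the weights of the claimed direct sum. Since \<open>E\<close> and \<open>F\<close> are adjoint to each other, the weight
  multiplicities yield mutually orthogonal highest weight vectors whose orbits span \<open>Harm\<close>.

  The decomposition contains no trivial summand in the degrees \<open>(N, \<dots>, N)\<close> with \<open>N \<ge> 1\<close>, the only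
  ones in which nonconstant \<open>K\<close>-invariants occur. Hence all of them lie in the ideal of the
  trace and the determinant, and \<open>Harm\<close> is the space of harmonic polynomials.\<close>

text \<open>The obstacle is that the ring of K-invariants is not known beforehand:
  \<open>harmonic\<close> refers to all invariant operators, whereas dimensions can be counted only
  for an explicit ideal. Hence everything is proved for the two explicit invariants, and the fact
  that they suffice is recovered from the resulting decomposition itself.

  Positivity of the Fischer product takes the place of complete reducibility, of character theory
  and of finite-dimensional sl2 theory: a vector is shown to vanish because its norm does. Both
  invariants are homogeneous of weight 0, so that the whole count can be made in one weight space at
  a time, with finitely many monomials.

  The group enters through scalars and through unipotent elements at one vertex. The latter act by
  exponentials of locally nilpotent derivations; these are polynomial in the parameter t, so that
  passing between group and Lie algebra amounts to comparing coefficients. Scalars act on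
  \<open>CV_graded r n\<close> by a single character, which produces the exponents z and is where
  the two groups differ.\<close>

lemma lookup_sum_single:
  "finite S \<Longrightarrow> lookup (\<Sum>a\<in>S. Poly_Mapping.single a (c a)) k = (if k \<in> S then c k else (0::'b::comm_monoid_add))"
  by (simp add: lookup_sum lookup_single when_def sum.delta)

lemma pm_eq_sum_single:
  assumes "finite S" "keys f \<subseteq> S"
  shows "f = (\<Sum>\<alpha>\<in>S. Poly_Mapping.single \<alpha> (lookup f \<alpha>))"
  using assms by (intro poly_mapping_eqI) (auto simp: lookup_sum_single in_keys_iff)

text \<open>Identities that are additive in each argument are reduced by this rule to single
  monomials.\<close>

lemma pm_additive_induct [case_names single add]:
  assumes "\<And>a c. P (Poly_Mapping.single a c)" and "\<And>f g. P f \<Longrightarrow> P g \<Longrightarrow> P (f + g)"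
  shows "P (f :: 'a \<Rightarrow>\<^sub>0 'b::comm_monoid_add)"
proof -
  have "P (\<Sum>a\<in>S. Poly_Mapping.single a (lookup f a))" if "finite S" for S
    using that
  proof induction
    case empty
    \<comment> \<open>Zero is the monomial with coefficient 0 at an arbitrary exponent.\<close>
    show ?case using assms(1)[of undefined 0] by simp
  next
    case (insert a S)
    then show ?case by (simp add: assms)
  qed
  from this[OF finite_keys[of f]] show ?thesis
    by (simp flip: pm_eq_sum_single)
qed

lemma scale_single [simp]: "scale c (Poly_Mapping.single a x) = Poly_Mapping.single a (c * x)"
  by (intro poly_mapping_eqI) (simp add: lookup_single when_def)

lemma scale_conv_const_poly: "scale c f = const_poly c * f"
proof (induction f rule: pm_additive_induct)
  case (single a x)
  then show ?case by (simp add: const_poly_def mult_single)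
qed (simp add: cvec.scale_right_distrib distrib_left)

lemma scale_mult_left: "scale c (f * g) = scale c f * g" for f g :: mpoly
  by (simp add: scale_conv_const_poly mult.assoc)

lemma scale_mult_right: "scale c (f * g) = f * scale c g" for f g :: mpoly
  by (simp add: scale_conv_const_poly mult_ac)

lemma mult_scale_scale: "scale c f * scale d g = scale (c * d) (f * g)" for f g :: mpoly
  by (metis cvec.scale_scale scale_mult_left scale_mult_right)

lemma scale_uminus_1: "scale (-1) f = - f"
  by (intro poly_mapping_eqI) simp

section \<open>The Fischer inner product\<close>

text \<open>The multi-index factorial \<alpha>!, which is the squared Fischer norm of the monomial
  with exponent \<alpha>.\<close>

definition mfact :: "('v \<Rightarrow>\<^sub>0 nat) \<Rightarrow> nat" where
  "mfact \<alpha> = (\<Prod>v\<in>keys \<alpha>. fact (lookup \<alpha> v))"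

lemma mfact_altdef: "finite S \<Longrightarrow> keys \<alpha> \<subseteq> S \<Longrightarrow> mfact \<alpha> = (\<Prod>v\<in>S. fact (lookup \<alpha> v))"
  unfolding mfact_def by (rule prod.mono_neutral_left) (auto simp: in_keys_iff)

lemma mfact_pos [simp]: "mfact \<alpha> > 0" by (simp add: mfact_def prod_pos)

lemma mfact_nonzero [simp]: "mfact \<alpha> \<noteq> 0"
  using mfact_pos by (metis less_irrefl)

text \<open>In each variable this is the identity b! C(c + b, b) c! = (c + b)!, with b and c the
  exponents in \<beta> and \<gamma>; variables outside \<open>keys \<beta>\<close> contribute equal
  factors to both sides.\<close>

lemma diffop_coeff:
  "(\<Prod>v\<in>keys \<beta>. fact (lookup \<beta> v) * (lookup (\<gamma> + \<beta>) v choose lookup \<beta> v)) * mfact \<gamma> = mfact (\<gamma> + \<beta>)"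
proof -
  let ?S = "keys \<gamma> \<union> keys \<beta>"
  have *: "(\<Prod>v\<in>keys \<beta>. fact (lookup \<beta> v) * (lookup (\<gamma> + \<beta>) v choose lookup \<beta> v)) =
      (\<Prod>v\<in>?S. fact (lookup \<beta> v) * (lookup (\<gamma> + \<beta>) v choose lookup \<beta> v) :: nat)"
    by (rule prod.mono_neutral_left) (auto simp: in_keys_iff)
  have k: "keys (\<gamma> + \<beta>) \<subseteq> ?S" by (rule keys_add)
  have "fact (lookup \<beta> v) * (lookup (\<gamma> + \<beta>) v choose lookup \<beta> v) * fact (lookup \<gamma> v) =
      (fact (lookup (\<gamma> + \<beta>) v) :: nat)" for v
    using binomial_fact_lemma[of "lookup \<beta> v" "lookup (\<gamma> + \<beta>) v"]
    by (simp add: lookup_add mult_ac)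
  then show ?thesis
    unfolding * mfact_altdef[OF _ k] mfact_altdef[OF _ Un_upper1[of "keys \<gamma>"]]
    by (simp add: mfact_altdef[of ?S] k flip: prod.distrib)
qed

text \<open>A variable in which \<alpha> has too small an exponent makes a binomial coefficient
  vanish. This protects \<open>diffop\<close> from the truncated subtraction in its
  exponents.\<close>

lemma diffop_coeff_zero:
  assumes "\<not> (\<exists>\<gamma>. \<alpha> = \<gamma> + \<beta>)"
  shows "(\<Prod>v\<in>keys \<beta>. fact (lookup \<beta> v) * (lookup \<alpha> v choose lookup \<beta> v)) = (0::nat)"
proof -
  have "\<exists>v. lookup \<alpha> v < lookup \<beta> v"
  proof (rule ccontr)
    assume "\<not> ?thesis"
    then have "\<alpha> = (\<alpha> - \<beta>) + \<beta>"
      by (intro poly_mapping_eqI) (simp add: lookup_add lookup_minus not_less)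
    with assms show False by blast
  qed
  then show ?thesis by (intro prod_zero) (auto simp: in_keys_iff intro: gr_implies_not0)
qed

text \<open>Up to the factors \<alpha>!, applying \<open>diffop D\<close> is the transpose of
  multiplication by D; this coefficient formula turns the Fischer adjointness into a rearrangement
  of sums.\<close>

lemma lookup_diffop:
  assumes "finite S" "keys D \<subseteq> S"
  shows "lookup (diffop D f) \<gamma> =
    (\<Sum>\<beta>\<in>S. lookup D \<beta> * lookup f (\<gamma> + \<beta>) * of_nat (mfact (\<gamma> + \<beta>)) / of_nat (mfact \<gamma>))"
proof -
  have inner: "(\<Sum>\<alpha>\<in>keys f. lookup (Poly_Mapping.single (\<alpha> - \<beta>)
     (lookup D \<beta> * lookup f \<alpha> *
      of_nat (\<Prod>v\<in>keys \<beta>. fact (lookup \<beta> v) * (lookup \<alpha> v choose lookup \<beta> v)))) \<gamma>) =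
      lookup D \<beta> * lookup f (\<gamma> + \<beta>) * of_nat (mfact (\<gamma> + \<beta>)) / of_nat (mfact \<gamma>)" (is "?l = ?r") for \<beta>
  proof -
    define q where "q \<alpha> = lookup D \<beta> * lookup f \<alpha> *
      of_nat (\<Prod>v\<in>keys \<beta>. fact (lookup \<beta> v) * (lookup \<alpha> v choose lookup \<beta> v))" for \<alpha>
    \<comment> \<open>By truncation several \<alpha> may have \<alpha> - \<beta> = \<gamma>, but
      only \<alpha> = \<gamma> + \<beta> can carry a nonzero coefficient.\<close>
    have z: "q \<alpha> = 0" if "\<alpha> - \<beta> = \<gamma>" "\<alpha> \<noteq> \<gamma> + \<beta>" for \<alpha>
    proof -
      have "\<not> (\<exists>\<gamma>'. \<alpha> = \<gamma>' + \<beta>)" using that by auto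
      from diffop_coeff_zero[OF this] show ?thesis unfolding q_def by simp
    qed
    have "?l = (\<Sum>\<alpha>\<in>keys f. if \<alpha> = \<gamma> + \<beta> then q \<alpha> else 0)"
      unfolding q_def[symmetric] by (intro sum.cong) (auto simp: lookup_single when_def z)
    also have "\<dots> = q (\<gamma> + \<beta>)"
      by (auto simp: sum.delta in_keys_iff q_def)
    also have "\<dots> = ?r"
      using diffop_coeff[of \<beta> \<gamma>, THEN arg_cong[where f = "of_nat :: nat \<Rightarrow> complex"]]
      unfolding q_def of_nat_mult by (simp add: field_simps)
    finally show ?thesis .
  qed
  have "lookup (diffop D f) \<gamma> =
    (\<Sum>\<beta>\<in>keys D. lookup D \<beta> * lookup f (\<gamma> + \<beta>) * of_nat (mfact (\<gamma> + \<beta>)) / of_nat (mfact \<gamma>))"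
    unfolding diffop_def lookup_sum inner ..
  also have "\<dots> = (\<Sum>\<beta>\<in>S. lookup D \<beta> * lookup f (\<gamma> + \<beta>) * of_nat (mfact (\<gamma> + \<beta>)) / of_nat (mfact \<gamma>))"
    by (rule sum.mono_neutral_left) (use assms in \<open>auto simp: in_keys_iff\<close>)
  finally show ?thesis .
qed

lemma diffop_add: "diffop D (f + g) = diffop D f + diffop D g"
  by (intro poly_mapping_eqI)
    (simp add: lookup_diffop[OF finite_keys order_refl] lookup_add algebra_simps add_divide_distrib sum.distrib)

lemma diffop_scale: "diffop D (scale c f) = scale c (diffop D f)"
  by (intro poly_mapping_eqI)
    (simp add: lookup_diffop[OF finite_keys order_refl] sum_distrib_left algebra_simps)

lemma diffop_0 [simp]: "diffop D 0 = 0" "diffop 0 f = 0"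
  by (simp_all add: diffop_def)

text \<open>The value at the origin of the operator of the conjugate of f applied to g;
  conjugate-linear in the first argument and positive definite.\<close>

definition fischer :: "mpoly \<Rightarrow> mpoly \<Rightarrow> complex" where
  "fischer f g = (\<Sum>\<alpha>\<in>keys f. cnj (lookup f \<alpha>) * lookup g \<alpha> * of_nat (mfact \<alpha>))"

lemma fischer_altdef:
  "finite S \<Longrightarrow> keys f \<subseteq> S \<Longrightarrow>
    fischer f g = (\<Sum>\<alpha>\<in>S. cnj (lookup f \<alpha>) * lookup g \<alpha> * of_nat (mfact \<alpha>))"
  unfolding fischer_def by (rule sum.mono_neutral_left) (auto simp: in_keys_iff)

lemma fischer_add_left: "fischer (f + f') g = fischer f g + fischer f' g"
proof -
  let ?S = "keys f \<union> keys f'"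
  have "keys (f + f') \<subseteq> ?S" by (rule keys_add)
  then show ?thesis
    by (simp add: fischer_altdef[of ?S] lookup_add algebra_simps sum.distrib)
qed

lemma fischer_cnj: "cnj (fischer f g) = fischer g f"
  by (simp add: fischer_altdef[of "keys f \<union> keys g"] mult_ac)

lemma fischer_add_right: "fischer f (g + g') = fischer f g + fischer f g'"
  by (metis fischer_add_left fischer_cnj complex_cnj_add)

lemma fischer_scale_right: "fischer f (scale c g) = c * fischer f g"
  by (simp add: fischer_def sum_distrib_left mult_ac)

lemma fischer_scale_left: "fischer (scale c f) g = cnj c * fischer f g"
  by (metis fischer_scale_right fischer_cnj complex_cnj_mult)

lemma fischer_0 [simp]: "fischer 0 g = 0" "fischer f 0 = 0"
  by (simp_all add: fischer_def)

lemma fischer_uminus [simp]: "fischer (- f) g = - fischer f g" "fischer f (- g) = - fischer f g"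
  using fischer_scale_left[of "-1" f g] fischer_scale_right[of f "-1" g]
  by (simp_all add: scale_uminus_1)

lemma fischer_diff: "fischer (f - f') g = fischer f g - fischer f' g"
  "fischer f (g - g') = fischer f g - fischer f g'"
  using fischer_add_left[of f "- f'" g] fischer_add_right[of f g "- g'"] by simp_all

lemma fischer_sum_left: "fischer (sum f A) g = (\<Sum>a\<in>A. fischer (f a) g)"
  by (induction A rule: infinite_finite_induct) (auto simp: fischer_add_left)

lemma fischer_sum_right: "fischer g (sum f A) = (\<Sum>a\<in>A. fischer g (f a))"
  by (induction A rule: infinite_finite_induct) (auto simp: fischer_add_right)

lemma fischer_single: "fischer (Poly_Mapping.single \<alpha> c) g = cnj c * lookup g \<alpha> * of_nat (mfact \<alpha>)"
  by (subst fischer_altdef[of "{\<alpha>}"]) auto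

lemma fischer_self_eq_0: "fischer f f = 0 \<longleftrightarrow> f = 0"
proof
  assume "fischer f f = 0"
  define S where "S = (\<Sum>\<alpha>\<in>keys f. (cmod (lookup f \<alpha>))\<^sup>2 * of_nat (mfact \<alpha>))"
  have "fischer f f = of_real S"
    unfolding S_def fischer_def of_real_sum of_real_mult complex_norm_square
    by (intro sum.cong) (auto simp: mult_ac)
  with \<open>fischer f f = 0\<close> have "S = 0" by simp
  then have "\<forall>\<alpha>\<in>keys f. (cmod (lookup f \<alpha>))\<^sup>2 * of_nat (mfact \<alpha>) = 0"
    unfolding S_def by (subst (asm) sum_nonneg_eq_0_iff) auto
  then show "f = 0" by (intro poly_mapping_eqI) (auto simp: in_keys_iff)
qed simp

text \<open>Nondegeneracy: operator identities are proved by moving the operators to the other side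
  of the product, as in \<open>diffop_commute\<close>.\<close>

lemma fischer_ext: "(\<And>f. fischer f g = fischer f h) \<Longrightarrow> g = h"
  using fischer_self_eq_0[of "g - h"] fischer_diff(2)[of "g - h" g h] by simp

text \<open>Conjugating the coefficients compensates for the conjugate-linearity of
  \<open>fischer\<close> when a multiplication is moved across it.\<close>

definition cnjp :: "mpoly \<Rightarrow> mpoly" where "cnjp = Poly_Mapping.map cnj"

lemma lookup_cnjp [simp]: "lookup (cnjp f) \<alpha> = cnj (lookup f \<alpha>)"
  by (simp add: cnjp_def map.rep_eq when_def)

lemma keys_cnjp [simp]: "keys (cnjp f) = keys f"
  by (auto simp: in_keys_iff)

lemma cnjp_single [simp]: "cnjp (Poly_Mapping.single a c) = Poly_Mapping.single a (cnj c)"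
  by (intro poly_mapping_eqI) (simp add: lookup_single when_def)

lemma cnjp_add: "cnjp (f + g) = cnjp f + cnjp g"
  by (intro poly_mapping_eqI) (simp add: lookup_add)

lemma cnjp_mult: "cnjp (f * g) = cnjp f * cnjp g"
proof (induction f rule: pm_additive_induct)
  case (single a c)
  show ?case
    by (induction g rule: pm_additive_induct) (auto simp: mult_single cnjp_add distrib_left)
qed (auto simp: cnjp_add distrib_right)

lemma cnjp_cnjp [simp]: "cnjp (cnjp f) = f"
  by (intro poly_mapping_eqI) simp

lemma fischer_mult_left: "fischer (D * f) g = fischer f (diffop (cnjp D) g)"
proof (induction f rule: pm_additive_induct)
  case (single \<gamma> c)
  have "D * Poly_Mapping.single \<gamma> c =
      (\<Sum>\<beta>\<in>keys D. Poly_Mapping.single (\<gamma> + \<beta>) (lookup D \<beta> * c))"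
    by (subst pm_eq_sum_single[OF finite_keys order_refl, of D])
      (simp add: sum_distrib_right mult_single add.commute)
  then show ?case
    by (simp add: fischer_sum_left fischer_single lookup_diffop[OF finite_keys order_refl]
        sum_distrib_left sum_divide_distrib sum_distrib_right mult_ac)
qed (simp add: distrib_left fischer_add_left)

section \<open>Partial derivatives and derivations of the polynomial ring\<close>

definition dv :: "var \<Rightarrow> mpoly \<Rightarrow> mpoly" where "dv v = diffop (var_poly v)"

lemma dv_add: "dv v (f + g) = dv v f + dv v g"
  and dv_scale: "dv v (scale c f) = scale c (dv v f)"
  by (simp_all add: dv_def diffop_add diffop_scale)

lemma dv_single: "dv v (Poly_Mapping.single \<alpha> c) =
    Poly_Mapping.single (\<alpha> - Poly_Mapping.single v 1) (of_nat (lookup \<alpha> v) * c)"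
  unfolding dv_def diffop_def var_poly_def by (simp add: mult_ac)

lemma add_single_diff:
  fixes \<alpha> \<beta> :: "'v \<Rightarrow>\<^sub>0 nat"
  assumes "lookup \<alpha> v \<noteq> 0"
  shows "\<alpha> + \<beta> - Poly_Mapping.single v 1 = (\<alpha> - Poly_Mapping.single v 1) + \<beta>"
  using assms by (intro poly_mapping_eqI) (auto simp: lookup_add lookup_minus lookup_single when_def)

lemma dv_mult: "dv v (f * g) = dv v f * g + f * dv v g"
proof (induction f rule: pm_additive_induct)
  case (single \<alpha> c)
  show ?case
  proof (induction g rule: pm_additive_induct)
    case (single \<beta> d)
    let ?s = "Poly_Mapping.single v (1::nat)"
    \<comment> \<open>If the exponent of v is zero, truncated subtraction gives a wrong monomial,
      but its coefficient is then zero.\<close>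
    have 1: "Poly_Mapping.single (\<alpha> + \<beta> - ?s) (of_nat (lookup \<alpha> v) * (c * d)) =
      Poly_Mapping.single (\<alpha> - ?s + \<beta>) (of_nat (lookup \<alpha> v) * (c * d))"
      using add_single_diff[of \<alpha> v \<beta>] by (cases "lookup \<alpha> v = 0") simp_all
    have 2: "Poly_Mapping.single (\<alpha> + \<beta> - ?s) (of_nat (lookup \<beta> v) * (c * d)) =
      Poly_Mapping.single (\<alpha> + (\<beta> - ?s)) (of_nat (lookup \<beta> v) * (c * d))"
      using add_single_diff[of \<beta> v \<alpha>] by (cases "lookup \<beta> v = 0") (simp_all add: add.commute)
    show ?case
      using arg_cong2[OF 1 2, of "(+)"] unfolding mult_single dv_single single_add[symmetric]
      by (simp add: lookup_add algebra_simps)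
  qed (simp_all add: dv_add algebra_simps)
qed (simp_all add: dv_add algebra_simps)

lemma dv_var: "dv v (var_poly u) = (if u = v then 1 else 0)"
  by (intro poly_mapping_eqI)
     (auto simp: var_poly_def dv_single lookup_single when_def lookup_one)

lemma fischer_var_mult: "fischer (var_poly v * f) g = fischer f (dv v g)"
  by (simp add: fischer_mult_left dv_def var_poly_def)

lemma fischer_dv_left: "fischer (dv v f) g = fischer f (var_poly v * g)"
  by (metis fischer_cnj fischer_var_mult)

lemma single_eq_prod: "Poly_Mapping.single \<alpha> c = const_poly c * (\<Prod>v\<in>keys \<alpha>. var_poly v ^ lookup \<alpha> v)"
proof -
  have pw: "var_poly v ^ k = Poly_Mapping.single (Poly_Mapping.single v k) 1" for v k
    by (induction k) (auto simp: var_poly_def mult_single simp flip: single_add)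
  have "(\<Prod>v\<in>S. var_poly v ^ lookup \<alpha> v) =
     Poly_Mapping.single (\<Sum>v\<in>S. Poly_Mapping.single v (lookup \<alpha> v)) 1" if "finite S" for S
    using that by induction (auto simp: pw mult_single)
  from this[OF finite_keys[of \<alpha>]] show ?thesis
    by (simp add: const_poly_def mult_single flip: pm_eq_sum_single)
qed

lemma poly_alg_induct:
  assumes f: "\<And>\<alpha> v. \<alpha> \<in> keys f \<Longrightarrow> v \<in> keys \<alpha> \<Longrightarrow> v \<in> A"
    and c: "\<And>c. P (const_poly c)" and v: "\<And>v. v \<in> A \<Longrightarrow> P (var_poly v)"
    and a: "\<And>f g. P f \<Longrightarrow> P g \<Longrightarrow> P (f + g)" and m: "\<And>f g. P f \<Longrightarrow> P g \<Longrightarrow> P (f * g)"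
  shows "P f"
proof -
  have P1: "P 1" using c[of 1] by (simp add: const_poly_def)
  have pw: "P (g ^ k)" if "P g" for g k by (induction k) (use P1 m that in auto)
  have pr: "P (\<Prod>v\<in>S. h v)" if "\<And>v. v \<in> S \<Longrightarrow> P (h v)" for S :: "var set" and h
    using that by (induction S rule: infinite_finite_induct) (use P1 m in auto)
  have s: "P (\<Sum>\<alpha>\<in>S. h \<alpha>)" if "\<And>\<alpha>. \<alpha> \<in> S \<Longrightarrow> P (h \<alpha>)" for S :: "(var \<Rightarrow>\<^sub>0 nat) set" and h
    using that by (induction S rule: infinite_finite_induct) (use c[of 0] a in \<open>auto simp: const_poly_def\<close>)
  have "P (\<Sum>\<alpha>\<in>keys f. Poly_Mapping.single \<alpha> (lookup f \<alpha>))"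
    unfolding single_eq_prod by (intro s m c pr pw v f)
  then show ?thesis by (simp flip: poly_eq_sum_single)
qed

definition derivation :: "(mpoly \<Rightarrow> mpoly) \<Rightarrow> bool" where
  "derivation \<delta> \<longleftrightarrow> (\<forall>f g. \<delta> (f + g) = \<delta> f + \<delta> g) \<and> (\<forall>c f. \<delta> (scale c f) = scale c (\<delta> f)) \<and>
     (\<forall>f g. \<delta> (f * g) = \<delta> f * g + f * \<delta> g)"

lemma derivation_const:
  assumes "derivation \<delta>" shows "\<delta> (const_poly c) = 0"
proof -
  have "\<delta> 1 = \<delta> 1 + \<delta> 1" using assms unfolding derivation_def by (metis mult.left_neutral mult.right_neutral)
  then have "\<delta> 1 = 0" by simp
  moreover have "const_poly c = scale c 1" by (simp add: scale_conv_const_poly)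
  ultimately show ?thesis using assms unfolding derivation_def by simp
qed

text \<open>The variables generate the algebra, so a derivation is determined by its values on them;
  all bracket relations below are thereby checked on variables only.\<close>

lemma derivation_eqI:
  assumes "derivation \<delta>" "derivation \<epsilon>" "\<And>v. \<delta> (var_poly v) = \<epsilon> (var_poly v)"
  shows "\<delta> f = \<epsilon> f"
proof (rule poly_alg_induct[where A = UNIV and P = "\<lambda>f. \<delta> f = \<epsilon> f"])
  show "\<delta> (const_poly c) = \<epsilon> (const_poly c)" for c
    using assms by (simp add: derivation_const)
qed (use assms in \<open>simp_all add: derivation_def\<close>)

lemma derivation_dv [simp]: "derivation (dv v)"
  by (simp add: derivation_def dv_add dv_scale dv_mult)

lemma derivation_add: "derivation \<delta> \<Longrightarrow> derivation \<epsilon> \<Longrightarrow> derivation (\<lambda>f. \<delta> f + \<epsilon> f)"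
  by (simp add: derivation_def algebra_simps cvec.scale_right_distrib)

lemma derivation_diff: "derivation \<delta> \<Longrightarrow> derivation \<epsilon> \<Longrightarrow> derivation (\<lambda>f. \<delta> f - \<epsilon> f)"
  by (simp add: derivation_def algebra_simps cvec.scale_right_diff_distrib)

lemma derivation_mult: "derivation \<delta> \<Longrightarrow> derivation (\<lambda>f. p * \<delta> f)"
  unfolding derivation_def
  by (elim conjE, intro conjI allI) (simp only: distrib_left, simp only: scale_mult_right, simp add: algebra_simps)

lemma derivation_scale: "derivation \<delta> \<Longrightarrow> derivation (\<lambda>f. scale c (\<delta> f))"
  unfolding scale_conv_const_poly by (rule derivation_mult)

lemma derivation_commutator:
  assumes "derivation \<delta>" "derivation \<epsilon>"
  shows "derivation (\<lambda>f. \<delta> (\<epsilon> f) - \<epsilon> (\<delta> f))"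
  using assms unfolding derivation_def
  by (simp add: algebra_simps cvec.scale_right_diff_distrib)

lemma derivation_0 [simp]: "derivation (\<lambda>_. 0)"
  by (simp add: derivation_def)

lemma derivationD:
  assumes "derivation \<delta>"
  shows "\<delta> (f + g) = \<delta> f + \<delta> g" "\<delta> (scale c f) = scale c (\<delta> f)" "\<delta> (f * g) = \<delta> f * g + f * \<delta> g"
    "\<delta> 0 = 0" "\<delta> (f - g) = \<delta> f - \<delta> g" "\<delta> (- f) = - \<delta> f" "\<delta> (sum h A) = (\<Sum>a\<in>A. \<delta> (h a))"
    "\<delta> 1 = 0"
proof -
  show *: "\<delta> (f + g) = \<delta> f + \<delta> g" "\<delta> (scale c f) = scale c (\<delta> f)" "\<delta> (f * g) = \<delta> f * g + f * \<delta> g" for f g c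
    using assms by (simp_all add: derivation_def)
  show 0: "\<delta> 0 = 0" using *(1)[of 0 0] by simp
  show m: "\<delta> (- f) = - \<delta> f" for f using *(2)[of "-1" f] by (simp only: scale_uminus_1)
  show "\<delta> (f - g) = \<delta> f - \<delta> g" using *(1)[of f "-g"] m by simp
  show "\<delta> (sum h A) = (\<Sum>a\<in>A. \<delta> (h a))"
    by (induction A rule: infinite_finite_induct) (auto simp: * 0)
  show "\<delta> 1 = 0" using derivation_const[OF assms, of 1] by (simp add: const_poly_def)
qed

section \<open>The action of the Lie algebra\<close>

lemma prv_in [simp]: "i \<in> {1..r} \<Longrightarrow> prv r i \<in> {1..r}"
  and nxt_in [simp]: "i \<in> {1..r} \<Longrightarrow> nxt r i \<in> {1..r}"
  and nxt_prv [simp]: "i \<in> {1..r} \<Longrightarrow> nxt r (prv r i) = i"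
  and prv_nxt [simp]: "i \<in> {1..r} \<Longrightarrow> prv r (nxt r i) = i"
  by (auto simp: prv_def nxt_def)

lemma prv_neq: "r \<ge> 2 \<Longrightarrow> i \<in> {1..r} \<Longrightarrow> prv r i \<noteq> i"
  and nxt_neq: "r \<ge> 2 \<Longrightarrow> i \<in> {1..r} \<Longrightarrow> nxt r i \<noteq> i"
  by (auto simp: prv_def nxt_def)

lemma prv_inj: "i \<in> {1..r} \<Longrightarrow> j \<in> {1..r} \<Longrightarrow> prv r i = prv r j \<longleftrightarrow> i = j"
  by (metis nxt_prv)

lemma scale_2: "scale 2 f = f + f" "scale (-2) f = - f - f"
  by (intro poly_mapping_eqI; simp add: lookup_add lookup_minus)+

text \<open>\<open>opE\<close>, \<open>opF\<close>, \<open>opH\<close> are the actions on polynomials of the standard basis of the \<open>i\<close>-th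
  copy of \<open>sl\<^sub>2\<close>.\<close>

definition opE :: "nat \<Rightarrow> nat \<Rightarrow> mpoly \<Rightarrow> mpoly" where
  "opE r i f = var_poly (i, 1, 1) * dv (i, 1, 2) f + var_poly (i, 2, 1) * dv (i, 2, 2) f
     - var_poly (prv r i, 2, 1) * dv (prv r i, 1, 1) f - var_poly (prv r i, 2, 2) * dv (prv r i, 1, 2) f"

definition opF :: "nat \<Rightarrow> nat \<Rightarrow> mpoly \<Rightarrow> mpoly" where
  "opF r i f = var_poly (i, 1, 2) * dv (i, 1, 1) f + var_poly (i, 2, 2) * dv (i, 2, 1) f
     - var_poly (prv r i, 1, 1) * dv (prv r i, 2, 1) f - var_poly (prv r i, 1, 2) * dv (prv r i, 2, 2) f"

definition xdx :: "var \<Rightarrow> mpoly \<Rightarrow> mpoly" where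
  "xdx v f = var_poly v * dv v f"

definition opH :: "nat \<Rightarrow> nat \<Rightarrow> mpoly \<Rightarrow> mpoly" where
  "opH r i f = (xdx (i, 1, 1) f + xdx (i, 2, 1) f - xdx (i, 1, 2) f - xdx (i, 2, 2) f)
     - (xdx (prv r i, 1, 1) f + xdx (prv r i, 1, 2) f - xdx (prv r i, 2, 1) f - xdx (prv r i, 2, 2) f)"

definition euler :: "nat \<Rightarrow> mpoly \<Rightarrow> mpoly" where
  "euler k f = xdx (k, 1, 1) f + xdx (k, 1, 2) f + (xdx (k, 2, 1) f + xdx (k, 2, 2) f)"

lemma derivation_xdx: "derivation (xdx v)"
  unfolding xdx_def by (intro derivation_mult) simp

lemma derivation_opE: "derivation (opE r i)"
  and derivation_opF: "derivation (opF r i)"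
  and derivation_opH: "derivation (opH r i)"
  and derivation_euler: "derivation (euler k)"
  unfolding opE_def opF_def opH_def euler_def
  by (intro derivation_add derivation_diff derivation_mult derivation_xdx; simp)+

lemma opE_var: "opE r i (var_poly (k, a, b)) =
   (if k = i \<and> b = 2 then var_poly (i, a, 1) else 0) - (if k = prv r i \<and> a = 1 then var_poly (k, 2, b) else 0)"
  and opF_var: "opF r i (var_poly (k, a, b)) =
   (if k = i \<and> b = 1 then var_poly (i, a, 2) else 0) - (if k = prv r i \<and> a = 2 then var_poly (k, 1, b) else 0)"
  and opH_var: "opH r i (var_poly (k, a, b)) =
   scale ((if k = i then if b = 1 then 1 else -1 else 0) - (if k = prv r i then if a = 1 then 1 else -1 else 0))
     (var_poly (k, a, b))"
  and euler_var: "euler j (var_poly (k, a, b)) = (if k = j then var_poly (k, a, b) else 0)"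
  using exhaust_2[of a] exhaust_2[of b]
  by (auto simp: opE_def opF_def opH_def euler_def xdx_def dv_var scale_uminus_1 cvec.scale_left_diff_distrib
      cvec.scale_left_distrib)

lemmas op_var = opE_var opF_var opH_var euler_var
lemmas opE_simps = derivationD[OF derivation_opE]
lemmas opF_simps = derivationD[OF derivation_opF]
lemmas opH_simps = derivationD[OF derivation_opH]
lemmas euler_simps = derivationD[OF derivation_euler]
text \<open>The commutator of two derivations is again a derivation, so it can be compared with
  \<eta> on the variables.\<close>

lemma commutator_eqI:
  assumes "derivation \<delta>" "derivation \<epsilon>" "derivation \<eta>"
    and "\<And>k a b. a = 1 \<or> a = 2 \<Longrightarrow> b = 1 \<or> b = 2 \<Longrightarrow>
      \<delta> (\<epsilon> (var_poly (k, a, b))) - \<epsilon> (\<delta> (var_poly (k, a, b))) = \<eta> (var_poly (k, a, b))"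
  shows "\<delta> (\<epsilon> f) = \<epsilon> (\<delta> f) + \<eta> f"
proof -
  have "\<delta> (\<epsilon> f) - \<epsilon> (\<delta> f) = \<eta> f"
    by (rule derivation_eqI) (use assms exhaust_2 in \<open>auto intro!: derivation_commutator\<close>)
  then show ?thesis by (simp add: algebra_simps)
qed

lemma commute_eqI:
  assumes "derivation \<delta>" "derivation \<epsilon>"
    and "\<And>k a b. a = 1 \<or> a = 2 \<Longrightarrow> b = 1 \<or> b = 2 \<Longrightarrow>
      \<delta> (\<epsilon> (var_poly (k, a, b))) = \<epsilon> (\<delta> (var_poly (k, a, b)))"
  shows "\<delta> (\<epsilon> f) = \<epsilon> (\<delta> f)"
  using commutator_eqI[OF assms(1,2) derivation_0, of f] assms(3) by simp

context
  fixes r :: nat assumes r: "r \<ge> 2"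
begin

text \<open>Vertex i acts on the columns of X_i and on the rows of the preceding matrix. If two
  vertices share a matrix, one of them acts on its rows and the other on its columns, so their
  actions commute.\<close>

lemma
  assumes "i \<in> {1..r}" "j \<in> {1..r}" "i \<noteq> j"
  shows opE_opF_other: "opE r i (opF r j f) = opF r j (opE r i f)"
    and opE_opE_other: "opE r i (opE r j f) = opE r j (opE r i f)"
    and opF_opF_other: "opF r i (opF r j f) = opF r j (opF r i f)"
proof -
  define p where "p = prv r i"
  define q where "q = prv r j"
  have *: "p \<noteq> i" "q \<noteq> j" "p \<noteq> q" "i \<noteq> j"
    using prv_neq[OF r] prv_inj assms by (auto simp: p_def q_def)
  have pq: "prv r i = p" "prv r j = q" by (simp_all add: p_def q_def)
  have mem: "p \<in> {1..r}" "q \<in> {1..r}" unfolding p_def q_def using assms by (simp_all only: prv_in)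
  \<comment> \<open>With at least two vertices, the two matrices at a vertex are different, so its
    row action and its column action never meet in one variable.\<close>
  have neq: "(prv r x = x) = False" "(x = prv r x) = False" if "x \<in> {1..r}" for x
    using prv_neq[OF r that] by auto
  show "opE r i (opF r j f) = opF r j (opE r i f)"
  proof (rule commute_eqI[OF derivation_opE derivation_opF])
    fix k and a b :: 2 assume "a = 1 \<or> a = 2" "b = 1 \<or> b = 2"
    then show "opE r i (opF r j (var_poly (k, a, b))) = opF r j (opE r i (var_poly (k, a, b)))"
      using * assms mem pq by (elim disjE) (auto simp: neq op_var opE_simps opF_simps opH_simps euler_simps scale_uminus_1 scale_2
        simp del: atLeastAtMost_iff)
  qed
  show "opE r i (opE r j f) = opE r j (opE r i f)"
  proof (rule commute_eqI[OF derivation_opE derivation_opE])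
    fix k and a b :: 2 assume "a = 1 \<or> a = 2" "b = 1 \<or> b = 2"
    then show "opE r i (opE r j (var_poly (k, a, b))) = opE r j (opE r i (var_poly (k, a, b)))"
      using * assms mem pq by (elim disjE) (auto simp: neq op_var opE_simps opF_simps opH_simps euler_simps scale_uminus_1 scale_2
        simp del: atLeastAtMost_iff)
  qed
  show "opF r i (opF r j f) = opF r j (opF r i f)"
  proof (rule commute_eqI[OF derivation_opF derivation_opF])
    fix k and a b :: 2 assume "a = 1 \<or> a = 2" "b = 1 \<or> b = 2"
    then show "opF r i (opF r j (var_poly (k, a, b))) = opF r j (opF r i (var_poly (k, a, b)))"
      using * assms mem pq by (elim disjE) (auto simp: neq op_var opE_simps opF_simps opH_simps euler_simps scale_uminus_1 scale_2
        simp del: atLeastAtMost_iff)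
  qed
qed

lemma
  assumes "i \<in> {1..r}" "j \<in> {1..r}"
  shows opE_opF: "opE r i (opF r j f) = opF r j (opE r i f) + (if i = j then opH r i f else 0)"
    and opH_opE: "opH r i (opE r j f) = opE r j (opH r i f) + scale (if i = j then 2 else 0) (opE r j f)"
    and opH_opF: "opH r i (opF r j f) = opF r j (opH r i f) + scale (if i = j then -2 else 0) (opF r j f)"
proof -
  define p where "p = prv r i"
  define q where "q = prv r j"
  have *: "p \<noteq> i" "q \<noteq> j" "p = q \<longleftrightarrow> i = j"
    using prv_neq[OF r] prv_inj assms by (auto simp: p_def q_def)
  have pq: "prv r i = p" "prv r j = q" by (simp_all add: p_def q_def)
  have mem: "p \<in> {1..r}" "q \<in> {1..r}" unfolding p_def q_def using assms by (simp_all only: prv_in)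
  have neq: "(prv r x = x) = False" "(x = prv r x) = False" if "x \<in> {1..r}" for x
    using prv_neq[OF r that] by auto
  have same: "opE r i (opF r i f) = opF r i (opE r i f) + opH r i f"
  proof (rule commutator_eqI[OF derivation_opE derivation_opF derivation_opH])
    fix k and a b :: 2 assume "a = 1 \<or> a = 2" "b = 1 \<or> b = 2"
    then show "opE r i (opF r i (var_poly (k, a, b))) - opF r i (opE r i (var_poly (k, a, b))) = opH r i (var_poly (k, a, b))"
      using * assms mem pq by (elim disjE) (auto simp: neq op_var opE_simps opF_simps opH_simps euler_simps scale_uminus_1 scale_2
        simp del: atLeastAtMost_iff)
  qed
  then show "opE r i (opF r j f) = opF r j (opE r i f) + (if i = j then opH r i f else 0)"
    using opE_opF_other[OF assms] by auto
  show "opH r i (opE r j f) = opE r j (opH r i f) + scale (if i = j then 2 else 0) (opE r j f)"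
  proof (rule commutator_eqI[OF derivation_opH derivation_opE derivation_scale[OF derivation_opE]])
    fix k and a b :: 2 assume "a = 1 \<or> a = 2" "b = 1 \<or> b = 2"
    then show "opH r i (opE r j (var_poly (k, a, b))) - opE r j (opH r i (var_poly (k, a, b))) = scale (if i = j then 2 else 0) (opE r j (var_poly (k, a, b)))"
      using * assms mem pq by (elim disjE) (auto simp: neq op_var opE_simps opF_simps opH_simps euler_simps scale_uminus_1 scale_2
        simp del: atLeastAtMost_iff)
  qed
  show "opH r i (opF r j f) = opF r j (opH r i f) + scale (if i = j then -2 else 0) (opF r j f)"
  proof (rule commutator_eqI[OF derivation_opH derivation_opF derivation_scale[OF derivation_opF]])
    fix k and a b :: 2 assume "a = 1 \<or> a = 2" "b = 1 \<or> b = 2"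
    then show "opH r i (opF r j (var_poly (k, a, b))) - opF r j (opH r i (var_poly (k, a, b))) = scale (if i = j then -2 else 0) (opF r j (var_poly (k, a, b)))"
      using * assms mem pq by (elim disjE) (auto simp: neq op_var opE_simps opF_simps opH_simps euler_simps scale_uminus_1 scale_2
        simp del: atLeastAtMost_iff)
  qed
qed

text \<open>Each vertex maps the variables of a block to linear combinations of variables of the
  same block, so all multidegrees are preserved.\<close>

lemma
  assumes i: "i \<in> {1..r}"
  shows euler_opE: "euler l (opE r i f) = opE r i (euler l f)"
    and euler_opF: "euler l (opF r i f) = opF r i (euler l f)"
proof -
  define j where "j = i"
  have assms: "i \<in> {1..r}" "j \<in> {1..r}" using i by (simp_all add: j_def)
  define p where "p = prv r i"
  define q where "q = prv r j"
  have *: "p \<noteq> i" "q \<noteq> j" "p = q \<longleftrightarrow> i = j"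
    using prv_neq[OF r] prv_inj assms by (auto simp: p_def q_def)
  have pq: "prv r i = p" "prv r j = q" by (simp_all add: p_def q_def)
  have mem: "p \<in> {1..r}" "q \<in> {1..r}" unfolding p_def q_def using assms by (simp_all only: prv_in)
  have neq: "(prv r x = x) = False" "(x = prv r x) = False" if "x \<in> {1..r}" for x
    using prv_neq[OF r that] by auto
  show "euler l (opE r i f) = opE r i (euler l f)"
  proof (rule commute_eqI[OF derivation_euler derivation_opE])
    fix k and a b :: 2 assume "a = 1 \<or> a = 2" "b = 1 \<or> b = 2"
    then show "euler l (opE r i (var_poly (k, a, b))) = opE r i (euler l (var_poly (k, a, b)))"
      using * assms mem pq by (elim disjE) (auto simp: neq op_var opE_simps opF_simps opH_simps euler_simps scale_uminus_1 scale_2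
        simp del: atLeastAtMost_iff)
  qed
  show "euler l (opF r i f) = opF r i (euler l f)"
  proof (rule commute_eqI[OF derivation_euler derivation_opF])
    fix k and a b :: 2 assume "a = 1 \<or> a = 2" "b = 1 \<or> b = 2"
    then show "euler l (opF r i (var_poly (k, a, b))) = opF r i (euler l (var_poly (k, a, b)))"
      using * assms mem pq by (elim disjE) (auto simp: neq op_var opE_simps opF_simps opH_simps euler_simps scale_uminus_1 scale_2
        simp del: atLeastAtMost_iff)
  qed
qed

end

text \<open>The adjoint of x_u d_v is x_v d_u; exchanging u and v term by term turns
  \<open>opE\<close> into \<open>opF\<close>. This is the Hermitian structure belonging to the
  compact form SU(2).\<close>

lemma fischer_opE: "fischer (opE r i f) g = fischer f (opF r i g)"
  and fischer_opF: "fischer (opF r i f) g = fischer f (opE r i g)"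
  by (simp_all add: opE_def opF_def fischer_add_left fischer_diff fischer_add_right fischer_var_mult fischer_dv_left)

lemma fischer_opE_right: "fischer f (opE r i g) = fischer (opF r i f) g"
  and fischer_opF_right: "fischer f (opF r i g) = fischer (opE r i f) g"
  by (simp_all add: fischer_opE fischer_opF)

section \<open>Multidegrees and weights of monomials\<close>

definition mdeg :: "(var \<Rightarrow>\<^sub>0 nat) \<Rightarrow> nat \<Rightarrow> nat" where
  "mdeg \<alpha> k = (\<Sum>a\<in>UNIV. \<Sum>b\<in>UNIV. lookup \<alpha> (k, a, b))"

definition mwt :: "nat \<Rightarrow> (var \<Rightarrow>\<^sub>0 nat) \<Rightarrow> nat \<Rightarrow> int" where
  "mwt r \<alpha> i = (int (lookup \<alpha> (i, 1, 1)) + int (lookup \<alpha> (i, 2, 1)) - int (lookup \<alpha> (i, 1, 2)) - int (lookup \<alpha> (i, 2, 2)))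
    - (int (lookup \<alpha> (prv r i, 1, 1)) + int (lookup \<alpha> (prv r i, 1, 2))
        - int (lookup \<alpha> (prv r i, 2, 1)) - int (lookup \<alpha> (prv r i, 2, 2)))"

lemma lookup_xdx: "lookup (xdx v f) \<alpha> = of_nat (lookup \<alpha> v) * lookup f \<alpha>"
proof (induction f rule: pm_additive_induct)
  case (single \<beta> c)
  have "Poly_Mapping.single v 1 + (\<beta> - Poly_Mapping.single v 1) = \<beta>" if "lookup \<beta> v \<noteq> 0"
    using that by (intro poly_mapping_eqI) (auto simp: lookup_add lookup_minus lookup_single when_def)
  then have "xdx v (Poly_Mapping.single \<beta> c) = Poly_Mapping.single \<beta> (of_nat (lookup \<beta> v) * c)"
    by (cases "lookup \<beta> v = 0") (auto simp: xdx_def dv_single var_poly_def mult_single)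
  then show ?case by (simp add: lookup_single when_def)
qed (simp add: derivationD[OF derivation_xdx] lookup_add algebra_simps)

lemma lookup_euler: "lookup (euler k f) \<alpha> = of_nat (mdeg \<alpha> k) * lookup f \<alpha>"
  by (simp add: euler_def lookup_add lookup_xdx mdeg_def sum_2 algebra_simps)

lemma lookup_opH: "lookup (opH r i f) \<alpha> = of_int (mwt r \<alpha> i) * lookup f \<alpha>"
  by (simp add: opH_def lookup_add lookup_minus lookup_xdx mwt_def algebra_simps)

lemma mdeg_add: "mdeg (\<alpha> + \<beta>) k = mdeg \<alpha> k + mdeg \<beta> k"
  and mwt_add: "mwt r (\<alpha> + \<beta>) i = mwt r \<alpha> i + mwt r \<beta> i"
  by (simp_all add: mdeg_def mwt_def lookup_add sum.distrib)

text \<open>Extension by 0 outside [r] makes one family of degree conditions, over all k, also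
  confine the variables to those of V.\<close>

definition deg_ext :: "nat \<Rightarrow> (nat \<Rightarrow> nat) \<Rightarrow> nat \<Rightarrow> nat" where
  "deg_ext r n k = (if k \<in> {1..r} then n k else 0)"

definition Mon :: "nat \<Rightarrow> (nat \<Rightarrow> nat) \<Rightarrow> (nat \<Rightarrow> int) \<Rightarrow> (var \<Rightarrow>\<^sub>0 nat) set" where
  "Mon r n \<mu> = {\<alpha>. (\<forall>k. mdeg \<alpha> k = deg_ext r n k) \<and> (\<forall>i\<in>{1..r}. mwt r \<alpha> i = \<mu> i)}"

lemma CV_iff: "f \<in> CV r \<longleftrightarrow> (\<forall>\<alpha>\<in>keys f. \<forall>k. k \<notin> {1..r} \<longrightarrow> mdeg \<alpha> k = 0)"
proof
  assume "f \<in> CV r"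
  then show "\<forall>\<alpha>\<in>keys f. \<forall>k. k \<notin> {1..r} \<longrightarrow> mdeg \<alpha> k = 0"
    unfolding CV_def mdeg_def by (force simp: in_keys_iff)
next
  assume *: "\<forall>\<alpha>\<in>keys f. \<forall>k. k \<notin> {1..r} \<longrightarrow> mdeg \<alpha> k = 0"
  have "i \<in> {1..r}" if "\<alpha> \<in> keys f" "(i, a, b) \<in> keys \<alpha>" for \<alpha> i a b
  proof (rule ccontr)
    assume "i \<notin> {1..r}"
    with * that have "mdeg \<alpha> i = 0" by blast
    then show False using that exhaust_2[of a] exhaust_2[of b]
      by (auto simp: mdeg_def sum_2 in_keys_iff)
  qed
  then show "f \<in> CV r" unfolding CV_def by auto
qed

lemma CV_graded_iff: "f \<in> CV_graded r n \<longleftrightarrow> (\<forall>\<alpha>\<in>keys f. \<forall>k. mdeg \<alpha> k = deg_ext r n k)"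
  unfolding CV_graded_def mem_Collect_eq CV_iff deg_ext_def
  by (auto simp flip: mdeg_def)

lemma eigen_iff_keys:
  assumes "\<And>\<alpha>. lookup (\<delta> f) \<alpha> = of_int (w \<alpha>) * lookup f \<alpha>"
  shows "\<delta> f = scale (of_int c) f \<longleftrightarrow> (\<forall>\<alpha>\<in>keys f. w \<alpha> = c)"
  by (auto simp: poly_mapping_eq_iff fun_eq_iff assms in_keys_iff)

text \<open>As joint eigenspaces of the Euler operators, the graded pieces are preserved by every
  linear operator that commutes with these.\<close>

lemma CV_graded_iff_euler:
  "f \<in> CV_graded r n \<longleftrightarrow> (\<forall>k. euler k f = scale (of_nat (deg_ext r n k)) f)"
  using eigen_iff_keys[of "euler k" f "\<lambda>\<alpha>. int (mdeg \<alpha> k)" "int (deg_ext r n k)" for k]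
  by (auto simp: CV_graded_iff lookup_euler)

definition wspace :: "nat \<Rightarrow> (nat \<Rightarrow> int) \<Rightarrow> mpoly set" where
  "wspace r \<mu> = {f. \<forall>i\<in>{1..r}. opH r i f = scale (of_int (\<mu> i)) f}"

lemma wspace_iff: "f \<in> wspace r \<mu> \<longleftrightarrow> (\<forall>\<alpha>\<in>keys f. \<forall>i\<in>{1..r}. mwt r \<alpha> i = \<mu> i)"
  using eigen_iff_keys[of "opH r i" f "\<lambda>\<alpha>. mwt r \<alpha> i" "\<mu> i" for i]
  by (auto simp: wspace_def lookup_opH)

lemma graded_wspace_iff: "f \<in> CV_graded r n \<inter> wspace r \<mu> \<longleftrightarrow> keys f \<subseteq> Mon r n \<mu>"
  by (auto simp: CV_graded_iff wspace_iff Mon_def)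

lemma finite_mdeg: "finite {\<alpha>. \<forall>k. mdeg \<alpha> k = deg_ext r n k}"
proof -
  let ?V = "{1..r} \<times> (UNIV :: (2 \<times> 2) set)"
  let ?B = "PiE ?V (\<lambda>(k, _). {..n k})"
  have "inj_on (\<lambda>\<alpha>. restrict (lookup \<alpha>) ?V) {\<alpha>. \<forall>k. mdeg \<alpha> k = deg_ext r n k}"
  proof (rule inj_onI, rule poly_mapping_eqI)
    fix \<alpha> \<beta> and v :: var
    assume \<alpha>: "\<alpha> \<in> {\<alpha>. \<forall>k. mdeg \<alpha> k = deg_ext r n k}" and \<beta>: "\<beta> \<in> {\<alpha>. \<forall>k. mdeg \<alpha> k = deg_ext r n k}"
      and eq: "restrict (lookup \<alpha>) ?V = restrict (lookup \<beta>) ?V"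
    obtain k a b where v: "v = (k, a, b)" by (metis prod_cases3)
    show "lookup \<alpha> v = lookup \<beta> v"
    proof (cases "k \<in> {1..r}")
      case True
      then have "v \<in> ?V" by (simp add: v)
      then show ?thesis using fun_cong[OF eq, of v] by simp
    next
      case False
      then have "mdeg \<alpha> k = 0" "mdeg \<beta> k = 0" using \<alpha> \<beta> by (auto simp: deg_ext_def)
      then show ?thesis using exhaust_2[of a] exhaust_2[of b] by (auto simp: mdeg_def sum_2 v)
    qed
  qed
  moreover have "(\<lambda>\<alpha>. restrict (lookup \<alpha>) ?V) ` {\<alpha>. \<forall>k. mdeg \<alpha> k = deg_ext r n k} \<subseteq> ?B"
  proof (rule image_subsetI)
    fix \<alpha> :: "var \<Rightarrow>\<^sub>0 nat" assume "\<alpha> \<in> {\<alpha>. \<forall>k. mdeg \<alpha> k = deg_ext r n k}"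
    then have \<alpha>: "\<forall>k. mdeg \<alpha> k = deg_ext r n k" by simp
    have "lookup \<alpha> (k, a, b) \<le> n k" if "k \<in> {1..r}" for k a b
      using \<alpha>[rule_format, of k] that exhaust_2[of a] exhaust_2[of b]
      by (auto simp: mdeg_def sum_2 deg_ext_def)
    then show "restrict (lookup \<alpha>) ?V \<in> ?B" by auto
  qed
  moreover have "finite ?B" by (intro finite_PiE) auto
  ultimately show ?thesis using finite_subset finite_imageD by blast
qed

lemma finite_Mon [simp]: "finite (Mon r n \<mu>)"
  by (rule finite_subset[OF _ finite_mdeg[of r n]]) (auto simp: Mon_def)

section \<open>The trace and the determinant of the monodromy\<close>

text \<open>The trace of \<open>X\<^sub>r \<dots> X\<^sub>1\<close> is written as a sum over closed paths.\<close>

definition path_poly :: "nat \<Rightarrow> (nat \<Rightarrow> 2) \<Rightarrow> mpoly" where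
  "path_poly r c = (\<Prod>i\<in>{1..r}. var_poly (i, c (nxt r i), c i))"

definition tr_poly :: "nat \<Rightarrow> mpoly" where
  "tr_poly r = (\<Sum>c\<in>{1..r} \<rightarrow>\<^sub>E UNIV. path_poly r c)"

definition det_var :: "nat \<Rightarrow> mpoly" where
  "det_var i = var_poly (i, 1, 1) * var_poly (i, 2, 2) - var_poly (i, 1, 2) * var_poly (i, 2, 1)"

definition det_poly :: "nat \<Rightarrow> mpoly" where
  "det_poly r = (\<Prod>i\<in>{1..r}. det_var i)"

lemma derivation_prod_0:
  assumes "derivation \<delta>" "\<And>i. i \<in> A \<Longrightarrow> \<delta> (h i) = 0"
  shows "\<delta> (prod h A) = 0"
  using assms(2) by (induction A rule: infinite_finite_induct) (auto simp: derivationD[OF assms(1)])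

text \<open>Each vertex acts on a matrix X_k by traceless row or column operations, which annihilate
  its determinant; hence every factor is annihilated separately.\<close>

lemma op_det_poly:
  assumes "r \<ge> 2" "i \<in> {1..r}"
  shows "opE r i (det_poly r) = 0" "opF r i (det_poly r) = 0"
proof -
  note p = prv_neq[OF assms]
  have "opE r i (det_var k) = 0" "opF r i (det_var k) = 0" for k
    by (cases "k = i"; cases "k = prv r i";
        use p p[symmetric] in \<open>simp add: det_var_def op_var opE_simps opF_simps\<close>)+
  note 0 = this
  show "opE r i (det_poly r) = 0"
    unfolding det_poly_def by (rule derivation_prod_0[OF derivation_opE]) (rule 0)
  show "opF r i (det_poly r) = 0"
    unfolding det_poly_def by (rule derivation_prod_0[OF derivation_opF]) (rule 0)
qed

text \<open>Only two factors of a path involve its index x at vertex i: an entry in column x of X_i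
  and an entry in row x of the preceding matrix. Summing over x contracts these two indices, on
  which the vertex acts by mutually dual representations, so the sum is annihilated.\<close>

lemma op_tr_poly:
  assumes r: "r \<ge> 2" and i: "i \<in> {1..r}"
  shows "opE r i (tr_poly r) = 0" "opF r i (tr_poly r) = 0"
proof -
  note p = prv_neq[OF r i] prv_in[OF i]
  define S where "S = {1..r} - {i}"
  have ins: "{1..r} = insert i S" "i \<notin> S" using i by (auto simp: S_def)
  define R where "R g = (\<Prod>j\<in>{1..r} - {i, prv r i}. var_poly (j, g (nxt r j), g j))" for g :: "nat \<Rightarrow> 2"
  have path: "path_poly r (g(i := x)) =
      var_poly (i, g (nxt r i), x) * (var_poly (prv r i, x, g (prv r i)) * R g)" for g x
  proof -
    have n: "nxt r j \<noteq> i" if "j \<in> {1..r} - {i, prv r i}" for j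
      using that prv_nxt[of j r] by auto
    define D where "D = {1..r} - {i, prv r i}"
    define h where "h j = var_poly (j, (g(i := x)) (nxt r j), (g(i := x)) j)" for j
    have D: "{1..r} = insert i (insert (prv r i) D)" "finite D" "i \<notin> D" "prv r i \<notin> D"
      using i p unfolding D_def by auto
    have "path_poly r (g(i := x)) = prod h (insert i (insert (prv r i) D))"
      unfolding path_poly_def h_def D(1)[symmetric] ..
    also have "\<dots> = h i * (h (prv r i) * prod h D)"
      using D(2-4) p(1) by simp
    also have "prod h D = R g"
      unfolding R_def D_def h_def by (intro prod.cong) (use n in auto)
    finally show ?thesis using p nxt_neq[OF r i] nxt_prv[OF i] by (simp add: h_def fun_upd_def)
  qed
  have tr: "tr_poly r = (\<Sum>g\<in>S \<rightarrow>\<^sub>E UNIV. path_poly r (g(i := 1)) + path_poly r (g(i := 2)))"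
  proof -
    have "tr_poly r = (\<Sum>(x, g)\<in>UNIV \<times> (S \<rightarrow>\<^sub>E UNIV). path_poly r (g(i := x)))"
      unfolding tr_poly_def ins(1) PiE_insert_eq
      by (subst sum.reindex) (use inj_combinator[OF ins(2), of "\<lambda>_. UNIV"] in \<open>auto simp: case_prod_unfold\<close>)
    also have "\<dots> = (\<Sum>g\<in>S \<rightarrow>\<^sub>E UNIV. \<Sum>x\<in>UNIV. path_poly r (g(i := x)))"
      by (subst sum.cartesian_product[symmetric], subst sum.swap) simp
    finally show ?thesis by (simp only: sum_2)
  qed
  \<comment> \<open>The remaining factors lie in blocks on which vertex i does not act.\<close>
  have RE: "opE r i (R g) = 0" for g
    unfolding R_def by (rule derivation_prod_0[OF derivation_opE]) (simp add: op_var)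
  have RF: "opF r i (R g) = 0" for g
    unfolding R_def by (rule derivation_prod_0[OF derivation_opF]) (simp add: op_var)
  show "opE r i (tr_poly r) = 0" "opF r i (tr_poly r) = 0"
    unfolding tr opE_simps(7) opF_simps(7) path
    by (intro sum.neutral ballI; use p in \<open>simp add: opE_simps opF_simps op_var RE RF algebra_simps\<close>)+
qed

lemma op_H_of_EF:
  assumes "r \<ge> 2" "i \<in> {1..r}" "opE r i f = 0" "opF r i f = 0"
  shows "opH r i f = 0"
  using opE_opF[OF assms(1,2,2), of f] assms by (simp add: opE_simps opF_simps)

lemma euler_path_poly: "euler k (path_poly r c) = scale (of_nat (deg_ext r (\<lambda>_. 1) k)) (path_poly r c)"
proof -
  have "euler k (\<Prod>i\<in>S. var_poly (i, c (nxt r i), c i)) =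
      (if k \<in> S then (\<Prod>i\<in>S. var_poly (i, c (nxt r i), c i)) else 0)" if "finite S" for S
    using that by induction (auto simp: euler_simps euler_var)
  from this[of "{1..r}"] show ?thesis by (simp add: path_poly_def deg_ext_def)
qed

lemma euler_tr_poly: "euler k (tr_poly r) = scale (of_nat (deg_ext r (\<lambda>_. 1) k)) (tr_poly r)"
  unfolding tr_poly_def euler_simps(7) euler_path_poly cvec.scale_sum_right ..

lemma euler_det_poly: "euler k (det_poly r) = scale (of_nat (deg_ext r (\<lambda>_. 2) k)) (det_poly r)"
proof -
  have 1: "euler k (det_var i) = (if i = k then scale 2 (det_var i) else 0)" for i
    by (auto simp: det_var_def euler_simps euler_var cvec.scale_right_diff_distrib
       simp flip: cvec.scale_left_distrib[of 1 1, simplified])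
  have "euler k (\<Prod>i\<in>S. det_var i) = (if k \<in> S then scale 2 (\<Prod>i\<in>S. det_var i) else 0)" if "finite S" for S
    using that by induction (auto simp: euler_simps 1 scale_mult_left scale_mult_right[symmetric])
  from this[of "{1..r}"] show ?thesis by (simp add: det_poly_def deg_ext_def)
qed

lemma cnjp_var [simp]: "cnjp (var_poly v) = var_poly v"
  by (simp add: var_poly_def)

lemma cnjp_diff: "cnjp (f - g) = cnjp f - cnjp g"
  by (intro poly_mapping_eqI; simp add: lookup_minus)+

lemma cnjp_prod: "cnjp (prod h A) = (\<Prod>a\<in>A. cnjp (h a))"
  by (induction A rule: infinite_finite_induct) (auto simp: cnjp_mult cnjp_single[of 0 1, simplified])

lemma cnjp_sum: "cnjp (sum h A) = (\<Sum>a\<in>A. cnjp (h a))"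
  by (induction A rule: infinite_finite_induct) (auto simp: cnjp_add cnjp_single[of 0 0, simplified])

text \<open>Real coefficients: the operators of both invariants are adjoint to multiplication by the
  invariants themselves.\<close>

lemma cnjp_invariants [simp]: "cnjp (tr_poly r) = tr_poly r" "cnjp (det_poly r) = det_poly r"
  by (simp_all add: tr_poly_def path_poly_def det_poly_def det_var_def cnjp_sum cnjp_prod cnjp_diff cnjp_mult)

section \<open>Leading monomials\<close>

abbreviation mon :: "('v \<Rightarrow>\<^sub>0 nat) \<Rightarrow> (('v \<Rightarrow>\<^sub>0 nat) \<Rightarrow>\<^sub>0 complex)" where
  "mon \<alpha> \<equiv> Poly_Mapping.single \<alpha> 1"

lemma pm_eq_sum_scale_mon: "f = (\<Sum>\<alpha>\<in>keys f. scale (lookup f \<alpha>) (mon \<alpha>))"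
  using pm_eq_sum_single[OF finite_keys order_refl, of f] by simp

lemma span_mon_iff: "f \<in> cvec.span (mon ` X) \<longleftrightarrow> keys f \<subseteq> X"
proof
  assume "f \<in> cvec.span (mon ` X)"
  then show "keys f \<subseteq> X"
  proof (induction rule: cvec.span_induct_alt)
    case (step c x y)
    have "keys (scale c x + y) \<subseteq> keys (scale c x) \<union> keys y" by (rule keys_add)
    moreover have "keys (scale c x) \<subseteq> keys x" by (auto simp: in_keys_iff)
    moreover have "keys x \<subseteq> X" using step by auto
    ultimately show ?case using step by blast
  qed simp
next
  assume "keys f \<subseteq> X"
  then show "f \<in> cvec.span (mon ` X)"
    by (subst pm_eq_sum_scale_mon) (intro cvec.span_sum cvec.span_scale cvec.span_base, auto)
qed

lemma inj_mon: "inj_on mon X"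
  by (rule inj_onI) (metis keys_single one_neq_zero singleton_inject)

lemma independent_mon: "cvec.independent (mon ` X)"
  unfolding cvec.dependent_def
proof safe
  fix \<alpha> assume "\<alpha> \<in> X" "mon \<alpha> \<in> cvec.span (mon ` X - {mon \<alpha>})"
  moreover have "mon ` X - {mon \<alpha>} = mon ` (X - {\<alpha>})"
    using inj_on_image_set_diff[OF inj_mon[of UNIV], of X "{\<alpha>}"] \<open>\<alpha> \<in> X\<close> by simp
  ultimately have "keys (mon \<alpha>) \<subseteq> X - {\<alpha>}" by (simp only: span_mon_iff)
  then show False by simp
qed

text \<open>Gram-Schmidt for a spanning set that may be dependent: the new vector is replaced by its
  component \<open>s - s1\<close> orthogonal to the span of the others.\<close>

lemma fischer_projection:
  assumes "finite S"
  shows "\<exists>j\<in>cvec.span S. \<forall>x\<in>S. fischer x (f - j) = 0"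
  using assms
proof (induction S arbitrary: f)
  case (insert s S)
  obtain s1 where s1: "s1 \<in> cvec.span S" "\<forall>x\<in>S. fischer x (s - s1) = 0" using insert.IH by blast
  obtain j where j: "j \<in> cvec.span S" "\<forall>x\<in>S. fischer x (f - j) = 0" using insert.IH by blast
  let ?s = "s - s1"
  \<comment> \<open>If s already lies in the span of S, then \<open>?s = 0\<close>, and division by
    zero gives \<open>c = 0\<close>.\<close>
  define c where "c = fischer ?s (f - j) / fischer ?s ?s"
  have sub: "cvec.span S \<subseteq> cvec.span (insert s S)" by (intro cvec.span_mono) auto
  have S0: "fischer x (f - (j + scale c ?s)) = 0" if "x \<in> S" for x
    using that s1 j by (simp add: fischer_diff fischer_add_right fischer_scale_right)
  have span0: "fischer x (f - (j + scale c ?s)) = 0" if "x \<in> cvec.span S" for x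
    using that by (induction rule: cvec.span_induct_alt) (auto simp: fischer_add_left fischer_scale_left S0)
  have "fischer ?s (f - (j + scale c ?s)) = 0"
    unfolding diff_diff_eq[symmetric] fischer_diff(2)[of ?s "f - j" "scale c ?s"] fischer_scale_right
  proof (cases "?s = 0")
    case False
    then have "fischer ?s ?s \<noteq> 0" by (simp only: fischer_self_eq_0 not_False_eq_True)
    then show "fischer ?s (f - j) - c * fischer ?s ?s = 0" unfolding c_def by simp
  qed simp
  then have "fischer s (f - (j + scale c ?s)) = 0"
    using span0[OF s1(1)] by (simp add: fischer_diff)
  moreover have "j + scale c ?s \<in> cvec.span (insert s S)"
    using s1(1) j(1) sub by (intro cvec.span_add cvec.span_scale cvec.span_diff) (auto intro: cvec.span_base)
  ultimately show ?case using S0 by (intro bexI[of _ "j + scale c ?s"]) auto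
qed (auto intro: cvec.span_zero)

lemma fischer_span_left:
  "f \<in> cvec.span S \<Longrightarrow> (\<And>x. x \<in> S \<Longrightarrow> fischer x g = 0) \<Longrightarrow> fischer f g = 0"
  by (induction rule: cvec.span_induct_alt) (auto simp: fischer_add_left fischer_scale_left)

lemma fischer_disjoint_keys: "keys f \<inter> keys g = {} \<Longrightarrow> fischer f g = 0"
  unfolding fischer_def by (intro sum.neutral) (auto simp: in_keys_iff)

text \<open>With these weights of the variables, the invariants \<open>tr_poly\<close> and \<open>det_poly\<close> have the coprime
  leading monomials \<open>Tmon\<close> and \<open>Dmon\<close>.\<close>

definition mw :: "nat \<Rightarrow> (var \<Rightarrow>\<^sub>0 nat) \<Rightarrow> nat" where
  "mw r \<alpha> = (\<Sum>i\<in>{1..r}. 3 * lookup \<alpha> (i, 1, 1) + 2 * lookup \<alpha> (i, 1, 2) + 2 * lookup \<alpha> (i, 2, 1))"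

definition Tmon :: "nat \<Rightarrow> var \<Rightarrow>\<^sub>0 nat" where
  "Tmon r = (\<Sum>i\<in>{1..r}. Poly_Mapping.single (i, 1, 1) 1)"

definition Dmon :: "nat \<Rightarrow> var \<Rightarrow>\<^sub>0 nat" where
  "Dmon r = (\<Sum>i\<in>{1..r}. Poly_Mapping.single (i, 1, 2) 1 + Poly_Mapping.single (i, 2, 1) 1)"

definition mdvd :: "('v \<Rightarrow>\<^sub>0 nat) \<Rightarrow> ('v \<Rightarrow>\<^sub>0 nat) \<Rightarrow> bool" where
  "mdvd \<tau> \<alpha> \<longleftrightarrow> (\<exists>\<beta>. \<alpha> = \<beta> + \<tau>)"

lemma mdvd_iff: "mdvd \<tau> \<alpha> \<longleftrightarrow> (\<forall>v. lookup \<tau> v \<le> lookup \<alpha> v)"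
proof
  assume "\<forall>v. lookup \<tau> v \<le> lookup \<alpha> v"
  then have "\<alpha> = (\<alpha> - \<tau>) + \<tau>" by (intro poly_mapping_eqI) (simp add: lookup_add lookup_minus)
  then show "mdvd \<tau> \<alpha>" unfolding mdvd_def by blast
qed (auto simp: mdvd_def lookup_add)

lemma lookup_Tmon: "lookup (Tmon r) (i, a, b) = (if i \<in> {1..r} \<and> a = 1 \<and> b = 1 then 1 else 0)"
proof -
  have "lookup (Tmon r) (i, a, b) = (\<Sum>j\<in>{1..r}. if j = i then if a = 1 \<and> b = 1 then 1 else 0 else 0)"
    unfolding Tmon_def lookup_sum by (intro sum.cong) (auto simp: lookup_single when_def)
  then show ?thesis by (simp add: sum.delta)
qed

lemma lookup_Dmon: "lookup (Dmon r) (i, a, b) =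
   (if i \<in> {1..r} \<and> (a = 1 \<and> b = 2 \<or> a = 2 \<and> b = 1) then 1 else 0)"
proof -
  have "lookup (Dmon r) (i, a, b) =
      (\<Sum>j\<in>{1..r}. if j = i then if a = 1 \<and> b = 2 \<or> a = 2 \<and> b = 1 then 1 else 0 else 0)"
    unfolding Dmon_def lookup_sum by (intro sum.cong) (auto simp: lookup_add lookup_single when_def)
  then show ?thesis by (simp add: sum.delta)
qed

lemma mw_add: "mw r (\<alpha> + \<beta>) = mw r \<alpha> + mw r \<beta>"
  by (simp add: mw_def lookup_add sum.distrib algebra_simps)

lemma mw_0 [simp]: "mw r 0 = 0" by (simp add: mw_def)

lemma mw_sum: "mw r (sum h A) = (\<Sum>a\<in>A. mw r (h a))"
  by (induction A rule: infinite_finite_induct) (auto simp: mw_add)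

lemma mw_single: "i \<in> {1..r} \<Longrightarrow> mw r (Poly_Mapping.single (i, a, b) 1) =
   (if a = 1 \<and> b = 1 then 3 else if a = 2 \<and> b = 2 then 0 else 2)"
proof -
  assume i: "i \<in> {1..r}"
  have "mw r (Poly_Mapping.single (i, a, b) 1) =
    (\<Sum>j\<in>{1..r}. if j = i then (if a = 1 \<and> b = 1 then 3 else if a = 2 \<and> b = 2 then 0 else 2) else 0)"
    unfolding mw_def using exhaust_2[of a] exhaust_2[of b]
    by (intro sum.cong) (auto simp: lookup_single when_def)
  then show ?thesis using i by (simp add: sum.delta)
qed

text \<open>Not a monomial order: only weights are compared, and for nonzero c the monomial \<tau>
  must be the unique one of top weight. The form as a difference lets products be treated
  algebraically.\<close>

definition leading :: "nat \<Rightarrow> mpoly \<Rightarrow> (var \<Rightarrow>\<^sub>0 nat) \<Rightarrow> complex \<Rightarrow> bool" where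
  "leading r f \<tau> c \<longleftrightarrow> (\<forall>\<alpha>\<in>keys (f - Poly_Mapping.single \<tau> c). mw r \<alpha> < mw r \<tau>)"

text \<open>The flag \<open>strict\<close> tells which factor has the strict weight bound, so that
  one lemma serves both error terms of \<open>leading_mult\<close>.\<close>

lemma keys_mult_mw:
  assumes "\<And>\<alpha>. \<alpha> \<in> keys f \<Longrightarrow> mw r \<alpha> < a \<or> mw r \<alpha> \<le> a \<and> strict" "\<And>\<beta>. \<beta> \<in> keys g \<Longrightarrow> mw r \<beta> \<le> b \<and> (strict \<longrightarrow> mw r \<beta> < b)"
    and "\<gamma> \<in> keys (f * g)"
  shows "mw r \<gamma> < a + b"
proof -
  obtain \<alpha> \<beta> where "\<alpha> \<in> keys f" "\<beta> \<in> keys g" "\<gamma> = \<alpha> + \<beta>"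
    using keys_mult[of f g] assms(3) by blast
  then show ?thesis using assms(1)[of \<alpha>] assms(2)[of \<beta>] by (auto simp: mw_add)
qed

lemma leading_le: "leading r f \<tau> c \<Longrightarrow> \<alpha> \<in> keys f \<Longrightarrow> mw r \<alpha> \<le> mw r \<tau>"
proof (cases "\<alpha> = \<tau>")
  case False
  assume "leading r f \<tau> c" "\<alpha> \<in> keys f"
  moreover from this False have "\<alpha> \<in> keys (f - Poly_Mapping.single \<tau> c)"
    by (simp add: in_keys_iff lookup_minus lookup_single)
  ultimately show ?thesis unfolding leading_def by (meson less_imp_le)
qed simp

lemma leading_mult:
  assumes "leading r f \<sigma> c" "leading r g \<tau> d"
  shows "leading r (f * g) (\<sigma> + \<tau>) (c * d)"
  unfolding leading_def
proof
  fix \<gamma>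
  let ?f = "f - Poly_Mapping.single \<sigma> c" and ?g = "g - Poly_Mapping.single \<tau> d"
  have eq: "f * g - Poly_Mapping.single (\<sigma> + \<tau>) (c * d) = ?f * g + Poly_Mapping.single \<sigma> c * ?g"
    by (simp add: algebra_simps mult_single)
  assume "\<gamma> \<in> keys (f * g - Poly_Mapping.single (\<sigma> + \<tau>) (c * d))"
  then have "\<gamma> \<in> keys (?f * g) \<union> keys (Poly_Mapping.single \<sigma> c * ?g)"
    unfolding eq using keys_add by (rule rev_subsetD)
  then consider "\<gamma> \<in> keys (?f * g)" | "\<gamma> \<in> keys (Poly_Mapping.single \<sigma> c * ?g)" by blast
  then show "mw r \<gamma> < mw r (\<sigma> + \<tau>)"
  proof cases
    case 1
    then show ?thesis unfolding mw_add
      by (rule keys_mult_mw[where strict = False, rotated 2])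
        (use assms leading_le in \<open>auto simp: leading_def\<close>)
  next
    case 2
    then show ?thesis unfolding mw_add
      by (rule keys_mult_mw[where strict = True, rotated 2])
        (use assms in \<open>auto simp: leading_def less_imp_le split: if_splits\<close>)
  qed
qed

lemma leading_mon [simp]: "leading r (mon \<alpha>) \<alpha> 1"
  by (simp add: leading_def)

lemma path_poly_mon: "path_poly r c = mon (\<Sum>i\<in>{1..r}. Poly_Mapping.single (i, c (nxt r i), c i) 1)"
proof -
  have "(\<Prod>i\<in>S. var_poly (i, c (nxt r i), c i)) = mon (\<Sum>i\<in>S. Poly_Mapping.single (i, c (nxt r i), c i) 1)"
    if "finite S" for S
    using that by induction (auto simp: var_poly_def mult_single)
  then show ?thesis by (simp add: path_poly_def)
qed

lemma mw_Tmon: "mw r (Tmon r) = 3 * r"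
proof -
  have "mw r (Tmon r) = (\<Sum>i\<in>{1..r}. 3)"
    unfolding Tmon_def mw_sum by (intro sum.cong refl) (subst mw_single; simp)
  then show ?thesis by simp
qed

text \<open>The constant path with index 1 consists of entries (1, 1), of weight 3. A path whose
  index at i differs from 1 contains an entry in the second column of X_i, of weight at most
  2.\<close>

lemma leading_tr_poly: "leading r (tr_poly r) (Tmon r) 1"
proof -
  define c1 :: "nat \<Rightarrow> 2" where "c1 = (\<lambda>i\<in>{1..r}. 1)"
  have c1: "c1 \<in> {1..r} \<rightarrow>\<^sub>E UNIV" by (simp add: c1_def)
  have T: "path_poly r c1 = mon (Tmon r)"
  proof -
    have "c1 (nxt r i) = 1 \<and> c1 i = 1" if "i \<in> {1..r}" for i
      using that nxt_in[OF that] by (simp add: c1_def)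
    then show ?thesis
      unfolding path_poly_mon Tmon_def by (intro arg_cong[where f = mon] sum.cong refl) simp
  qed
  have fin: "finite ({1..r} \<rightarrow>\<^sub>E (UNIV :: 2 set))" by (intro finite_PiE) auto
  have "mw r \<alpha> < mw r (Tmon r)"
    if c: "c \<in> ({1..r} \<rightarrow>\<^sub>E UNIV) - {c1}" and \<alpha>: "\<alpha> \<in> keys (path_poly r c)" for c \<alpha>
  proof -
    obtain i where i: "i \<in> {1..r}" "c i \<noteq> 1"
      using c unfolding c1_def by (auto simp: fun_eq_iff PiE_iff extensional_def split: if_splits)
    have "mw r \<alpha> = (\<Sum>i\<in>{1..r}. mw r (Poly_Mapping.single (i, c (nxt r i), c i) 1))"
      using \<alpha> unfolding path_poly_mon by (simp add: mw_sum)
    also have "\<dots> < (\<Sum>i\<in>{1..r}. 3)"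
    proof (rule sum_strict_mono_ex1)
      show "\<forall>j\<in>{1..r}. mw r (Poly_Mapping.single (j, c (nxt r j), c j) 1) \<le> 3"
        by (intro ballI, subst mw_single) auto
      show "\<exists>j\<in>{1..r}. mw r (Poly_Mapping.single (j, c (nxt r j), c j) 1) < 3"
        by (intro bexI[of _ i] i(1), subst mw_single[OF i(1)]) (use i(2) in auto)
    qed simp
    finally show ?thesis by (simp add: mw_Tmon)
  qed
  note lt = this
  have "tr_poly r - mon (Tmon r) = (\<Sum>c\<in>({1..r} \<rightarrow>\<^sub>E UNIV) - {c1}. path_poly r c)"
    unfolding tr_poly_def T[symmetric] using sum.remove[OF fin c1, of "path_poly r"] by simp
  note sum = this
  show ?thesis
    unfolding leading_def sum
  proof
    fix \<alpha> assume "\<alpha> \<in> keys (\<Sum>c\<in>({1..r} \<rightarrow>\<^sub>E UNIV) - {c1}. path_poly r c)"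
    then obtain c where "c \<in> ({1..r} \<rightarrow>\<^sub>E UNIV) - {c1}" "\<alpha> \<in> keys (path_poly r c)"
      using keys_sum[of "path_poly r" "({1..r} \<rightarrow>\<^sub>E UNIV) - {c1}"] by fast
    then show "mw r \<alpha> < mw r (Tmon r)" by (rule lt)
  qed
qed

text \<open>The antidiagonal product weighs 2 + 2, the diagonal one 3 + 0. So 3 > 2 lets the trace
  lead with upper left entries while 4 > 3 lets the determinant lead with the antidiagonal, which
  makes the two leading monomials coprime.\<close>

lemma leading_det_var:
  assumes "i \<in> {1..r}"
  shows "leading r (det_var i) (Poly_Mapping.single (i, 1, 2) 1 + Poly_Mapping.single (i, 2, 1) 1) (-1)"
proof -
  have "det_var i - Poly_Mapping.single (Poly_Mapping.single (i, 1, 2) 1 + Poly_Mapping.single (i, 2, 1) 1) (-1) =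
      mon (Poly_Mapping.single (i, 1, 1) 1 + Poly_Mapping.single (i, 2, 2) 1)"
    by (simp add: det_var_def var_poly_def mult_single single_uminus)
  then show ?thesis
    unfolding leading_def using assms by (simp add: mw_add mw_single del: atLeastAtMost_iff One_nat_def)
qed

lemma leading_det_poly: "leading r (det_poly r) (Dmon r) ((-1) ^ r)"
proof -
  have "leading r (\<Prod>i\<in>S. det_var i)
     (\<Sum>i\<in>S. Poly_Mapping.single (i, 1, 2) 1 + Poly_Mapping.single (i, 2, 1) 1) ((-1) ^ card S)"
    if "finite S" "S \<subseteq> {1..r}" for S
    using that
  proof induction
    case empty
    then show ?case using leading_mon[of r 0] by simp
  next
    case (insert i S)
    then show ?case using leading_mult[OF leading_det_var[of i r]] by simp
  qed
  from this[of "{1..r}"] show ?thesis by (simp add: det_poly_def Dmon_def)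
qed

lemma mdeg_Tmon: "mdeg (Tmon r) k = deg_ext r (\<lambda>_. 1) k"
  and mdeg_Dmon: "mdeg (Dmon r) k = deg_ext r (\<lambda>_. 2) k"
  by (simp_all add: mdeg_def sum_2 lookup_Tmon lookup_Dmon deg_ext_def)

lemma mwt_Tmon: "i \<in> {1..r} \<Longrightarrow> mwt r (Tmon r) i = 0"
  and mwt_Dmon: "i \<in> {1..r} \<Longrightarrow> mwt r (Dmon r) i = 0"
  using prv_in[of i r] by (simp_all add: mwt_def lookup_Tmon lookup_Dmon)

text \<open>The form in which coprimality is used: \<open>Tmon\<close> and \<open>Dmon\<close> have
  no variable in common.\<close>

lemma mdvd_Tmon_add_Dmon: "mdvd (Tmon r) (\<beta> + Dmon r) \<longleftrightarrow> mdvd (Tmon r) \<beta>"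
  unfolding mdvd_iff by (auto simp: lookup_Tmon lookup_Dmon lookup_add)

section \<open>Dimensions of weight spaces of harmonic polynomials\<close>

definition Harm :: "nat \<Rightarrow> mpoly set" where
  "Harm r = {f. diffop (tr_poly r) f = 0 \<and> diffop (det_poly r) f = 0}"

lemma subspace_Harm: "cvec.subspace (Harm r)"
  by (auto simp: Harm_def cvec.subspace_def diffop_add diffop_scale)

lemma subspace_CV_graded: "cvec.subspace (CV_graded r n)"
proof -
  have "CV_graded r n = cvec.span (mon ` {\<alpha>. \<forall>k. mdeg \<alpha> k = deg_ext r n k})"
    unfolding set_eq_iff span_mon_iff CV_graded_iff by blast
  then show ?thesis by simp
qed

lemma subspace_wspace: "cvec.subspace (wspace r \<mu>)"
  by (auto simp: wspace_def cvec.subspace_def opH_simps cvec.scale_right_distrib mult.commute)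

lemma Harm_fischer:
  "h \<in> Harm r \<Longrightarrow> fischer (tr_poly r * f) h = 0"
  "h \<in> Harm r \<Longrightarrow> fischer (det_poly r * f) h = 0"
  by (simp_all add: fischer_mult_left Harm_def)

lemma euler_mon: "euler k (mon \<alpha>) = scale (of_nat (mdeg \<alpha> k)) (mon \<alpha>)"
  and opH_mon: "opH r i (mon \<alpha>) = scale (of_int (mwt r \<alpha> i)) (mon \<alpha>)"
  by (intro poly_mapping_eqI; simp add: lookup_euler lookup_opH lookup_single when_def)+

text \<open>Multiplication by an invariant shifts multidegree and weight exactly as its leading
  monomial \<tau> does. Reduction modulo the ideal therefore never leaves one multidegree and
  weight, where only finitely many monomials live.\<close>

lemma keys_invariant_mult:
  assumes p: "\<And>k. euler k p = scale (of_nat (mdeg \<tau> k)) p" "\<And>i. i \<in> {1..r} \<Longrightarrow> opH r i p = 0"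
    and \<tau>: "\<And>i. i \<in> {1..r} \<Longrightarrow> mwt r \<tau> i = 0"
    and \<gamma>: "\<gamma> \<in> keys (p * mon \<beta>)"
  shows "mdeg \<gamma> k = mdeg (\<beta> + \<tau>) k" "i \<in> {1..r} \<Longrightarrow> mwt r \<gamma> i = mwt r (\<beta> + \<tau>) i"
proof -
  have "euler k (p * mon \<beta>) = scale (of_nat (mdeg (\<beta> + \<tau>) k)) (p * mon \<beta>)"
    unfolding euler_simps p euler_mon mdeg_add
    by (simp add: cvec.scale_left_distrib add.commute del: scale_single flip: scale_mult_left scale_mult_right)
  from arg_cong[OF this, of "\<lambda>q. lookup q \<gamma>"] show "mdeg \<gamma> k = mdeg (\<beta> + \<tau>) k"
    using \<gamma> by (simp add: lookup_euler in_keys_iff)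
  assume i: "i \<in> {1..r}"
  have "opH r i (p * mon \<beta>) = scale (of_int (mwt r (\<beta> + \<tau>) i)) (p * mon \<beta>)"
    unfolding opH_simps p(2)[OF i] opH_mon mwt_add \<tau>[OF i] by (simp del: scale_single flip: scale_mult_right)
  from arg_cong[OF this, of "\<lambda>q. lookup q \<gamma>"] show "mwt r \<gamma> i = mwt r (\<beta> + \<tau>) i"
    using \<gamma> by (simp add: lookup_opH in_keys_iff)
qed

lemma keys_invariant_mult_Mon:
  assumes p: "\<And>k. euler k p = scale (of_nat (mdeg \<tau> k)) p" "\<And>i. i \<in> {1..r} \<Longrightarrow> opH r i p = 0"
    and \<tau>: "\<And>i. i \<in> {1..r} \<Longrightarrow> mwt r \<tau> i = 0"
  shows "\<beta> + \<tau> \<in> Mon r n \<mu> \<Longrightarrow> keys (p * mon \<beta>) \<subseteq> Mon r n \<mu>"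
    and "\<beta> + \<tau> \<notin> Mon r n \<mu> \<Longrightarrow> keys (p * mon \<beta>) \<inter> Mon r n \<mu> = {}"
  using keys_invariant_mult[OF p \<tau>, of _ \<beta>] by (auto simp: Mon_def)

section \<open>Reduction modulo the ideal inside one weight space\<close>

context
  fixes r :: nat assumes r: "r \<ge> 2"
begin

lemma tr_poly_homogeneous:
  "euler k (tr_poly r) = scale (of_nat (mdeg (Tmon r) k)) (tr_poly r)"
  "i \<in> {1..r} \<Longrightarrow> opH r i (tr_poly r) = 0"
  and det_poly_homogeneous:
  "euler k (det_poly r) = scale (of_nat (mdeg (Dmon r) k)) (det_poly r)"
  "i \<in> {1..r} \<Longrightarrow> opH r i (det_poly r) = 0"
  unfolding euler_tr_poly euler_det_poly mdeg_Tmon mdeg_Dmon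
  using op_H_of_EF[OF r _ op_tr_poly[OF r]] op_H_of_EF[OF r _ op_det_poly[OF r]] by auto

lemmas tr_keys = keys_invariant_mult_Mon[OF tr_poly_homogeneous mwt_Tmon, simplified]
lemmas det_keys = keys_invariant_mult_Mon[OF det_poly_homogeneous mwt_Dmon, simplified]

text \<open>One division step: modulo a multiple of p, the monomial \<beta> + \<tau> is a
  combination of lighter monomials that stay in M.\<close>

lemma leading_reduce:
  assumes "leading r p \<tau> c" "c \<noteq> 0" "keys (p * mon \<beta>) \<subseteq> M" "\<beta> + \<tau> \<in> M"
    and IH: "\<And>\<alpha>. \<alpha> \<in> M \<Longrightarrow> mw r \<alpha> < mw r (\<beta> + \<tau>) \<Longrightarrow> mon \<alpha> \<in> cvec.span S"
    and p: "p * mon \<beta> \<in> cvec.span S"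
  shows "mon (\<beta> + \<tau>) \<in> cvec.span S"
proof -
  let ?q = "p * mon \<beta> - Poly_Mapping.single (\<beta> + \<tau>) c"
  have l: "leading r (p * mon \<beta>) (\<beta> + \<tau>) c"
    using leading_mult[OF assms(1) leading_mon, of \<beta>] by (simp add: add.commute)
  have "mon \<alpha> \<in> cvec.span S" if "\<alpha> \<in> keys ?q" for \<alpha>
  proof (rule IH)
    show "mw r \<alpha> < mw r (\<beta> + \<tau>)" using l that unfolding leading_def by blast
    have "keys ?q \<subseteq> keys (p * mon \<beta>) \<union> {\<beta> + \<tau>}"
      by (auto simp: in_keys_iff lookup_minus lookup_single when_def split: if_splits)
    then show "\<alpha> \<in> M" using that assms(3,4) by auto
  qed
  then have "?q \<in> cvec.span S"
    by (subst pm_eq_sum_scale_mon) (intro cvec.span_sum cvec.span_scale)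
  with p have "p * mon \<beta> - ?q \<in> cvec.span S" by (rule cvec.span_diff)
  moreover have "p * mon \<beta> - ?q = scale c (mon (\<beta> + \<tau>))" by simp
  ultimately have "scale (1 / c) (scale c (mon (\<beta> + \<tau>))) \<in> cvec.span S"
    by (simp only: cvec.span_scale)
  then show ?thesis using \<open>c \<noteq> 0\<close> by simp
qed

text \<open>Multiples of the determinant are taken only by monomials that \<open>Tmon\<close> does
  not divide. Then no \<open>\<beta> + Dmon r\<close> is divisible by \<open>Tmon\<close>, and the
  leading monomials of the two families are disjoint, as the count requires.\<close>

definition Jgen :: "(nat \<Rightarrow> nat) \<Rightarrow> (nat \<Rightarrow> int) \<Rightarrow> mpoly set" where
  "Jgen n \<mu> = (\<lambda>\<beta>. tr_poly r * mon \<beta>) ` {\<beta>. \<beta> + Tmon r \<in> Mon r n \<mu>} \<union>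
     (\<lambda>\<beta>. det_poly r * mon \<beta>) ` {\<beta>. \<beta> + Dmon r \<in> Mon r n \<mu> \<and> \<not> mdvd (Tmon r) \<beta>}"

definition Std :: "(nat \<Rightarrow> nat) \<Rightarrow> (nat \<Rightarrow> int) \<Rightarrow> (var \<Rightarrow>\<^sub>0 nat) set" where
  "Std n \<mu> = {\<alpha> \<in> Mon r n \<mu>. \<not> mdvd (Tmon r) \<alpha> \<and> \<not> mdvd (Dmon r) \<alpha>}"

text \<open>Division with remainder: a monomial divisible by a leading monomial is traded for
  lighter ones until only standard monomials remain.\<close>

lemma mon_in_span_Jgen_Std: "\<alpha> \<in> Mon r n \<mu> \<Longrightarrow> mon \<alpha> \<in> cvec.span (Jgen n \<mu> \<union> mon ` Std n \<mu>)"
proof (induction "mw r \<alpha>" arbitrary: \<alpha> rule: less_induct)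
  case less
  show ?case
  proof (cases "mdvd (Tmon r) \<alpha>")
    case True
    then obtain \<beta> where \<beta>: "\<alpha> = \<beta> + Tmon r" unfolding mdvd_def by blast
    show ?thesis unfolding \<beta>
    proof (rule leading_reduce[OF leading_tr_poly _ tr_keys(1)])
      show "tr_poly r * mon \<beta> \<in> cvec.span (Jgen n \<mu> \<union> mon ` Std n \<mu>)"
        using less.prems by (intro cvec.span_base) (auto simp: Jgen_def \<beta>)
    qed (use less in \<open>auto simp: \<beta>\<close>)
  next
    case nT: False
    show ?thesis
    proof (cases "mdvd (Dmon r) \<alpha>")
      case True
      then obtain \<beta> where \<beta>: "\<alpha> = \<beta> + Dmon r" unfolding mdvd_def by blast
      have nT': "\<not> mdvd (Tmon r) \<beta>" using nT unfolding \<beta> mdvd_Tmon_add_Dmon .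
      show ?thesis unfolding \<beta>
      proof (rule leading_reduce[OF leading_det_poly _ det_keys(1)])
        show "det_poly r * mon \<beta> \<in> cvec.span (Jgen n \<mu> \<union> mon ` Std n \<mu>)"
          using less.prems nT' by (intro cvec.span_base) (auto simp: Jgen_def \<beta>)
      qed (use less in \<open>auto simp: \<beta>\<close>)
    next
      case False
      then show ?thesis using nT less.prems by (intro cvec.span_base) (auto simp: Std_def)
    qed
  qed
qed

lemma tr_mult_in_span_Jgen: "\<beta> + Tmon r \<in> Mon r n \<mu> \<Longrightarrow> tr_poly r * mon \<beta> \<in> cvec.span (Jgen n \<mu>)"
  by (intro cvec.span_base) (auto simp: Jgen_def)

text \<open>Reducing \<open>\<beta>\<close> modulo the trace shows that the multiples of the determinant that are omitted in
  \<open>Jgen\<close> are redundant.\<close>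

lemma det_mult_in_span_Jgen:
  assumes "\<beta> + Dmon r \<in> Mon r n \<mu>"
  shows "det_poly r * mon \<beta> \<in> cvec.span (Jgen n \<mu>)"
proof -
  define M where "M = {\<gamma>. \<gamma> + Dmon r \<in> Mon r n \<mu>}"
  define S where "S = (\<lambda>\<gamma>. tr_poly r * mon \<gamma>) ` {\<gamma>. \<gamma> + Tmon r \<in> M} \<union> mon ` {\<gamma> \<in> M. \<not> mdvd (Tmon r) \<gamma>}"
  \<comment> \<open>Removing \<open>Dmon\<close> from a weight space leaves again a full weight
    space, so the division steps for the trace can be carried out inside M.\<close>
  have M_eq: "M = Mon r (mdeg \<beta>) (mwt r \<beta>)" if "\<beta> \<in> M" for \<beta>
  proof -
    have deg: "mdeg \<beta> k + mdeg (Dmon r) k = deg_ext r n k" for k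
      using that by (simp add: M_def Mon_def mdeg_add)
    have wt: "mwt r \<beta> i + mwt r (Dmon r) i = \<mu> i" if "i \<in> {1..r}" for i
      using \<open>\<beta> \<in> M\<close> that by (simp add: M_def Mon_def mwt_add)
    have ext: "deg_ext r (mdeg \<beta>) k = mdeg \<beta> k" for k
      using deg[of k] by (auto simp: deg_ext_def)
    have "\<gamma> \<in> M \<longleftrightarrow> \<gamma> \<in> Mon r (mdeg \<beta>) (mwt r \<beta>)" for \<gamma>
    proof -
      have "\<gamma> \<in> M \<longleftrightarrow> (\<forall>k. mdeg \<gamma> k + mdeg (Dmon r) k = mdeg \<beta> k + mdeg (Dmon r) k) \<and>
          (\<forall>i\<in>{1..r}. mwt r \<gamma> i + mwt r (Dmon r) i = mwt r \<beta> i + mwt r (Dmon r) i)"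
        unfolding M_def Mon_def mem_Collect_eq mdeg_add mwt_add using deg wt by simp
      then show ?thesis by (simp add: Mon_def ext)
    qed
    then show ?thesis by blast
  qed
  have red: "mon \<beta> \<in> cvec.span S" if "\<beta> \<in> M" for \<beta>
    using that
  proof (induction "mw r \<beta>" arbitrary: \<beta> rule: less_induct)
    case less
    show ?case
    proof (cases "mdvd (Tmon r) \<beta>")
      case True
      then obtain \<gamma> where \<gamma>: "\<beta> = \<gamma> + Tmon r" unfolding mdvd_def by blast
      show ?thesis unfolding \<gamma>
      proof (rule leading_reduce[OF leading_tr_poly])
        show "keys (tr_poly r * mon \<gamma>) \<subseteq> M"
          using less.prems unfolding M_eq[OF less.prems] \<gamma> by (rule tr_keys(1))
        show "tr_poly r * mon \<gamma> \<in> cvec.span S"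
          using less.prems by (intro cvec.span_base) (auto simp: S_def \<gamma>)
      qed (use less in \<open>auto simp: \<gamma>\<close>)
    next
      case False
      then show ?thesis using less.prems by (intro cvec.span_base) (auto simp: S_def)
    qed
  qed
  have gen: "det_poly r * s \<in> cvec.span (Jgen n \<mu>)" if "s \<in> S" for s
    using that unfolding S_def
  proof (elim UnE imageE CollectE conjE)
    fix \<gamma> assume s: "s = tr_poly r * mon \<gamma>" and \<gamma>: "\<gamma> + Tmon r \<in> M"
    \<comment> \<open>The only syzygy in play is the trivial one: a multiple of both invariants is
      read as a multiple of the trace.\<close>
    have "det_poly r * s = tr_poly r * (det_poly r * mon \<gamma>)"
      unfolding s by (rule mult.left_commute)
    also have "\<dots> = tr_poly r * (\<Sum>\<delta>\<in>keys (det_poly r * mon \<gamma>). scale (lookup (det_poly r * mon \<gamma>) \<delta>) (mon \<delta>))"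
      by (rule arg_cong[OF pm_eq_sum_scale_mon])
    also have "\<dots> = (\<Sum>\<delta>\<in>keys (det_poly r * mon \<gamma>). scale (lookup (det_poly r * mon \<gamma>) \<delta>) (tr_poly r * mon \<delta>))"
      unfolding sum_distrib_left scale_mult_right ..
    also have "\<dots> \<in> cvec.span (Jgen n \<mu>)"
    proof (intro cvec.span_sum cvec.span_scale tr_mult_in_span_Jgen)
      fix \<delta> assume \<delta>: "\<delta> \<in> keys (det_poly r * mon \<gamma>)"
      note k = keys_invariant_mult[OF det_poly_homogeneous mwt_Dmon \<delta>]
      have "\<gamma> + Tmon r + Dmon r \<in> Mon r n \<mu>" using \<gamma> by (simp add: M_def)
      then show "\<delta> + Tmon r \<in> Mon r n \<mu>"
        using k by (simp add: Mon_def mdeg_add mwt_add add_ac)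
    qed
    finally show ?thesis .
  next
    fix \<gamma> assume "s = mon \<gamma>" "\<gamma> \<in> M" "\<not> mdvd (Tmon r) \<gamma>"
    then show ?thesis by (intro cvec.span_base) (auto simp: Jgen_def M_def)
  qed
  have "det_poly r * f \<in> cvec.span (Jgen n \<mu>)" if "f \<in> cvec.span S" for f
    using that
  proof (induction rule: cvec.span_induct_alt)
    case base
    then show ?case by (simp add: cvec.span_zero)
  next
    case (step c x y)
    then show ?case
      unfolding distrib_left scale_mult_right[symmetric]
      using cvec.span_add[OF cvec.span_scale[OF gen[OF step.hyps(1)]] step.IH] by simp
  qed
  then show ?thesis using red assms by (simp add: M_def)
qed

text \<open>The monomials \<open>\<beta> + Tmon r\<close> and \<open>\<beta> + Dmon r\<close> that
  lead the generators, together with the standard ones, are pairwise different monomials of the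
  weight space.\<close>

lemma finite_Jgen_card: "finite (Jgen n \<mu>) \<and> card (Jgen n \<mu>) + card (Std n \<mu>) \<le> card (Mon r n \<mu>)"
proof -
  define A where "A = {\<beta>. \<beta> + Tmon r \<in> Mon r n \<mu>}"
  define B where "B = {\<beta>. \<beta> + Dmon r \<in> Mon r n \<mu> \<and> \<not> mdvd (Tmon r) \<beta>}"
  have i: "inj_on (\<lambda>\<beta>. \<beta> + \<tau>) X" for \<tau> :: "var \<Rightarrow>\<^sub>0 nat" and X by (auto intro: inj_onI)
  have fA: "finite A" and fB: "finite B"
    using finite_imageD[OF finite_subset[OF _ finite_Mon] i, of "Tmon r" A r n \<mu>]
      finite_imageD[OF finite_subset[OF _ finite_Mon] i, of "Dmon r" B r n \<mu>]
    by (auto simp: A_def B_def)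
  have J: "Jgen n \<mu> = (\<lambda>\<beta>. tr_poly r * mon \<beta>) ` A \<union> (\<lambda>\<beta>. det_poly r * mon \<beta>) ` B"
    by (simp add: Jgen_def A_def B_def)
  let ?A = "(\<lambda>\<beta>. \<beta> + Tmon r) ` A" and ?B = "(\<lambda>\<beta>. \<beta> + Dmon r) ` B"
  have "card (Jgen n \<mu>) \<le> card A + card B"
    unfolding J by (intro order_trans[OF card_Un_le] add_mono card_image_le fA fB)
  also have "\<dots> = card ?A + card ?B" by (simp add: card_image i)
  also have "\<dots> = card (?A \<union> ?B)"
  proof (intro card_Un_disjoint[symmetric] finite_imageI fA fB)
    have "mdvd (Tmon r) x" if "x \<in> ?A" for x using that by (auto simp: mdvd_def)
    moreover have "\<not> mdvd (Tmon r) x" if "x \<in> ?B" for x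
      using that by (auto simp: B_def mdvd_Tmon_add_Dmon)
    ultimately show "?A \<inter> ?B = {}" by blast
  qed
  finally have "card (Jgen n \<mu>) + card (Std n \<mu>) \<le> card (?A \<union> ?B) + card (Std n \<mu>)" by simp
  also have "\<dots> = card ((?A \<union> ?B) \<union> Std n \<mu>)"
    by (intro card_Un_disjoint[symmetric] finite_UnI finite_imageI fA fB)
      (auto simp: Std_def mdvd_def)
  also have "\<dots> \<le> card (Mon r n \<mu>)"
    by (intro card_mono) (auto simp: A_def B_def Std_def)
  finally show ?thesis using fA fB J by simp
qed

abbreviation Harm_nw :: "(nat \<Rightarrow> nat) \<Rightarrow> (nat \<Rightarrow> int) \<Rightarrow> mpoly set" where
  "Harm_nw n \<mu> \<equiv> Harm r \<inter> (CV_graded r n \<inter> wspace r \<mu>)"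

text \<open>Harmonicity is a condition on all multiples of the invariants. Those outside the given
  weight space are orthogonal to f because they share no monomial with it, and those inside are
  spanned by the finite set \<open>Jgen\<close>.\<close>

lemma Harm_nw_iff: "f \<in> Harm_nw n \<mu> \<longleftrightarrow> keys f \<subseteq> Mon r n \<mu> \<and> (\<forall>x\<in>Jgen n \<mu>. fischer x f = 0)"
proof
  assume "f \<in> Harm_nw n \<mu>"
  then show "keys f \<subseteq> Mon r n \<mu> \<and> (\<forall>x\<in>Jgen n \<mu>. fischer x f = 0)"
    using graded_wspace_iff[of f r n \<mu>] Harm_fischer[of f r] by (auto simp: Jgen_def)
next
  assume *: "keys f \<subseteq> Mon r n \<mu> \<and> (\<forall>x\<in>Jgen n \<mu>. fischer x f = 0)"
  then have span: "fischer x f = 0" if "x \<in> cvec.span (Jgen n \<mu>)" for x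
    using that fischer_span_left by blast
  have 1: "fischer (tr_poly r * mon \<beta>) f = 0" for \<beta>
  proof (cases "\<beta> + Tmon r \<in> Mon r n \<mu>")
    case True
    then show ?thesis by (intro span tr_mult_in_span_Jgen)
  next
    case False
    then show ?thesis using tr_keys(2)[OF False] * by (intro fischer_disjoint_keys) auto
  qed
  have 2: "fischer (det_poly r * mon \<beta>) f = 0" for \<beta>
  proof (cases "\<beta> + Dmon r \<in> Mon r n \<mu>")
    case True
    then show ?thesis by (intro span det_mult_in_span_Jgen)
  next
    case False
    then show ?thesis using det_keys(2)[OF False] * by (intro fischer_disjoint_keys) auto
  qed
  have zero: "diffop p f = 0" if "\<And>\<beta>. fischer (p * mon \<beta>) f = 0" "cnjp p = p" for p
  proof (rule poly_mapping_eqI)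
    fix \<beta>
    have "fischer (mon \<beta>) (diffop p f) = 0" using that fischer_mult_left[of p "mon \<beta>" f] by simp
    then show "lookup (diffop p f) \<beta> = lookup 0 \<beta>" by (simp add: fischer_single)
  qed
  show "f \<in> Harm_nw n \<mu>"
    using * zero[OF 1] zero[OF 2] graded_wspace_iff[of f r n \<mu>] by (auto simp: Harm_def)
qed

lemma Jgen_Harm_decomp:
  assumes "keys f \<subseteq> Mon r n \<mu>"
  shows "\<exists>j\<in>cvec.span (Jgen n \<mu>). f - j \<in> Harm_nw n \<mu>"
proof -
  obtain j where j: "j \<in> cvec.span (Jgen n \<mu>)" "\<forall>x\<in>Jgen n \<mu>. fischer x (f - j) = 0"
    using fischer_projection finite_Jgen_card by blast
  have "Jgen n \<mu> \<subseteq> cvec.span (mon ` Mon r n \<mu>)"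
    using tr_keys(1) det_keys(1) by (auto simp: Jgen_def span_mon_iff)
  then have "j \<in> cvec.span (mon ` Mon r n \<mu>)"
    using j(1) cvec.span_minimal[OF _ cvec.subspace_span] by blast
  then have "f - j \<in> cvec.span (mon ` Mon r n \<mu>)"
    using assms by (intro cvec.span_diff) (auto simp: span_mon_iff)
  then show ?thesis using j Harm_nw_iff by (auto simp: span_mon_iff)
qed

lemma Jgen_Harm_inter: "f \<in> cvec.span (Jgen n \<mu>) \<Longrightarrow> f \<in> Harm_nw n \<mu> \<Longrightarrow> f = 0"
  using fischer_span_left[of f "Jgen n \<mu>" f] unfolding Harm_nw_iff fischer_self_eq_0 by blast

lemma subspace_Harm_nw: "cvec.subspace (Harm_nw n \<mu>)"
  by (intro cvec.subspace_inter subspace_Harm subspace_CV_graded subspace_wspace)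

lemma Harm_nw_subset: "Harm_nw n \<mu> \<subseteq> cvec.span (mon ` Mon r n \<mu>)"
proof
  fix f assume "f \<in> Harm_nw n \<mu>"
  then show "f \<in> cvec.span (mon ` Mon r n \<mu>)" unfolding span_mon_iff Harm_nw_iff by blast
qed

text \<open>Lower bound: the generators and a basis of the harmonic part span all monomials, and the
  number of generators is at most the number of nonstandard monomials. Upper bound: the orthogonal
  projections of the standard monomials span the harmonic part. The independence of the standard
  monomials modulo the ideal comes out of these two bounds.\<close>

theorem dim_Harm_nw: "cvec.dim (Harm_nw n \<mu>) = card (Std n \<mu>)"
proof (rule antisym)
  have finStd: "finite (Std n \<mu>)" by (auto simp: Std_def)
  obtain B where B: "B \<subseteq> Harm_nw n \<mu>" "cvec.independent B" "Harm_nw n \<mu> \<subseteq> cvec.span B"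
    "card B = cvec.dim (Harm_nw n \<mu>)" using cvec.basis_exists by blast
  have finB: "finite B"
    using cvec.independent_span_bound[OF _ B(2), of "mon ` Mon r n \<mu>"] order_trans[OF B(1) Harm_nw_subset] by simp
  have "mon ` Mon r n \<mu> \<subseteq> cvec.span (Jgen n \<mu> \<union> B)"
  proof safe
    fix \<alpha> assume "\<alpha> \<in> Mon r n \<mu>"
    then obtain j where j: "j \<in> cvec.span (Jgen n \<mu>)" "mon \<alpha> - j \<in> Harm_nw n \<mu>"
      using Jgen_Harm_decomp[of "mon \<alpha>"] by auto
    then have "j \<in> cvec.span (Jgen n \<mu> \<union> B)" "mon \<alpha> - j \<in> cvec.span (Jgen n \<mu> \<union> B)"
      using B(3) cvec.span_mono[of B "Jgen n \<mu> \<union> B"] cvec.span_mono[of "Jgen n \<mu>" "Jgen n \<mu> \<union> B"] by auto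
    from cvec.span_add[OF this] show "mon \<alpha> \<in> cvec.span (Jgen n \<mu> \<union> B)" by simp
  qed
  then have "card (Mon r n \<mu>) \<le> card (Jgen n \<mu> \<union> B)"
    using cvec.independent_span_bound[OF _ independent_mon[of "Mon r n \<mu>"], of "Jgen n \<mu> \<union> B"]
      finB finite_Jgen_card by (simp add: card_image inj_mon)
  also have "\<dots> \<le> card (Jgen n \<mu>) + card B" by (rule card_Un_le)
  finally show "card (Std n \<mu>) \<le> cvec.dim (Harm_nw n \<mu>)"
    using finite_Jgen_card[of n \<mu>] B(4) by linarith
  have "\<forall>\<alpha>\<in>Std n \<mu>. \<exists>j\<in>cvec.span (Jgen n \<mu>). mon \<alpha> - j \<in> Harm_nw n \<mu>"
    by (intro ballI Jgen_Harm_decomp) (auto simp: Std_def)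
  then obtain j where j: "\<And>\<alpha>. \<alpha> \<in> Std n \<mu> \<Longrightarrow> j \<alpha> \<in> cvec.span (Jgen n \<mu>) \<and> mon \<alpha> - j \<alpha> \<in> Harm_nw n \<mu>"
    by metis
  define P where "P = (\<lambda>\<alpha>. mon \<alpha> - j \<alpha>) ` Std n \<mu>"
  have P: "cvec.span P \<subseteq> Harm_nw n \<mu>"
    using j by (intro cvec.span_minimal subspace_Harm_nw) (auto simp: P_def)
  \<comment> \<open>Modulo \<open>Jgen\<close>, a standard monomial agrees with its harmonic
    projection.\<close>
  have ex: "\<exists>p\<in>cvec.span P. x - p \<in> cvec.span (Jgen n \<mu>)" if "x \<in> cvec.span (Jgen n \<mu> \<union> mon ` Std n \<mu>)" for x
    using that
  proof (induction rule: cvec.span_induct_alt)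
    case base
    then show ?case using cvec.span_zero by (intro bexI[of _ 0]) auto
  next
    case (step c x y)
    from step.IH obtain p where p: "p \<in> cvec.span P" "y - p \<in> cvec.span (Jgen n \<mu>)" by blast
    have "\<exists>p'\<in>cvec.span P. x - p' \<in> cvec.span (Jgen n \<mu>)"
      using step.hyps
    proof
      assume "x \<in> Jgen n \<mu>"
      then show ?thesis by (intro bexI[of _ 0]) (auto intro: cvec.span_zero cvec.span_base)
    next
      assume "x \<in> mon ` Std n \<mu>"
      then obtain \<alpha> where "x = mon \<alpha>" "\<alpha> \<in> Std n \<mu>" by blast
      then show ?thesis
        using j[of \<alpha>] by (intro bexI[of _ "mon \<alpha> - j \<alpha>"]) (auto simp: P_def intro: cvec.span_base)
    qed
    then obtain p' where p': "p' \<in> cvec.span P" "x - p' \<in> cvec.span (Jgen n \<mu>)" by blast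
    have eq: "scale c x + y - (scale c p' + p) = scale c (x - p') + (y - p)"
      by (simp add: cvec.scale_right_diff_distrib)
    have "scale c x + y - (scale c p' + p) \<in> cvec.span (Jgen n \<mu>)"
      unfolding eq by (intro cvec.span_add cvec.span_scale p p')
    moreover have "scale c p' + p \<in> cvec.span P" by (intro cvec.span_add cvec.span_scale p p')
    ultimately show ?case by blast
  qed
  have "Harm_nw n \<mu> \<subseteq> cvec.span P"
  proof
    fix h assume h: "h \<in> Harm_nw n \<mu>"
    have "h \<in> cvec.span (Jgen n \<mu> \<union> mon ` Std n \<mu>)"
      using h[THEN Harm_nw_iff[THEN iffD1]]
      by (subst pm_eq_sum_scale_mon) (intro cvec.span_sum cvec.span_scale mon_in_span_Jgen_Std, blast)
    then obtain p where p: "p \<in> cvec.span P" "h - p \<in> cvec.span (Jgen n \<mu>)" using ex by blast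
    then have "h - p \<in> Harm_nw n \<mu>" using P h by (intro cvec.subspace_diff subspace_Harm_nw) auto
    then have "h - p = 0" using p(2) by (intro Jgen_Harm_inter)
    then show "h \<in> cvec.span P" using p(1) by simp
  qed
  then have "cvec.dim (Harm_nw n \<mu>) \<le> card P"
    using finStd by (intro cvec.dim_le_card) (auto simp: P_def)
  also have "\<dots> \<le> card (Std n \<mu>)" unfolding P_def by (rule card_image_le[OF finStd])
  finally show "cvec.dim (Harm_nw n \<mu>) \<le> card (Std n \<mu>)" .
qed

end

section \<open>Highest weight vectors\<close>

text \<open>A product of powers of commuting operators, written as a recursion over the vertices
  because composition is not commutative on the type of all operators.\<close>

fun opF_mult :: "nat \<Rightarrow> nat \<Rightarrow> (nat \<Rightarrow> nat) \<Rightarrow> mpoly \<Rightarrow> mpoly" where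
  "opF_mult r 0 b v = v"
| "opF_mult r (Suc k) b v = (opF r (Suc k) ^^ b (Suc k)) (opF_mult r k b v)"

abbreviation opFs :: "nat \<Rightarrow> (nat \<Rightarrow> nat) \<Rightarrow> mpoly \<Rightarrow> mpoly" where
  "opFs r b v \<equiv> opF_mult r r b v"

definition hwv :: "nat \<Rightarrow> (nat \<Rightarrow> nat) \<Rightarrow> mpoly \<Rightarrow> bool" where
  "hwv r s v \<longleftrightarrow> (\<forall>i\<in>{1..r}. opE r i v = 0 \<and> opH r i v = scale (of_nat (s i)) v)"

lemma funpow_commute: "(\<And>f. A (B f) = B (A f)) \<Longrightarrow> A ((B ^^ n) f) = (B ^^ n) (A f)"
  by (induction n) auto

lemma funpow_scale:
  fixes B :: "('a \<Rightarrow>\<^sub>0 complex) \<Rightarrow> ('a \<Rightarrow>\<^sub>0 complex)"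
  assumes "\<And>c f. B (scale c f) = scale c (B f)"
  shows "(B ^^ n) (scale c f) = scale c ((B ^^ n) f)"
proof (induction n)
  case (Suc n)
  then show ?case using assms by simp
qed simp

lemma opF_mult_scale: "opF_mult r k b (scale c v) = scale c (opF_mult r k b v)"
  by (induction k) (auto simp: funpow_scale opF_simps)

lemma opF_mult_cong: "(\<And>i. i \<in> {1..k} \<Longrightarrow> b i = c i) \<Longrightarrow> opF_mult r k b v = opF_mult r k c v"
  by (induction k) auto

lemma opF_mult_0: "(\<And>i. i \<in> {1..k} \<Longrightarrow> b i = 0) \<Longrightarrow> opF_mult r k b v = v"
  by (induction k) auto

lemma opF_mult_in:
  assumes "\<And>i f. i \<in> {1..r} \<Longrightarrow> f \<in> W \<Longrightarrow> opF r i f \<in> W" "v \<in> W" "k \<le> r"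
  shows "opF_mult r k b v \<in> W"
  using assms(3)
proof (induction k)
  case (Suc k)
  have "(opF r (Suc k) ^^ n) f \<in> W" if "f \<in> W" for n f
    by (induction n) (use that assms(1) Suc.prems in auto)
  then show ?case using Suc by simp
qed (use assms in simp)

lemma fischer_wspace:
  assumes "f \<in> wspace r \<mu>" "g \<in> wspace r \<nu>" "i \<in> {1..r}" "\<mu> i \<noteq> \<nu> i"
  shows "fischer f g = 0"
  using assms unfolding wspace_iff by (intro fischer_disjoint_keys) fastforce

text \<open>An infinite basis would also have cardinality 0; the finite spanning set S excludes
  this.\<close>

lemma dim_0_iff:
  assumes "U \<subseteq> cvec.span S" "finite S"
  shows "cvec.dim U = 0 \<longleftrightarrow> U \<subseteq> {0}"
proof
  obtain B where B: "B \<subseteq> U" "cvec.independent B" "U \<subseteq> cvec.span B" "card B = cvec.dim U"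
    using cvec.basis_exists by blast
  have "finite B" using cvec.independent_span_bound[OF assms(2) B(2)] B(1) assms(1) by auto
  moreover assume "cvec.dim U = 0"
  ultimately show "U \<subseteq> {0}" using B by auto
next
  assume "U \<subseteq> {0}"
  then have "U \<subseteq> cvec.span {}" by simp
  from cvec.dim_le_card[OF this] show "cvec.dim U = 0" by simp
qed

lemma dim_orthogonal:
  assumes "cvec.subspace U" "U \<subseteq> cvec.span S" "finite S" "u \<in> U" "u \<noteq> 0"
  shows "cvec.dim U = Suc (cvec.dim {w \<in> U. fischer u w = 0})"
proof -
  let ?U = "{w \<in> U. fischer u w = 0}"
  have sub: "cvec.subspace ?U"
    using assms(1) by (auto simp: cvec.subspace_def fischer_add_right fischer_scale_right)
  obtain B where B: "B \<subseteq> ?U" "cvec.independent B" "?U \<subseteq> cvec.span B" "card B = cvec.dim ?U"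
    using cvec.basis_exists by blast
  have fin: "finite B" using cvec.independent_span_bound[OF assms(3) B(2)] B(1) assms(2) by auto
  have "cvec.span B \<subseteq> ?U" using B(1) sub by (rule cvec.span_minimal)
  then have u: "u \<notin> cvec.span B" using assms(5) by (auto simp: fischer_self_eq_0)
  have "U \<subseteq> cvec.span (insert u B)"
  proof
    fix w assume w: "w \<in> U"
    define c where "c = fischer u w / fischer u u"
    have "w - scale c u \<in> ?U"
      using w assms by (auto simp: c_def fischer_diff fischer_scale_right fischer_self_eq_0
          intro!: cvec.subspace_diff cvec.subspace_scale)
    then have "w - scale c u \<in> cvec.span (insert u B)"
      using B(3) cvec.span_mono[of B "insert u B"] by auto
    moreover have "scale c u \<in> cvec.span (insert u B)" by (intro cvec.span_scale cvec.span_base) auto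
    ultimately have "(w - scale c u) + scale c u \<in> cvec.span (insert u B)" by (rule cvec.span_add)
    then show "w \<in> cvec.span (insert u B)" by simp
  qed
  moreover have "insert u B \<subseteq> U" using B(1) assms(4) by auto
  moreover have "cvec.independent (insert u B)" by (rule cvec.independent_insertI[OF u B(2)])
  ultimately have "card (insert u B) = cvec.dim U" by (intro cvec.basis_card_eq_dim)
  moreover have "u \<notin> B" using u cvec.span_base by blast
  ultimately show ?thesis using fin B(4) by simp
qed

lemma finite_F_basis [simp]: "finite (F_basis r s)"
  by (simp add: F_basis_def finite_PiE)

lemma F_basis_upd: "b \<in> F_basis r s \<Longrightarrow> i \<in> {1..r} \<Longrightarrow> k \<le> s i \<Longrightarrow> b(i := k) \<in> F_basis r s"
  by (auto simp: F_basis_def PiE_iff extensional_def)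

lemma F_basisD: "b \<in> F_basis r s \<Longrightarrow> i \<in> {1..r} \<Longrightarrow> b i \<le> s i"
  by (auto simp: F_basis_def PiE_iff)

context
  fixes r :: nat assumes r: "r \<ge> 2"
begin

lemma opE_opF_mult_gt:
  assumes "i \<in> {1..r}" "k < i"
  shows "opE r i (opF_mult r k b v) = opF_mult r k b (opE r i v)"
  using assms(2)
proof (induction k)
  case (Suc k)
  have "Suc k \<in> {1..r}" "i \<noteq> Suc k" using Suc.prems assms(1) by auto
  then have "opE r i (opF r (Suc k) f) = opF r (Suc k) (opE r i f)" for f
    using opE_opF_other[OF r assms(1)] by blast
  from funpow_commute[of "opE r i" "opF r (Suc k)", OF this] show ?case using Suc by simp
qed simp

lemma opF_opF_mult:
  assumes "i \<in> {1..k}" "k \<le> r"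
  shows "opF r i (opF_mult r k b v) = opF_mult r k (b(i := Suc (b i))) v"
  using assms
proof (induction k)
  case (Suc k)
  show ?case
  proof (cases "i = Suc k")
    case True
    have "opF_mult r k (b(i := Suc (b i))) v = opF_mult r k b v"
      by (rule opF_mult_cong) (use True in auto)
    then show ?thesis using True by (simp del: fun_upd_apply add: fun_upd_same)
  next
    case False
    have "Suc k \<in> {1..r}" "i \<in> {1..r}" using Suc.prems by auto
    then have "opF r i (opF r (Suc k) f) = opF r (Suc k) (opF r i f)" for f
      using opF_opF_other[OF r _ _ False] by blast
    from funpow_commute[of "opF r i" "opF r (Suc k)", OF this] show ?thesis using False Suc by simp
  qed
qed simp

lemma opH_opF_pow:
  assumes "i \<in> {1..r}" "j \<in> {1..r}" "opH r i u = scale c u"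
  shows "opH r i ((opF r j ^^ n) u) = scale (c - (if i = j then 2 * of_nat n else 0)) ((opF r j ^^ n) u)"
proof (induction n)
  case (Suc n)
  let ?w = "(opF r j ^^ n) u" and ?d = "if i = j then - 2 else 0 :: complex"
  have "opH r i (opF r j ?w) = scale (c - (if i = j then 2 * of_nat n else 0) + ?d) (opF r j ?w)"
    unfolding opH_opF[OF r assms(1,2)] Suc.IH opF_simps cvec.scale_left_distrib ..
  also have "c - (if i = j then 2 * of_nat n else 0) + ?d = c - (if i = j then 2 * of_nat (Suc n) else 0)"
    by simp
  finally show ?case by simp
qed (use assms in simp)

lemma opH_opF_mult:
  assumes "i \<in> {1..r}" "opH r i v = scale c v" "k \<le> r"
  shows "opH r i (opF_mult r k b v) = scale (c - (if i \<le> k then 2 * of_nat (b i) else 0)) (opF_mult r k b v)"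
  using assms(3)
proof (induction k)
  case 0
  then show ?case using assms by auto
next
  case (Suc k)
  have "Suc k \<in> {1..r}" using Suc.prems by auto
  from opH_opF_pow[OF assms(1) this Suc.IH, of "b (Suc k)"] show ?case
    using Suc.prems by (auto simp: le_Suc_eq)
qed

lemma opE_opF_pow:
  assumes "i \<in> {1..r}" "opE r i u = 0" "opH r i u = scale (of_nat s) u"
  shows "opE r i ((opF r i ^^ n) u) = scale (of_nat n * (of_nat s - of_nat n + 1)) ((opF r i ^^ (n - 1)) u)"
proof (induction n)
  case 0
  then show ?case using assms by simp
next
  case (Suc m)
  let ?c = "of_nat m * (of_nat s - of_nat m + 1) :: complex"
  \<comment> \<open>For \<open>m = 0\<close> the truncated exponent is off by one, but then
    \<open>?c\<close> is 0.\<close>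
  have "opF r i (scale ?c ((opF r i ^^ (m - 1)) u)) = scale ?c ((opF r i ^^ m) u)"
    by (cases m) (simp_all add: opF_simps)
  then have "opE r i ((opF r i ^^ Suc m) u) = scale (?c + (of_nat s - 2 * of_nat m)) ((opF r i ^^ m) u)"
    using opE_opF[OF r assms(1,1), of "(opF r i ^^ m) u"] Suc.IH opH_opF_pow[OF assms(1,1,3), of m]
    by (simp add: cvec.scale_left_distrib)
  also have "?c + (of_nat s - 2 * of_nat m) = of_nat (Suc m) * (of_nat s - of_nat (Suc m) + 1)"
    by (simp add: algebra_simps)
  finally show ?case by simp
qed

lemma opE_opF_mult:
  assumes v: "opE r i v = 0" "opH r i v = scale (of_nat s) v" and i: "i \<in> {1..k}" "k \<le> r"
  shows "opE r i (opF_mult r k b v) =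
    scale (of_nat (b i) * (of_nat s - of_nat (b i) + 1)) (opF_mult r k (b(i := b i - 1)) v)"
  using i
proof (induction k)
  case (Suc k)
  have ir: "i \<in> {1..r}" and kr: "k \<le> r" using Suc.prems by auto
  show ?case
  proof (cases "i = Suc k")
    case True
    have 1: "opF_mult r k (b(i := b i - 1)) v = opF_mult r k b v"
      by (rule opF_mult_cong) (use True in auto)
    have "opE r i (opF_mult r k b v) = 0" "opH r i (opF_mult r k b v) = scale (of_nat s) (opF_mult r k b v)"
      using opE_opF_mult_gt[OF ir, of k b v] opH_opF_mult[OF ir v(2) kr, of b] True v(1)
        opF_mult_scale[of r k b 0 v] by auto
    from opE_opF_pow[OF ir this, of "b i"] show ?thesis
      using True 1 by (simp del: fun_upd_apply add: fun_upd_same)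
  next
    case False
    have "Suc k \<in> {1..r}" using Suc.prems by auto
    then have "opE r i (opF r (Suc k) f) = opF r (Suc k) (opE r i f)" for f
      using opE_opF_other[OF r ir _ False] by blast
    from funpow_commute[of "opE r i" "opF r (Suc k)", OF this] show ?thesis
      using False Suc by (simp add: funpow_scale opF_simps)
  qed
qed simp

context
  fixes s v assumes hwv: "hwv r s v"
begin

lemma opF_opFs: "i \<in> {1..r} \<Longrightarrow> opF r i (opFs r b v) = opFs r (b(i := Suc (b i))) v"
  by (rule opF_opF_mult) auto

lemma opE_opFs: "i \<in> {1..r} \<Longrightarrow> opE r i (opFs r b v) =
    scale (of_nat (b i) * (of_nat (s i) - of_nat (b i) + 1)) (opFs r (b(i := b i - 1)) v)"
  using hwv unfolding hwv_def by (intro opE_opF_mult) auto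

lemma opFs_wspace: "(\<And>i. i \<in> {1..r} \<Longrightarrow> int (s i) - 2 * int (b i) = \<mu> i) \<Longrightarrow> opFs r b v \<in> wspace r \<mu>"
  unfolding wspace_def
proof safe
  fix i assume *: "\<And>i. i \<in> {1..r} \<Longrightarrow> int (s i) - 2 * int (b i) = \<mu> i" and i: "i \<in> {1..r}"
  have "opH r i v = scale (of_nat (s i)) v" using hwv i by (auto simp: hwv_def)
  from opH_opF_mult[OF i this order_refl, of b] show "opH r i (opFs r b v) = scale (of_int (\<mu> i)) (opFs r b v)"
    using i *[OF i, symmetric] by simp
qed

text \<open>A norm argument instead of finite-dimensionality: the vector has the form F_i u, and it
  is annihilated by E_i because the coefficient s - (s + 1) + 1 vanishes. By adjointness its squared
  norm is (u, E_i F_i u) = 0.\<close>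

lemma opFs_eq_0:
  assumes "i \<in> {1..r}" "b i = Suc (s i)"
  shows "opFs r b v = 0"
proof -
  have "opFs r b v = opF r i (opFs r (b(i := s i)) v)"
    using opF_opFs[OF assms(1), of "b(i := s i)"] assms(2) by (metis fun_upd_same fun_upd_triv fun_upd_upd)
  then have "fischer (opFs r b v) (opFs r b v) = fischer (opFs r (b(i := s i)) v) (opE r i (opFs r b v))"
    by (metis fischer_opF)
  also have "opE r i (opFs r b v) = 0"
    using opE_opFs[OF assms(1), of b] assms(2) by simp
  finally show ?thesis by (simp add: fischer_self_eq_0)
qed

text \<open>Lowering b by E_i multiplies by b_i (s_i - b_i + 1), which is nonzero in this range, so
  a vanishing vector would force v itself to vanish.\<close>

lemma opFs_nonzero:
  assumes "v \<noteq> 0" "\<And>i. i \<in> {1..r} \<Longrightarrow> b i \<le> s i"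
  shows "opFs r b v \<noteq> 0"
  using assms(2)
proof (induction "\<Sum>i\<in>{1..r}. b i" arbitrary: b rule: less_induct)
  case less
  show ?case
  proof (cases "\<forall>i\<in>{1..r}. b i = 0")
    case True
    then show ?thesis using assms(1) opF_mult_0[of r b r v] by simp
  next
    case False
    then obtain i where i: "i \<in> {1..r}" "b i \<noteq> 0" by blast
    have "opFs r (b(i := b i - 1)) v \<noteq> 0"
    proof (rule less.hyps)
      show "(\<Sum>j\<in>{1..r}. (b(i := b i - 1)) j) < (\<Sum>j\<in>{1..r}. b j)"
        by (rule sum_strict_mono_ex1) (use i in auto)
      show "(b(i := b i - 1)) j \<le> s j" if "j \<in> {1..r}" for j
        using less.prems[OF that] by auto
    qed
    moreover have "of_nat (b i) * (of_nat (s i) - of_nat (b i) + 1) \<noteq> (0 :: complex)"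
    proof -
      have "of_nat (s i) - of_nat (b i) + 1 = (of_nat (s i - b i + 1) :: complex)"
        using less.prems[OF i(1)] by (simp add: of_nat_diff)
      then show ?thesis using i(2) by (metis Suc_eq_plus1 mult_eq_0_iff nat.distinct(1) of_nat_eq_0_iff)
    qed
    ultimately have "opE r i (opFs r b v) \<noteq> 0"
      unfolding opE_opFs[OF i(1)] by simp
    then show ?thesis by (auto simp: opE_simps)
  qed
qed

end

section \<open>Submodules and the splitting off of orbits\<close>

lemma opE_wspace:
  "f \<in> wspace r \<mu> \<Longrightarrow> j \<in> {1..r} \<Longrightarrow> opE r j f \<in> wspace r (\<mu>(j := \<mu> j + 2))"
  by (auto simp: wspace_def opH_opE[OF r] opE_simps cvec.scale_left_distrib simp del: atLeastAtMost_iff)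

definition submodule :: "mpoly set \<Rightarrow> bool" where
  "submodule W \<longleftrightarrow> cvec.subspace W \<and> (\<forall>i\<in>{1..r}. \<forall>f\<in>W. opE r i f \<in> W \<and> opF r i f \<in> W)"

lemma submodule_opH: "submodule W \<Longrightarrow> i \<in> {1..r} \<Longrightarrow> f \<in> W \<Longrightarrow> opH r i f \<in> W"
proof -
  assume W: "submodule W" and i: "i \<in> {1..r}" and f: "f \<in> W"
  have "opH r i f = opE r i (opF r i f) - opF r i (opE r i f)" using opE_opF[OF r i i, of f] by simp
  then show ?thesis using W i f unfolding submodule_def by (metis cvec.subspace_diff)
qed

text \<open>If f has two weights differing at some vertex i, then H_i minus one of the two
  eigenvalues removes the first weight and keeps the second; the number of weights drops until one
  is left.\<close>

lemma exists_weight_vector: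
  assumes "submodule W" "f \<in> W" "f \<noteq> 0"
  shows "\<exists>\<mu>. \<exists>g\<in>W \<inter> wspace r \<mu>. g \<noteq> 0"
  using assms(2,3)
proof (induction "card ((\<lambda>\<alpha>. restrict (mwt r \<alpha>) {1..r}) ` keys f)" arbitrary: f rule: less_induct)
  case less
  show ?case
  proof (cases "\<exists>i\<in>{1..r}. \<exists>\<alpha>\<in>keys f. \<exists>\<beta>\<in>keys f. mwt r \<alpha> i \<noteq> mwt r \<beta> i")
    case True
    then obtain i \<alpha> \<beta> where i: "i \<in> {1..r}" "\<alpha> \<in> keys f" "\<beta> \<in> keys f" "mwt r \<alpha> i \<noteq> mwt r \<beta> i" by blast
    define g where "g = opH r i f - scale (of_int (mwt r \<alpha> i)) f"
    have l: "lookup g \<gamma> = of_int (mwt r \<gamma> i - mwt r \<alpha> i) * lookup f \<gamma>" for \<gamma>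
      by (simp add: g_def lookup_minus lookup_opH algebra_simps)
    then have keys: "keys g = {\<gamma> \<in> keys f. mwt r \<gamma> i \<noteq> mwt r \<alpha> i}"
      by (auto simp: in_keys_iff)
    define w where "w = (\<lambda>\<alpha>. restrict (mwt r \<alpha>) {1..r})"
    have "w \<alpha> \<notin> w ` keys g"
    proof
      assume "w \<alpha> \<in> w ` keys g"
      then obtain \<gamma> where \<gamma>: "\<gamma> \<in> keys g" "w \<alpha> = w \<gamma>" by (rule imageE)
      have "w \<alpha> i = w \<gamma> i" using \<gamma>(2) by simp
      then have "mwt r \<alpha> i = mwt r \<gamma> i" using i(1) by (simp add: w_def)
      then show False using \<gamma>(1) unfolding keys by simp
    qed
    moreover have "w \<alpha> \<in> w ` keys f" using i(2) by (rule imageI)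
    moreover have "w ` keys g \<subseteq> w ` keys f" unfolding keys by (rule image_mono) simp
    ultimately have "w ` keys g \<subset> w ` keys f" by (metis psubsetI)
    then have "card (w ` keys g) < card (w ` keys f)" by (intro psubset_card_mono) auto
    moreover have "g \<in> W"
      unfolding g_def using assms(1) less.prems i(1)
      by (intro cvec.subspace_diff cvec.subspace_scale submodule_opH) (auto simp: submodule_def)
    moreover have "\<beta> \<in> keys g" using i keys by auto
    then have "g \<noteq> 0" by auto
    ultimately show ?thesis unfolding w_def by (rule less.hyps)
  next
    case False
    have "keys f \<noteq> {}" using less.prems(2) by simp
    then obtain \<alpha> where "\<alpha> \<in> keys f" by blast
    then have "f \<in> wspace r (mwt r \<alpha>)" unfolding wspace_iff using False by blast
    then show ?thesis using less.prems by blast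
  qed
qed

text \<open>The span of the orbit is stable under E and F, and these are adjoint to each other, so
  its orthogonal complement is stable as well: Weyl's unitary trick at the level of the Lie
  algebra.\<close>

lemma orthogonal_complement_submodule:
  assumes W: "submodule W" and v: "hwv r s v"
  shows "submodule {w \<in> W. \<forall>b\<in>F_basis r s. fischer (opFs r b v) w = 0}" (is "submodule ?W")
  unfolding submodule_def
proof (intro conjI ballI)
  show "cvec.subspace ?W"
    using W by (auto simp: submodule_def cvec.subspace_def fischer_add_right fischer_scale_right)
  fix i w assume i: "i \<in> {1..r}" and w: "w \<in> ?W"
  have "fischer (opFs r b v) (opE r i w) = 0" if b: "b \<in> F_basis r s" for b
  proof -
    have "fischer (opFs r b v) (opE r i w) = fischer (opFs r (b(i := Suc (b i))) v) w"
      unfolding fischer_opE_right opF_opFs[OF v i] ..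
    also have "\<dots> = 0"
    proof (cases "b i = s i")
      case True
      then show ?thesis using opFs_eq_0[OF v i, of "b(i := Suc (b i))"] by simp
    next
      case False
      then have "b(i := Suc (b i)) \<in> F_basis r s"
        using F_basisD[OF b i] by (intro F_basis_upd b i) auto
      then show ?thesis using w by blast
    qed
    finally show ?thesis .
  qed
  then show "opE r i w \<in> ?W" using W w i by (auto simp: submodule_def)
  have "fischer (opFs r b v) (opF r i w) = 0" if b: "b \<in> F_basis r s" for b
  proof -
    have "b(i := b i - 1) \<in> F_basis r s"
      using F_basisD[OF b i] by (intro F_basis_upd b i) auto
    then show ?thesis
      unfolding fischer_opF_right opE_opFs[OF v i] fischer_scale_left using w by simp
  qed
  then show "opF r i w \<in> ?W" using W w i by (auto simp: submodule_def)
qed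

text \<open>The basis vectors of weight \<mu> in the direct sum of the modules with highest weights
  s k; its cardinality is the multiplicity of \<mu>.\<close>

definition weight_index :: "'k set \<Rightarrow> ('k \<Rightarrow> nat \<Rightarrow> nat) \<Rightarrow> (nat \<Rightarrow> int) \<Rightarrow> ('k \<times> (nat \<Rightarrow> nat)) set" where
  "weight_index I s \<mu> = {(k, b). k \<in> I \<and> b \<in> F_basis r (s k) \<and> (\<forall>i\<in>{1..r}. int (s k i) - 2 * int (b i) = \<mu> i)}"

lemma finite_weight_index: "finite I \<Longrightarrow> finite (weight_index I s \<mu>)"
  by (rule finite_subset[of _ "SIGMA k:I. F_basis r (s k)"]) (auto simp: weight_index_def)

text \<open>The weight multiplicities determine the module. A summand of largest total weight is
  split off: the count provides a vector of its weight, which must be a highest weight vector, and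
  on the orthogonal complement of its orbit the multiplicities are those of the remaining
  summands.\<close>

theorem decomposition:
  assumes "finite (I :: 'k set)" "submodule W" "W \<subseteq> cvec.span S" "finite S"
    and "\<And>\<mu>. cvec.dim (W \<inter> wspace r \<mu>) = card (weight_index I s \<mu>)"
  shows "\<exists>v. (\<forall>k\<in>I. v k \<in> W \<and> v k \<noteq> 0 \<and> hwv r (s k) (v k)) \<and>
    (\<forall>k\<in>I. \<forall>l\<in>I. k \<noteq> l \<longrightarrow> (\<forall>b\<in>F_basis r (s k). \<forall>c\<in>F_basis r (s l).
       fischer (opFs r b (v k)) (opFs r c (v l)) = 0)) \<and>
    W \<subseteq> cvec.span (\<Union>k\<in>I. (\<lambda>b. opFs r b (v k)) ` F_basis r (s k))"
  using assms(1-3,5)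
proof (induction "card I" arbitrary: I W)
  case 0
  then have I: "I = {}" by simp
  have "W \<subseteq> {0}"
  proof (rule ccontr)
    assume "\<not> W \<subseteq> {0}"
    then obtain \<mu> g where g: "g \<in> W \<inter> wspace r \<mu>" "g \<noteq> 0" using exists_weight_vector[OF 0(3)] by blast
    have "cvec.dim (W \<inter> wspace r \<mu>) = 0" using 0(5)[of \<mu>] I by (simp add: weight_index_def)
    moreover have "W \<inter> wspace r \<mu> \<subseteq> cvec.span S" using 0(4) by blast
    ultimately have "W \<inter> wspace r \<mu> \<subseteq> {0}" using dim_0_iff[OF _ assms(4)] by simp
    then show False using g by blast
  qed
  then show ?case by (simp add: I)
next
  case (Suc n)
  \<comment> \<open>The total weight. Every E_j raises it by 2, so a weight vector that attains its
    maximum is annihilated by all E_j.\<close>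
  define S' where "S' k = (\<Sum>i\<in>{1..r}. s k i)" for k
  have "I \<noteq> {}" using Suc.hyps(2) by auto
  then obtain k where k: "k \<in> I" "\<And>l. l \<in> I \<Longrightarrow> S' l \<le> S' k"
  proof -
    have "Max (S' ` I) \<in> S' ` I" using Suc.prems(1) \<open>I \<noteq> {}\<close> by (intro Max_in) auto
    then obtain k where "k \<in> I" "Max (S' ` I) = S' k" by (rule imageE)
    moreover have "S' l \<le> Max (S' ` I)" if "l \<in> I" for l
      using Suc.prems(1) that by (intro Max_ge) auto
    ultimately show ?thesis using that by simp
  qed
  have Wsub: "cvec.subspace W" using Suc.prems(2) by (simp add: submodule_def)
  have dim0: "W \<inter> wspace r \<mu> \<subseteq> {0} \<longleftrightarrow> weight_index I s \<mu> = {}" for \<mu>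
  proof -
    have "W \<inter> wspace r \<mu> \<subseteq> cvec.span S" using Suc.prems(3) by blast
    from dim_0_iff[OF this assms(4)] show ?thesis
      unfolding Suc.prems(4) by (simp add: finite_weight_index[OF Suc.prems(1)])
  qed
  have "(k, \<lambda>i\<in>{1..r}. 0) \<in> weight_index I s (\<lambda>i. int (s k i))"
    using k(1) by (auto simp: weight_index_def F_basis_def)
  then obtain v where v: "v \<in> W" "v \<in> wspace r (\<lambda>i. int (s k i))" "v \<noteq> 0"
    using dim0[of "\<lambda>i. int (s k i)"] by blast
  have hwv: "hwv r (s k) v"
    unfolding hwv_def
  proof (intro ballI conjI)
    fix j assume j: "j \<in> {1..r}"
    show "opH r j v = scale (of_nat (s k j)) v" using v(2) j by (auto simp: wspace_def)
    \<comment> \<open>If E_j v were nonzero, its weight would occur in some summand l, whose total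
      weight would then exceed that of k.\<close>
    let ?\<mu> = "(\<lambda>i. int (s k i))(j := int (s k j) + 2)"
    have "weight_index I s ?\<mu> = {}"
    proof (rule ccontr)
      assume "weight_index I s ?\<mu> \<noteq> {}"
      then obtain l b where l: "l \<in> I" "\<forall>i\<in>{1..r}. int (s l i) - 2 * int (b i) = ?\<mu> i"
        by (auto simp: weight_index_def)
      have "int (S' k) < (\<Sum>i\<in>{1..r}. ?\<mu> i)"
        unfolding S'_def of_nat_sum by (rule sum_strict_mono_ex1) (use j in auto)
      also have "\<dots> \<le> int (S' l)"
        unfolding S'_def of_nat_sum by (intro sum_mono) (use l(2) in fastforce)
      finally show False using k(2)[OF l(1)] by simp
    qed
    then have "W \<inter> wspace r ?\<mu> \<subseteq> {0}" using dim0 by blast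
    moreover have "opE r j v \<in> W" using v(1) j Suc.prems(2) by (auto simp: submodule_def)
    ultimately show "opE r j v = 0" using opE_wspace[OF v(2) j] by auto
  qed
  define W' where "W' = {w \<in> W. \<forall>b\<in>F_basis r (s k). fischer (opFs r b v) w = 0}"
  have W': "submodule W'"
    unfolding W'_def by (rule orthogonal_complement_submodule[OF Suc.prems(2) hwv])
  have opFs_in: "opFs r b x \<in> U" if "submodule U" "x \<in> U" for b x U
    using that by (intro opF_mult_in) (auto simp: submodule_def)
  have dimW': "cvec.dim (W' \<inter> wspace r \<mu>) = card (weight_index (I - {k}) s \<mu>)" for \<mu>
  proof (cases "\<exists>b\<in>F_basis r (s k). \<forall>i\<in>{1..r}. int (s k i) - 2 * int (b i) = \<mu> i")
    case False
    have "W' \<inter> wspace r \<mu> = W \<inter> wspace r \<mu>"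
      unfolding W'_def
    proof safe
      fix w b assume w: "w \<in> wspace r \<mu>" and b: "b \<in> F_basis r (s k)"
      then obtain i where i: "i \<in> {1..r}" "int (s k i) - 2 * int (b i) \<noteq> \<mu> i" using False by blast
      show "fischer (opFs r b v) w = 0"
        using i(2) by (rule fischer_wspace[OF opFs_wspace[OF hwv refl] w i(1)])
    qed
    moreover have "weight_index (I - {k}) s \<mu> = weight_index I s \<mu>"
      using False by (auto simp: weight_index_def)
    ultimately show ?thesis using Suc.prems(4) by simp
  next
    case True
    then obtain b where b: "b \<in> F_basis r (s k)" "\<And>i. i \<in> {1..r} \<Longrightarrow> int (s k i) - 2 * int (b i) = \<mu> i" by blast
    let ?u = "opFs r b v"
    have "W' \<inter> wspace r \<mu> = {w \<in> W \<inter> wspace r \<mu>. fischer ?u w = 0}"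
      unfolding W'_def
    proof (rule equalityI[OF _ subsetI])
      fix w assume "w \<in> {w \<in> W \<inter> wspace r \<mu>. fischer ?u w = 0}"
      then have w: "w \<in> W" "w \<in> wspace r \<mu>" "fischer ?u w = 0" by auto
      have "fischer (opFs r c v) w = 0" if c: "c \<in> F_basis r (s k)" for c
      proof (cases "\<forall>i\<in>{1..r}. c i = b i")
        case True
        then have "opFs r c v = ?u" by (intro opF_mult_cong) auto
        then show ?thesis using w(3) by simp
      next
        case False
        then obtain i where i: "i \<in> {1..r}" "c i \<noteq> b i" by blast
        then have "int (s k i) - 2 * int (c i) \<noteq> \<mu> i" using b(2)[OF i(1)] by auto
        then show ?thesis by (rule fischer_wspace[OF opFs_wspace[OF hwv refl] w(2) i(1)])
      qed
      then show "w \<in> {w \<in> W. \<forall>b\<in>F_basis r (s k). fischer (opFs r b v) w = 0} \<inter> wspace r \<mu>" using w by auto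
    qed (use b(1) in auto)
    moreover have "cvec.dim (W \<inter> wspace r \<mu>) = Suc (cvec.dim {w \<in> W \<inter> wspace r \<mu>. fischer ?u w = 0})"
    proof (rule dim_orthogonal[OF _ _ assms(4)])
      show "cvec.subspace (W \<inter> wspace r \<mu>)" by (intro cvec.subspace_inter Wsub subspace_wspace)
      show "W \<inter> wspace r \<mu> \<subseteq> cvec.span S" using Suc.prems(3) by blast
      show "?u \<in> W \<inter> wspace r \<mu>" using opFs_in[OF Suc.prems(2) v(1)] opFs_wspace[OF hwv b(2)] by blast
      show "?u \<noteq> 0" using F_basisD[OF b(1)] by (intro opFs_nonzero[OF hwv v(3)])
    qed
    \<comment> \<open>Weights of an outer tensor product of irreducible sl2-modules have
      multiplicity one: b is recovered from the numbers s k i - 2 b i.\<close>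
    moreover have "weight_index I s \<mu> = insert (k, b) (weight_index (I - {k}) s \<mu>)"
    proof -
      have "c = b" if "c \<in> F_basis r (s k)" "\<forall>i\<in>{1..r}. int (s k i) - 2 * int (c i) = \<mu> i" for c
      proof (rule PiE_ext)
        show "c \<in> PiE {1..r} (\<lambda>i. {0..s k i})" "b \<in> PiE {1..r} (\<lambda>i. {0..s k i})"
          using that b by (auto simp: F_basis_def)
        show "c i = b i" if "i \<in> {1..r}" for i
          using that b(2)[OF that] \<open>\<forall>i\<in>{1..r}. int (s k i) - 2 * int (c i) = \<mu> i\<close> by force
      qed
      then show ?thesis using k(1) b unfolding weight_index_def by fast
    qed
    moreover have "(k, b) \<notin> weight_index (I - {k}) s \<mu>" by (simp add: weight_index_def)
    ultimately show ?thesis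
      using Suc.prems(4)[of \<mu>] finite_weight_index[of "I - {k}" s \<mu>] Suc.prems(1) by simp
  qed
  have n: "n = card (I - {k})" using Suc.hyps(2) k(1) Suc.prems(1) by simp
  have fin: "finite (I - {k})" using Suc.prems(1) by simp
  have sub: "W' \<subseteq> cvec.span S" using Suc.prems(3) by (auto simp: W'_def)
  from Suc.hyps(1)[OF n fin W' sub dimW'] obtain v' where *:
    "(\<forall>l\<in>I - {k}. v' l \<in> W' \<and> v' l \<noteq> 0 \<and> hwv r (s l) (v' l)) \<and>
     (\<forall>l\<in>I - {k}. \<forall>m\<in>I - {k}. l \<noteq> m \<longrightarrow> (\<forall>b\<in>F_basis r (s l). \<forall>c\<in>F_basis r (s m).
        fischer (opFs r b (v' l)) (opFs r c (v' m)) = 0)) \<and>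
     W' \<subseteq> cvec.span (\<Union>l\<in>I - {k}. (\<lambda>b. opFs r b (v' l)) ` F_basis r (s l))" ..
  have v': "v' l \<in> W' \<and> v' l \<noteq> 0 \<and> hwv r (s l) (v' l)" if "l \<in> I - {k}" for l
    using * that by simp
  have v'_orth: "fischer (opFs r b (v' l)) (opFs r c (v' m)) = 0"
    if "l \<in> I - {k}" "m \<in> I - {k}" "l \<noteq> m" "b \<in> F_basis r (s l)" "c \<in> F_basis r (s m)" for l m b c
    using * that by simp
  have v'_span: "W' \<subseteq> cvec.span (\<Union>l\<in>I - {k}. (\<lambda>b. opFs r b (v' l)) ` F_basis r (s l))"
    using * by simp
  define w where "w = v'(k := v)"
  have orth: "fischer (opFs r b v) (opFs r c (v' l)) = 0"
    if "l \<in> I - {k}" "b \<in> F_basis r (s k)" for l b c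
    using opFs_in[OF W', of "v' l" c] v'[OF that(1)] that(2) by (auto simp: W'_def)
  have "W \<subseteq> cvec.span (\<Union>k\<in>I. (\<lambda>b. opFs r b (w k)) ` F_basis r (s k))" (is "_ \<subseteq> cvec.span ?X")
  proof
    fix f assume f: "f \<in> W"
    let ?N = "(\<lambda>b. opFs r b v) ` F_basis r (s k)"
    obtain j where j: "j \<in> cvec.span ?N" "\<forall>x\<in>?N. fischer x (f - j) = 0"
      using fischer_projection[of ?N f] by auto
    have "cvec.span ?N \<subseteq> W" using opFs_in[OF Suc.prems(2) v(1)] Wsub by (intro cvec.span_minimal) auto
    then have "f - j \<in> W'" using f j Wsub by (auto simp: W'_def intro: cvec.subspace_diff)
    moreover have "(\<Union>l\<in>I - {k}. (\<lambda>b. opFs r b (v' l)) ` F_basis r (s l)) \<subseteq> ?X" by (auto simp: w_def)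
    ultimately have "f - j \<in> cvec.span ?X" using v'_span cvec.span_mono by blast
    moreover have "?N \<subseteq> ?X" using k(1) by (auto simp: w_def)
    then have "j \<in> cvec.span ?X" using j(1) cvec.span_mono by blast
    ultimately have "(f - j) + j \<in> cvec.span ?X" by (rule cvec.span_add)
    then show "f \<in> cvec.span ?X" by simp
  qed
  moreover have "w l \<in> W \<and> w l \<noteq> 0 \<and> hwv r (s l) (w l)" if "l \<in> I" for l
    using that v'[of l] v hwv by (auto simp: w_def W'_def)
  moreover have "fischer (opFs r b (w l)) (opFs r c (w m)) = 0"
    if lm: "l \<in> I" "m \<in> I" "l \<noteq> m" "b \<in> F_basis r (s l)" "c \<in> F_basis r (s m)" for l m b c
  proof -
    consider "l = k" "m \<noteq> k" | "l \<noteq> k" "m = k" | "l \<noteq> k" "m \<noteq> k" using lm by blast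
    then show ?thesis
    proof cases
      case 1
      then show ?thesis using orth[of m b c] lm by (simp add: w_def)
    next
      case 2
      then show ?thesis using orth[of l c b] lm fischer_cnj[of "opFs r c v" "opFs r b (v' l)"] by (simp add: w_def)
    next
      case 3
      then show ?thesis using v'_orth[of l m b c] lm by (simp add: w_def)
    qed
  qed
  ultimately show ?case by (intro exI[of _ w]) blast
qed

end

section \<open>Counting standard monomials\<close>

text \<open>Given the parity condition, adding 2 leaves the range exactly at its upper end, so the
  boundary consists of the tuples with at least one maximal coordinate.\<close>

lemma mem_boundary_Lambda_big:
  "m \<in> boundary r (Lambda_big r n) \<longleftrightarrow> m \<in> extensional {1..r} \<and>
     (\<forall>i\<in>{1..r}. m i \<le> n i \<and> even (n i - m i)) \<and> (\<exists>i\<in>{1..r}. m i = n i)"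
proof -
  have 1: "x \<in> steps_by_2 h (h mod 2) \<longleftrightarrow> x \<le> h \<and> even (h - x)" for x h
  proof -
    have "h mod 2 \<le> x" if "x \<le> h" "even (h - x)" using that by presburger
    then show ?thesis by (auto simp: steps_by_2_def)
  qed
  have 2: "x + 2 \<in> steps_by_2 h (h mod 2) \<longleftrightarrow> x \<noteq> h" if "x \<le> h" "even (h - x)" for x h
    unfolding 1 using that by presburger
  show ?thesis
  proof (cases "m \<in> extensional {1..r} \<and> (\<forall>i\<in>{1..r}. m i \<le> n i \<and> even (n i - m i))")
    case True
    have "(\<lambda>i\<in>{1..r}. m i + 2) \<in> Lambda_big r n \<longleftrightarrow>
        (\<forall>i\<in>{1..r}. m i + 2 \<in> steps_by_2 (n i) (n i mod 2))"
      unfolding Lambda_big_def PiE_iff by simp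
    moreover have "\<forall>i\<in>{1..r}. m i + 2 \<in> steps_by_2 (n i) (n i mod 2) \<longleftrightarrow> m i \<noteq> n i"
      using True 2 by blast
    moreover have "m \<in> Lambda_big r n" using True unfolding Lambda_big_def PiE_iff 1 by blast
    ultimately show ?thesis using True unfolding boundary_def by blast
  next
    case False
    then show ?thesis unfolding boundary_def Lambda_big_def PiE_iff 1 by blast
  qed
qed

text \<open>As for \<open>Lambda_big\<close>; the lower end of the range becomes the two triangle
  inequalities of the Clebsch-Gordan rule, which are free of absolute values.\<close>

lemma mem_boundary_lambda_small:
  "s \<in> boundary r (lambda_small r m) \<longleftrightarrow> s \<in> extensional {1..r} \<and>
     (\<forall>i\<in>{1..r}. s i \<le> m i + m (prv r i) \<and> even (m i + m (prv r i) - s i) \<and>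
        m i \<le> m (prv r i) + s i \<and> m (prv r i) \<le> m i + s i) \<and>
     (\<exists>i\<in>{1..r}. s i = m i + m (prv r i))"
proof -
  let ?lo = "\<lambda>i. nat \<bar>int (m i) - int (m (prv r i))\<bar>"
  have 1: "x \<in> steps_by_2 (a + b) (nat \<bar>int a - int b\<bar>) \<longleftrightarrow>
      x \<le> a + b \<and> even (a + b - x) \<and> a \<le> b + x \<and> b \<le> a + x" for x a b
    by (auto simp: steps_by_2_def)
  have 2: "x + 2 \<in> steps_by_2 (a + b) (nat \<bar>int a - int b\<bar>) \<longleftrightarrow> x \<noteq> a + b"
    if "x \<le> a + b" "even (a + b - x)" "a \<le> b + x" "b \<le> a + x" for x a b
    unfolding 1 using that by presburger
  show ?thesis
  proof (cases "s \<in> extensional {1..r} \<and> (\<forall>i\<in>{1..r}. s i \<le> m i + m (prv r i) \<and> even (m i + m (prv r i) - s i) \<and>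
        m i \<le> m (prv r i) + s i \<and> m (prv r i) \<le> m i + s i)")
    case True
    have "(\<lambda>i\<in>{1..r}. s i + 2) \<in> lambda_small r m \<longleftrightarrow>
        (\<forall>i\<in>{1..r}. s i + 2 \<in> steps_by_2 (m i + m (prv r i)) (?lo i))"
      unfolding lambda_small_def PiE_iff by simp
    moreover have "\<forall>i\<in>{1..r}. s i + 2 \<in> steps_by_2 (m i + m (prv r i)) (?lo i) \<longleftrightarrow> s i \<noteq> m i + m (prv r i)"
      using True 2 by blast
    moreover have "s \<in> lambda_small r m" using True unfolding lambda_small_def PiE_iff 1 by blast
    ultimately show ?thesis using True unfolding boundary_def by blast
  next
    case False
    then show ?thesis unfolding boundary_def lambda_small_def PiE_iff 1 by blast
  qed
qed

text \<open>The monomial with exponent matrix \<open>(A, B; C, D)\<close> at \<open>i\<close> is recorded by \<open>j = min B C\<close>, the power of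
  the determinant, and by \<open>mj = A + B + C + D - 2 j\<close>, \<open>rj = A + B - j\<close>, \<open>cj = A + C - j\<close>: the last two
  index a weight vector of the outer tensor product of two copies of \<open>F\<^sub>m\<close>. At the vertex \<open>i\<close> the pair
  \<open>(cj i, rj (i - 1))\<close> is recorded by its minimum \<open>kj i\<close>, which selects a Clebsch-Gordan summand,
  and by its position in the hook of pairs with this minimum.\<close>

definition dj :: "(var \<Rightarrow>\<^sub>0 nat) \<Rightarrow> nat \<Rightarrow> nat" where
  "dj \<alpha> i = min (lookup \<alpha> (i, 1, 2)) (lookup \<alpha> (i, 2, 1))"

definition rj :: "(var \<Rightarrow>\<^sub>0 nat) \<Rightarrow> nat \<Rightarrow> nat" where
  "rj \<alpha> i = lookup \<alpha> (i, 1, 1) + lookup \<alpha> (i, 1, 2) - dj \<alpha> i"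

definition cj :: "(var \<Rightarrow>\<^sub>0 nat) \<Rightarrow> nat \<Rightarrow> nat" where
  "cj \<alpha> i = lookup \<alpha> (i, 1, 1) + lookup \<alpha> (i, 2, 1) - dj \<alpha> i"

definition mj :: "(var \<Rightarrow>\<^sub>0 nat) \<Rightarrow> nat \<Rightarrow> nat" where
  "mj \<alpha> i = lookup \<alpha> (i, 1, 1) + lookup \<alpha> (i, 1, 2) + lookup \<alpha> (i, 2, 1) + lookup \<alpha> (i, 2, 2) - 2 * dj \<alpha> i"

definition kj :: "nat \<Rightarrow> (var \<Rightarrow>\<^sub>0 nat) \<Rightarrow> nat \<Rightarrow> nat" where
  "kj r \<alpha> i = min (cj \<alpha> i) (rj \<alpha> (prv r i))"

text \<open>One of B - j and C - j is 0, so their difference, which equals rj - cj, determines both;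
  truncated subtraction selects the right one. The row and column sums then give A and D.\<close>

lemma lookup_of_mj:
  "lookup \<alpha> (i, 1, 1) = min (rj \<alpha> i) (cj \<alpha> i)"
  "lookup \<alpha> (i, 1, 2) = dj \<alpha> i + (rj \<alpha> i - cj \<alpha> i)"
  "lookup \<alpha> (i, 2, 1) = dj \<alpha> i + (cj \<alpha> i - rj \<alpha> i)"
  "lookup \<alpha> (i, 2, 2) = mj \<alpha> i - max (rj \<alpha> i) (cj \<alpha> i)"
  and rj_le: "rj \<alpha> i \<le> mj \<alpha> i" and cj_le: "cj \<alpha> i \<le> mj \<alpha> i"
  unfolding rj_def cj_def mj_def dj_def by (auto simp: min_def max_def)

lemma mdeg_eq_mj: "mdeg \<alpha> i = mj \<alpha> i + 2 * dj \<alpha> i"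
  unfolding mdeg_def sum_2 mj_def dj_def by auto

lemma mwt_eq_mj: "mwt r \<alpha> i = (2 * int (cj \<alpha> i) - int (mj \<alpha> i)) - (2 * int (rj \<alpha> (prv r i)) - int (mj \<alpha> (prv r i)))"
proof -
  have 1: "2 * int (cj \<alpha> i) - int (mj \<alpha> i) =
     int (lookup \<alpha> (i, 1, 1)) + int (lookup \<alpha> (i, 2, 1)) - int (lookup \<alpha> (i, 1, 2)) - int (lookup \<alpha> (i, 2, 2))" for i
    unfolding mj_def cj_def dj_def by (auto simp: min_def)
  have 2: "2 * int (rj \<alpha> i) - int (mj \<alpha> i) =
     int (lookup \<alpha> (i, 1, 1)) + int (lookup \<alpha> (i, 1, 2)) - int (lookup \<alpha> (i, 2, 1)) - int (lookup \<alpha> (i, 2, 2))" for i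
    unfolding mj_def rj_def dj_def by (auto simp: min_def)
  show ?thesis unfolding 1 2 mwt_def ..
qed

text \<open>With its minimum k fixed, the pair (cj i, rj (i-1)) moves on a hook that starts at (m_i,
  k), descends to the corner (k, k) and continues to (k, m_(i-1)). The last component counts the
  steps made, so it runs from 0 to s_i = m_i + m_(i-1) - 2k, and the weight is s_i - 2 b_i.\<close>

definition code :: "nat \<Rightarrow> (var \<Rightarrow>\<^sub>0 nat) \<Rightarrow> ((nat \<Rightarrow> nat) \<times> (nat \<Rightarrow> nat)) \<times> (nat \<Rightarrow> nat)" where
  "code r \<alpha> = ((\<lambda>i\<in>{1..r}. mj \<alpha> i, \<lambda>i\<in>{1..r}. mj \<alpha> i + mj \<alpha> (prv r i) - 2 * kj r \<alpha> i),
     \<lambda>i\<in>{1..r}. (mj \<alpha> i - cj \<alpha> i) + (rj \<alpha> (prv r i) - kj r \<alpha> i))"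

text \<open>All upper left exponents min(r_i, c_i) are positive iff all r_i and all c_i are. The
  same numbers can be regrouped along the cycle into the pairs (c_i, r_(i-1)), whose minima are the
  k_i. A vanishing k_i says that s_i is maximal, which is the boundary condition on s.\<close>

lemma not_mdvd_Tmon: "\<not> mdvd (Tmon r) \<alpha> \<longleftrightarrow> (\<exists>i\<in>{1..r}. kj r \<alpha> i = 0)"
proof -
  have min0: "min a b = 0 \<longleftrightarrow> a = 0 \<or> b = 0" for a b :: nat by auto
  have "mdvd (Tmon r) \<alpha> \<longleftrightarrow> (\<forall>i\<in>{1..r}. lookup \<alpha> (i, 1, 1) \<noteq> 0)"
  proof
    assume "mdvd (Tmon r) \<alpha>"
    then have *: "lookup (Tmon r) (i, 1, 1) \<le> lookup \<alpha> (i, 1, 1)" for i unfolding mdvd_iff by blast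
    show "\<forall>i\<in>{1..r}. lookup \<alpha> (i, 1, 1) \<noteq> 0"
    proof
      fix i assume "i \<in> {1..r}"
      then show "lookup \<alpha> (i, 1, 1) \<noteq> 0" using *[of i] by (simp add: lookup_Tmon)
    qed
  next
    assume *: "\<forall>i\<in>{1..r}. lookup \<alpha> (i, 1, 1) \<noteq> 0"
    show "mdvd (Tmon r) \<alpha>"
      unfolding mdvd_iff
    proof
      fix v :: var
      obtain i a b where v: "v = (i, a, b)" by (metis prod_cases3)
      show "lookup (Tmon r) v \<le> lookup \<alpha> v"
        unfolding v lookup_Tmon using *[rule_format, of i] by (auto simp: Suc_le_eq)
    qed
  qed
  then have "\<not> mdvd (Tmon r) \<alpha> \<longleftrightarrow> (\<exists>i\<in>{1..r}. cj \<alpha> i = 0) \<or> (\<exists>i\<in>{1..r}. rj \<alpha> i = 0)"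
    unfolding lookup_of_mj min0 by blast
  also have "(\<exists>i\<in>{1..r}. rj \<alpha> i = 0) \<longleftrightarrow> (\<exists>i\<in>{1..r}. rj \<alpha> (prv r i) = 0)"
  proof
    assume "\<exists>i\<in>{1..r}. rj \<alpha> i = 0"
    then obtain i where i: "i \<in> {1..r}" "rj \<alpha> i = 0" by blast
    show "\<exists>i\<in>{1..r}. rj \<alpha> (prv r i) = 0"
      by (rule bexI[of _ "nxt r i"]) (use i nxt_in[OF i(1)] prv_nxt[OF i(1)] in simp_all)
  next
    assume "\<exists>i\<in>{1..r}. rj \<alpha> (prv r i) = 0"
    then show "\<exists>i\<in>{1..r}. rj \<alpha> i = 0" using prv_in by blast
  qed
  also have "(\<exists>i\<in>{1..r}. cj \<alpha> i = 0) \<or> \<dots> \<longleftrightarrow> (\<exists>i\<in>{1..r}. kj r \<alpha> i = 0)"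
    unfolding kj_def min0 by blast
  finally show ?thesis .
qed

text \<open>A vanishing power of the determinant at i means m_i = n_i, the boundary condition on
  m.\<close>

lemma not_mdvd_Dmon: "\<not> mdvd (Dmon r) \<alpha> \<longleftrightarrow> (\<exists>i\<in>{1..r}. dj \<alpha> i = 0)"
proof
  assume "\<not> mdvd (Dmon r) \<alpha>"
  then obtain v where v: "lookup \<alpha> v < lookup (Dmon r) v" unfolding mdvd_iff by (auto simp: not_le)
  obtain i a b where "v = (i, a, b)" by (metis prod_cases3)
  then show "\<exists>i\<in>{1..r}. dj \<alpha> i = 0"
    using v by (intro bexI[of _ i]) (auto simp: lookup_Dmon dj_def split: if_splits)
next
  assume "\<exists>i\<in>{1..r}. dj \<alpha> i = 0"
  then obtain i where i: "i \<in> {1..r}" "dj \<alpha> i = 0" by blast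
  then have "lookup \<alpha> (i, 1, 2) = 0 \<or> lookup \<alpha> (i, 2, 1) = 0" by (auto simp: dj_def min_def split: if_splits)
  moreover have "lookup (Dmon r) (i, 1, 2) = 1" "lookup (Dmon r) (i, 2, 1) = 1"
    using i(1) by (simp_all only: lookup_Dmon simp_thms if_True)
  ultimately show "\<not> mdvd (Dmon r) \<alpha>" unfolding mdvd_iff by (metis not_one_le_zero)
qed

context
  fixes r :: nat and n :: "nat \<Rightarrow> nat" assumes r: "r \<ge> 2"
begin

abbreviation summands :: "((nat \<Rightarrow> nat) \<times> (nat \<Rightarrow> nat)) set" where
  "summands \<equiv> SIGMA m : boundary r (Lambda_big r n). boundary r (lambda_small r m)"

lemma code_in:
  assumes "\<alpha> \<in> Std r n \<mu>"
  shows "code r \<alpha> \<in> weight_index r summands snd \<mu>"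
proof -
  have \<alpha>: "mdeg \<alpha> i = n i" "mwt r \<alpha> i = \<mu> i" if "i \<in> {1..r}" for i
    using assms that by (auto simp: Std_def[OF r] Mon_def deg_ext_def)
  have nd: "\<exists>i\<in>{1..r}. kj r \<alpha> i = 0" "\<exists>i\<in>{1..r}. dj \<alpha> i = 0"
    using assms by (simp_all only: Std_def[OF r] mem_Collect_eq not_mdvd_Tmon not_mdvd_Dmon)
  define m where "m = (\<lambda>i\<in>{1..r}. mj \<alpha> i)"
  define s where "s = (\<lambda>i\<in>{1..r}. mj \<alpha> i + mj \<alpha> (prv r i) - 2 * kj r \<alpha> i)"
  define b where "b = (\<lambda>i\<in>{1..r}. (mj \<alpha> i - cj \<alpha> i) + (rj \<alpha> (prv r i) - kj r \<alpha> i))"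
  have k: "kj r \<alpha> i \<le> cj \<alpha> i" "kj r \<alpha> i \<le> rj \<alpha> (prv r i)" "kj r \<alpha> i = cj \<alpha> i \<or> kj r \<alpha> i = rj \<alpha> (prv r i)" for i
    by (auto simp: kj_def)
  have mi: "m i = mj \<alpha> i" and si: "s i = mj \<alpha> i + mj \<alpha> (prv r i) - 2 * kj r \<alpha> i"
    and bi: "b i = (mj \<alpha> i - cj \<alpha> i) + (rj \<alpha> (prv r i) - kj r \<alpha> i)" if "i \<in> {1..r}" for i
    using that by (simp_all add: m_def s_def b_def)
  have mp: "m (prv r i) = mj \<alpha> (prv r i)" if "i \<in> {1..r}" for i
    using mi[OF prv_in[OF that]] .
  note le = rj_le[of \<alpha>] cj_le[of \<alpha>] k
  have "m \<in> boundary r (Lambda_big r n)"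
    unfolding mem_boundary_Lambda_big
  proof (intro conjI ballI)
    show "m i \<le> n i" "even (n i - m i)" if "i \<in> {1..r}" for i
      using \<alpha>(1)[OF that, symmetric] unfolding mi[OF that] by (auto simp: mdeg_eq_mj)
    obtain i where i: "i \<in> {1..r}" "dj \<alpha> i = 0" using nd(2) by blast
    then have "m i = n i" using \<alpha>(1)[OF i(1)] mi[OF i(1)] by (simp add: mdeg_eq_mj)
    then show "\<exists>i\<in>{1..r}. m i = n i" using i(1) by blast
  qed (simp add: m_def)
  moreover have "s \<in> boundary r (lambda_small r m)"
    unfolding mem_boundary_lambda_small
  proof (intro conjI ballI)
    fix i assume i: "i \<in> {1..r}"
    show "s i \<le> m i + m (prv r i)" unfolding si[OF i] mi[OF i] mp[OF i] by simp
    have "2 * kj r \<alpha> i \<le> mj \<alpha> i + mj \<alpha> (prv r i)" using le(1)[of "prv r i"] le(2)[of i] le(3,4)[of i] by linarith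
    then have "mj \<alpha> i + mj \<alpha> (prv r i) - s i = 2 * kj r \<alpha> i" unfolding si[OF i] by simp
    then show "even (m i + m (prv r i) - s i)" unfolding mi[OF i] mp[OF i] by simp
    show "m i \<le> m (prv r i) + s i" "m (prv r i) \<le> m i + s i"
      unfolding si[OF i] mi[OF i] mp[OF i] using le(1)[of "prv r i"] le(2)[of i] le(3,4)[of i] by linarith+
  next
    obtain i where i: "i \<in> {1..r}" "kj r \<alpha> i = 0" using nd(1) by blast
    then have "s i = m i + m (prv r i)" using si[OF i(1)] mi[OF i(1)] mp[OF i(1)] by simp
    then show "\<exists>i\<in>{1..r}. s i = m i + m (prv r i)" using i(1) by blast
  qed (simp add: s_def)
  moreover have "b \<in> F_basis r s"
    unfolding F_basis_def
  proof (rule PiE_I)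
    fix i assume i: "i \<in> {1..r}"
    show "b i \<in> {0..s i}"
      unfolding si[OF i] bi[OF i] using le(1)[of "prv r i"] le(2)[of i] le(3,4)[of i] by simp
  next
    fix i assume "i \<notin> {1..r}"
    then show "b i = undefined" unfolding b_def by (simp only: restrict_apply if_False)
  qed
  moreover have "int (s i) - 2 * int (b i) = \<mu> i" if i: "i \<in> {1..r}" for i
  proof -
    have "int (s i) - 2 * int (b i) = mwt r \<alpha> i"
    proof -
      have "2 * kj r \<alpha> i \<le> mj \<alpha> i + mj \<alpha> (prv r i)"
        using le(1)[of "prv r i"] le(2)[of i] le(3,4)[of i] by linarith
      then show ?thesis
        unfolding si[OF i] bi[OF i] mwt_eq_mj using le(1)[of "prv r i"] le(2)[of i] le(3,4)[of i]
        by (simp add: of_nat_diff)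
    qed
    then show ?thesis using \<alpha>(2)[OF i] by simp
  qed
  ultimately have "((m, s), b) \<in> weight_index r summands snd \<mu>" by (simp add: weight_index_def[OF r])
  moreover have "code r \<alpha> = ((m, s), b)" by (simp add: code_def m_def s_def b_def)
  ultimately show ?thesis by simp
qed

text \<open>The first two components give every kj; the last one then locates the point on the hook,
  hence cj and the preceding rj, and the degree gives dj.\<close>

lemma inj_code: "inj_on (code r) (Std r n \<mu>)"
proof (rule inj_onI)
  fix \<alpha> \<beta> assume \<alpha>: "\<alpha> \<in> Std r n \<mu>" and \<beta>: "\<beta> \<in> Std r n \<mu>" and eq: "code r \<alpha> = code r \<beta>"
  have m: "mj \<alpha> i = mj \<beta> i" if "i \<in> {1..r}" for i
    using eq that unfolding code_def by (auto dest!: fun_cong[where x = i])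
  have s: "mj \<alpha> i + mj \<alpha> (prv r i) - 2 * kj r \<alpha> i = mj \<beta> i + mj \<beta> (prv r i) - 2 * kj r \<beta> i" if "i \<in> {1..r}" for i
    using eq that unfolding code_def by (auto dest!: fun_cong[where x = i])
  have b: "(mj \<alpha> i - cj \<alpha> i) + (rj \<alpha> (prv r i) - kj r \<alpha> i) = (mj \<beta> i - cj \<beta> i) + (rj \<beta> (prv r i) - kj r \<beta> i)"
    if "i \<in> {1..r}" for i
    using eq that unfolding code_def by (auto dest!: fun_cong[where x = i])
  have deg: "mdeg \<alpha> k = mdeg \<beta> k" for k using \<alpha> \<beta> by (auto simp: Std_def[OF r] Mon_def)
  have cr: "cj \<alpha> i = cj \<beta> i \<and> rj \<alpha> (prv r i) = rj \<beta> (prv r i)" if i: "i \<in> {1..r}" for i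
  proof -
    have k: "kj r \<alpha> i \<le> cj \<alpha> i" "kj r \<alpha> i \<le> rj \<alpha> (prv r i)" "kj r \<alpha> i = cj \<alpha> i \<or> kj r \<alpha> i = rj \<alpha> (prv r i)" for \<alpha>
      by (auto simp: kj_def)
    note le = rj_le[of \<alpha> "prv r i"] cj_le[of \<alpha> i] k[of \<alpha>] rj_le[of \<beta> "prv r i"] cj_le[of \<beta> i] k[of \<beta>]
      m[OF i] m[OF prv_in[OF i]]
    have "kj r \<alpha> i = kj r \<beta> i" using s[OF i] le by linarith
    then show ?thesis using b[OF i] le by linarith
  qed
  have c: "cj \<alpha> i = cj \<beta> i" and rr: "rj \<alpha> i = rj \<beta> i" and d: "dj \<alpha> i = dj \<beta> i" if i: "i \<in> {1..r}" for i
    using cr[OF i] cr[OF nxt_in[OF i]] prv_nxt[OF i] deg[of i] m[OF i] by (auto simp: mdeg_eq_mj)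
  show "\<alpha> = \<beta>"
  proof (rule poly_mapping_eqI)
    fix v :: var
    obtain i x y where v: "v = (i, x, y)" by (metis prod_cases3)
    show "lookup \<alpha> v = lookup \<beta> v"
    proof (cases "i \<in> {1..r}")
      case True
      then show ?thesis
        unfolding v using exhaust_2[of x] exhaust_2[of y] c rr d m by (elim disjE) (simp_all only: lookup_of_mj)
    next
      case False
      then have "mdeg \<alpha> i = 0" "mdeg \<beta> i = 0" using \<alpha> \<beta> by (auto simp: Std_def[OF r] Mon_def deg_ext_def)
      then show ?thesis unfolding v using exhaust_2[of x] exhaust_2[of y] by (auto simp: mdeg_def sum_2)
    qed
  qed
qed

lemma code_surj:
  assumes "x \<in> weight_index r summands snd \<mu>"
  shows "x \<in> code r ` Std r n \<mu>"
proof -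
  obtain m s b where x: "x = ((m, s), b)" by (metis prod_cases3 surj_pair)
  have wt: "int (s i) - 2 * int (b i) = \<mu> i" if "i \<in> {1..r}" for i
    using assms that unfolding x weight_index_def[OF r] by auto
  have mem: "m \<in> boundary r (Lambda_big r n)" "s \<in> boundary r (lambda_small r m)" "b \<in> F_basis r s"
    using assms unfolding x weight_index_def[OF r] by auto
  note m' = mem(1)[unfolded mem_boundary_Lambda_big] and s' = mem(2)[unfolded mem_boundary_lambda_small]
  have m: "m \<in> extensional {1..r}" "\<And>i. i \<in> {1..r} \<Longrightarrow> m i \<le> n i \<and> even (n i - m i)" "\<exists>i\<in>{1..r}. m i = n i"
    using m' by blast+
  have s: "s \<in> extensional {1..r}" "\<And>i. i \<in> {1..r} \<Longrightarrow> s i \<le> m i + m (prv r i) \<and> even (m i + m (prv r i) - s i) \<and>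
        m i \<le> m (prv r i) + s i \<and> m (prv r i) \<le> m i + s i" "\<exists>i\<in>{1..r}. s i = m i + m (prv r i)"
    using s' by blast+
  have b: "b \<in> extensional {1..r}" "\<And>i. i \<in> {1..r} \<Longrightarrow> b i \<le> s i"
    using mem(3) F_basisD[OF mem(3)] by (auto simp: F_basis_def PiE_iff)
  define k where "k i = (m i + m (prv r i) - s i) div 2" for i
  \<comment> \<open>The inverse of the hook coordinate: for b_i at most m_i - k_i the point is (m_i
    - b_i, k_i), and beyond the corner it is (k_i, 2 k_i + b_i - m_i). The maxima, with truncated
    subtraction, cover both arms; p involves \<open>nxt\<close> because the second coordinate
    belongs to the preceding matrix.\<close>
  define q where "q i = max (k i) (m i - b i)" for i
  define p where "p i = max (k (nxt r i)) (2 * k (nxt r i) + b (nxt r i) - m (nxt r i))" for i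
  define j where "j i = (n i - m i) div 2" for i
  have k2: "2 * k i + s i = m i + m (prv r i)" if "i \<in> {1..r}" for i
  proof -
    have "2 * k i = m i + m (prv r i) - s i"
      unfolding k_def using s(2)[OF that] by (intro dvd_mult_div_cancel) blast
    then show ?thesis using s(2)[OF that] by linarith
  qed
  have kle: "k i \<le> m i" "k i \<le> m (prv r i)" if "i \<in> {1..r}" for i
    using s(2)[OF that] k2[OF that] by linarith+
  have j2: "2 * j i + m i = n i" if "i \<in> {1..r}" for i
    using m(2)[OF that] unfolding j_def by auto
  have qm: "q i \<le> m i" if "i \<in> {1..r}" for i using kle[OF that] by (simp add: q_def)
  have pp: "p (prv r i) = max (k i) (2 * k i + b i - m i)" if "i \<in> {1..r}" for i
    unfolding p_def nxt_prv[OF that] ..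
  have pm': "p (prv r i) \<le> m (prv r i)" if "i \<in> {1..r}" for i
    using kle[OF that] k2[OF that] b(2)[OF that] unfolding pp[OF that] by simp
  have pm: "p i \<le> m i" if "i \<in> {1..r}" for i using pm'[OF nxt_in[OF that]] prv_nxt[OF that] by simp
  have kmin: "min (q i) (p (prv r i)) = k i" and bq: "(m i - q i) + (p (prv r i) - k i) = b i" if "i \<in> {1..r}" for i
    using kle[OF that] k2[OF that] b(2)[OF that] unfolding pp[OF that] q_def by (auto simp: max_def min_def)
  \<comment> \<open>These exponents are the ones forced by \<open>lookup_of_mj\<close>.\<close>
  define ex where "ex i x y = (if x = (1::2) then if y = (1::2) then min (p i) (q i) else j i + (p i - q i)
    else if y = 1 then j i + (q i - p i) else m i - max (p i) (q i))" for i x y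
  define \<alpha> :: "var \<Rightarrow>\<^sub>0 nat" where
    "\<alpha> = (\<Sum>v\<in>{1..r} \<times> UNIV. Poly_Mapping.single v (case v of (i, x, y) \<Rightarrow> ex i x y))"
  have l: "lookup \<alpha> (i, x, y) = (if i \<in> {1..r} then ex i x y else 0)" for i x y
    unfolding \<alpha>_def by (subst lookup_sum_single) auto
  have d: "dj \<alpha> i = j i" if "i \<in> {1..r}" for i
    using that by (simp add: dj_def l ex_def min_def)
  have c: "cj \<alpha> i = q i" and rr: "rj \<alpha> i = p i" and mm: "mj \<alpha> i = m i" if "i \<in> {1..r}" for i
    unfolding cj_def rj_def mj_def d[OF that] using that pm[OF that] qm[OF that]
    by (auto simp: l ex_def min_def max_def)
  have kk: "kj r \<alpha> i = k i" if "i \<in> {1..r}" for i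
    unfolding kj_def c[OF that] rr[OF prv_in[OF that]] kmin[OF that] ..
  have "code r \<alpha> = x"
    unfolding x code_def prod.inject
  proof (intro conjI; rule extensionalityI[of _ "{1..r}"])
    fix i assume i: "i \<in> {1..r}"
    note e = mm[OF i] c[OF i] kk[OF i] mm[OF prv_in[OF i]] rr[OF prv_in[OF i]]
    show "(\<lambda>i\<in>{1..r}. mj \<alpha> i) i = m i" using i e(1) by simp
    have "m i + m (prv r i) - 2 * k i = s i" using k2[OF i] by linarith
    then show "(\<lambda>i\<in>{1..r}. mj \<alpha> i + mj \<alpha> (prv r i) - 2 * kj r \<alpha> i) i = s i"
      using i unfolding e[symmetric] by simp
    show "(\<lambda>i\<in>{1..r}. (mj \<alpha> i - cj \<alpha> i) + (rj \<alpha> (prv r i) - kj r \<alpha> i)) i = b i"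
      using i bq[OF i] unfolding e[symmetric] by simp
  qed (simp_all add: m(1) s(1) b(1) del: One_nat_def)
  moreover have "\<alpha> \<in> Std r n \<mu>"
    unfolding Std_def[OF r] Mon_def mem_Collect_eq not_mdvd_Tmon not_mdvd_Dmon
  proof (intro conjI allI ballI)
    show "mdeg \<alpha> i = deg_ext r n i" for i
    proof (cases "i \<in> {1..r}")
      case True
      then show ?thesis using j2[OF True] by (simp add: mdeg_eq_mj mm d deg_ext_def)
    next
      case False
      show ?thesis unfolding mdeg_def deg_ext_def l if_not_P[OF False] by simp
    qed
    show "mwt r \<alpha> i = \<mu> i" if i: "i \<in> {1..r}" for i
      unfolding mwt_eq_mj wt[OF i, symmetric] c[OF i] mm[OF i] mm[OF prv_in[OF i]] rr[OF prv_in[OF i]]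
      using bq[OF i] k2[OF i] qm[OF i] kmin[OF i] by linarith
    obtain i where i: "i \<in> {1..r}" "s i = m i + m (prv r i)" using s(3) by blast
    then have "kj r \<alpha> i = 0" using k2[OF i(1)] kk[OF i(1)] by simp
    then show "\<exists>i\<in>{1..r}. kj r \<alpha> i = 0" using i(1) by blast
    obtain i where i: "i \<in> {1..r}" "m i = n i" using m(3) by blast
    then have "dj \<alpha> i = 0" using j2[OF i(1)] d[OF i(1)] by simp
    then show "\<exists>i\<in>{1..r}. dj \<alpha> i = 0" using i(1) by blast
  qed
  ultimately show ?thesis by blast
qed

theorem card_Std: "card (Std r n \<mu>) = card (weight_index r summands snd \<mu>)"
proof (rule bij_betw_same_card)
  show "bij_betw (code r) (Std r n \<mu>) (weight_index r summands snd \<mu>)"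
    unfolding bij_betw_def using inj_code code_in code_surj by blast
qed

end

section \<open>The group action on polynomials\<close>

lemma const_poly_simps [simp]: "const_poly 0 = 0" "const_poly 1 = 1"
  by (simp_all add: const_poly_def)

lemma const_poly_add: "const_poly (a + b) = const_poly a + const_poly b"
  and const_poly_mult: "const_poly (a * b) = const_poly a * const_poly b"
  by (simp_all add: const_poly_def mult_single single_add)

lemma subst_altdef:
  assumes "finite S" "keys f \<subseteq> S"
  shows "subst \<sigma> f = (\<Sum>\<alpha>\<in>S. const_poly (lookup f \<alpha>) * (\<Prod>v\<in>keys \<alpha>. \<sigma> v ^ lookup \<alpha> v))"
  unfolding subst_def by (rule sum.mono_neutral_left) (use assms in \<open>auto simp: in_keys_iff\<close>)

lemma subst_add: "subst \<sigma> (f + g) = subst \<sigma> f + subst \<sigma> g"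
proof -
  let ?S = "keys f \<union> keys g"
  have "keys (f + g) \<subseteq> ?S" by (rule keys_add)
  then show ?thesis
    by (simp add: subst_altdef[of ?S] lookup_add const_poly_add algebra_simps sum.distrib)
qed

lemma subst_single: "subst \<sigma> (Poly_Mapping.single \<alpha> c) = const_poly c * (\<Prod>v\<in>keys \<alpha>. \<sigma> v ^ lookup \<alpha> v)"
  by (subst subst_altdef[of "{\<alpha>}"]) auto

lemma subst_mult: "subst \<sigma> (f * g) = subst \<sigma> f * subst \<sigma> g"
proof (induction f rule: pm_additive_induct)
  case (single \<alpha> c)
  show ?case
  proof (induction g rule: pm_additive_induct)
    case (single \<beta> d)
    let ?S = "keys \<alpha> \<union> keys \<beta>"
    have *: "(\<Prod>v\<in>keys \<gamma>. \<sigma> v ^ lookup \<gamma> v) = (\<Prod>v\<in>?S. \<sigma> v ^ lookup \<gamma> v)"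
      if "keys \<gamma> \<subseteq> ?S" for \<gamma>
      by (rule prod.mono_neutral_left) (use that in \<open>auto simp: in_keys_iff\<close>)
    show ?case
      unfolding mult_single subst_single *[OF keys_add] *[OF Un_upper1] *[OF Un_upper2]
      by (simp add: lookup_add power_add prod.distrib const_poly_mult mult_ac)
  qed (simp add: distrib_left subst_add)
qed (simp add: distrib_right subst_add)

lemma subst_const: "subst \<sigma> (const_poly c) = const_poly c"
  by (simp add: const_poly_def[of c] subst_single)

lemma subst_var: "subst \<sigma> (var_poly v) = \<sigma> v"
  by (simp add: var_poly_def subst_single)

lemma subst_scale: "subst \<sigma> (scale c f) = scale c (subst \<sigma> f)"
  by (simp add: scale_conv_const_poly subst_mult subst_const)

lemma poly_act_add: "poly_act r g (f + h) = poly_act r g f + poly_act r g h"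
  and poly_act_mult: "poly_act r g (f * h) = poly_act r g f * poly_act r g h"
  and poly_act_const: "poly_act r g (const_poly c) = const_poly c"
  and poly_act_scale: "poly_act r g (scale c f) = scale c (poly_act r g f)"
  and poly_act_var: "poly_act r g (var_poly (i, a, b)) =
     (const_mat (matrix_inv (g (nxt r i))) ** generic_mat i ** const_mat (g i)) $ a $ b"
  by (simp_all add: poly_act_def subst_add subst_mult subst_const subst_scale subst_var)

lemmas poly_act_simps = poly_act_add poly_act_mult poly_act_const poly_act_scale

lemma poly_act_0 [simp]: "poly_act r g 0 = 0"
  using poly_act_const[of r g 0] by simp

lemma poly_act_sum: "poly_act r g (sum h A) = (\<Sum>a\<in>A. poly_act r g (h a))"
  by (induction A rule: infinite_finite_induct) (auto simp: poly_act_add)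

lemma CV_alg_induct [consumes 1, case_names const var add mult]:
  assumes "f \<in> CV r" "\<And>c. P (const_poly c)" "\<And>i a b. i \<in> {1..r} \<Longrightarrow> P (var_poly (i, a, b))"
    "\<And>f g. P f \<Longrightarrow> P g \<Longrightarrow> P (f + g)" "\<And>f g. P f \<Longrightarrow> P g \<Longrightarrow> P (f * g)"
  shows "P f"
proof (rule poly_alg_induct[where A = "{v. fst v \<in> {1..r}}"])
  show "v \<in> {v. fst v \<in> {1..r}}" if "\<alpha> \<in> keys f" "v \<in> keys \<alpha>" for \<alpha> v
    using assms(1) that unfolding CV_def by fastforce
  show "P (var_poly v)" if "v \<in> {v. fst v \<in> {1..r}}" for v
    using assms(3)[of "fst v" "fst (snd v)" "snd (snd v)"] that by simp
qed (use assms in auto)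

lemma generic_sandwich: "(const_mat P ** generic_mat i ** const_mat Q) $ a $ b =
   (\<Sum>d\<in>UNIV. \<Sum>c\<in>UNIV. scale (P $ a $ c * Q $ d $ b) (var_poly (i, c, d)))"
  by (simp add: matrix_matrix_mult_def const_mat_def generic_mat_def scale_conv_const_poly
      const_poly_mult sum_distrib_right sum_distrib_left mult_ac)

lemma euler_poly_act:
  assumes "f \<in> CV r"
  shows "euler k (poly_act r g f) = poly_act r g (euler k f)"
  using assms
proof (induction rule: CV_alg_induct)
  case (var i a b)
  then show ?case
    by (simp add: poly_act_var generic_sandwich sum_2 euler_simps euler_var del: matrix_mul_assoc)
qed (simp_all add: derivation_const[OF derivation_euler] euler_simps poly_act_simps)

lemma CV_graded_CV: "f \<in> CV_graded r n \<Longrightarrow> f \<in> CV r"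
  by (simp add: CV_graded_def)

lemma poly_act_CV_graded:
  assumes "f \<in> CV_graded r n"
  shows "poly_act r g f \<in> CV_graded r n"
  using assms euler_poly_act[OF CV_graded_CV[OF assms]]
  by (simp add: CV_graded_iff_euler poly_act_scale)

lemma CV_iff_euler: "f \<in> CV r \<longleftrightarrow> (\<forall>k. k \<notin> {1..r} \<longrightarrow> euler k f = 0)"
proof -
  have "euler k f = 0 \<longleftrightarrow> (\<forall>\<alpha>\<in>keys f. mdeg \<alpha> k = 0)" for k
    using eigen_iff_keys[of "euler k" f "\<lambda>\<alpha>. int (mdeg \<alpha> k)" 0] by (auto simp: lookup_euler)
  then show ?thesis unfolding CV_iff by blast
qed

lemma poly_act_CV: "f \<in> CV r \<Longrightarrow> poly_act r g f \<in> CV r"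
  unfolding CV_iff_euler using euler_poly_act[of f r _ g] by (auto simp: CV_iff_euler)

lemma matrix_inv_mult:
  fixes A B :: mat2
  assumes "invertible A" "invertible B"
  shows "matrix_inv (A ** B) = matrix_inv B ** matrix_inv (A :: mat2)"
proof (rule matrix_inv_unique')
  show "A ** B ** (matrix_inv B ** matrix_inv A) = mat 1"
    by (metis assms matrix_inv_right matrix_mul_assoc matrix_mul_rid)
  show "matrix_inv B ** matrix_inv A ** (A ** B) = mat 1"
    by (metis assms matrix_inv_left matrix_mul_assoc matrix_mul_rid)
qed

lemma const_mat_mult: "const_mat (A ** B) = const_mat A ** const_mat B"
  by (simp add: const_mat_def matrix_matrix_mult_def vec_eq_iff const_poly_mult const_poly_add sum_2)

lemma GL2_powD: "g \<in> carrier (GL2_pow r) \<Longrightarrow> i \<in> {1..r} \<Longrightarrow> invertible (g i)"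
  by (auto simp: GL2_pow_def GL2_def)

lemma mult_GL2_pow: "g \<otimes>\<^bsub>GL2_pow r\<^esub> h = (\<lambda>i\<in>{1..r}. g i ** h i)"
  by (simp add: GL2_pow_def GL2_def)

lemma one_GL2_pow: "\<one>\<^bsub>GL2_pow r\<^esub> = (\<lambda>i\<in>{1..r}. mat 1)"
  by (simp add: GL2_pow_def GL2_def)

text \<open>Both sides are algebra homomorphisms in f, so the variables suffice. Substituting the
  matrices for g into those for h nests the two sandwiches with h on the outside, and this is the
  sandwich of the product gh.\<close>

lemma poly_act_mult_group:
  assumes g: "\<And>i. i \<in> {1..r} \<Longrightarrow> invertible (g i)" and h: "\<And>i. i \<in> {1..r} \<Longrightarrow> invertible (h i)"
    and f: "f \<in> CV r"
  shows "poly_act r (\<lambda>i\<in>{1..r}. g i ** h i) f = poly_act r g (poly_act r h f)"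
  using f
proof (induction rule: CV_alg_induct)
  case (var i a b)
  let ?P = "const_mat (matrix_inv (h (nxt r i)))" and ?Q = "const_mat (h i)"
  let ?M = "const_mat (matrix_inv (g (nxt r i))) ** generic_mat i ** const_mat (g i)"
  note n = nxt_in[OF var]
  have "poly_act r g (poly_act r h (var_poly (i, a, b))) =
      (\<Sum>d\<in>UNIV. \<Sum>c\<in>UNIV. scale (matrix_inv (h (nxt r i)) $ a $ c * h i $ d $ b) (?M $ c $ d))"
    unfolding poly_act_var generic_sandwich[of "matrix_inv (h (nxt r i))"] poly_act_sum poly_act_scale poly_act_var ..
  also have "\<dots> = (?P ** ?M ** ?Q) $ a $ b"
    unfolding matrix_matrix_mult_def[of _ ?Q] matrix_matrix_mult_def[of ?P]
    by (simp add: const_mat_def scale_conv_const_poly const_poly_mult sum_distrib_right sum_distrib_left mult_ac)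
  also have "?P ** ?M ** ?Q = (?P ** const_mat (matrix_inv (g (nxt r i)))) ** generic_mat i ** (const_mat (g i) ** ?Q)"
    by (simp only: matrix_mul_assoc)
  also have "\<dots> = const_mat (matrix_inv (g (nxt r i) ** h (nxt r i))) ** generic_mat i ** const_mat (g i ** h i)"
    unfolding const_mat_mult matrix_inv_mult[OF g[OF n] h[OF n]] ..
  finally show ?case using var n by (simp add: poly_act_var)
qed (simp_all add: poly_act_simps)

lemma matrix_inv_mat: "c \<noteq> 0 \<Longrightarrow> matrix_inv (mat c :: mat2) = mat (1 / c)"
  by (intro matrix_inv_unique') (simp_all add: mat_mult_mat)

lemma poly_act_one:
  assumes "f \<in> CV r" shows "poly_act r (\<lambda>i\<in>{1..r}. mat 1) f = f"
  using assms
proof (induction rule: CV_alg_induct)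
  case (var i a b)
  have "const_mat (mat 1) = (mat 1 :: mpoly^2^2)"
    by (simp add: const_mat_def mat_def vec_eq_iff)
  moreover note nxt_in[OF var]
  ultimately show ?case using var by (simp add: poly_act_var matrix_inv_mat generic_mat_def)
qed (simp_all add: poly_act_simps)

lemma poly_act_cong:
  assumes "\<And>i. i \<in> {1..r} \<Longrightarrow> g i = h i" "f \<in> CV r"
  shows "poly_act r g f = poly_act r h f"
  using assms(2)
proof (induction rule: CV_alg_induct)
  case (var i a b)
  then show ?case using assms(1)[OF nxt_in] assms(1) by (simp only: poly_act_var)
qed (simp_all add: poly_act_simps)

section \<open>The action of scalar matrices\<close>

definition scalar_char :: "nat \<Rightarrow> (nat \<Rightarrow> complex) \<Rightarrow> (nat \<Rightarrow> int) \<Rightarrow> complex" where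
  "scalar_char r u n = (\<Prod>i\<in>{1..r}. u i powi (n i - n (prv r i)))"

definition mon_char :: "nat \<Rightarrow> (nat \<Rightarrow> complex) \<Rightarrow> (var \<Rightarrow>\<^sub>0 nat) \<Rightarrow> complex" where
  "mon_char r u \<alpha> = scalar_char r u (\<lambda>i. int (mdeg \<alpha> i))"

lemma mon_char_add:
  assumes "\<And>i. i \<in> {1..r} \<Longrightarrow> u i \<noteq> 0"
  shows "mon_char r u (\<alpha> + \<beta>) = mon_char r u \<alpha> * mon_char r u \<beta>"
  unfolding mon_char_def scalar_char_def prod.distrib[symmetric]
proof (intro prod.cong refl)
  fix i assume i: "i \<in> {1..r}"
  have "int (mdeg (\<alpha> + \<beta>) i) - int (mdeg (\<alpha> + \<beta>) (prv r i)) =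
      (int (mdeg \<alpha> i) - int (mdeg \<alpha> (prv r i))) + (int (mdeg \<beta> i) - int (mdeg \<beta> (prv r i)))"
    by (simp add: mdeg_add)
  then show "u i powi (int (mdeg (\<alpha> + \<beta>) i) - int (mdeg (\<alpha> + \<beta>) (prv r i))) =
      u i powi (int (mdeg \<alpha> i) - int (mdeg \<alpha> (prv r i))) * u i powi (int (mdeg \<beta> i) - int (mdeg \<beta> (prv r i)))"
    using assms[OF i] by (simp add: power_int_add)
qed

lemma mdeg_single_var: "mdeg (Poly_Mapping.single (i, a, b) 1) k = (if k = i then 1 else 0)"
  using exhaust_2[of a] exhaust_2[of b] by (auto simp: mdeg_def sum_2 lookup_single when_def)

text \<open>The entries of g^-1 X for scalars u are u_i / u_(i+1) times those of X. Collecting the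
  powers of each u_i over a monomial of multidegree n gives the exponent n_i - n_(i-1) in
  \<open>scalar_char\<close>.\<close>

lemma mon_char_var:
  assumes r: "r \<ge> 2" and u: "\<And>i. i \<in> {1..r} \<Longrightarrow> u i \<noteq> 0" and i: "i \<in> {1..r}"
  shows "mon_char r u (Poly_Mapping.single (i, a, b) 1) = u i / u (nxt r i)"
proof -
  note n = nxt_in[OF i] nxt_neq[OF r i]
  have eq: "prv r k = i \<longleftrightarrow> k = nxt r i" if "k \<in> {1..r}" for k
    using that i nxt_prv[OF that] prv_nxt[OF i] by auto
  have "mon_char r u (Poly_Mapping.single (i, a, b) 1) =
      (\<Prod>k\<in>{1..r}. u k powi ((if k = i then 1 else 0) - (if k = nxt r i then 1 else 0)))"
    unfolding mon_char_def scalar_char_def mdeg_single_var by (intro prod.cong refl) (auto simp: eq)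
  also have "\<dots> = (\<Prod>k\<in>{1..r}. (if k = i then u i else 1) * (if k = nxt r i then inverse (u (nxt r i)) else 1))"
    using n by (intro prod.cong refl) (auto simp: power_int_minus)
  also have "\<dots> = u i / u (nxt r i)"
    using i n by (simp add: prod.distrib prod.delta divide_inverse)
  finally show ?thesis .
qed

lemma matrix_inv_scalar: "invertible A \<Longrightarrow> c \<noteq> 0 \<Longrightarrow> matrix_inv (mat c ** A) = mat (1 / c) ** matrix_inv (A :: mat2)"
proof -
  assume A: "invertible A" and c: "c \<noteq> 0"
  have "invertible (mat c :: mat2)"
    unfolding invertible_det_nz using c by (simp add: det_2 mat_def)
  from matrix_inv_mult[OF this A] show ?thesis
    unfolding matrix_inv_mat[OF c] scalar_commute .
qed

lemma mat_mult_component: "(mat c ** A) $ a $ b = c * (A $ a $ b)" for A :: mat2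
  using exhaust_2[of a] by (auto simp: matrix_matrix_mult_def mat_def sum_2)

lemma poly_act_scalar_mon:
  assumes r: "r \<ge> 2" and u: "\<And>i. i \<in> {1..r} \<Longrightarrow> u i \<noteq> 0" and h: "\<And>i. i \<in> {1..r} \<Longrightarrow> invertible (h i)"
    and \<alpha>: "mon \<alpha> \<in> CV r"
  shows "poly_act r (\<lambda>i\<in>{1..r}. mat (u i) ** h i) (mon \<alpha>) = scale (mon_char r u \<alpha>) (poly_act r h (mon \<alpha>))"
proof -
  define g where "g = (\<lambda>i\<in>{1..r}. mat (u i) ** h i)"
  have v: "poly_act r g (var_poly (i, a, b)) = scale (u i / u (nxt r i)) (poly_act r h (var_poly (i, a, b)))"
    if i: "i \<in> {1..r}" for i a b
  proof -
    note n = nxt_in[OF i]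
    have gi: "g i = mat (u i) ** h i" "g (nxt r i) = mat (u (nxt r i)) ** h (nxt r i)"
      using i n by (simp_all add: g_def)
    show ?thesis
      unfolding poly_act_var generic_sandwich gi matrix_inv_scalar[OF h[OF n] u[OF n]] mat_mult_component
      by (simp add: cvec.scale_sum_right mult_ac)
  qed
  have add: "mon_char r u (\<alpha> + \<beta>) = mon_char r u \<alpha> * mon_char r u \<beta>" for \<alpha> \<beta>
    by (rule mon_char_add) (rule u)
  have pw: "poly_act r g (f ^ k) = poly_act r g f ^ k" for g f k
    by (induction k) (auto simp: poly_act_mult poly_act_const[of r g 1, simplified])
  have idx: "fst v \<in> {1..r}" if "v \<in> keys \<alpha>" for v
    using \<alpha> that by (auto simp: CV_def)
  have main: "poly_act r g (\<Prod>v\<in>S. var_poly v ^ k v) =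
      scale (mon_char r u (\<Sum>v\<in>S. Poly_Mapping.single v (k v))) (poly_act r h (\<Prod>v\<in>S. var_poly v ^ k v))"
    if "finite S" "\<And>v. v \<in> S \<Longrightarrow> fst v \<in> {1..r}" for S k
    using that
  proof (induction S)
    case empty
    show ?case using poly_act_const[of r _ 1] by (simp add: mon_char_def scalar_char_def mdeg_def)
  next
    case (insert v S)
    obtain i a b where vi: "v = (i, a, b)" by (metis prod_cases3)
    then have i: "i \<in> {1..r}" using insert.prems[of v] by simp
    have chk: "mon_char r u (Poly_Mapping.single v m) = (u i / u (nxt r i)) ^ m" for m
    proof (induction m)
      case 0
      show ?case by (simp add: mon_char_def scalar_char_def mdeg_def)
    next
      case (Suc m)
      have "Poly_Mapping.single v (Suc m) = Poly_Mapping.single v 1 + Poly_Mapping.single v m"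
        by (simp flip: single_add)
      then show ?case
        using Suc mon_char_add[where u = u and r = r, OF u, of "Poly_Mapping.single v 1" "Poly_Mapping.single v m"]
          mon_char_var[where u = u and a = a and b = b, OF r u i] by (simp add: vi)
    qed
    have p: "scale c f ^ m = scale (c ^ m) (f ^ m)" for c and f :: mpoly and m :: nat
      by (induction m) (auto simp: mult_scale_scale)
    have "poly_act r g (\<Prod>v\<in>insert v S. var_poly v ^ k v) =
        scale ((u i / u (nxt r i)) ^ k v) (poly_act r h (var_poly v) ^ k v) *
        scale (mon_char r u (\<Sum>v\<in>S. Poly_Mapping.single v (k v))) (poly_act r h (\<Prod>v\<in>S. var_poly v ^ k v))"
      using insert.hyps v[OF i, where a = a and b = b] insert.IH insert.prems
      by (simp add: poly_act_mult pw p vi del: atLeastAtMost_iff)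
    also have "\<dots> = scale (mon_char r u (Poly_Mapping.single v (k v)) * mon_char r u (\<Sum>v\<in>S. Poly_Mapping.single v (k v)))
        (poly_act r h (var_poly v) ^ k v * poly_act r h (\<Prod>v\<in>S. var_poly v ^ k v))"
      unfolding mult_scale_scale chk ..
    also have "\<dots> = scale (mon_char r u (\<Sum>v\<in>insert v S. Poly_Mapping.single v (k v)))
        (poly_act r h (\<Prod>v\<in>insert v S. var_poly v ^ k v))"
      using insert.hyps by (simp add: add poly_act_mult pw)
    finally show ?case .
  qed
  have m: "(\<Prod>v\<in>keys \<alpha>. var_poly v ^ lookup \<alpha> v) = mon \<alpha>"
    using single_eq_prod[of \<alpha> 1] by simp
  have sm: "(\<Sum>v\<in>keys \<alpha>. Poly_Mapping.single v (lookup \<alpha> v)) = \<alpha>"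
    by (rule pm_eq_sum_single[symmetric]) auto
  have "poly_act r g (\<Prod>v\<in>keys \<alpha>. var_poly v ^ lookup \<alpha> v) =
      scale (mon_char r u (\<Sum>v\<in>keys \<alpha>. Poly_Mapping.single v (lookup \<alpha> v)))
        (poly_act r h (\<Prod>v\<in>keys \<alpha>. var_poly v ^ lookup \<alpha> v))"
    by (rule main[OF finite_keys idx])
  then show ?thesis unfolding m sm g_def .
qed

lemma mon_CV: "f \<in> CV r \<Longrightarrow> \<alpha> \<in> keys f \<Longrightarrow> mon \<alpha> \<in> CV r"
  by (auto simp: CV_def)

text \<open>All monomials of one multidegree have the same character, so it factors out of the sum;
  this is the origin of z.\<close>

lemma poly_act_scalar:
  assumes "r \<ge> 2" "\<And>i. i \<in> {1..r} \<Longrightarrow> u i \<noteq> 0" "\<And>i. i \<in> {1..r} \<Longrightarrow> invertible (h i)" "f \<in> CV_graded r n"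
  shows "poly_act r (\<lambda>i\<in>{1..r}. mat (u i) ** h i) f = scale (scalar_char r u (\<lambda>i. int (n i))) (poly_act r h f)"
proof -
  have ch: "mon_char r u \<alpha> = scalar_char r u (\<lambda>i. int (n i))" if "\<alpha> \<in> keys f" for \<alpha>
  proof -
    have "mdeg \<alpha> k = n k" if "k \<in> {1..r}" for k
      using assms(4) \<open>\<alpha> \<in> keys f\<close> that by (auto simp: CV_graded_iff deg_ext_def)
    then show ?thesis unfolding mon_char_def scalar_char_def
      using prv_in by (intro prod.cong refl) simp
  qed
  have "poly_act r (\<lambda>i\<in>{1..r}. mat (u i) ** h i) (\<Sum>\<alpha>\<in>keys f. scale (lookup f \<alpha>) (mon \<alpha>)) =
    (\<Sum>\<alpha>\<in>keys f. scale (lookup f \<alpha>) (scale (scalar_char r u (\<lambda>i. int (n i))) (poly_act r h (mon \<alpha>))))"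
    unfolding poly_act_sum poly_act_scale
    by (intro sum.cong refl)
      (simp only: poly_act_scalar_mon[OF assms(1-3) mon_CV[OF CV_graded_CV[OF assms(4)]]] ch)
  also have "\<dots> = scale (scalar_char r u (\<lambda>i. int (n i))) (poly_act r h (\<Sum>\<alpha>\<in>keys f. scale (lookup f \<alpha>) (mon \<alpha>)))"
    unfolding poly_act_sum poly_act_scale cvec.scale_sum_right by (simp only: cvec.scale_scale mult.commute)
  finally show ?thesis by (simp flip: pm_eq_sum_scale_mon del: scale_single)
qed

section \<open>Unipotent elements act as exponentials\<close>

text \<open>The exponential of t \<delta> applied to f, as a finite sum. It is a relation since the
  order of nilpotency of \<delta> depends on f.\<close>

definition exp_rel :: "complex \<Rightarrow> (mpoly \<Rightarrow> mpoly) \<Rightarrow> mpoly \<Rightarrow> mpoly \<Rightarrow> bool" where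
  "exp_rel t \<delta> f g \<longleftrightarrow> (\<exists>N. (\<forall>k\<ge>N. (\<delta> ^^ k) f = 0) \<and> g = (\<Sum>k<N. scale (t ^ k / fact k) ((\<delta> ^^ k) f)))"

lemma exp_rel_sum:
  assumes "exp_rel t \<delta> f g" "\<And>k. k \<ge> M \<Longrightarrow> (\<delta> ^^ k) f = 0"
  shows "g = (\<Sum>k<M. scale (t ^ k / fact k) ((\<delta> ^^ k) f))"
proof -
  obtain N where N: "\<forall>k\<ge>N. (\<delta> ^^ k) f = 0" "g = (\<Sum>k<N. scale (t ^ k / fact k) ((\<delta> ^^ k) f))"
    using assms(1) unfolding exp_rel_def by blast
  have "(\<Sum>k<M. scale (t ^ k / fact k) ((\<delta> ^^ k) f)) = (\<Sum>k<max M N. scale (t ^ k / fact k) ((\<delta> ^^ k) f))"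
    by (rule sum.mono_neutral_left) (use assms(2) in auto)
  moreover have "(\<Sum>k<N. scale (t ^ k / fact k) ((\<delta> ^^ k) f)) = (\<Sum>k<max M N. scale (t ^ k / fact k) ((\<delta> ^^ k) f))"
    by (rule sum.mono_neutral_left) (use N(1) in auto)
  ultimately show ?thesis using N(2) by simp
qed

context
  fixes \<delta> assumes der: "derivation \<delta>"
begin

lemma funpow_der: "(\<delta> ^^ k) (f + g) = (\<delta> ^^ k) f + (\<delta> ^^ k) g" "(\<delta> ^^ k) (scale c f) = scale c ((\<delta> ^^ k) f)"
  "(\<delta> ^^ k) 0 = 0"
  by (induction k) (simp_all add: derivationD[OF der])

text \<open>Divided powers, for which the iterated Leibniz rule has no binomial
  coefficients.\<close>

definition dpow :: "nat \<Rightarrow> mpoly \<Rightarrow> mpoly" where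
  "dpow k f = scale (1 / fact k) ((\<delta> ^^ k) f)"

lemma der_dpow: "\<delta> (dpow k f) = scale (of_nat (Suc k)) (dpow (Suc k) f)"
proof -
  have "of_nat (Suc k) * (1 / fact (Suc k)) = (1 / fact k :: complex)"
    by (simp del: of_nat_Suc)
  then show ?thesis unfolding dpow_def derivationD[OF der] cvec.scale_scale by simp
qed

text \<open>Applying \<delta> to the formula for k puts the factors j and k + 1 - j on the same
  product; they add up to k + 1, which is then cancelled.\<close>

lemma dpow_mult: "dpow k (f * g) = (\<Sum>j\<le>k. dpow j f * dpow (k - j) g)"
proof (induction k)
  case 0
  show ?case by (simp add: dpow_def)
next
  case (Suc k)
  have "scale (of_nat (Suc k)) (dpow (Suc k) (f * g)) = \<delta> (\<Sum>j\<le>k. dpow j f * dpow (k - j) g)"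
    using der_dpow[of k "f * g"] Suc by simp
  also have "\<dots> = (\<Sum>j\<le>k. scale (of_nat (Suc j)) (dpow (Suc j) f * dpow (k - j) g)) +
      (\<Sum>j\<le>k. scale (of_nat (Suc k - j)) (dpow j f * dpow (Suc k - j) g))"
    unfolding derivationD(7)[OF der] sum.distrib[symmetric]
  proof (intro sum.cong refl)
    fix j assume "j \<in> {..k}"
    then have "Suc k - j = Suc (k - j)" by auto
    then show "\<delta> (dpow j f * dpow (k - j) g) = scale (of_nat (Suc j)) (dpow (Suc j) f * dpow (k - j) g) +
        scale (of_nat (Suc k - j)) (dpow j f * dpow (Suc k - j) g)"
      unfolding derivationD(3)[OF der] der_dpow by (simp only: scale_mult_left scale_mult_right[symmetric])
  qed
  also have "(\<Sum>j\<le>k. scale (of_nat (Suc j)) (dpow (Suc j) f * dpow (k - j) g)) =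
      (\<Sum>j\<le>Suc k. scale (of_nat j) (dpow j f * dpow (Suc k - j) g))"
    by (subst sum.atMost_Suc_shift) simp
  also have "(\<Sum>j\<le>k. scale (of_nat (Suc k - j)) (dpow j f * dpow (Suc k - j) g)) =
      (\<Sum>j\<le>Suc k. scale (of_nat (Suc k - j)) (dpow j f * dpow (Suc k - j) g))"
    by simp
  also have "(\<Sum>j\<le>Suc k. scale (of_nat j) (dpow j f * dpow (Suc k - j) g)) + \<dots> =
      scale (of_nat (Suc k)) (\<Sum>j\<le>Suc k. dpow j f * dpow (Suc k - j) g)"
    unfolding cvec.scale_sum_right sum.distrib[symmetric]
  proof (intro sum.cong refl)
    fix j assume "j \<in> {..Suc k}"
    then have "of_nat j + of_nat (Suc k - j) = (of_nat (Suc k) :: complex)"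
      by (simp only: of_nat_add[symmetric] atMost_iff le_add_diff_inverse)
    then show "scale (of_nat j) (dpow j f * dpow (Suc k - j) g) + scale (of_nat (Suc k - j)) (dpow j f * dpow (Suc k - j) g) =
        scale (of_nat (Suc k)) (dpow j f * dpow (Suc k - j) g)"
      by (simp only: cvec.scale_left_distrib[symmetric])
  qed
  finally show ?case by (subst (asm) cvec.scale_cancel_left) (auto simp del: of_nat_Suc)
qed

lemma exp_rel_dpow: "exp_rel t \<delta> f g \<longleftrightarrow> (\<exists>N. (\<forall>k\<ge>N. dpow k f = 0) \<and> g = (\<Sum>k<N. scale (t ^ k) (dpow k f)))"
  unfolding exp_rel_def dpow_def by (simp add: cvec.scale_eq_0_iff)

text \<open>The exponential of a derivation is multiplicative: the triangle i + j < N + M of the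
  Cauchy product contains the rectangle of possibly nonzero terms, and everything outside the
  rectangle vanishes.\<close>

lemma exp_rel_mult:
  assumes "exp_rel t \<delta> f f'" "exp_rel t \<delta> g g'"
  shows "exp_rel t \<delta> (f * g) (f' * g')"
proof -
  obtain N where N: "\<And>k. k \<ge> N \<Longrightarrow> dpow k f = 0" "f' = (\<Sum>k<N. scale (t ^ k) (dpow k f))"
    using assms(1) unfolding exp_rel_dpow by blast
  obtain M where M: "\<And>k. k \<ge> M \<Longrightarrow> dpow k g = 0" "g' = (\<Sum>k<M. scale (t ^ k) (dpow k g))"
    using assms(2) unfolding exp_rel_dpow by blast
  have "dpow k (f * g) = 0" if "k \<ge> N + M" for k
    unfolding dpow_mult
  proof (intro sum.neutral ballI)
    fix j assume "j \<in> {..k}"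
    then have "j \<ge> N \<or> k - j \<ge> M" using that by auto
    then show "dpow j f * dpow (k - j) g = 0" using N M by auto
  qed
  moreover have "f' * g' = (\<Sum>k<N + M. scale (t ^ k) (dpow k (f * g)))"
  proof -
    let ?h = "\<lambda>i j. scale (t ^ (i + j)) (dpow i f * dpow j g)"
    have "f' * g' = (\<Sum>(i, j)\<in>{..<N} \<times> {..<M}. ?h i j)"
      unfolding N(2) M(2) sum_product sum.cartesian_product[symmetric]
      by (simp add: mult_scale_scale power_add)
    also have "\<dots> = (\<Sum>(i, j)\<in>{(i, j). i + j < N + M}. ?h i j)"
    proof (rule sum.mono_neutral_left)
      show "finite {(i, j). i + j < N + M}"
        by (rule finite_subset[of _ "{..<N + M} \<times> {..<N + M}"]) auto
      show "\<forall>x\<in>{(i, j). i + j < N + M} - {..<N} \<times> {..<M}. (case x of (i, j) \<Rightarrow> ?h i j) = 0"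
      proof
        fix x assume x: "x \<in> {(i, j). i + j < N + M} - {..<N} \<times> {..<M}"
        obtain i j where ij: "x = (i, j)" by fastforce
        then have "i \<ge> N \<or> j \<ge> M" using x by auto
        then show "(case x of (i, j) \<Rightarrow> ?h i j) = 0" using N M by (auto simp: ij)
      qed
    qed auto
    also have "\<dots> = (\<Sum>k<N + M. \<Sum>i\<le>k. ?h i (k - i))" by (rule sum.triangle_reindex)
    also have "\<dots> = (\<Sum>k<N + M. scale (t ^ k) (dpow k (f * g)))"
      unfolding dpow_mult cvec.scale_sum_right by (intro sum.cong refl) auto
    finally show ?thesis .
  qed
  ultimately show ?thesis unfolding exp_rel_dpow by blast
qed

lemma exp_rel_add:
  assumes "exp_rel t \<delta> f f'" "exp_rel t \<delta> g g'"
  shows "exp_rel t \<delta> (f + g) (f' + g')"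
proof -
  obtain N where N: "\<And>k. k \<ge> N \<Longrightarrow> (\<delta> ^^ k) f = 0" using assms(1) unfolding exp_rel_def by blast
  obtain M where M: "\<And>k. k \<ge> M \<Longrightarrow> (\<delta> ^^ k) g = 0" using assms(2) unfolding exp_rel_def by blast
  have "f' = (\<Sum>k<max N M. scale (t ^ k / fact k) ((\<delta> ^^ k) f))"
    by (rule exp_rel_sum[OF assms(1)]) (use N in auto)
  moreover have "g' = (\<Sum>k<max N M. scale (t ^ k / fact k) ((\<delta> ^^ k) g))"
    by (rule exp_rel_sum[OF assms(2)]) (use M in auto)
  ultimately show ?thesis
    unfolding exp_rel_def
    by (intro exI[of _ "max N M"]) (simp add: funpow_der N M cvec.scale_right_distrib sum.distrib)
qed

lemma exp_rel_const: "exp_rel t \<delta> (const_poly c) (const_poly c)"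
proof -
  have "(\<delta> ^^ k) (const_poly c) = 0" if "k \<ge> 1" for k
    using that by (cases k) (auto simp: derivation_const[OF der] funpow_der funpow_swap1)
  then show ?thesis unfolding exp_rel_def by (intro exI[of _ 1]) auto
qed

lemma exp_rel_linear: "\<delta> (\<delta> f) = 0 \<Longrightarrow> exp_rel t \<delta> f (f + scale t (\<delta> f))"
proof -
  assume *: "\<delta> (\<delta> f) = 0"
  have "(\<delta> ^^ k) f = 0" if "k \<ge> 2" for k
  proof -
    obtain l where "k = Suc (Suc l)" using \<open>k \<ge> 2\<close> by (metis Suc_le_D numeral_2_eq_2 Suc_le_mono)
    then show ?thesis by (simp add: funpow_swap1 * funpow_der)
  qed
  then show ?thesis unfolding exp_rel_def by (intro exI[of _ 2]) (auto simp: numeral_2_eq_2)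
qed

end

section \<open>Unipotent generators of SL_2^r\<close>

definition umat :: "complex \<Rightarrow> mat2" where
  "umat t = (\<chi> a b. if a = b then 1 else if a = 1 then t else 0)"

definition lmat :: "complex \<Rightarrow> mat2" where
  "lmat t = (\<chi> a b. if a = b then 1 else if a = 2 then t else 0)"

definition at_vertex :: "nat \<Rightarrow> nat \<Rightarrow> mat2 \<Rightarrow> nat \<Rightarrow> mat2" where
  "at_vertex r i A = (\<lambda>j\<in>{1..r}. if j = i then A else mat 1)"

lemma umat_entries: "umat t $ 1 $ 1 = 1" "umat t $ 1 $ 2 = t" "umat t $ 2 $ 1 = 0" "umat t $ 2 $ 2 = 1"
  and lmat_entries: "lmat t $ 1 $ 1 = 1" "lmat t $ 1 $ 2 = 0" "lmat t $ 2 $ 1 = t" "lmat t $ 2 $ 2 = 1"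
  and mat1_entries: "(mat 1 :: mat2) $ 1 $ 1 = 1" "(mat 1 :: mat2) $ 1 $ 2 = 0" "(mat 1 :: mat2) $ 2 $ 1 = 0" "(mat 1 :: mat2) $ 2 $ 2 = 1"
  by (simp_all add: umat_def lmat_def mat_def)

lemma mat2_eqI: "(A :: mat2) $ 1 $ 1 = B $ 1 $ 1 \<Longrightarrow> A $ 1 $ 2 = B $ 1 $ 2 \<Longrightarrow> A $ 2 $ 1 = B $ 2 $ 1 \<Longrightarrow> A $ 2 $ 2 = B $ 2 $ 2 \<Longrightarrow> A = B"
  by (simp add: vec_eq_iff forall_2)

lemma mat2_mult_entries: "((A :: mat2) ** B) $ a $ b = A $ a $ 1 * B $ 1 $ b + A $ a $ 2 * B $ 2 $ b"
  by (simp add: matrix_matrix_mult_def sum_2)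

lemma umat_add: "umat s ** umat t = umat (s + t)" and lmat_add: "lmat s ** lmat t = lmat (s + t)"
  and umat_0: "umat 0 = mat 1" and lmat_0: "lmat 0 = mat 1"
  by (rule mat2_eqI; simp add: mat2_mult_entries umat_entries lmat_entries mat1_entries)+

lemma inv_umat: "matrix_inv (umat t) = umat (- t)" and inv_lmat: "matrix_inv (lmat t) = lmat (- t)"
  by (rule matrix_inv_unique'; simp add: umat_add lmat_add umat_0 lmat_0)+

lemma det_umat [simp]: "det (umat t) = 1" and det_lmat [simp]: "det (lmat t) = 1"
  by (simp_all add: det_2 umat_entries lmat_entries)

text \<open>The group acts by algebra homomorphisms and so does the exponential of a derivation,
  hence the variables suffice. There the derivation has square zero, and the substitution is x + t
  \<delta> x.\<close>

lemma exp_at_vertex: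
  assumes r: "r \<ge> 2" and i: "i \<in> {1..r}" and f: "f \<in> CV r"
  shows "exp_rel t (opE r i) f (poly_act r (at_vertex r i (umat t)) f)"
    and "exp_rel t (opF r i) f (poly_act r (at_vertex r i (lmat t)) f)"
proof -
  define p where "p = prv r i"
  have p: "p \<noteq> i" "prv r i = p" using prv_neq[OF r i] by (simp_all add: p_def)
  have eq: "nxt r k = i \<longleftrightarrow> k = p" if "k \<in> {1..r}" for k
    using that i prv_nxt[OF that] nxt_prv[OF i] by (auto simp: p_def)
  have inv1: "matrix_inv (mat 1 :: mat2) = mat 1" using matrix_inv_mat[of 1] by simp
  show "exp_rel t (opE r i) f (poly_act r (at_vertex r i (umat t)) f)"
    using f
  proof (induction rule: CV_alg_induct)
    case (var k a b)
    note n = nxt_in[OF var]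
    have "poly_act r (at_vertex r i (umat t)) (var_poly (k, a, b)) =
        var_poly (k, a, b) + scale t (opE r i (var_poly (k, a, b)))"
      unfolding poly_act_var generic_sandwich at_vertex_def restrict_apply if_P[OF var] if_P[OF n] eq[OF var]
      using exhaust_2[of a] exhaust_2[of b] p
      by (elim disjE) (simp_all add: sum_2 opE_var inv1 inv_umat umat_entries mat1_entries flip: cvec.scale_minus_left)
    moreover have "opE r i (opE r i (var_poly (k, a, b))) = 0"
      using p by (simp add: opE_var opE_simps)
    ultimately show ?case using exp_rel_linear[OF derivation_opE] by simp
  qed (simp_all add: poly_act_simps exp_rel_const exp_rel_add exp_rel_mult derivation_opE)
  show "exp_rel t (opF r i) f (poly_act r (at_vertex r i (lmat t)) f)"
    using f
  proof (induction rule: CV_alg_induct)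
    case (var k a b)
    note n = nxt_in[OF var]
    have "poly_act r (at_vertex r i (lmat t)) (var_poly (k, a, b)) =
        var_poly (k, a, b) + scale t (opF r i (var_poly (k, a, b)))"
      unfolding poly_act_var generic_sandwich at_vertex_def restrict_apply if_P[OF var] if_P[OF n] eq[OF var]
      using exhaust_2[of a] exhaust_2[of b] p
      by (elim disjE) (simp_all add: sum_2 opF_var inv1 inv_lmat lmat_entries mat1_entries flip: cvec.scale_minus_left)
    moreover have "opF r i (opF r i (var_poly (k, a, b))) = 0"
      using p by (simp add: opF_var opF_simps)
    ultimately show ?case using exp_rel_linear[OF derivation_opF] by simp
  qed (simp_all add: poly_act_simps exp_rel_const exp_rel_add exp_rel_mult derivation_opF)
qed

text \<open>For rows (a, b) and (c, d) with c nonzero, the factors upper, lower, upper are forced,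
  with entries (a - 1)/c, c and (d - 1)/c. If c = 0, a left factor \<open>lmat 1\<close> makes this
  entry nonzero.\<close>

lemma SL2_decompose:
  assumes "det (A :: mat2) = 1"
  shows "\<exists>t a b c. A = lmat t ** (umat a ** (lmat b ** umat c))"
proof -
  have d: "A $ 1 $ 1 * A $ 2 $ 2 - A $ 1 $ 2 * A $ 2 $ 1 = 1" using assms by (simp add: det_2)
  have nz: "\<exists>a b c. B = umat a ** (lmat b ** umat c)" if B: "det B = 1" "B $ 2 $ 1 \<noteq> 0" for B :: mat2
  proof -
    have "B $ 1 $ 1 * B $ 2 $ 2 - B $ 1 $ 2 * B $ 2 $ 1 = 1" using B by (simp add: det_2)
    then have "B = umat ((B $ 1 $ 1 - 1) / B $ 2 $ 1) ** (lmat (B $ 2 $ 1) ** umat ((B $ 2 $ 2 - 1) / B $ 2 $ 1))"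
      using B(2) by (intro mat2_eqI) (simp_all add: mat2_mult_entries umat_entries lmat_entries field_simps)
    then show ?thesis by blast
  qed
  show ?thesis
  proof (cases "A $ 2 $ 1 = 0")
    case False
    then obtain a b c where "A = umat a ** (lmat b ** umat c)" using nz assms by blast
    then have "A = lmat 0 ** (umat a ** (lmat b ** umat c))" by (simp add: lmat_0)
    then show ?thesis by blast
  next
    case True
    then have "A $ 1 $ 1 \<noteq> 0" using d by auto
    then have "(lmat 1 ** A) $ 2 $ 1 \<noteq> 0" using True by (simp add: mat2_mult_entries lmat_entries)
    moreover have "det (lmat 1 ** A) = 1" unfolding det_mul assms by simp
    ultimately obtain a b c where abc: "lmat 1 ** A = umat a ** (lmat b ** umat c)" using nz by blast
    have "A = (lmat (-1) ** lmat 1) ** A" by (simp add: lmat_add lmat_0)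
    also have "\<dots> = lmat (-1) ** (umat a ** (lmat b ** umat c))" by (simp only: abc flip: matrix_mul_assoc)
    finally show ?thesis by blast
  qed
qed

abbreviation SL2_pow :: "nat \<Rightarrow> (nat \<Rightarrow> mat2) set" where
  "SL2_pow r \<equiv> PiE {1..r} (\<lambda>_. {A. det A = 1})"

lemma at_vertex_mult: "(\<lambda>j\<in>{1..r}. at_vertex r i A j ** at_vertex r i B j) = at_vertex r i (A ** B)"
  by (auto simp: at_vertex_def)

lemma at_vertex_SL2: "det A = 1 \<Longrightarrow> at_vertex r i A \<in> SL2_pow r"
  by (auto simp: at_vertex_def)

lemma SL2_pow_induct [consumes 1, case_names umat lmat mult]:
  assumes h: "h \<in> SL2_pow r"
    and u: "\<And>i t. i \<in> {1..r} \<Longrightarrow> P (at_vertex r i (umat t))"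
    and l: "\<And>i t. i \<in> {1..r} \<Longrightarrow> P (at_vertex r i (lmat t))"
    and m: "\<And>g h. g \<in> SL2_pow r \<Longrightarrow> h \<in> SL2_pow r \<Longrightarrow> P g \<Longrightarrow> P h \<Longrightarrow> P (\<lambda>i\<in>{1..r}. g i ** h i)"
    and r: "r \<ge> 1"
  shows "P h"
proof -
  have v: "P (at_vertex r i A)" if i: "i \<in> {1..r}" and A: "det A = 1" for i A
  proof -
    obtain t a b c where "A = lmat t ** (umat a ** (lmat b ** umat c))" using SL2_decompose[OF A] by blast
    moreover have "P (at_vertex r i (A ** B))"
      if "P (at_vertex r i A)" "P (at_vertex r i B)" "det A = 1" "det B = 1" for A B
      using m[OF at_vertex_SL2[OF that(3), of r i] at_vertex_SL2[OF that(4), of r i] that(1,2)]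
      unfolding at_vertex_mult .
    ultimately have "P (at_vertex r i A)"
      using u[OF i] l[OF i] det_mul[of "lmat b" "umat c"] det_mul[of "umat a" "lmat b ** umat c"] by simp
    then show ?thesis .
  qed
  \<comment> \<open>The components up to k; passing from k to k + 1 multiplies by an element
    supported at one vertex.\<close>
  define tr where "tr k = (\<lambda>i\<in>{1..r}. if i \<le> k then h i else mat 1)" for k :: nat
  have trin: "tr k \<in> SL2_pow r" for k using h by (auto simp: tr_def PiE_iff)
  have "P (tr k)" if "k \<le> r" for k
    using that
  proof (induction k)
    case 0
    \<comment> \<open>The identity is the unipotent element of parameter 0, placed at vertex
      1.\<close>
    have "tr 0 = at_vertex r 1 (umat 0)" by (auto simp: tr_def at_vertex_def umat_0)
    then show ?case using u[of 1 0] r by simp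
  next
    case (Suc k)
    have k: "Suc k \<in> {1..r}" using Suc.prems by simp
    have d: "det (h (Suc k)) = 1" using h k by (auto simp: PiE_iff)
    have "tr (Suc k) = (\<lambda>i\<in>{1..r}. tr k i ** at_vertex r (Suc k) (h (Suc k)) i)"
      by (auto simp: tr_def at_vertex_def le_Suc_eq)
    moreover have "P \<dots>"
      by (intro m trin at_vertex_SL2 d v k) (use Suc in auto)
    ultimately show ?case by (simp only:)
  qed
  from this[of r] have "P (tr r)" by simp
  moreover have "tr r = h" using h by (auto simp: tr_def PiE_iff extensional_def)
  ultimately show ?thesis by simp
qed

section \<open>Symmetric powers\<close>

lemma sum_linear_mult_homogeneous:
  fixes q :: "complex poly"
  assumes "degree q \<le> n"
  shows "(\<Sum>i\<le>Suc n. coeff ([:a, b:] * q) i * (X ^ (Suc n - i) * Y ^ i)) =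
    (a * X + b * Y) * (\<Sum>i\<le>n. coeff q i * (X ^ (n - i) * Y ^ i))"
proof -
  have top: "coeff q (Suc n) = 0" using assms by (intro coeff_eq_0) auto
  have "(\<Sum>i\<le>Suc n. coeff ([:a, b:] * q) i * (X ^ (Suc n - i) * Y ^ i)) =
      (\<Sum>i\<le>Suc n. a * coeff q i * (X ^ (Suc n - i) * Y ^ i)) +
      (\<Sum>i\<le>Suc n. (case i of 0 \<Rightarrow> 0 | Suc j \<Rightarrow> b * coeff q j) * (X ^ (Suc n - i) * Y ^ i))"
    unfolding sum.distrib[symmetric]
    by (intro sum.cong refl) (simp add: coeff_pCons distrib_right split: nat.split)
  also have "(\<Sum>i\<le>Suc n. a * coeff q i * (X ^ (Suc n - i) * Y ^ i)) =
      a * X * (\<Sum>i\<le>n. coeff q i * (X ^ (n - i) * Y ^ i))"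
    using top by (simp add: sum_distrib_left) (intro sum.cong refl, simp add: Suc_diff_le)
  also have "(\<Sum>i\<le>Suc n. (case i of 0 \<Rightarrow> 0 | Suc j \<Rightarrow> b * coeff q j) * (X ^ (Suc n - i) * Y ^ i)) =
      b * Y * (\<Sum>i\<le>n. coeff q i * (X ^ (n - i) * Y ^ i))"
    unfolding sum_distrib_left by (subst sum.atMost_Suc_shift) (simp add: mult_ac)
  finally show ?thesis by (simp add: distrib_right)
qed

lemma degree_linear_powers: "degree ([:a, b:] ^ m * [:c, d:] ^ n) \<le> m + (n :: nat)" for a b c d :: complex
proof -
  have l: "degree ([:a, b:] ^ m) \<le> m" for a b :: complex and m
    by (rule order_trans[OF degree_power_le]) (auto intro: order_trans[OF mult_le_mono1[of _ 1]])
  show ?thesis by (rule order_trans[OF degree_mult_le]) (intro add_mono l)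
qed

text \<open>Homogenization of the polynomials in t that define \<open>sym_power_entry\<close>. Two
  variables X and Y are kept because a product of matrices arises by substituting linear forms for
  both.\<close>

lemma sum_linear_powers_homogeneous:
  "(\<Sum>i\<le>m + n. coeff ([:a, b:] ^ m * [:c, d:] ^ n) i * (X ^ (m + n - i) * Y ^ i)) =
    (a * X + b * Y) ^ m * (c * X + d * Y) ^ n" for a b c d X Y :: complex
proof (induction m)
  case 0
  show ?case
  proof (induction n)
    case (Suc n)
    then show ?case
      using sum_linear_mult_homogeneous[of "[:c, d:] ^ n" n c d X Y] degree_linear_powers[of a b 0 c d n] by simp
  qed simp
next
  case (Suc m)
  then show ?case
    by (simp only: add_Suc power_Suc mult.assoc sum_linear_mult_homogeneous[OF degree_linear_powers])
qed

lemma sum_sym_power_entry: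
  assumes "b \<le> k"
  shows "(\<Sum>a\<le>k. sym_power_entry k A a b * (X ^ (k - a) * Y ^ a)) =
    (A $ 1 $ 1 * X + A $ 2 $ 1 * Y) ^ (k - b) * (A $ 1 $ 2 * X + A $ 2 $ 2 * Y) ^ b"
  using sum_linear_powers_homogeneous[where m = "k - b" and n = b and a = "A $ 1 $ 1" and b = "A $ 2 $ 1"
      and c = "A $ 1 $ 2" and d = "A $ 2 $ 2" and X = X and Y = Y] assms
  by (simp add: sym_power_entry_def)

text \<open>Columns are compared through their generating functions: the one of B, evaluated at the
  images of the two basis vectors under A, is the one of the product. Both sides are polynomials in
  t, whose coefficients then agree.\<close>

lemma sym_power_entry_mult:
  assumes "a \<le> k" "c \<le> k"
  shows "sym_power_entry k (A ** B) a c = (\<Sum>b\<le>k. sym_power_entry k A a b * sym_power_entry k B b c)"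
proof -
  have "(\<Sum>a\<le>k. sym_power_entry k (A ** B) a c * t ^ a) =
      (\<Sum>a\<le>k. (\<Sum>b\<le>k. sym_power_entry k A a b * sym_power_entry k B b c) * t ^ a)" for t
  proof -
    let ?X = "A $ 1 $ 1 + A $ 2 $ 1 * t" and ?Y = "A $ 1 $ 2 + A $ 2 $ 2 * t"
    have "(\<Sum>a\<le>k. (\<Sum>b\<le>k. sym_power_entry k A a b * sym_power_entry k B b c) * t ^ a) =
        (\<Sum>b\<le>k. sym_power_entry k B b c * (\<Sum>a\<le>k. sym_power_entry k A a b * t ^ a))"
      unfolding sum_distrib_left sum_distrib_right by (subst sum.swap) (simp add: mult_ac)
    also have "\<dots> = (\<Sum>b\<le>k. sym_power_entry k B b c * (?X ^ (k - b) * ?Y ^ b))"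
      by (intro sum.cong refl) (use sum_sym_power_entry[of _ k A 1 t] in simp)
    also have "\<dots> = (B $ 1 $ 1 * ?X + B $ 2 $ 1 * ?Y) ^ (k - c) * (B $ 1 $ 2 * ?X + B $ 2 $ 2 * ?Y) ^ c"
      by (rule sum_sym_power_entry[OF assms(2)])
    also have "\<dots> = (\<Sum>a\<le>k. sym_power_entry k (A ** B) a c * t ^ a)"
      using sum_sym_power_entry[OF assms(2), of "A ** B" 1 t] by (simp add: mat2_mult_entries algebra_simps)
    finally show ?thesis by simp
  qed
  then have "\<forall>t. (\<Sum>a\<le>k. sym_power_entry k (A ** B) a c * t ^ a) =
      (\<Sum>a\<le>k. (\<Sum>b\<le>k. sym_power_entry k A a b * sym_power_entry k B b c) * t ^ a)"
    by (rule allI)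
  then show ?thesis using assms(1) unfolding polyfun_eq_coeffs by simp
qed

lemma sym_power_entry_umat:
  "b \<le> k \<Longrightarrow> sym_power_entry k (umat t) a b = (if a \<le> b then of_nat (b choose a) * t ^ (b - a) else 0)"
proof -
  have "[:1, 0:] ^ n = (1 :: complex poly)" for n by (simp flip: one_pCons)
  then show ?thesis
    using coeff_linear_poly_power[of a b t 1] coeff_eq_0[of "[:t, 1:] ^ b" a] degree_linear_powers[of 0 0 0 t 1 b]
    by (auto simp: sym_power_entry_def umat_entries)
qed

lemma coeff_mult_x_power: "coeff (p * [:0, 1:] ^ b) a = (if b \<le> a then coeff p (a - b) else (0::complex))"
proof -
  have "[:0, 1:] ^ b = monom (1::complex) b" by (simp add: monom_altdef)
  then show ?thesis by (simp add: coeff_monom_mult mult.commute[of p])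
qed

lemma sym_power_entry_lmat:
  "b \<le> k \<Longrightarrow> a \<le> k \<Longrightarrow> sym_power_entry k (lmat t) a b =
     (if b \<le> a then of_nat ((k - b) choose (a - b)) * t ^ (a - b) else 0)"
  using coeff_linear_poly_power[of "a - b" "k - b" 1 t]
  by (simp add: sym_power_entry_def lmat_entries coeff_mult_x_power)

lemma sym_power_entry_one: "b \<le> k \<Longrightarrow> a \<le> k \<Longrightarrow> sym_power_entry k (mat 1) a b = (if a = b then 1 else 0)"
  using sym_power_entry_umat[of b k 0 a] by (auto simp: umat_0)

section \<open>The action of SL_2^r on the outer tensor product\<close>

definition F_lin :: "nat \<Rightarrow> (nat \<Rightarrow> nat) \<Rightarrow> (nat \<Rightarrow> mat2) \<Rightarrow> ((nat \<Rightarrow> nat) \<Rightarrow>\<^sub>0 complex) \<Rightarrow> ((nat \<Rightarrow> nat) \<Rightarrow>\<^sub>0 complex)" where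
  "F_lin r s h v = (\<Sum>a\<in>F_basis r s. Poly_Mapping.single a
     (\<Sum>b\<in>F_basis r s. (\<Prod>i\<in>{1..r}. sym_power_entry (s i) (h i) (a i) (b i)) * lookup v b))"

lemma F_act_eq: "F_act l r z s (w, h) v = scale (\<Prod>j\<in>{1..l}. w j powi z j) (F_lin r s h v)"
  unfolding F_act_def F_lin_def case_prod_conv cvec.scale_sum_right scale_single ..

lemma lookup_F_lin: "lookup (F_lin r s h v) a = (if a \<in> F_basis r s then
    \<Sum>b\<in>F_basis r s. (\<Prod>i\<in>{1..r}. sym_power_entry (s i) (h i) (a i) (b i)) * lookup v b else 0)"
  unfolding F_lin_def by (subst lookup_sum_single) (auto simp: F_basis_def finite_PiE)

lemma F_lin_in: "F_lin r s h v \<in> F_space r s"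
  by (auto simp: F_space_def in_keys_iff lookup_F_lin split: if_splits)

lemma F_lin_add: "F_lin r s h (u + v) = F_lin r s h u + F_lin r s h v"
  by (intro poly_mapping_eqI) (simp add: lookup_F_lin lookup_add distrib_left sum.distrib)

lemma F_lin_scale: "F_lin r s h (scale c v) = scale c (F_lin r s h v)"
  by (intro poly_mapping_eqI) (simp add: lookup_F_lin sum_distrib_left mult_ac)

lemma F_lin_0 [simp]: "F_lin r s h 0 = 0"
  by (simp add: F_lin_def)

lemma F_lin_sum: "F_lin r s h (sum f A) = (\<Sum>a\<in>A. F_lin r s h (f a))"
  by (induction A rule: infinite_finite_induct) (auto simp: F_lin_add)

lemma F_space_eq_sum: "x \<in> F_space r s \<Longrightarrow> x = (\<Sum>b\<in>F_basis r s. scale (lookup x b) (Poly_Mapping.single b 1))"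
  using pm_eq_sum_single[of "F_basis r s" x] by (simp add: F_space_def F_basis_def finite_PiE)

lemma subspace_F_space: "cvec.subspace (F_space r s)"
proof -
  have "keys (u + v) \<subseteq> X" if "keys u \<subseteq> X" "keys v \<subseteq> X" for u v :: "(nat \<Rightarrow> nat) \<Rightarrow>\<^sub>0 complex" and X
    using that keys_add[of u v] by blast
  moreover have "keys (scale c u) \<subseteq> keys u" for u :: "(nat \<Rightarrow> nat) \<Rightarrow>\<^sub>0 complex" and c
    by (auto simp: in_keys_iff)
  ultimately show ?thesis unfolding cvec.subspace_def F_space_def by (simp, blast)
qed

text \<open>Multiplicativity of Kronecker products: a product over vertices of sums is expanded into
  a sum over index tuples by \<open>prod_sum_PiE\<close>.\<close>

lemma F_lin_mult: "F_lin r s (\<lambda>i\<in>{1..r}. g i ** h i) v = F_lin r s g (F_lin r s h v)"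
proof (rule poly_mapping_eqI)
  fix a
  let ?S = "\<lambda>h a b. \<Prod>i\<in>{1..r}. sym_power_entry (s i) (h i) (a i) (b i)"
  have mult: "?S (\<lambda>i\<in>{1..r}. g i ** h i) a c = (\<Sum>b\<in>F_basis r s. ?S g a b * ?S h b c)"
    if a: "a \<in> F_basis r s" and c: "c \<in> F_basis r s" for a c
  proof -
    have "?S (\<lambda>i\<in>{1..r}. g i ** h i) a c =
        (\<Prod>i\<in>{1..r}. \<Sum>b\<in>{0..s i}. sym_power_entry (s i) (g i) (a i) b * sym_power_entry (s i) (h i) b (c i))"
      using F_basisD[OF a] F_basisD[OF c]
      by (intro prod.cong refl) (simp add: sym_power_entry_mult atLeast0AtMost)
    also have "\<dots> = (\<Sum>b\<in>F_basis r s. \<Prod>i\<in>{1..r}. sym_power_entry (s i) (g i) (a i) (b i) * sym_power_entry (s i) (h i) (b i) (c i))"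
      unfolding F_basis_def by (rule prod_sum_PiE) auto
    finally show ?thesis by (simp only: prod.distrib)
  qed
  show "lookup (F_lin r s (\<lambda>i\<in>{1..r}. g i ** h i) v) a = lookup (F_lin r s g (F_lin r s h v)) a"
  proof (cases "a \<in> F_basis r s")
    case True
    have "lookup (F_lin r s (\<lambda>i\<in>{1..r}. g i ** h i) v) a =
        (\<Sum>c\<in>F_basis r s. (\<Sum>b\<in>F_basis r s. ?S g a b * ?S h b c) * lookup v c)"
      using True unfolding lookup_F_lin by (simp only: if_True mult[OF True] cong: sum.cong)
    also have "\<dots> = (\<Sum>b\<in>F_basis r s. ?S g a b * (\<Sum>c\<in>F_basis r s. ?S h b c * lookup v c))"
      unfolding sum_distrib_left sum_distrib_right by (subst sum.swap) (simp only: mult.assoc)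
    also have "\<dots> = lookup (F_lin r s g (F_lin r s h v)) a"
      using True unfolding lookup_F_lin by (simp only: if_True cong: sum.cong)
    finally show ?thesis .
  qed (simp add: lookup_F_lin)
qed

text \<open>At all other vertices the matrix is the identity, so only the index at i can
  change.\<close>

lemma F_lin_at_vertex:
  assumes i: "i \<in> {1..r}" and b: "b \<in> F_basis r s"
  shows "F_lin r s (at_vertex r i A) (Poly_Mapping.single b 1) =
    (\<Sum>k\<le>s i. scale (sym_power_entry (s i) A k (b i)) (Poly_Mapping.single (b(i := k)) 1))"
proof -
  let ?S = "\<lambda>a. \<Prod>j\<in>{1..r}. sym_power_entry (s j) (at_vertex r i A j) (a j) (b j)"
  have fin: "finite (F_basis r s)" by (simp add: F_basis_def finite_PiE)
  have S: "?S a = (if a = b(i := a i) then sym_power_entry (s i) A (a i) (b i) else 0)" if a: "a \<in> F_basis r s" for a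
  proof -
    have "?S a = (\<Prod>j\<in>{1..r}. if j = i then sym_power_entry (s i) A (a i) (b i) else if a j = b j then 1 else 0)"
      using F_basisD[OF a] F_basisD[OF b] by (intro prod.cong refl) (auto simp: at_vertex_def sym_power_entry_one)
    also have "\<dots> = sym_power_entry (s i) A (a i) (b i) * (\<Prod>j\<in>{1..r} - {i}. if a j = b j then 1 else 0)"
      using i by (subst prod.remove[of _ i]) (auto intro!: arg_cong2[where f = "(*)"] prod.cong)
    also have "(\<Prod>j\<in>{1..r} - {i}. if a j = b j then 1 else 0) = (if a = b(i := a i) then 1 else (0::complex))"
    proof (cases "\<forall>j\<in>{1..r} - {i}. a j = b j")
      case True
      have "a j = (b(i := a i)) j" for j
      proof (cases "j \<in> {1..r}")
        case True
        then show ?thesis using \<open>\<forall>j\<in>{1..r} - {i}. a j = b j\<close> by auto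
      next
        case False
        then have "j \<noteq> i" "a j = undefined" "b j = undefined"
          using i a b by (auto simp: F_basis_def PiE_iff extensional_def)
        then show ?thesis by simp
      qed
      then have "a = b(i := a i)" by (rule ext)
      then show ?thesis using True by simp
    next
      case False
      then obtain j where j: "j \<in> {1..r} - {i}" "a j \<noteq> b j" by blast
      then have "a \<noteq> b(i := a i)" by (metis DiffD2 fun_upd_other insertI1)
      moreover have "(\<Prod>j\<in>{1..r} - {i}. if a j = b j then 1 else 0) = (0::complex)"
        using j by (intro prod_zero) auto
      ultimately show ?thesis by simp
    qed
    finally show ?thesis by simp
  qed
  have "F_lin r s (at_vertex r i A) (Poly_Mapping.single b 1) = (\<Sum>a\<in>F_basis r s. Poly_Mapping.single a (?S a))"
    unfolding F_lin_def using b fin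
    by (intro sum.cong refl) (simp add: lookup_single when_def if_distrib[of "(*) _"] sum.delta cong: if_cong)
  also have "\<dots> = (\<Sum>a\<in>(\<lambda>k. b(i := k)) ` {..s i}. Poly_Mapping.single a (?S a))"
  proof (rule sum.mono_neutral_right[OF fin])
    show "(\<lambda>k. b(i := k)) ` {..s i} \<subseteq> F_basis r s" using F_basis_upd[OF b i] by auto
    show "\<forall>a\<in>F_basis r s - (\<lambda>k. b(i := k)) ` {..s i}. Poly_Mapping.single a (?S a) = 0"
    proof
      fix a assume a: "a \<in> F_basis r s - (\<lambda>k. b(i := k)) ` {..s i}"
      then have ne: "a \<noteq> b(i := a i)" using F_basisD[of a r s i] i by auto
      have "?S a = (if a = b(i := a i) then sym_power_entry (s i) A (a i) (b i) else 0)"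
        using a by (intro S) blast
      then show "Poly_Mapping.single a (?S a) = 0" unfolding if_not_P[OF ne] by (simp only: single_zero)
    qed
  qed
  also have "\<dots> = (\<Sum>k\<le>s i. Poly_Mapping.single (b(i := k)) (?S (b(i := k))))"
    by (subst sum.reindex) (auto intro!: inj_onI dest: fun_cong[where x = i])
  also have "\<dots> = (\<Sum>k\<le>s i. scale (sym_power_entry (s i) A k (b i)) (Poly_Mapping.single (b(i := k)) 1))"
  proof (intro sum.cong refl)
    fix k assume "k \<in> {..s i}"
    then have "b(i := k) \<in> F_basis r s" by (intro F_basis_upd b i) simp
    from S[OF this] have "?S (b(i := k)) = sym_power_entry (s i) A k (b i)"
      by (simp only: fun_upd_same fun_upd_upd if_True simp_thms)
    then show "Poly_Mapping.single (b(i := k)) (?S (b(i := k))) =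
        scale (sym_power_entry (s i) A k (b i)) (Poly_Mapping.single (b(i := k)) 1)"
      by (simp only: scale_single mult_1_right)
  qed
  finally show ?thesis .
qed

section \<open>The embedding of F generated by a highest weight vector\<close>

text \<open>F acts on the s-th symmetric power as the derivation sending e_1 to e_2, so F^b applied
  to e_1^s is s!/(s - b)! times the basis vector with index b. The coefficient inverts this factor
  at every vertex.\<close>

definition emb_coeff :: "nat \<Rightarrow> (nat \<Rightarrow> nat) \<Rightarrow> (nat \<Rightarrow> nat) \<Rightarrow> complex" where
  "emb_coeff r s b = (\<Prod>i\<in>{1..r}. fact (s i - b i) / fact (s i))"

definition emb :: "nat \<Rightarrow> (nat \<Rightarrow> nat) \<Rightarrow> mpoly \<Rightarrow> ((nat \<Rightarrow> nat) \<Rightarrow>\<^sub>0 complex) \<Rightarrow> mpoly" where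
  "emb r s v x = (\<Sum>b\<in>F_basis r s. scale (lookup x b * emb_coeff r s b) (opFs r b v))"

lemma emb_coeff_nonzero: "emb_coeff r s b \<noteq> 0"
  by (simp add: emb_coeff_def)

lemma emb_coeff_upd:
  assumes "i \<in> {1..r}"
  shows "emb_coeff r s (b(i := k)) * fact (s i - b i) = emb_coeff r s b * fact (s i - k)"
proof -
  have "emb_coeff r s (b(i := k)) = fact (s i - k) / fact (s i) * (\<Prod>j\<in>{1..r} - {i}. fact (s j - b j) / fact (s j))" for k
    unfolding emb_coeff_def using assms by (subst prod.remove[of _ i]) (auto intro!: arg_cong2[where f = "(*)"] prod.cong)
  from this[of k] this[of "b i"] show ?thesis by (simp add: fun_upd_triv)
qed

lemma emb_add: "emb r s v (x + y) = emb r s v x + emb r s v y"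
  by (simp add: emb_def lookup_add distrib_right cvec.scale_left_distrib sum.distrib)

lemma emb_scale: "emb r s v (scale c x) = scale c (emb r s v x)"
  by (simp add: emb_def cvec.scale_sum_right mult_ac)

lemma emb_0 [simp]: "emb r s v 0 = 0" by (simp add: emb_def)

lemma emb_sum: "emb r s v (sum f A) = (\<Sum>a\<in>A. emb r s v (f a))"
  by (induction A rule: infinite_finite_induct) (auto simp: emb_add)

lemma emb_single: "b \<in> F_basis r s \<Longrightarrow> emb r s v (Poly_Mapping.single b 1) = scale (emb_coeff r s b) (opFs r b v)"
proof -
  assume b: "b \<in> F_basis r s"
  have fin: "finite (F_basis r s)" by (simp add: F_basis_def finite_PiE)
  have "emb r s v (Poly_Mapping.single b 1) =
      (\<Sum>c\<in>F_basis r s. if c = b then scale (emb_coeff r s b) (opFs r b v) else 0)"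
    unfolding emb_def by (intro sum.cong refl) (auto simp: lookup_single when_def)
  then show ?thesis using fin b by (simp add: sum.delta)
qed

context
  fixes r s v assumes r: "r \<ge> (2::nat)" and hwv: "hwv r s v"
begin

abbreviation "uvec b \<equiv> scale (emb_coeff r s b) (opFs r b v)"

text \<open>With the normalization by \<open>emb_coeff\<close>, E_i and F_i have the coefficients
  b_i and s_i - b_i that they have on the monomial basis of the symmetric power.\<close>

lemma opE_uvec:
  assumes i: "i \<in> {1..r}" and b: "b i \<le> s i"
  shows "opE r i (uvec b) = scale (of_nat (b i)) (uvec (b(i := b i - 1)))"
proof (cases "b i")
  case 0
  then show ?thesis unfolding opE_simps opE_opFs[OF r hwv i] by simp
next
  case (Suc k)
  have "emb_coeff r s (b(i := k)) * fact (s i - b i) = emb_coeff r s b * fact (s i - k)"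
    by (rule emb_coeff_upd[OF i])
  moreover have "(fact (s i - k) :: complex) = (of_nat (s i) - of_nat (b i) + 1) * fact (s i - b i)"
  proof -
    have "s i - k = Suc (s i - b i)" using Suc b by auto
    then show ?thesis using b by (simp add: of_nat_diff)
  qed
  ultimately have "emb_coeff r s (b(i := k)) = emb_coeff r s b * (of_nat (s i) - of_nat (b i) + 1)"
    by simp
  then show ?thesis
    unfolding opE_simps opE_opFs[OF r hwv i] cvec.scale_scale using Suc by (simp add: mult_ac)
qed

lemma opF_uvec:
  assumes i: "i \<in> {1..r}" and b: "b i \<le> s i"
  shows "opF r i (uvec b) = scale (of_nat (s i - b i)) (uvec (b(i := Suc (b i))))"
proof (cases "b i = s i")
  case True
  then show ?thesis unfolding opF_simps opF_opFs[OF r hwv i]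
    using opFs_eq_0[OF r hwv i, of "b(i := Suc (b i))"] by simp
next
  case False
  have "emb_coeff r s (b(i := Suc (b i))) * fact (s i - b i) = emb_coeff r s b * fact (s i - Suc (b i))"
    by (rule emb_coeff_upd[OF i])
  moreover have "(fact (s i - b i) :: complex) = of_nat (s i - b i) * fact (s i - Suc (b i))"
  proof -
    have "s i - b i = Suc (s i - Suc (b i))" using False b by auto
    then show ?thesis by (metis fact_Suc)
  qed
  ultimately have "emb_coeff r s b = of_nat (s i - b i) * emb_coeff r s (b(i := Suc (b i)))"
    by (simp add: mult_ac)
  then show ?thesis unfolding opF_simps opF_opFs[OF r hwv i] cvec.scale_scale by simp
qed

lemma opE_pow_uvec:
  assumes i: "i \<in> {1..r}" and b: "b i \<le> s i"
  shows "(opE r i ^^ j) (uvec b) =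
    (if j \<le> b i then scale (fact j * of_nat (b i choose j)) (uvec (b(i := b i - j))) else 0)"
proof (induction j)
  case 0
  show ?case by (simp add: fun_upd_triv)
next
  case (Suc j)
  show ?case
  proof (cases "j \<le> b i")
    case True
    have le: "(b(i := b i - j)) i \<le> s i" using b by simp
    have "(opE r i ^^ Suc j) (uvec b) = opE r i (scale (fact j * of_nat (b i choose j)) (uvec (b(i := b i - j))))"
      using Suc True by simp
    also have "\<dots> = scale (fact j * of_nat (b i choose j)) (opE r i (uvec (b(i := b i - j))))"
      by (rule opE_simps(2))
    also have "opE r i (uvec (b(i := b i - j))) = scale (of_nat (b i - j)) (uvec (b(i := b i - Suc j)))"
      using opE_uvec[where b = "b(i := b i - j)", OF i le] by simp
    also have "scale (fact j * of_nat (b i choose j)) \<dots> = scale (fact j * of_nat (b i choose j) * of_nat (b i - j)) (uvec (b(i := b i - Suc j)))"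
      by (rule cvec.scale_scale)
    finally have "(opE r i ^^ Suc j) (uvec b) = \<dots>" .
    moreover have "fact j * of_nat (b i choose j) * of_nat (b i - j) =
        (fact (Suc j) * of_nat (b i choose Suc j) :: complex)"
    proof -
      have "(b i choose j) * (b i - j) = Suc j * (b i choose Suc j)"
        using binomial_absorb_comp[of "b i" j] binomial_absorption[of j "b i"] by (metis mult.commute binomial_absorption)
      from arg_cong[OF this, of "of_nat :: nat \<Rightarrow> complex"] show ?thesis
        unfolding of_nat_mult fact_Suc mult.assoc by (simp only: mult.left_commute)
    qed
    ultimately show ?thesis by (cases "Suc j \<le> b i") (auto simp: not_less_eq_eq binomial_eq_0)
  next
    case False
    then show ?thesis using Suc by (simp add: opE_simps)
  qed
qed

lemma opF_pow_uvec:
  assumes i: "i \<in> {1..r}" and b: "b i \<le> s i"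
  shows "(opF r i ^^ j) (uvec b) =
    (if j \<le> s i - b i then scale (fact j * of_nat ((s i - b i) choose j)) (uvec (b(i := b i + j))) else 0)"
proof (induction j)
  case 0
  show ?case by (simp add: fun_upd_triv)
next
  case (Suc j)
  show ?case
  proof (cases "j \<le> s i - b i")
    case True
    have le: "(b(i := b i + j)) i \<le> s i" using b True by simp
    have "(opF r i ^^ Suc j) (uvec b) = opF r i (scale (fact j * of_nat ((s i - b i) choose j)) (uvec (b(i := b i + j))))"
      using Suc True by simp
    also have "\<dots> = scale (fact j * of_nat ((s i - b i) choose j)) (opF r i (uvec (b(i := b i + j))))"
      by (rule opF_simps(2))
    also have "opF r i (uvec (b(i := b i + j))) = scale (of_nat (s i - b i - j)) (uvec (b(i := b i + Suc j)))"
      using opF_uvec[where b = "b(i := b i + j)", OF i le] by simp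
    also have "scale (fact j * of_nat ((s i - b i) choose j)) \<dots> = scale (fact j * of_nat ((s i - b i) choose j) * of_nat (s i - b i - j)) (uvec (b(i := b i + Suc j)))"
      by (rule cvec.scale_scale)
    finally have "(opF r i ^^ Suc j) (uvec b) = \<dots>" .
    moreover have "fact j * of_nat ((s i - b i) choose j) * of_nat (s i - b i - j) =
        (fact (Suc j) * of_nat ((s i - b i) choose Suc j) :: complex)"
    proof -
      have "((s i - b i) choose j) * (s i - b i - j) = Suc j * ((s i - b i) choose Suc j)"
        by (metis mult.commute binomial_absorption binomial_absorb_comp)
      from arg_cong[OF this, of "of_nat :: nat \<Rightarrow> complex"] show ?thesis
        unfolding of_nat_mult fact_Suc mult.assoc by (simp only: mult.left_commute)
    qed
    ultimately show ?thesis by (cases "Suc j \<le> s i - b i") (auto simp: not_less_eq_eq binomial_eq_0)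
  next
    case False
    then show ?thesis using Suc by (simp add: opF_simps)
  qed
qed

context
  assumes v: "v \<in> CV r"
begin

lemma opF_CV: "i \<in> {1..r} \<Longrightarrow> f \<in> CV r \<Longrightarrow> opF r i f \<in> CV r"
  and opE_CV: "i \<in> {1..r} \<Longrightarrow> f \<in> CV r \<Longrightarrow> opE r i f \<in> CV r"
  by (simp_all add: CV_iff_euler euler_opF[OF r] euler_opE[OF r] opE_simps opF_simps del: atLeastAtMost_iff)

lemma subspace_CV: "cvec.subspace (CV r)"
  by (auto simp: cvec.subspace_def CV_iff_euler euler_simps)

lemma opFs_CV: "opFs r b v \<in> CV r"
  by (rule opF_mult_in[OF opF_CV v]) auto

lemma emb_CV: "emb r s v x \<in> CV r"
  unfolding emb_def by (intro cvec.subspace_sum cvec.subspace_scale subspace_CV opFs_CV)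

text \<open>The exponential series of E_i reproduces the binomial expansion of (t e_1 + e_2)^b,
  which times e_1^(s - b) is the image of the b-th basis vector under \<open>umat t\<close>.\<close>

lemma emb_umat:
  assumes i: "i \<in> {1..r}" and b: "b \<in> F_basis r s"
  shows "poly_act r (at_vertex r i (umat t)) (uvec b) = emb r s v (F_lin r s (at_vertex r i (umat t)) (Poly_Mapping.single b 1))"
proof -
  have bi: "b i \<le> s i" by (rule F_basisD[OF b i])
  have "uvec b \<in> CV r" by (intro cvec.subspace_scale subspace_CV opFs_CV)
  from exp_rel_sum[OF exp_at_vertex(1)[OF r i this], where M = "Suc (b i)"]
  have "poly_act r (at_vertex r i (umat t)) (uvec b) =
      (\<Sum>k\<le>b i. scale (t ^ k / fact k) ((opE r i ^^ k) (uvec b)))"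
    unfolding opE_pow_uvec[where b = b, OF i bi] by (simp add: lessThan_Suc_atMost)
  also have "\<dots> = (\<Sum>k\<le>b i. scale (of_nat (b i choose k) * t ^ k) (uvec (b(i := b i - k))))"
    by (intro sum.cong refl) (simp add: opE_pow_uvec[where b = b, OF i bi] mult_ac)
  also have "\<dots> = (\<Sum>k\<le>b i. scale (of_nat (b i choose k) * t ^ (b i - k)) (uvec (b(i := k))))"
    by (rule sum.reindex_bij_witness[where i = "\<lambda>k. b i - k" and j = "\<lambda>k. b i - k"])
      (auto simp: binomial_symmetric[symmetric])
  also have "\<dots> = (\<Sum>k\<le>s i. scale (sym_power_entry (s i) (umat t) k (b i)) (uvec (b(i := k))))"
    unfolding sym_power_entry_umat[OF bi] by (rule sum.mono_neutral_cong_left) (use bi in auto)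
  also have "\<dots> = emb r s v (F_lin r s (at_vertex r i (umat t)) (Poly_Mapping.single b 1))"
    unfolding F_lin_at_vertex[OF i b] emb_sum emb_scale
    by (intro sum.cong refl arg_cong[where f = "scale _"] emb_single[symmetric] F_basis_upd b i) simp
  finally show ?thesis .
qed

text \<open>The counterpart for F_i, with the expansion of (e_1 + t e_2)^(s - b).\<close>

lemma emb_lmat:
  assumes i: "i \<in> {1..r}" and b: "b \<in> F_basis r s"
  shows "poly_act r (at_vertex r i (lmat t)) (uvec b) = emb r s v (F_lin r s (at_vertex r i (lmat t)) (Poly_Mapping.single b 1))"
proof -
  have bi: "b i \<le> s i" by (rule F_basisD[OF b i])
  have "uvec b \<in> CV r" by (intro cvec.subspace_scale subspace_CV opFs_CV)
  from exp_rel_sum[OF exp_at_vertex(2)[OF r i this], where M = "Suc (s i - b i)"]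
  have "poly_act r (at_vertex r i (lmat t)) (uvec b) =
      (\<Sum>k\<le>s i - b i. scale (t ^ k / fact k) ((opF r i ^^ k) (uvec b)))"
    unfolding opF_pow_uvec[where b = b, OF i bi] by (simp add: lessThan_Suc_atMost)
  also have "\<dots> = (\<Sum>k\<le>s i - b i. scale (of_nat ((s i - b i) choose k) * t ^ k) (uvec (b(i := b i + k))))"
    by (intro sum.cong refl) (simp add: opF_pow_uvec[where b = b, OF i bi] mult_ac)
  also have "\<dots> = (\<Sum>k\<in>{b i..s i}. scale (of_nat ((s i - b i) choose (k - b i)) * t ^ (k - b i)) (uvec (b(i := k))))"
    by (rule sum.reindex_bij_witness[where i = "\<lambda>k. k - b i" and j = "\<lambda>k. b i + k"]) (use bi in auto)
  also have "\<dots> = (\<Sum>k\<le>s i. scale (sym_power_entry (s i) (lmat t) k (b i)) (uvec (b(i := k))))"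
    by (rule sum.mono_neutral_cong_left) (use bi in \<open>auto simp: sym_power_entry_lmat\<close>)
  also have "\<dots> = emb r s v (F_lin r s (at_vertex r i (lmat t)) (Poly_Mapping.single b 1))"
    unfolding F_lin_at_vertex[OF i b] emb_sum emb_scale
    by (intro sum.cong refl arg_cong[where f = "scale _"] emb_single[symmetric] F_basis_upd b i) simp
  finally show ?thesis .
qed

lemma emb_equivariant_basis:
  assumes "\<And>b. b \<in> F_basis r s \<Longrightarrow> poly_act r g (uvec b) = emb r s v (F_lin r s g (Poly_Mapping.single b 1))"
    and x: "x \<in> F_space r s"
  shows "poly_act r g (emb r s v x) = emb r s v (F_lin r s g x)"
proof -
  have "poly_act r g (emb r s v x) = (\<Sum>b\<in>F_basis r s. scale (lookup x b) (poly_act r g (uvec b)))"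
    unfolding emb_def poly_act_sum cvec.scale_scale[symmetric] poly_act_scale ..
  also have "\<dots> = (\<Sum>b\<in>F_basis r s. scale (lookup x b) (emb r s v (F_lin r s g (Poly_Mapping.single b 1))))"
    by (intro sum.cong refl) (simp only: assms(1))
  also have "\<dots> = emb r s v (F_lin r s g (\<Sum>b\<in>F_basis r s. scale (lookup x b) (Poly_Mapping.single b 1)))"
    unfolding F_lin_sum F_lin_scale emb_sum emb_scale ..
  finally show ?thesis using F_space_eq_sum[OF x] by simp
qed

lemma SL2_pow_invertible: "h \<in> SL2_pow r \<Longrightarrow> i \<in> {1..r} \<Longrightarrow> invertible (h i)"
  by (auto simp: PiE_iff invertible_det_nz)

text \<open>Both actions are multiplicative and the unipotent elements at single vertices generate
  SL_2^r, so \<open>emb_umat\<close> and \<open>emb_lmat\<close> suffice.\<close>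

lemma emb_equivariant:
  assumes "h \<in> SL2_pow r" "x \<in> F_space r s"
  shows "poly_act r h (emb r s v x) = emb r s v (F_lin r s h x)"
proof -
  have "\<forall>x\<in>F_space r s. poly_act r h (emb r s v x) = emb r s v (F_lin r s h x)"
    using assms(1)
  proof (induction rule: SL2_pow_induct)
    case (umat i t)
    then show ?case using emb_equivariant_basis[OF emb_umat] by blast
  next
    case (lmat i t)
    then show ?case using emb_equivariant_basis[OF emb_lmat] by blast
  next
    case (mult g h)
    show ?case
    proof
      fix x assume x: "x \<in> F_space r s"
      have "poly_act r (\<lambda>i\<in>{1..r}. g i ** h i) (emb r s v x) = poly_act r g (poly_act r h (emb r s v x))"
        by (rule poly_act_mult_group[OF SL2_pow_invertible SL2_pow_invertible emb_CV]) (use mult in auto)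
      also have "\<dots> = emb r s v (F_lin r s (\<lambda>i\<in>{1..r}. g i ** h i) x)"
        using mult(3,4) x F_lin_in unfolding F_lin_mult by simp
      finally show "poly_act r (\<lambda>i\<in>{1..r}. g i ** h i) (emb r s v x) = emb r s v (F_lin r s (\<lambda>i\<in>{1..r}. g i ** h i) x)" .
    qed
  qed (use r in auto)
  then show ?thesis using assms(2) by blast
qed

end

end

section \<open>Harmonic polynomials as the kernel of the two generating invariants\<close>

text \<open>Infinitesimal invariance, the same degree N in all factors, and real coefficients; the
  last condition makes \<open>diffop D\<close> adjoint to multiplication by D itself.\<close>

definition inv_poly :: "nat \<Rightarrow> nat \<Rightarrow> mpoly \<Rightarrow> bool" where
  "inv_poly r N D \<longleftrightarrow> (\<forall>i\<in>{1..r}. opE r i D = 0 \<and> opF r i D = 0) \<and>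
     (\<forall>k. euler k D = scale (of_nat (deg_ext r (\<lambda>_. N) k)) D) \<and> cnjp D = D"

lemma inv_poly_tr: "r \<ge> 2 \<Longrightarrow> inv_poly r 1 (tr_poly r)"
  and inv_poly_det: "r \<ge> 2 \<Longrightarrow> inv_poly r 2 (det_poly r)"
  unfolding inv_poly_def by (simp_all add: op_tr_poly op_det_poly euler_tr_poly euler_det_poly del: atLeastAtMost_iff)

lemma diffop_fischer: "cnjp D = D \<Longrightarrow> fischer x (diffop D f) = fischer (D * x) f"
  by (simp add: fischer_mult_left)

text \<open>By duality: since F_i D = 0, multiplication by D commutes with the derivation F_i, and
  the adjoint of this statement is that \<open>diffop D\<close> commutes with E_i; likewise with the
  roles exchanged.\<close>

lemma diffop_commute:
  assumes D: "inv_poly r N D" and i: "i \<in> {1..r}"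
  shows "diffop D (opE r i f) = opE r i (diffop D f)" "diffop D (opF r i f) = opF r i (diffop D f)"
proof -
  have d: "opE r i D = 0" "opF r i D = 0" "cnjp D = D" using D i by (auto simp: inv_poly_def)
  show "diffop D (opE r i f) = opE r i (diffop D f)"
    by (rule fischer_ext)
      (simp add: diffop_fischer[OF d(3)] fischer_opE_right opF_simps d)
  show "diffop D (opF r i f) = opF r i (diffop D f)"
    by (rule fischer_ext)
      (simp add: diffop_fischer[OF d(3)] fischer_opF_right opE_simps d)
qed

lemma keys_diffop:
  assumes "\<gamma> \<in> keys (diffop D f)"
  shows "\<exists>\<beta>\<in>keys D. \<gamma> + \<beta> \<in> keys f"
proof (rule ccontr)
  assume "\<not> ?thesis"
  then have "lookup f (\<gamma> + \<beta>) = 0" if "\<beta> \<in> keys D" for \<beta> using that by (auto simp: in_keys_iff)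
  then have "lookup (diffop D f) \<gamma> = 0"
    unfolding lookup_diffop[OF finite_keys order_refl] by (intro sum.neutral ballI) simp
  then show False using assms by (simp add: in_keys_iff)
qed

lemma diffop_CV:
  assumes f: "f \<in> CV r"
  shows "diffop D f \<in> CV r"
  unfolding CV_iff
proof (intro ballI allI impI)
  fix \<gamma> k assume "\<gamma> \<in> keys (diffop D f)" and k: "k \<notin> {1..r}"
  then obtain \<beta> where "\<gamma> + \<beta> \<in> keys f" using keys_diffop by blast
  then have "mdeg (\<gamma> + \<beta>) k = 0" using f k unfolding CV_iff by blast
  then show "mdeg \<gamma> k = 0" by (simp add: mdeg_add)
qed

lemma exp_rel_intertwine:
  assumes e: "exp_rel t \<delta> f f'" "exp_rel t \<delta> (D f) g'"
    and D: "\<And>f. D (\<delta> f) = \<delta> (D f)" "\<And>f g. D (f + g) = D f + D g" "\<And>c f. D (scale c f) = scale c (D f)"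
  shows "D f' = g'"
proof -
  have 0: "D 0 = 0" using D(3)[of 0 0] by simp
  have s: "D (sum h A) = (\<Sum>a\<in>A. D (h a))" for h and A :: "nat set"
    by (induction A rule: infinite_finite_induct) (auto simp: D 0)
  have p: "D ((\<delta> ^^ k) f) = (\<delta> ^^ k) (D f)" for k
    by (induction k) (auto simp: D(1))
  obtain N where N: "\<And>k. k \<ge> N \<Longrightarrow> (\<delta> ^^ k) f = 0" using e(1) unfolding exp_rel_def by blast
  have N': "(\<delta> ^^ k) (D f) = 0" if "k \<ge> N" for k using N[OF that] p[of k] 0 by simp
  have "f' = (\<Sum>k<N. scale (t ^ k / fact k) ((\<delta> ^^ k) f))"
    using N by (rule exp_rel_sum[OF e(1)])
  moreover have "g' = (\<Sum>k<N. scale (t ^ k / fact k) ((\<delta> ^^ k) (D f)))"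
    using N' by (rule exp_rel_sum[OF e(2)])
  ultimately show ?thesis by (simp only: s D(3) p)
qed

context
  fixes r :: nat assumes r: "r \<ge> 2"
begin

lemma GL2_pow_scalar_SL2:
  assumes "g \<in> carrier (GL2_pow r)"
  shows "\<exists>u h. (\<forall>i\<in>{1..r}. u i \<noteq> 0) \<and> h \<in> SL2_pow r \<and> g = (\<lambda>i\<in>{1..r}. mat (u i) ** h i)"
proof -
  obtain x where x: "x \<in> carrier (K_tilde r r)" "g = phi_GL r x" using assms phi_GL_surj by blast
  obtain u h where uh: "x = (u, h)" by fastforce
  show ?thesis
    by (rule exI[of _ u], rule exI[of _ h])
      (use x in \<open>auto simp: uh K_tilde_def Cstar_def SL2_def phi_GL_def PiE_iff\<close>)
qed

lemma diffop_poly_act_SL2: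
  assumes D: "inv_poly r N D" and h: "h \<in> SL2_pow r" and f: "f \<in> CV r"
  shows "diffop D (poly_act r h f) = poly_act r h (diffop D f)"
proof -
  have "\<forall>f\<in>CV r. diffop D (poly_act r h f) = poly_act r h (diffop D f)"
    using h
  proof (induction rule: SL2_pow_induct)
    case (umat i t)
    show ?case
    proof
      fix f assume f: "f \<in> CV r"
      show "diffop D (poly_act r (at_vertex r i (umat t)) f) = poly_act r (at_vertex r i (umat t)) (diffop D f)"
        by (rule exp_rel_intertwine[where D = "diffop D", OF exp_at_vertex(1)[OF r umat f] exp_at_vertex(1)[OF r umat diffop_CV[OF f]]])
          (simp_all add: diffop_commute[OF D umat] diffop_add diffop_scale)
    qed
  next
    case (lmat i t)
    show ?case
    proof
      fix f assume f: "f \<in> CV r"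
      show "diffop D (poly_act r (at_vertex r i (lmat t)) f) = poly_act r (at_vertex r i (lmat t)) (diffop D f)"
        by (rule exp_rel_intertwine[where D = "diffop D", OF exp_at_vertex(2)[OF r lmat f] exp_at_vertex(2)[OF r lmat diffop_CV[OF f]]])
          (simp_all add: diffop_commute[OF D lmat] diffop_add diffop_scale)
    qed
  next
    case (mult g h)
    show ?case
    proof
      fix f assume f: "f \<in> CV r"
      have m: "poly_act r (\<lambda>i\<in>{1..r}. g i ** h i) f = poly_act r g (poly_act r h f)" if "f \<in> CV r" for f
        by (rule poly_act_mult_group) (use mult(1,2) that in \<open>auto simp: PiE_iff invertible_det_nz\<close>)
      show "diffop D (poly_act r (\<lambda>i\<in>{1..r}. g i ** h i) f) = poly_act r (\<lambda>i\<in>{1..r}. g i ** h i) (diffop D f)"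
        unfolding m[OF f] m[OF diffop_CV[OF f]]
        using mult(3,4) f poly_act_CV[OF f, of h] diffop_CV[OF f] by simp
    qed
  qed (use r in auto)
  then show ?thesis using f by blast
qed

text \<open>For the scalar part the degrees of D matter: equal degrees in all factors give its
  monomials the trivial character, so \<open>diffop D\<close> preserves the character of each
  monomial.\<close>

lemma diffop_poly_act:
  assumes D: "inv_poly r N D" and g: "g \<in> carrier (GL2_pow r)" and f: "f \<in> CV r"
  shows "diffop D (poly_act r g f) = poly_act r g (diffop D f)"
proof -
  obtain u h where u: "\<And>i. i \<in> {1..r} \<Longrightarrow> u i \<noteq> 0" and h: "h \<in> SL2_pow r" and g: "g = (\<lambda>i\<in>{1..r}. mat (u i) ** h i)"
    using GL2_pow_scalar_SL2[OF g] by blast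
  have hi: "invertible (h i)" if "i \<in> {1..r}" for i using h that by (auto simp: PiE_iff invertible_det_nz)
  have sc: "poly_act r g (mon \<alpha>) = scale (mon_char r u \<alpha>) (poly_act r h (mon \<alpha>))" if "mon \<alpha> \<in> CV r" for \<alpha>
    unfolding g by (rule poly_act_scalar_mon[OF r _ _ that]) (rule u hi; assumption)+
  have mon: "diffop D (poly_act r g (mon \<alpha>)) = poly_act r g (diffop D (mon \<alpha>))" if \<alpha>: "mon \<alpha> \<in> CV r" for \<alpha>
  proof -
    let ?q = "diffop D (mon \<alpha>)"
    have key: "mon_char r u \<gamma> = mon_char r u \<alpha> \<and> mon \<gamma> \<in> CV r" if \<gamma>: "\<gamma> \<in> keys ?q" for \<gamma>
    proof
      obtain \<beta> where \<beta>: "\<beta> \<in> keys D" "\<gamma> + \<beta> \<in> keys (mon \<alpha>)" using keys_diffop[OF \<gamma>] by blast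
      then have \<alpha>_eq: "\<alpha> = \<gamma> + \<beta>" by simp
      have "D \<in> CV_graded r (\<lambda>_. N)" using D by (simp add: inv_poly_def CV_graded_iff_euler)
      then have "mdeg \<beta> k = N" if "k \<in> {1..r}" for k
        using \<beta>(1) that by (auto simp: CV_graded_iff deg_ext_def)
      then have "mon_char r u \<beta> = 1"
        unfolding mon_char_def scalar_char_def using prv_in by (intro prod.neutral ballI) simp
      then show "mon_char r u \<gamma> = mon_char r u \<alpha>" 
      proof -
        have "mon_char r u (\<gamma> + \<beta>) = mon_char r u \<gamma> * mon_char r u \<beta>"
          by (rule mon_char_add) (rule u)
        then show ?thesis unfolding \<alpha>_eq using \<open>mon_char r u \<beta> = 1\<close> by simp
      qed
      show "mon \<gamma> \<in> CV r" by (rule mon_CV[OF diffop_CV[OF \<alpha>] \<gamma>])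
    qed
    have "poly_act r g ?q = (\<Sum>\<gamma>\<in>keys ?q. scale (lookup ?q \<gamma>) (poly_act r g (mon \<gamma>)))"
      by (subst pm_eq_sum_scale_mon[of ?q]) (simp only: poly_act_sum poly_act_scale)
    also have "\<dots> = (\<Sum>\<gamma>\<in>keys ?q. scale (mon_char r u \<alpha>) (scale (lookup ?q \<gamma>) (poly_act r h (mon \<gamma>))))"
    proof (intro sum.cong refl)
      fix \<gamma> assume "\<gamma> \<in> keys ?q"
      with key have a: "mon_char r u \<gamma> = mon_char r u \<alpha>" and b: "mon \<gamma> \<in> CV r" by blast+
      show "scale (lookup ?q \<gamma>) (poly_act r g (mon \<gamma>)) = scale (mon_char r u \<alpha>) (scale (lookup ?q \<gamma>) (poly_act r h (mon \<gamma>)))"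
        unfolding sc[OF b] a by (simp only: cvec.scale_scale mult.commute)
    qed
    also have "\<dots> = scale (mon_char r u \<alpha>) (poly_act r h (\<Sum>\<gamma>\<in>keys ?q. scale (lookup ?q \<gamma>) (mon \<gamma>)))"
      by (simp only: poly_act_sum poly_act_scale cvec.scale_sum_right)
    also have "(\<Sum>\<gamma>\<in>keys ?q. scale (lookup ?q \<gamma>) (mon \<gamma>)) = ?q" by (rule pm_eq_sum_scale_mon[symmetric])
    also have "poly_act r h ?q = diffop D (poly_act r h (mon \<alpha>))" by (rule diffop_poly_act_SL2[OF D h \<alpha>, symmetric])
    also have "scale (mon_char r u \<alpha>) \<dots> = diffop D (poly_act r g (mon \<alpha>))" by (simp only: sc[OF \<alpha>] diffop_scale)
    finally show ?thesis by simp
  qed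
  have dsum: "diffop D (sum k A) = (\<Sum>a\<in>A. diffop D (k a))" for k and A :: "(var \<Rightarrow>\<^sub>0 nat) set"
    by (induction A rule: infinite_finite_induct) (auto simp: diffop_add)
  have "diffop D (poly_act r g (\<Sum>\<alpha>\<in>keys f. scale (lookup f \<alpha>) (mon \<alpha>))) =
      poly_act r g (diffop D (\<Sum>\<alpha>\<in>keys f. scale (lookup f \<alpha>) (mon \<alpha>)))"
    unfolding poly_act_sum poly_act_scale dsum diffop_scale
    by (intro sum.cong refl arg_cong[where f = "scale _"] mon mon_CV[OF f])
  then show ?thesis unfolding pm_eq_sum_scale_mon[of f, symmetric] .
qed

lemma submodule_Harm: "submodule r (Harm r \<inter> CV_graded r n)"
  unfolding submodule_def[OF r]
proof (intro conjI ballI)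
  show "cvec.subspace (Harm r \<inter> CV_graded r n)" by (intro cvec.subspace_inter subspace_Harm subspace_CV_graded)
  fix i f assume i: "i \<in> {1..r}" and f: "f \<in> Harm r \<inter> CV_graded r n"
  have "opE r i f \<in> Harm r" "opF r i f \<in> Harm r"
    using f diffop_commute[OF inv_poly_tr[OF r] i] diffop_commute[OF inv_poly_det[OF r] i]
    by (auto simp: Harm_def opE_simps opF_simps)
  moreover have "opE r i f \<in> CV_graded r n" "opF r i f \<in> CV_graded r n"
    using f by (auto simp: CV_graded_iff_euler euler_opE[OF r i] euler_opF[OF r i] opE_simps opF_simps)
  ultimately show "opE r i f \<in> Harm r \<inter> CV_graded r n" "opF r i f \<in> Harm r \<inter> CV_graded r n" by auto
qed

lemma finite_summands: "finite (summands r n)"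
proof -
  have "finite (Lambda_big r n)" for n unfolding Lambda_big_def by (intro finite_PiE) (auto simp: steps_by_2_def)
  moreover have "finite (lambda_small r m)" for m unfolding lambda_small_def by (intro finite_PiE) (auto simp: steps_by_2_def)
  ultimately show ?thesis by (intro finite_SigmaI) (auto simp: boundary_def)
qed

lemma Harm_decomposition_ex:
  "\<exists>v. (\<forall>k\<in>summands r n. v k \<in> Harm r \<inter> CV_graded r n \<and> v k \<noteq> 0 \<and> hwv r (snd k) (v k)) \<and>
    (\<forall>k\<in>summands r n. \<forall>l\<in>summands r n. k \<noteq> l \<longrightarrow> (\<forall>b\<in>F_basis r (snd k). \<forall>c\<in>F_basis r (snd l).
       fischer (opFs r b (v k)) (opFs r c (v l)) = 0)) \<and>
    Harm r \<inter> CV_graded r n \<subseteq> cvec.span (\<Union>k\<in>summands r n. (\<lambda>b. opFs r b (v k)) ` F_basis r (snd k))"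
proof (rule decomposition[OF r finite_summands submodule_Harm, where s = snd])
  show "Harm r \<inter> CV_graded r n \<subseteq> cvec.span (mon ` {\<alpha>. \<forall>k. mdeg \<alpha> k = deg_ext r n k})"
  proof
    fix f assume "f \<in> Harm r \<inter> CV_graded r n"
    then have "\<forall>\<alpha>\<in>keys f. \<forall>k. mdeg \<alpha> k = deg_ext r n k" by (simp add: CV_graded_iff)
    then show "f \<in> cvec.span (mon ` {\<alpha>. \<forall>k. mdeg \<alpha> k = deg_ext r n k})"
      unfolding span_mon_iff by blast
  qed
  show "finite (mon ` {\<alpha>. \<forall>k. mdeg \<alpha> k = deg_ext r n k})" by (rule finite_imageI[OF finite_mdeg])
  show "cvec.dim (Harm r \<inter> CV_graded r n \<inter> wspace r \<mu>) = card (weight_index r (summands r n) snd \<mu>)" for \<mu>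
    using dim_Harm_nw[OF r, of n \<mu>] card_Std[OF r, of n \<mu>] by (simp only: Int_assoc)
qed

lemma Harm_decomposition:
  obtains v where
    "\<And>k. k \<in> summands r n \<Longrightarrow> v k \<in> Harm r \<inter> CV_graded r n \<and> v k \<noteq> 0 \<and> hwv r (snd k) (v k)"
    "\<And>k l b c. k \<in> summands r n \<Longrightarrow> l \<in> summands r n \<Longrightarrow> k \<noteq> l \<Longrightarrow> b \<in> F_basis r (snd k) \<Longrightarrow> c \<in> F_basis r (snd l) \<Longrightarrow>
       fischer (opFs r b (v k)) (opFs r c (v l)) = 0"
    "Harm r \<inter> CV_graded r n \<subseteq> cvec.span (\<Union>k\<in>summands r n. (\<lambda>b. opFs r b (v k)) ` F_basis r (snd k))"
proof -
  note ex = Harm_decomposition_ex[of n]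
  show thesis
    by (rule exE[OF ex], elim conjE, rule that) ((drule bspec, assumption, assumption) | (drule (1) bspec, drule (1) bspec, drule (1) mp, drule (1) bspec, drule (1) bspec, assumption) | assumption)+
qed

text \<open>Every summand in degree (N, ..., N) has some s_i > 0, so each vector of its orbit basis
  is in the image of E_i or F_i. An invariant, being annihilated by both, is orthogonal to these
  images by adjointness.\<close>

lemma no_invariants_in_Harm:
  assumes h: "h \<in> Harm r \<inter> CV_graded r (\<lambda>_. N)" and N: "N \<ge> 1"
    and inv: "\<And>i. i \<in> {1..r} \<Longrightarrow> opE r i h = 0" "\<And>i. i \<in> {1..r} \<Longrightarrow> opF r i h = 0"
  shows "h = 0"
proof -
  obtain v where v: "\<And>k. k \<in> summands r (\<lambda>_. N) \<Longrightarrow> v k \<in> Harm r \<inter> CV_graded r (\<lambda>_. N) \<and> v k \<noteq> 0 \<and> hwv r (snd k) (v k)"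
    and orth: "\<And>k l b c. k \<in> summands r (\<lambda>_. N) \<Longrightarrow> l \<in> summands r (\<lambda>_. N) \<Longrightarrow> k \<noteq> l \<Longrightarrow> b \<in> F_basis r (snd k) \<Longrightarrow>
       c \<in> F_basis r (snd l) \<Longrightarrow> fischer (opFs r b (v k)) (opFs r c (v l)) = 0"
    and span: "Harm r \<inter> CV_graded r (\<lambda>_. N) \<subseteq>
      cvec.span (\<Union>k\<in>summands r (\<lambda>_. N). (\<lambda>b. opFs r b (v k)) ` F_basis r (snd k))"
    by (rule Harm_decomposition[of "\<lambda>_. N"]) (rule that)
  have 0: "fischer (opFs r b (v k)) h = 0" if k: "k \<in> summands r (\<lambda>_. N)" and b: "b \<in> F_basis r (snd k)" for k b
  proof -
    obtain m s where ms: "k = (m, s)" by fastforce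
    have m: "m \<in> boundary r (Lambda_big r (\<lambda>_. N))" and s: "s \<in> boundary r (lambda_small r m)"
      using k by (auto simp: ms)
    have "\<exists>i\<in>{1..r}. s i \<noteq> 0"
    proof (rule ccontr)
      \<comment> \<open>If s = 0, the triangle inequalities make m constant, and the boundary
        condition on s makes it 0; but some m_i equals N.\<close>
      assume "\<not> ?thesis"
      then have s0: "s i = 0" if "i \<in> {1..r}" for i using that by blast
      have eq: "m i = m (prv r i)" if "i \<in> {1..r}" for i
        using s s0[OF that] that unfolding mem_boundary_lambda_small by fastforce
      obtain i0 where i0: "i0 \<in> {1..r}" "m i0 = 0"
        using s s0 unfolding mem_boundary_lambda_small by fastforce
      have all: "m i = m 1" if "i \<in> {1..r}" for i
        using that
      proof (induction i)
        case (Suc i)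
        show ?case
        proof (cases "i = 0")
          case False
          then have "m (Suc i) = m i" using eq[OF Suc.prems] by (simp add: prv_def)
          then show ?thesis using Suc False by auto
        qed simp
      qed simp
      obtain i1 where "i1 \<in> {1..r}" "m i1 = N" using m unfolding mem_boundary_Lambda_big by blast
      then show False using all[of i1] all[OF i0(1)] i0(2) N by simp
    qed
    then obtain i where i: "i \<in> {1..r}" "s i \<noteq> 0" by blast
    have hw: "hwv r s (v k)" using v[OF k] by (simp add: ms)
    show ?thesis
    proof (cases "b i")
      case 0
      \<comment> \<open>The coefficient for b_i = 1 is 1 (s_i - 1 + 1) = s_i, which is nonzero by
        the choice of i.\<close>
      have "opE r i (opFs r (b(i := 1)) (v k)) = scale (of_nat (s i)) (opFs r b (v k))"
        using opE_opFs[OF r hw i(1), of "b(i := 1)"] 0 by (simp add: fun_upd_idem)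
      then have "of_nat (s i) * fischer (opFs r b (v k)) h = fischer (opE r i (opFs r (b(i := 1)) (v k))) h"
        by (simp add: fischer_scale_left)
      also have "\<dots> = 0" by (simp add: fischer_opE inv(2)[OF i(1)])
      finally show ?thesis using i(2) by simp
    next
      case (Suc j)
      have "opFs r b (v k) = opF r i (opFs r (b(i := j)) (v k))"
        using opF_opFs[OF r hw i(1), of "b(i := j)"] Suc by (simp add: fun_upd_idem)
      then show ?thesis by (simp add: fischer_opF inv(1)[OF i(1)])
    qed
  qed
  have "fischer h h = 0"
    by (rule fischer_span_left[OF subsetD[OF span h]]) (use 0 in auto)
  then show ?thesis by (simp add: fischer_self_eq_0)
qed

lemma wspace_0_of_invariant:
  assumes "\<And>i. i \<in> {1..r} \<Longrightarrow> opE r i f = 0" "\<And>i. i \<in> {1..r} \<Longrightarrow> opF r i f = 0"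
  shows "f \<in> wspace r (\<lambda>_. 0)"
  using op_H_of_EF[OF r _ assms] by (auto simp: wspace_def)

text \<open>Membership in the ideal is expressed as orthogonality of all multiples of f to
  \<open>Harm\<close>. The harmonic part f - j of an invariant f turns out to be invariant too,
  whence it vanishes.\<close>

lemma invariant_in_ideal:
  assumes f: "f \<in> CV_graded r (\<lambda>_. N)" and N: "N \<ge> 1"
    and inv: "\<And>i. i \<in> {1..r} \<Longrightarrow> opE r i f = 0" "\<And>i. i \<in> {1..r} \<Longrightarrow> opF r i f = 0"
    and h: "h \<in> Harm r"
  shows "fischer (f * x) h = 0"
proof -
  let ?n = "\<lambda>_::nat. N" and ?\<mu> = "\<lambda>_::nat. 0::int"
  have "keys f \<subseteq> Mon r ?n ?\<mu>"
    unfolding graded_wspace_iff[symmetric] using f wspace_0_of_invariant[OF inv] by (rule IntI)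
  from Jgen_Harm_decomp[OF r this]
  obtain j where j: "j \<in> cvec.span (Jgen r ?n ?\<mu>)" "f - j \<in> Harm r \<inter> (CV_graded r ?n \<inter> wspace r ?\<mu>)" ..
  have jH: "fischer (j * x) h = 0" if "h \<in> Harm r" for h x
    using j(1)
  proof (induction rule: cvec.span_induct_alt)
    case (step c a b)
    have "fischer (a * x) h = 0"
      using step.hyps(1) Harm_fischer[OF that] unfolding Jgen_def[OF r] by (auto simp: mult.assoc)
    then show ?case
      using step by (simp add: distrib_right fischer_add_left fischer_scale_left flip: scale_mult_left)
  qed simp
  have fj: "f - j \<in> Harm r \<inter> CV_graded r ?n" using j(2) by auto
  have "f - j = 0"
  proof (rule no_invariants_in_Harm[OF fj N])
    fix i assume i: "i \<in> {1..r}"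
    have sub: "opE r i y \<in> Harm r \<inter> CV_graded r ?n" "opF r i y \<in> Harm r \<inter> CV_graded r ?n"
      if "y \<in> Harm r \<inter> CV_graded r ?n" for y
      using submodule_Harm that i unfolding submodule_def[OF r] by blast+
    let ?e = "opE r i (f - j)" and ?f = "opF r i (f - j)"
    \<comment> \<open>As E_i f = 0, the squared norm of E_i (f - j) is minus the product of j, which
      lies in the ideal, with the harmonic polynomial F_i E_i (f - j).\<close>
    have "fischer ?e ?e = - fischer (j * 1) (opF r i ?e)"
      by (simp add: opE_simps opF_simps inv(1)[OF i] fischer_opE)
    also have "\<dots> = 0" using jH[of "opF r i ?e" 1] sub(2)[OF sub(1)[OF fj]] by simp
    finally show "?e = 0" by (simp add: fischer_self_eq_0)
    have "fischer ?f ?f = - fischer (j * 1) (opE r i ?f)"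
      by (simp add: opE_simps opF_simps inv(2)[OF i] fischer_opF)
    also have "\<dots> = 0" using jH[of "opE r i ?f" 1] sub(1)[OF sub(2)[OF fj]] by simp
    finally show "?f = 0" by (simp add: fischer_self_eq_0)
  qed
  then show ?thesis using jH[OF h] by simp
qed

text \<open>Group invariance is differentiated algebraically: both sides of the commutation are
  polynomials in t, and their linear coefficients are compared.\<close>

lemma diffop_commute_of_invariant:
  assumes D: "\<And>g f. g \<in> SL2_pow r \<Longrightarrow> f \<in> CV r \<Longrightarrow> diffop D (poly_act r g f) = poly_act r g (diffop D f)"
    and \<delta>: "\<And>t f. f \<in> CV r \<Longrightarrow> exp_rel t \<delta> f (poly_act r (g t) f)" "\<And>t. g t \<in> SL2_pow r"
    and f: "f \<in> CV r"
  shows "diffop D (\<delta> f) = \<delta> (diffop D f)"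
proof -
  obtain N where N: "\<And>k. k \<ge> N \<Longrightarrow> (\<delta> ^^ k) f = 0" using \<delta>(1)[OF f, of 0] unfolding exp_rel_def by blast
  obtain M where M: "\<And>k. k \<ge> M \<Longrightarrow> (\<delta> ^^ k) (diffop D f) = 0"
    using \<delta>(1)[OF diffop_CV[OF f], of 0] unfolding exp_rel_def by blast
  \<comment> \<open>Beyond both orders of nilpotency, and at least 2, so that the coefficient of t
    is among those compared.\<close>
  define L where "L = Suc (Suc (max N M))"
  obtain K where K: "L = Suc K" "1 \<le> K" by (simp add: L_def)
  have dsum: "diffop D (sum h A) = (\<Sum>a\<in>A. diffop D (h a))" for h and A :: "nat set"
    by (induction A rule: infinite_finite_induct) (auto simp: diffop_add)
  have eq: "(\<Sum>k<L. scale (t ^ k / fact k) (diffop D ((\<delta> ^^ k) f))) = (\<Sum>k<L. scale (t ^ k / fact k) ((\<delta> ^^ k) (diffop D f)))" for t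
  proof -
    have N': "(\<delta> ^^ k) f = 0" and M': "(\<delta> ^^ k) (diffop D f) = 0" if "k \<ge> L" for k
      using that N M by (auto simp: L_def)
    have "poly_act r (g t) f = (\<Sum>k<L. scale (t ^ k / fact k) ((\<delta> ^^ k) f))"
      using N' by (rule exp_rel_sum[OF \<delta>(1)[OF f]])
    moreover have "poly_act r (g t) (diffop D f) = (\<Sum>k<L. scale (t ^ k / fact k) ((\<delta> ^^ k) (diffop D f)))"
      using M' by (rule exp_rel_sum[OF \<delta>(1)[OF diffop_CV[OF f]]])
    ultimately show ?thesis using D[OF \<delta>(2) f, of t] by (simp only: dsum diffop_scale)
  qed
  show ?thesis
  proof (rule poly_mapping_eqI)
    fix \<alpha>
    have "(\<Sum>k\<le>K. (lookup (diffop D ((\<delta> ^^ k) f)) \<alpha> / fact k) * t ^ k) =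
        (\<Sum>k\<le>K. (lookup ((\<delta> ^^ k) (diffop D f)) \<alpha> / fact k) * t ^ k)" for t
      using arg_cong[OF eq[of t], of "\<lambda>q. lookup q \<alpha>"]
      by (simp add: lookup_sum K(1) lessThan_Suc_atMost mult_ac)
    then have "\<forall>k\<le>K. lookup (diffop D ((\<delta> ^^ k) f)) \<alpha> / fact k = lookup ((\<delta> ^^ k) (diffop D f)) \<alpha> / fact k"
      using polyfun_eq_coeffs[of "\<lambda>k. lookup (diffop D ((\<delta> ^^ k) f)) \<alpha> / fact k" K
        "\<lambda>k. lookup ((\<delta> ^^ k) (diffop D f)) \<alpha> / fact k"] by blast
    then have "1 \<le> K \<longrightarrow> lookup (diffop D ((\<delta> ^^ 1) f)) \<alpha> / fact 1 = lookup ((\<delta> ^^ 1) (diffop D f)) \<alpha> / fact 1"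
      by (rule spec)
    with K(2) have "lookup (diffop D ((\<delta> ^^ 1) f)) \<alpha> / fact 1 = lookup ((\<delta> ^^ 1) (diffop D f)) \<alpha> / fact 1"
      by (rule rev_mp)
    then show "lookup (diffop D (\<delta> f)) \<alpha> = lookup (\<delta> (diffop D f)) \<alpha>" by simp
  qed
qed

end

lemmas F_space_add = cvec.subspace_add[OF subspace_F_space]
  and F_space_scale = cvec.subspace_scale[OF subspace_F_space]
  and F_space_0 = cvec.subspace_0[OF subspace_F_space]

section \<open>Invariant operators without constant term\<close>

context
  fixes r :: nat assumes r: "r \<ge> 2"
begin

lemma SL2_pow_in_S: "h \<in> SL2_pow r \<Longrightarrow> h \<in> carrier (S_GL2_pow r)"
  by (auto simp: S_GL2_pow_def GL2_pow_def GL2_def PiE_iff invertible_det_nz intro!: prod.neutral)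

lemma inv_poly_CV: "inv_poly r N D \<Longrightarrow> D \<in> CV r"
  by (auto simp: inv_poly_def CV_iff_euler deg_ext_def)

lemma inv_poly_const: "inv_poly r N D \<Longrightarrow> N \<ge> 1 \<Longrightarrow> lookup D 0 = 0"
proof -
  assume D: "inv_poly r N D" "N \<ge> 1"
  have "euler 1 D = scale (of_nat N) D" using D r by (auto simp: inv_poly_def deg_ext_def)
  from arg_cong[OF this, of "\<lambda>q. lookup q 0"] show "lookup D 0 = 0"
    using D(2) by (simp add: lookup_euler mdeg_def)
qed

text \<open>The central torus of \<open>S(GL\<^sub>2\<^sup>r)\<close> forces the monomials of an invariant operator to have the same
  degree in each factor.\<close>

lemma invariant_mon_char:
  assumes D: "\<And>g f. g \<in> carrier (S_GL2_pow r) \<Longrightarrow> f \<in> CV r \<Longrightarrow> diffop D (poly_act r g f) = poly_act r g (diffop D f)"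
    and \<beta>: "\<beta> \<in> keys D" and DCV: "D \<in> CV r"
    and u: "\<And>i. i \<in> {1..r} \<Longrightarrow> u i \<noteq> 0" "(\<Prod>i\<in>{1..r}. (u i)\<^sup>2) = 1"
  shows "mon_char r u \<beta> = 1"
proof -
  let ?g = "\<lambda>i\<in>{1..r}. mat (u i) ** mat 1 :: mat2"
  have inv1: "invertible (mat 1 :: mat2)" by (simp add: invertible_det_nz)
  have g: "?g \<in> carrier (S_GL2_pow r)"
    using u by (auto simp: S_GL2_pow_def GL2_pow_def GL2_def invertible_det_nz det_scalar_mult simp del: matrix_mul_rid)
  have one: "poly_act r (\<lambda>_. mat 1) f = f" if "f \<in> CV r" for f
    using poly_act_cong[of r "\<lambda>_. mat 1" "\<lambda>i\<in>{1..r}. mat 1" f] poly_act_one[OF that] that by simp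
  have act: "poly_act r ?g (mon \<alpha>) = scale (mon_char r u \<alpha>) (mon \<alpha>)" if "mon \<alpha> \<in> CV r" for \<alpha>
    using poly_act_scalar_mon[of r u "\<lambda>_. mat 1" \<alpha>, OF r u(1) inv1 that] one[OF that] by simp
  have \<beta>CV: "mon \<beta> \<in> CV r" by (rule mon_CV[OF DCV \<beta>])
  let ?q = "diffop D (mon \<beta>)"
  \<comment> \<open>The constant term of D applied to the monomial \<beta> isolates the coefficient
    of \<beta>; scalar matrices fix constant terms but multiply the monomial by its
    character.\<close>
  have q0: "lookup ?q 0 = lookup D \<beta> * of_nat (mfact \<beta>)"
  proof -
    have "lookup ?q 0 = (\<Sum>\<gamma>\<in>keys D. if \<gamma> = \<beta> then lookup D \<beta> * of_nat (mfact \<beta>) else 0)"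
      unfolding lookup_diffop[OF finite_keys order_refl]
      by (intro sum.cong refl) (auto simp: lookup_single when_def mfact_def)
    then show ?thesis using \<beta> by (simp add: sum.delta)
  qed
  have "lookup (poly_act r ?g ?q) 0 = lookup ?q 0"
  proof -
    have "poly_act r ?g ?q = (\<Sum>\<gamma>\<in>keys ?q. scale (lookup ?q \<gamma>) (poly_act r ?g (mon \<gamma>)))"
      by (subst pm_eq_sum_scale_mon[of ?q]) (simp only: poly_act_sum poly_act_scale)
    also have "\<dots> = (\<Sum>\<gamma>\<in>keys ?q. Poly_Mapping.single \<gamma> (lookup ?q \<gamma> * mon_char r u \<gamma>))"
    proof (intro sum.cong refl)
      fix \<gamma> assume "\<gamma> \<in> keys ?q"
      then have "mon \<gamma> \<in> CV r" by (rule mon_CV[OF diffop_CV[OF \<beta>CV]])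
      then show "scale (lookup ?q \<gamma>) (poly_act r ?g (mon \<gamma>)) = Poly_Mapping.single \<gamma> (lookup ?q \<gamma> * mon_char r u \<gamma>)"
        by (simp only: act scale_single mult_1_right)
    qed
    also have "lookup \<dots> 0 = lookup ?q 0"
      by (subst lookup_sum_single) (auto simp: in_keys_iff mon_char_def scalar_char_def mdeg_def)
    finally show ?thesis .
  qed
  moreover have "poly_act r ?g ?q = scale (mon_char r u \<beta>) ?q"
    using D[OF g \<beta>CV] unfolding act[OF \<beta>CV] diffop_scale by simp
  ultimately have "mon_char r u \<beta> * lookup ?q 0 = lookup ?q 0" by simp
  then show ?thesis using \<beta> unfolding q0 by (simp add: in_keys_iff)
qed

text \<open>The scalars u_i = 2, u_j = 1/2 and 1 elsewhere define an element of S(GL_2^r), which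
  gives 2^(d_i - d_j) = 1. So the differences d_i of consecutive degrees are all equal, and as they
  sum to 0 around the cycle, they vanish.\<close>

lemma invariant_degrees_equal:
  assumes D: "\<And>g f. g \<in> carrier (S_GL2_pow r) \<Longrightarrow> f \<in> CV r \<Longrightarrow> diffop D (poly_act r g f) = poly_act r g (diffop D f)"
    and \<beta>: "\<beta> \<in> keys D" and DCV: "D \<in> CV r" and i: "i \<in> {1..r}"
  shows "mdeg \<beta> i = mdeg \<beta> 1"
proof -
  define d where "d i = int (mdeg \<beta> i) - int (mdeg \<beta> (prv r i))" for i
  have eq: "d i = d j" if ij: "i \<in> {1..r}" "j \<in> {1..r}" for i j
  proof (cases "i = j")
    case False
    define u :: "nat \<Rightarrow> complex" where "u k = (if k = i then 2 else if k = j then 1 / 2 else 1)" for k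
    have split: "(\<Prod>k\<in>{1..r}. f k) = f i * (f j * (\<Prod>k\<in>{1..r} - {i, j}. f k))" for f :: "nat \<Rightarrow> complex"
    proof -
      have "{1..r} = insert i (insert j ({1..r} - {i, j}))" using ij by auto
      then have "(\<Prod>k\<in>{1..r}. f k) = (\<Prod>k\<in>insert i (insert j ({1..r} - {i, j})). f k)" by simp
      also have "\<dots> = f i * (f j * (\<Prod>k\<in>{1..r} - {i, j}. f k))" using False by simp
      finally show ?thesis .
    qed
    have "mon_char r u \<beta> = 1"
    proof (rule invariant_mon_char[OF D \<beta> DCV])
      show "(\<Prod>k\<in>{1..r}. (u k)\<^sup>2) = 1"
        unfolding split using False by (simp add: u_def power2_eq_square)
    qed (auto simp: u_def)
    moreover have "mon_char r u \<beta> = 2 powi (d i - d j)"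
    proof -
      have "mon_char r u \<beta> = (\<Prod>k\<in>{1..r}. u k powi d k)"
        by (simp add: mon_char_def scalar_char_def d_def)
      also have "\<dots> = 2 powi d i * ((1 / 2) powi d j * (\<Prod>k\<in>{1..r} - {i, j}. u k powi d k))"
        unfolding split using False by (simp add: u_def)
      also have "(\<Prod>k\<in>{1..r} - {i, j}. u k powi d k) = 1"
        by (intro prod.neutral) (auto simp: u_def)
      also have "2 powi d i * ((1 / 2) powi d j * 1) = (2 powi (d i - d j) :: complex)"
        by (simp add: power_int_diff power_int_one_over divide_simps)
      finally show ?thesis .
    qed
    ultimately have "(2 :: complex) powi (d i - d j) = 1" by simp
    then have "norm ((2 :: complex) powi (d i - d j)) = 1" by simp
    then have p: "(2 :: real) powi (d i - d j) = 1" by (simp add: norm_power_int)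
    show "d i = d j"
    proof (rule ccontr)
      assume "d i \<noteq> d j"
      then consider "d i - d j > 0" | "d i - d j < 0" by linarith
      then show False
      proof cases
        case 1
        have "(2 :: real) powi 0 < 2 powi (d i - d j)" using 1 by (intro power_int_strict_increasing) auto
        then show False using p by simp
      next
        case 2
        have "(2 :: real) powi (d i - d j) < 2 powi 0" using 2 by (intro power_int_strict_increasing) auto
        then show False using p by simp
      qed
    qed
  qed simp
  have one: "1 \<in> {1..r}" using r by simp
  have "(\<Sum>i\<in>{1..r}. d i) = 0"
  proof -
    have "(\<Sum>i\<in>{1..r}. int (mdeg \<beta> (prv r i))) = (\<Sum>i\<in>{1..r}. int (mdeg \<beta> i))"
      by (rule sum.reindex_bij_witness[of _ "nxt r" "prv r"]) (simp_all del: atLeastAtMost_iff One_nat_def)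
    then show ?thesis by (simp add: d_def sum_subtractf)
  qed
  moreover have "(\<Sum>i\<in>{1..r}. d i) = (\<Sum>i\<in>{1..r}. d 1)"
    by (intro sum.cong refl eq one)
  ultimately have d1: "d 1 = 0" using r by simp
  show ?thesis using i
  proof (induction i)
    case (Suc k)
    show ?case
    proof (cases "k = 0")
      case False
      have "d (Suc k) = 0" using eq[OF Suc.prems one] d1 by simp
      then have "mdeg \<beta> (Suc k) = mdeg \<beta> k" using False by (simp add: d_def prv_def)
      then show ?thesis using Suc False by auto
    qed simp
  qed simp
qed

text \<open>One space serves every group between S(GL_2^r) and GL_2^r: the trace and the determinant
  are invariant under the larger group, while invariance under the smaller one already confines an
  operator without constant term to the ideal.\<close>

theorem harmonic_graded_eq:
  assumes K: "carrier (S_GL2_pow r) \<subseteq> carrier K" "carrier K \<subseteq> carrier (GL2_pow r)"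
  shows "harmonic_graded K r n = Harm r \<inter> CV_graded r n"
proof
  have inv: "invariant_diffop K r D" if "inv_poly r N D" for N D
    unfolding invariant_diffop_def using diffop_poly_act[OF r that] K(2) by blast
  show "harmonic_graded K r n \<subseteq> Harm r \<inter> CV_graded r n"
  proof
    fix f assume f: "f \<in> harmonic_graded K r n"
    have "diffop D f = 0" if "inv_poly r N D" "N \<ge> 1" for N D
      using f inv[OF that(1)] inv_poly_CV[OF that(1)] inv_poly_const[OF that]
      unfolding harmonic_graded_def harmonic_def by blast
    from this[OF inv_poly_tr[OF r]] this[OF inv_poly_det[OF r]] show "f \<in> Harm r \<inter> CV_graded r n"
      using f by (simp add: Harm_def harmonic_graded_def)
  qed
  show "Harm r \<inter> CV_graded r n \<subseteq> harmonic_graded K r n"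
  proof
    fix f assume f: "f \<in> Harm r \<inter> CV_graded r n"
    have "diffop D f = 0" if DCV: "D \<in> CV r" and Dinv: "invariant_diffop K r D" and D0: "lookup D 0 = 0" for D
    proof -
      have DS: "diffop D (poly_act r g f) = poly_act r g (diffop D f)"
        if "g \<in> carrier (S_GL2_pow r)" "f \<in> CV r" for g f
        using Dinv K(1) that unfolding invariant_diffop_def by blast
      have DSL: "diffop D (poly_act r g f) = poly_act r g (diffop D f)" if "g \<in> SL2_pow r" "f \<in> CV r" for g f
        using DS[OF SL2_pow_in_S] that by blast
      have cE: "diffop D (opE r i q) = opE r i (diffop D q)" and cF: "diffop D (opF r i q) = opF r i (diffop D q)"
        if i: "i \<in> {1..r}" and q: "q \<in> CV r" for i q
      proof -
        show "diffop D (opE r i q) = opE r i (diffop D q)"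
          by (rule diffop_commute_of_invariant[OF r DSL exp_at_vertex(1)[OF r i] at_vertex_SL2 q]) auto
        show "diffop D (opF r i q) = opF r i (diffop D q)"
          by (rule diffop_commute_of_invariant[OF r DSL exp_at_vertex(2)[OF r i] at_vertex_SL2 q]) auto
      qed
      \<comment> \<open>\<open>diffop D\<close> is adjoint to multiplication by this conjugate,
        which is then split into parts of degree (N, ..., N).\<close>
      let ?D = "cnjp D"
      define c where "c N = (\<Sum>\<beta>\<in>{\<beta> \<in> keys D. mdeg \<beta> 1 = N}. Poly_Mapping.single \<beta> (lookup ?D \<beta>))" for N
      have lc: "lookup (c N) \<beta> = (if mdeg \<beta> 1 = N then lookup ?D \<beta> else 0)" for N \<beta>
        unfolding c_def by (subst lookup_sum_single) (auto simp: in_keys_iff)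
      have deg: "mdeg \<beta> k = deg_ext r (\<lambda>_. mdeg \<beta> 1) k" if "\<beta> \<in> keys D" for \<beta> k
      proof (cases "k \<in> {1..r}")
        case True
        then show ?thesis using invariant_degrees_equal[OF DS that DCV True] by (simp add: deg_ext_def del: One_nat_def)
      next
        case False
        then show ?thesis using DCV that unfolding CV_iff by (auto simp: deg_ext_def)
      qed
      have cgr: "c N \<in> CV_graded r (\<lambda>_. N)" for N
        unfolding CV_graded_iff
      proof (intro ballI allI)
        fix \<beta> k assume "\<beta> \<in> keys (c N)"
        then have "\<beta> \<in> keys D" "mdeg \<beta> 1 = N" by (auto simp: in_keys_iff lc split: if_splits)
        then show "mdeg \<beta> k = deg_ext r (\<lambda>_. N) k" using deg by blast
      qed
      have fc: "fischer (c N) q = fischer (?D * 1) q" if q: "q \<in> CV_graded r (\<lambda>_. N)" for q N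
      proof -
        have "fischer (?D - c N) q = 0"
        proof (rule fischer_disjoint_keys)
          have "mdeg \<beta> 1 = N" if "\<beta> \<in> keys q" for \<beta>
            using q that r unfolding CV_graded_iff by (auto simp: deg_ext_def)
          then show "keys (?D - c N) \<inter> keys q = {}" by (auto simp: in_keys_iff lookup_minus lc)
        qed
        then show ?thesis by (simp add: fischer_diff)
      qed
      have grE: "opE r i q \<in> CV_graded r m" and grF: "opF r i q \<in> CV_graded r m"
        if "i \<in> {1..r}" "q \<in> CV_graded r m" for i q m
        using that(2) by (auto simp: CV_graded_iff_euler euler_opE[OF r that(1)] euler_opF[OF r that(1)] opE_simps opF_simps)
      have cinv: "opE r i (c N) = 0" "opF r i (c N) = 0" if i: "i \<in> {1..r}" for i N
      proof -
        let ?e = "opE r i (c N)" and ?f = "opF r i (c N)"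
        have gr: "?e \<in> CV_graded r (\<lambda>_. N)" "?f \<in> CV_graded r (\<lambda>_. N)" using cgr i grE grF by blast+
        \<comment> \<open>Infinitesimal invariance of the part \<open>c N\<close> is again read off
          from a norm: moving D across as an operator and commuting it with F_i leaves a product
          with E_i 1 = 0.\<close>
        have "fischer ?e ?e = fischer (?D * 1) (opF r i ?e)"
          unfolding fischer_opE by (rule fc[OF grF[OF i gr(1)]])
        also have "\<dots> = fischer 1 (opF r i (diffop D ?e))"
          unfolding fischer_mult_left cnjp_cnjp cF[OF i CV_graded_CV[OF gr(1)]] ..
        also have "\<dots> = 0" unfolding fischer_opF_right by (simp add: opE_simps)
        finally show "?e = 0" by (simp add: fischer_self_eq_0)
        have "fischer ?f ?f = fischer (?D * 1) (opE r i ?f)"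
          unfolding fischer_opF by (rule fc[OF grE[OF i gr(2)]])
        also have "\<dots> = fischer 1 (opE r i (diffop D ?f))"
          unfolding fischer_mult_left cnjp_cnjp cE[OF i CV_graded_CV[OF gr(2)]] ..
        also have "\<dots> = 0" unfolding fischer_opE_right by (simp add: opF_simps)
        finally show "?f = 0" by (simp add: fischer_self_eq_0)
      qed
      \<comment> \<open>The part of degree 0 is the constant term, which vanishes by assumption on
        D.\<close>
      have c0: "c 0 = 0"
      proof (rule poly_mapping_eqI)
        fix \<beta>
        have "lookup ?D \<beta> = 0" if "mdeg \<beta> 1 = 0"
        proof (cases "\<beta> \<in> keys D")
          case True
          have md: "mdeg \<beta> k = 0" for k using deg[OF True, of k] that by (simp add: deg_ext_def)
          have "lookup \<beta> (k, a, b) = 0" for k a b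
            using md[of k] exhaust_2[of a] exhaust_2[of b] by (auto simp: mdeg_def sum_2)
          then have "\<beta> = 0" by (intro poly_mapping_eqI) (metis lookup_zero prod_cases3)
          then show ?thesis using D0 by simp
        qed (simp add: in_keys_iff)
        then show "lookup (c 0) \<beta> = lookup 0 \<beta>" by (simp add: lc)
      qed
      define S where "S = (\<lambda>\<beta>. mdeg \<beta> 1) ` keys D"
      have Dsum: "?D = (\<Sum>N\<in>S. c N)"
      proof (rule poly_mapping_eqI)
        fix \<beta>
        have "lookup (\<Sum>N\<in>S. c N) \<beta> = (\<Sum>N\<in>S. if N = mdeg \<beta> 1 then lookup ?D \<beta> else 0)"
          unfolding lookup_sum lc by (intro sum.cong) auto
        also have "\<dots> = lookup ?D \<beta>"
          by (auto simp: sum.delta S_def in_keys_iff)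
        finally show "lookup ?D \<beta> = lookup (\<Sum>N\<in>S. c N) \<beta>" by simp
      qed
      show "diffop D f = 0"
      proof (rule fischer_ext)
        fix x
        have z: "fischer (c N * x) f = 0" for N
        proof (cases "N = 0")
          case False
          then show ?thesis using invariant_in_ideal[OF r cgr _ cinv] f by simp
        qed (simp add: c0)
        have "fischer x (diffop D f) = fischer (?D * x) f" by (simp add: fischer_mult_left)
        also have "\<dots> = 0" unfolding Dsum sum_distrib_right fischer_sum_left using z by simp
        finally show "fischer x (diffop D f) = fischer x 0" by simp
      qed
    qed
    then show "f \<in> harmonic_graded K r n"
      using f CV_graded_CV by (auto simp: harmonic_graded_def harmonic_def)
  qed
qed

section \<open>Irreducibility\<close>

lemma fischer_opFs_other:
  assumes "hwv r s v" "b \<in> F_basis r s" "c \<in> F_basis r s" "b \<noteq> c"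
  shows "fischer (opFs r b v) (opFs r c v) = 0"
proof -
  have "\<exists>i\<in>{1..r}. b i \<noteq> c i"
  proof (rule ccontr)
    assume "\<not> ?thesis"
    then have "b = c" using assms(2,3) unfolding F_basis_def by (intro PiE_ext) auto
    then show False using assms(4) by simp
  qed
  then obtain i where i: "i \<in> {1..r}" "b i \<noteq> c i" by blast
  have "int (s i) - 2 * int (b i) \<noteq> int (s i) - 2 * int (c i)" using i(2) by simp
  then show ?thesis
    by (intro fischer_wspace[OF opFs_wspace[OF r assms(1) refl] opFs_wspace[OF r assms(1) refl] i(1)])
qed

lemma fischer_opFs_emb:
  assumes "hwv r s v" "b \<in> F_basis r s"
  shows "fischer (opFs r b v) (emb r s v x) = lookup x b * emb_coeff r s b * fischer (opFs r b v) (opFs r b v)"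
proof -
  have fin: "finite (F_basis r s)" by (simp add: F_basis_def finite_PiE)
  have "fischer (opFs r b v) (emb r s v x) = (\<Sum>c\<in>F_basis r s. if c = b then
      lookup x b * emb_coeff r s b * fischer (opFs r b v) (opFs r b v) else 0)"
    unfolding emb_def fischer_sum_right fischer_scale_right
    by (intro sum.cong refl) (use fischer_opFs_other[OF assms(1,2)] in auto)
  then show ?thesis using fin assms(2) by (simp add: sum.delta)
qed

lemma opFs_norm_nonzero:
  assumes "hwv r s v" "v \<noteq> 0" "b \<in> F_basis r s"
  shows "fischer (opFs r b v) (opFs r b v) \<noteq> 0"
  using opFs_nonzero[OF r assms(1,2)] F_basisD[OF assms(3)] by (simp add: fischer_self_eq_0)

text \<open>The orbit vectors are orthogonal and of nonzero norm, so each coordinate of x is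
  recovered from its image.\<close>

lemma emb_inj:
  assumes "hwv r s v" "v \<noteq> 0" "x \<in> F_space r s" "emb r s v x = 0"
  shows "x = 0"
proof (rule poly_mapping_eqI)
  fix b
  show "lookup x b = lookup 0 b"
  proof (cases "b \<in> F_basis r s")
    case True
    then show ?thesis
      using fischer_opFs_emb[OF assms(1) True, of x] opFs_norm_nonzero[OF assms(1,2) True] assms(4)
      by (simp add: emb_coeff_nonzero)
  next
    case False
    then show ?thesis using assms(3) by (auto simp: F_space_def in_keys_iff)
  qed
qed

text \<open>For a curve p(t) of degree at most N in U, the curve p(2t) - 2^N p(t) in U has no term
  of degree N, and its k-th coefficient is multiplied by 2^k - 2^N, which is nonzero for k < N. This
  plays the part of a Vandermonde determinant.\<close>

lemma subspace_of_polynomial_curve: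
  assumes U: "cvec.subspace U" and "\<And>t. (\<Sum>k<N. scale (t ^ k) (a k)) \<in> U" and "k < N"
  shows "a k \<in> U"
  using assms(2,3)
proof (induction N arbitrary: k a)
  case (Suc N)
  have low: "a k \<in> U" if k: "k < N" for k
  proof -
    have "(\<Sum>k<N. scale (t ^ k) (scale (2 ^ k - 2 ^ N) (a k))) \<in> U" for t
    proof -
      have "(\<Sum>k<N. scale (t ^ k) (scale (2 ^ k - 2 ^ N) (a k))) =
          (\<Sum>k<Suc N. scale ((2 * t) ^ k) (a k)) - scale (2 ^ N) (\<Sum>k<Suc N. scale (t ^ k) (a k))"
        by (simp add: cvec.scale_right_distrib cvec.scale_sum_right power_mult_distrib
            algebra_simps cvec.scale_left_diff_distrib sum_subtractf)
      then show ?thesis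
        by (simp only: cvec.subspace_diff[OF U Suc.prems(1) cvec.subspace_scale[OF U Suc.prems(1)]])
    qed
    from Suc.IH[OF this k] have "scale (2 ^ k - 2 ^ N) (a k) \<in> U" .
    then have "scale (1 / (2 ^ k - 2 ^ N)) (scale (2 ^ k - 2 ^ N) (a k)) \<in> U"
      using U by (rule cvec.subspace_scale[rotated])
    moreover have "(2 ^ k - 2 ^ N :: complex) \<noteq> 0"
    proof
      assume "(2 ^ k - 2 ^ N :: complex) = 0"
      then have "norm ((2::complex) ^ k) = norm ((2::complex) ^ N)" by simp
      then have "(2::real) ^ k = 2 ^ N" by (simp add: norm_power)
      then show False using k by simp
    qed
    ultimately show ?thesis by simp
  qed
  show ?case
  proof (cases "k = N")
    case True
    have "(\<Sum>k<N. a k) \<in> U" using low U by (intro cvec.subspace_sum) auto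
    moreover have "(\<Sum>k<Suc N. a k) \<in> U" using Suc.prems(1)[of 1] by simp
    ultimately have "(\<Sum>k<Suc N. a k) - (\<Sum>k<N. a k) \<in> U" using U by (intro cvec.subspace_diff)
    then show ?thesis using True by simp
  qed (use low Suc.prems(2) in auto)
qed simp

text \<open>The generator applied to f is the coefficient of t in the curve A t, so it stays in
  every subspace containing the curve.\<close>

lemma exp_rel_stable:
  assumes U: "cvec.subspace U" and e: "\<And>t. exp_rel t \<delta> f (A t)" and A: "\<And>t. A t \<in> U"
  shows "\<delta> f \<in> U"
proof -
  obtain N where N: "\<And>k. k \<ge> N \<Longrightarrow> (\<delta> ^^ k) f = 0" using e[of 0] unfolding exp_rel_def by blast
  \<comment> \<open>Two terms beyond the order of nilpotency ensure that the index 1 occurs.\<close>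
  have "(\<Sum>k<N + 2. scale (t ^ k) (scale (1 / fact k) ((\<delta> ^^ k) f))) \<in> U" for t
    using A[of t] exp_rel_sum[OF e[of t], of "N + 2"] N by simp
  from subspace_of_polynomial_curve[OF U this, of 1] show ?thesis by simp
qed

text \<open>The image of U among the polynomials is stable under all E_i and F_i, hence contains a
  weight vector. As weights have multiplicity one, this is a multiple of some
  \<open>opFs r b v\<close>; the E_i lead from it to v, and the F_i generate the whole module from
  v.\<close>

lemma F_irreducible:
  assumes v: "hwv r s v" "v \<noteq> 0" "v \<in> CV r"
    and U: "cvec.subspace U" "U \<subseteq> F_space r s"
    and stable: "\<And>h u. h \<in> SL2_pow r \<Longrightarrow> u \<in> U \<Longrightarrow> F_lin r s h u \<in> U"
  shows "U = {0} \<or> U = F_space r s"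
proof (cases "U = {0}")
  case False
  define X where "X = emb r s v ` U"
  have Xsub: "cvec.subspace X"
    unfolding X_def cvec.subspace_def
  proof (intro conjI ballI allI)
    show "0 \<in> emb r s v ` U" using U(1) by (intro image_eqI[of _ _ 0]) (auto simp: cvec.subspace_def)
  next
    fix x y assume "x \<in> emb r s v ` U" "y \<in> emb r s v ` U"
    then obtain a b where "a \<in> U" "b \<in> U" "x = emb r s v a" "y = emb r s v b" by blast
    then show "x + y \<in> emb r s v ` U"
      using U(1) by (intro image_eqI[of _ _ "a + b"]) (auto simp: emb_add cvec.subspace_def)
  next
    fix c x assume "x \<in> emb r s v ` U"
    then obtain a where "a \<in> U" "x = emb r s v a" by blast
    then show "scale c x \<in> emb r s v ` U"
      using U(1) by (intro image_eqI[of _ _ "scale c a"]) (auto simp: emb_scale cvec.subspace_def)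
  qed
  have act: "poly_act r h x \<in> X" if "h \<in> SL2_pow r" "x \<in> X" for h x
  proof -
    from that(2) obtain a where a: "x = emb r s v a" "a \<in> U" unfolding X_def by (rule imageE)
    have "poly_act r h x = emb r s v (F_lin r s h a)"
      unfolding a(1) by (rule emb_equivariant[OF r v(1,3) that(1) subsetD[OF U(2) a(2)]])
    then show ?thesis unfolding X_def using stable[OF that(1) a(2)] by (rule image_eqI)
  qed
  have XCV: "x \<in> CV r" if "x \<in> X" for x using that emb_CV[OF r v(1,3)] by (auto simp: X_def)
  have Xmod: "submodule r X"
    unfolding submodule_def[OF r]
  proof (intro conjI ballI Xsub)
    fix i x assume i: "i \<in> {1..r}" and x: "x \<in> X"
    show "opE r i x \<in> X"
      by (rule exp_rel_stable[OF Xsub exp_at_vertex(1)[OF r i XCV[OF x]] act[OF at_vertex_SL2 x]]) simp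
    show "opF r i x \<in> X"
      by (rule exp_rel_stable[OF Xsub exp_at_vertex(2)[OF r i XCV[OF x]] act[OF at_vertex_SL2 x]]) simp
  qed
  obtain u where "u \<in> U" "u \<noteq> 0" using False U(1) by (auto simp: cvec.subspace_def)
  then have "emb r s v u \<in> X" "emb r s v u \<noteq> 0" using emb_inj[OF v(1,2)] U(2) by (auto simp: X_def)
  from exists_weight_vector[OF r Xmod this]
  obtain \<mu> where "\<exists>g\<in>X \<inter> wspace r \<mu>. g \<noteq> 0" ..
  then obtain g where g: "g \<in> X" "g \<in> wspace r \<mu>" "g \<noteq> 0" by blast
  from g(1) obtain x where x: "g = emb r s v x" "x \<in> U" unfolding X_def by (rule imageE)
  have "x \<noteq> 0" using g(3) x(1) by auto
  then obtain b where b: "lookup x b \<noteq> 0" by (metis lookup_zero poly_mapping_eqI)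
  have keys_x: "c \<in> F_basis r s" if "lookup x c \<noteq> 0" for c
    using subsetD[OF U(2) x(2)] that by (auto simp: F_space_def in_keys_iff)
  have bF: "b \<in> F_basis r s" by (rule keys_x[OF b])
  have \<mu>: "int (s i) - 2 * int (b i) = \<mu> i" if i: "i \<in> {1..r}" for i
  proof (rule ccontr)
    assume "int (s i) - 2 * int (b i) \<noteq> \<mu> i"
    then have "fischer (opFs r b v) g = 0"
      by (intro fischer_wspace[OF opFs_wspace[OF r v(1) refl] g(2) i])
    then show False
      using b fischer_opFs_emb[OF v(1) bF, of x] opFs_norm_nonzero[OF v(1,2) bF]
      unfolding x(1) by (simp add: emb_coeff_nonzero)
  qed
  \<comment> \<open>Coordinates at other indices belong to other weights, and orthogonality of
    weight spaces makes them 0.\<close>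
  have other: "lookup x c = 0" if c: "c \<noteq> b" for c
  proof (rule ccontr)
    assume "lookup x c \<noteq> 0"
    then have cF: "c \<in> F_basis r s" by (rule keys_x)
    have "\<exists>i\<in>{1..r}. c i \<noteq> b i"
    proof (rule ccontr)
      assume "\<not> ?thesis"
      then have "c = b" using bF cF unfolding F_basis_def by (intro PiE_ext) auto
      then show False using c by simp
    qed
    then obtain i where i: "i \<in> {1..r}" "c i \<noteq> b i" by blast
    have "int (s i) - 2 * int (c i) \<noteq> \<mu> i" using \<mu>[OF i(1)] i(2) by auto
    then have "fischer (opFs r c v) g = 0"
      by (intro fischer_wspace[OF opFs_wspace[OF r v(1) refl] g(2) i(1)])
    then show False
      using \<open>lookup x c \<noteq> 0\<close> fischer_opFs_emb[OF v(1) cF, of x] opFs_norm_nonzero[OF v(1,2) cF]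
      unfolding x(1) by (simp add: emb_coeff_nonzero)
  qed
  have "x = scale (lookup x b) (Poly_Mapping.single b 1)"
    by (rule poly_mapping_eqI) (use other in \<open>auto simp: lookup_single when_def\<close>)
  then have "g = scale (lookup x b * emb_coeff r s b) (opFs r b v)"
    using x(1) emb_scale[of r s v "lookup x b" "Poly_Mapping.single b 1"] emb_single[OF bF, of v] by (simp only: cvec.scale_scale)
  then have "scale (1 / (lookup x b * emb_coeff r s b)) g = opFs r b v"
    using b by (simp add: emb_coeff_nonzero)
  moreover have "scale (1 / (lookup x b * emb_coeff r s b)) g \<in> X" by (rule cvec.subspace_scale[OF Xsub g(1)])
  ultimately have bX: "opFs r b v \<in> X" by (simp only:)
  have "v \<in> X" using bX bF
  proof (induction "\<Sum>i\<in>{1..r}. b i" arbitrary: b rule: less_induct)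
    case less
    show ?case
    proof (cases "\<forall>i\<in>{1..r}. b i = 0")
      case True
      then have "opFs r b v = v" by (intro opF_mult_0) auto
      then show ?thesis using less.prems(1) by simp
    next
      case False
      then obtain i where i: "i \<in> {1..r}" "b i \<noteq> 0" by blast
      define d where "d = of_nat (b i) * (of_nat (s i) - of_nat (b i) + 1 :: complex)"
      have "of_nat (s i) - of_nat (b i) + 1 = (of_nat (s i - b i + 1) :: complex)"
        using F_basisD[OF less.prems(2) i(1)] by (simp add: of_nat_diff)
      then have d: "d \<noteq> 0" using i(2) unfolding d_def by (metis Suc_eq_plus1 mult_eq_0_iff nat.distinct(1) of_nat_eq_0_iff)
      have "opE r i (opFs r b v) \<in> X" using Xmod less.prems(1) i(1) unfolding submodule_def[OF r] by blast
      then have "scale d (opFs r (b(i := b i - 1)) v) \<in> X" unfolding opE_opFs[OF r v(1) i(1)] d_def .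
      then have "scale (1 / d) (scale d (opFs r (b(i := b i - 1)) v)) \<in> X" by (rule cvec.subspace_scale[OF Xsub])
      then have X': "opFs r (b(i := b i - 1)) v \<in> X" using d by simp
      show ?thesis
      proof (rule less.hyps[OF _ X'])
        show "(\<Sum>j\<in>{1..r}. (b(i := b i - 1)) j) < (\<Sum>j\<in>{1..r}. b j)"
          by (rule sum_strict_mono_ex1) (use i in auto)
        show "b(i := b i - 1) \<in> F_basis r s"
          using F_basisD[OF less.prems(2) i(1)] by (intro F_basis_upd[OF less.prems(2) i(1)]) simp
      qed
    qed
  qed
  then have all: "opFs r c v \<in> X" for c
    using Xmod by (intro opF_mult_in) (auto simp: submodule_def[OF r])
  have "F_space r s \<subseteq> U"
  proof
    fix y assume y: "y \<in> F_space r s"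
    have "emb r s v y \<in> X" unfolding emb_def by (intro cvec.subspace_sum cvec.subspace_scale Xsub all)
    then obtain z where z: "z \<in> U" "emb r s v y = emb r s v z" by (auto simp: X_def)
    have "emb r s v (y + scale (-1) z) = 0" unfolding emb_add emb_scale z(2) by (simp add: scale_uminus_1)
    moreover have "y + scale (-1) z \<in> F_space r s"
      by (intro F_space_add F_space_scale y subsetD[OF U(2) z(1)])
    ultimately have "y + scale (-1) z = 0" by (intro emb_inj[OF v(1,2)])
    then have "y = z" by (simp add: scale_uminus_1)
    then show "y \<in> U" using z(1) by simp
  qed
  then show ?thesis using U(2) by blast
qed simp

end

section \<open>Decomposition of the harmonic polynomials\<close>

lemma group_GL2_pow: "group (GL2_pow r)"
  unfolding GL2_pow_def by (rule product_group) (rule group_GL2)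

lemma group_S_GL2_pow: "group (S_GL2_pow r)"
proof -
  interpret group "GL2_pow r" by (rule group_GL2_pow)
  let ?H = "{g \<in> carrier (GL2_pow r). (\<Prod>j\<in>{1..r}. det (g j)) = 1}"
  have "subgroup ?H (GL2_pow r)"
  proof
    show "?H \<subseteq> carrier (GL2_pow r)" by blast
    show "\<one>\<^bsub>GL2_pow r\<^esub> \<in> ?H" by (simp add: one_GL2_pow del: One_nat_def) (use one_closed in \<open>simp add: one_GL2_pow\<close>)
    show "x \<otimes>\<^bsub>GL2_pow r\<^esub> y \<in> ?H" if "x \<in> ?H" "y \<in> ?H" for x y
    proof -
      have "(\<Prod>j\<in>{1..r}. det ((x \<otimes>\<^bsub>GL2_pow r\<^esub> y) j)) = (\<Prod>j\<in>{1..r}. det (x j) * det (y j))"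
        unfolding mult_GL2_pow by (intro prod.cong refl) (simp add: det_mul)
      then show ?thesis using that by (simp add: prod.distrib m_closed)
    qed
    show "inv\<^bsub>GL2_pow r\<^esub> x \<in> ?H" if x: "x \<in> ?H" for x
    proof -
      let ?y = "inv\<^bsub>GL2_pow r\<^esub> x"
      have c: "x \<in> carrier (GL2_pow r)" using x by blast
      have "(\<Prod>j\<in>{1..r}. det ((x \<otimes>\<^bsub>GL2_pow r\<^esub> ?y) j)) = (\<Prod>j\<in>{1..r}. det (x j) * det (?y j))"
        unfolding mult_GL2_pow by (intro prod.cong refl) (simp add: det_mul)
      moreover have "(\<Prod>j\<in>{1..r}. det ((x \<otimes>\<^bsub>GL2_pow r\<^esub> ?y) j)) = 1"
        unfolding r_inv[OF c] one_GL2_pow by (intro prod.neutral) auto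
      ultimately have "(\<Prod>j\<in>{1..r}. det (?y j)) = 1" using x by (simp add: prod.distrib)
      then show ?thesis using inv_closed[OF c] by blast
    qed
  qed
  from subgroup_imp_group[OF this] show ?thesis by (simp add: S_GL2_pow_def)
qed

section \<open>Both groups at once: any K between S(GL_2^r) and GL_2^r\<close>

context
  fixes r l :: nat and n :: "nat \<Rightarrow> nat" and K :: "(nat \<Rightarrow> mat2) monoid"
    and \<phi> :: "(nat \<Rightarrow> complex) \<times> (nat \<Rightarrow> mat2) \<Rightarrow> (nat \<Rightarrow> mat2)" and z :: "nat \<Rightarrow> int"
  assumes r: "r \<ge> 2"
    and K: "group K" "carrier (S_GL2_pow r) \<subseteq> carrier K" "carrier K \<subseteq> carrier (GL2_pow r)"
      "monoid.mult K = monoid.mult (GL2_pow r)" "\<one>\<^bsub>K\<^esub> = \<one>\<^bsub>GL2_pow r\<^esub>"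
    and \<phi>: "\<phi> ` carrier (K_tilde l r) = carrier K"
    and char: "\<And>w h f. (w, h) \<in> carrier (K_tilde l r) \<Longrightarrow> f \<in> CV_graded r n \<Longrightarrow>
      poly_act r (\<phi> (w, h)) f = scale (\<Prod>j\<in>{1..l}. w j powi z j) (poly_act r h f)"
begin

lemma K_tilde_carrier: "(w, h) \<in> carrier (K_tilde l r) \<longleftrightarrow> w \<in> PiE {1..l} (\<lambda>_. UNIV - {0}) \<and> h \<in> SL2_pow r"
  by (simp add: K_tilde_def Cstar_def SL2_def)

lemma K_invertible: "g \<in> carrier K \<Longrightarrow> i \<in> {1..r} \<Longrightarrow> invertible (g i)"
  using K(3) GL2_powD by blast

lemma representation_harmonic: "representation K (harmonic_graded K r n) (poly_act r)"
  unfolding representation_def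
proof (intro conjI ballI)
  have CV: "f \<in> CV r" if "f \<in> harmonic_graded K r n" for f
    using that by (simp add: harmonic_graded_def harmonic_def)
  show "group K" by (rule K(1))
  show "cvec.subspace (harmonic_graded K r n)"
    unfolding harmonic_graded_eq[OF r K(2,3)] by (intro cvec.subspace_inter subspace_Harm subspace_CV_graded)
  show "poly_act r g ` harmonic_graded K r n \<subseteq> harmonic_graded K r n" if g: "g \<in> carrier K" for g
  proof (rule image_subsetI)
    fix f assume f: "f \<in> harmonic_graded K r n"
    have "diffop D (poly_act r g f) = 0" if D: "D \<in> CV r" "invariant_diffop K r D" "lookup D 0 = 0" for D
    proof -
      have "diffop D (poly_act r g f) = poly_act r g (diffop D f)"
        using D(2) g CV[OF f] unfolding invariant_diffop_def by blast
      also have "diffop D f = 0" using f D unfolding harmonic_graded_def harmonic_def by blast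
      finally show ?thesis by simp
    qed
    then show "poly_act r g f \<in> harmonic_graded K r n"
      using f poly_act_CV[OF CV[OF f]] poly_act_CV_graded
      by (simp add: harmonic_graded_def harmonic_def)
  qed
  show "linear_on (harmonic_graded K r n) (poly_act r g)" for g
    by (simp add: linear_on_def poly_act_add poly_act_scale)
  show "poly_act r \<one>\<^bsub>K\<^esub> f = f" if "f \<in> harmonic_graded K r n" for f
    unfolding K(5) one_GL2_pow by (rule poly_act_one[OF CV[OF that]])
  show "poly_act r (g \<otimes>\<^bsub>K\<^esub> h) f = poly_act r g (poly_act r h f)"
    if "g \<in> carrier K" "h \<in> carrier K" "f \<in> harmonic_graded K r n" for g h f
    unfolding K(4) mult_GL2_pow
    by (rule poly_act_mult_group[OF K_invertible[OF that(1)] K_invertible[OF that(2)] CV[OF that(3)]])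
qed

text \<open>The isomorphism is the inverse of the sum \<Psi> of the embeddings \<open>emb\<close>.
  Since \<open>poly_act\<close> is known to be an action of K, transport along this isomorphism
  shows that the kernel of \<phi> acts trivially and that \<open>descend\<close> yields
  representations of K; the parity conditions behind this are satisfied automatically.\<close>

theorem harmonic_decomposition:
  "(\<forall>(m, s)\<in>summands r n. \<forall>x\<in>kernel (K_tilde l r) K \<phi>. \<forall>v\<in>F_space r s. F_act l r z s x v = v) \<and>
   irreducible_decomposition K (harmonic_graded K r n) (poly_act r) (summands r n)
     (\<lambda>(m, s). F_space r s) (\<lambda>(m, s). descend (K_tilde l r) \<phi> (F_act l r z s))"
proof -
  let ?I = "summands r n"
  let ?W = "Harm r \<inter> CV_graded r n"
  let ?F = "\<lambda>k :: (nat \<Rightarrow> nat) \<times> (nat \<Rightarrow> nat). F_space r (snd k)"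
  have W: "harmonic_graded K r n = ?W" by (rule harmonic_graded_eq[OF r K(2,3)])
  have rep: "representation K ?W (poly_act r)" using representation_harmonic unfolding W .
  have Wsub: "cvec.subspace ?W" using rep by (simp add: representation_def)
  obtain v where v: "\<And>k. k \<in> ?I \<Longrightarrow> v k \<in> ?W \<and> v k \<noteq> 0 \<and> hwv r (snd k) (v k)"
    and orth: "\<And>k l b c. k \<in> ?I \<Longrightarrow> l \<in> ?I \<Longrightarrow> k \<noteq> l \<Longrightarrow> b \<in> F_basis r (snd k) \<Longrightarrow> c \<in> F_basis r (snd l) \<Longrightarrow>
       fischer (opFs r b (v k)) (opFs r c (v l)) = 0"
    and span: "?W \<subseteq> cvec.span (\<Union>k\<in>?I. (\<lambda>b. opFs r b (v k)) ` F_basis r (snd k))"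
    by (rule Harm_decomposition[OF r, of n]) (rule that)
  have hw: "hwv r (snd k) (v k)" and vnz: "v k \<noteq> 0" and vCV: "v k \<in> CV r" if "k \<in> ?I" for k
    using v[OF that] CV_graded_CV by auto
  have fin: "finite ?I" by (rule finite_summands[OF r])
  have finF: "finite (F_basis r s)" for s by (simp add: F_basis_def finite_PiE)
  define \<Psi> where "\<Psi> x = (\<Sum>k\<in>?I. emb r (snd k) (v k) (x k))" for x
  define P where "P = PiE ?I ?F"
  have \<Psi>_cong: "\<Psi> x = \<Psi> y" if "\<And>k. k \<in> ?I \<Longrightarrow> x k = y k" for x y
    unfolding \<Psi>_def using that by (intro sum.cong) auto
  have opFs_W: "opFs r b (v k) \<in> ?W" if "k \<in> ?I" for b k
    using submodule_Harm[OF r, of n] v[OF that] by (intro opF_mult_in) (auto simp: submodule_def[OF r])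
  have emb_W: "emb r (snd k) (v k) y \<in> ?W" if "k \<in> ?I" for k y
    unfolding emb_def by (intro cvec.subspace_sum cvec.subspace_scale Wsub opFs_W that)
  have \<Psi>_W: "\<Psi> x \<in> ?W" for x
    unfolding \<Psi>_def by (intro cvec.subspace_sum Wsub emb_W)
  \<comment> \<open>The Fischer product with an orbit vector reads off one coordinate of one
    summand, which gives injectivity.\<close>
  have \<Psi>_fischer: "fischer (opFs r b (v k)) (\<Psi> x) =
      lookup (x k) b * emb_coeff r (snd k) b * fischer (opFs r b (v k)) (opFs r b (v k))"
    if k: "k \<in> ?I" and b: "b \<in> F_basis r (snd k)" for x k b
  proof -
    have "fischer (opFs r b (v k)) (\<Psi> x) = (\<Sum>l\<in>?I. if l = k then
        lookup (x k) b * emb_coeff r (snd k) b * fischer (opFs r b (v k)) (opFs r b (v k)) else 0)"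
      unfolding \<Psi>_def fischer_sum_right
    proof (intro sum.cong refl)
      fix l assume l: "l \<in> ?I"
      show "fischer (opFs r b (v k)) (emb r (snd l) (v l) (x l)) = (if l = k then
          lookup (x k) b * emb_coeff r (snd k) b * fischer (opFs r b (v k)) (opFs r b (v k)) else 0)"
      proof (cases "l = k")
        case True
        then show ?thesis using fischer_opFs_emb[OF r hw[OF k] b, of "x k"] by simp
      next
        case False
        then show ?thesis unfolding emb_def fischer_sum_right fischer_scale_right
          using orth[OF k l _ b] by (simp add: sum.neutral)
      qed
    qed
    then show ?thesis using fin k by (simp add: sum.delta)
  qed
  have inj: "inj_on \<Psi> P"
  proof (rule inj_onI)
    fix x y assume x: "x \<in> P" and y: "y \<in> P" and eq: "\<Psi> x = \<Psi> y"
    show "x = y"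
    proof (rule PiE_ext[OF x[unfolded P_def] y[unfolded P_def]])
      fix k assume k: "k \<in> ?I"
      show "x k = y k"
      proof (rule poly_mapping_eqI)
        fix b
        show "lookup (x k) b = lookup (y k) b"
        proof (cases "b \<in> F_basis r (snd k)")
          case True
          then show ?thesis
            using \<Psi>_fischer[OF k True, of x] \<Psi>_fischer[OF k True, of y] eq
              opFs_norm_nonzero[OF r hw[OF k] vnz[OF k] True] by (simp add: emb_coeff_nonzero)
        next
          case False
          have "x k \<in> ?F k" "y k \<in> ?F k" using x y k unfolding P_def by (auto dest: PiE_mem)
          then have "b \<notin> keys (x k)" "b \<notin> keys (y k)" using False unfolding F_space_def by blast+
          then show ?thesis by (simp add: in_keys_iff)
        qed
      qed
    qed
  qed
  have \<Psi>_add: "\<Psi> (\<lambda>k\<in>?I. x k + y k) = \<Psi> x + \<Psi> y" for x y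
    unfolding \<Psi>_def sum.distrib[symmetric] by (intro sum.cong refl) (simp add: emb_add)
  have \<Psi>_scale: "\<Psi> (\<lambda>k\<in>?I. scale c (x k)) = scale c (\<Psi> x)" for c x
    unfolding \<Psi>_def cvec.scale_sum_right by (intro sum.cong refl) (simp add: emb_scale)
  have P_add: "(\<lambda>k\<in>?I. x k + y k) \<in> P" if "x \<in> P" "y \<in> P" for x y
    using that unfolding P_def by (auto simp: PiE_iff intro: F_space_add)
  have P_scale: "(\<lambda>k\<in>?I. scale c (x k)) \<in> P" if "x \<in> P" for c x
    using that unfolding P_def by (auto simp: PiE_iff intro: F_space_scale)
  define single where "single k y = (\<lambda>l\<in>?I. if l = k then y else (0 :: (nat \<Rightarrow> nat) \<Rightarrow>\<^sub>0 complex))" for k y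
  have single_P: "single k y \<in> P" if "k \<in> ?I" "y \<in> ?F k" for k y
    using that unfolding P_def single_def by (auto simp: PiE_iff F_space_0)
  have \<Psi>_single: "\<Psi> (single k y) = emb r (snd k) (v k) y" if "k \<in> ?I" for k y
  proof -
    have "\<Psi> (single k y) = (\<Sum>l\<in>?I. if l = k then emb r (snd k) (v k) y else 0)"
      unfolding \<Psi>_def single_def by (intro sum.cong refl) simp
    then show ?thesis using fin that by (simp add: sum.delta)
  qed
  have surj: "\<Psi> ` P = ?W"
  proof
    show "\<Psi> ` P \<subseteq> ?W" using \<Psi>_W by blast
    have "cvec.subspace (\<Psi> ` P)"
      unfolding cvec.subspace_def
    proof (intro conjI ballI allI)
      have "(\<lambda>k\<in>?I. 0) \<in> P" unfolding P_def by (auto simp: PiE_iff F_space_0)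
      moreover have "\<Psi> (\<lambda>k\<in>?I. 0) = 0" unfolding \<Psi>_def by (intro sum.neutral) simp
      ultimately show "0 \<in> \<Psi> ` P" by (intro image_eqI[of 0 \<Psi> "\<lambda>k\<in>?I. 0"]) simp_all
      show "a + b \<in> \<Psi> ` P" if ab: "a \<in> \<Psi> ` P" "b \<in> \<Psi> ` P" for a b
      proof -
        obtain x y where "x \<in> P" "y \<in> P" "a = \<Psi> x" "b = \<Psi> y" using ab by blast
        then show ?thesis by (intro image_eqI[of _ _ "\<lambda>k\<in>?I. x k + y k"] P_add) (simp_all only: \<Psi>_add)
      qed
      show "scale c a \<in> \<Psi> ` P" if a: "a \<in> \<Psi> ` P" for c a
      proof -
        obtain x where "x \<in> P" "a = \<Psi> x" using a by blast
        then show ?thesis by (intro image_eqI[of _ _ "\<lambda>k\<in>?I. scale c (x k)"] P_scale) (simp_all only: \<Psi>_scale)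
      qed
    qed
    moreover have "(\<Union>k\<in>?I. (\<lambda>b. opFs r b (v k)) ` F_basis r (snd k)) \<subseteq> \<Psi> ` P"
    proof safe
      fix m s b assume k: "m \<in> boundary r (Lambda_big r n)" "s \<in> boundary r (lambda_small r m)"
        and b: "b \<in> F_basis r (snd (m, s))"
      let ?k = "(m, s)"
      have kI: "?k \<in> ?I" using k by simp
      let ?y = "scale (1 / emb_coeff r s b) (Poly_Mapping.single b 1)"
      have "?y \<in> ?F ?k" using b by (auto simp: F_space_def in_keys_iff lookup_single when_def split: if_splits)
      then have sP: "single ?k ?y \<in> P" by (rule single_P[OF kI])
      have sv: "\<Psi> (single ?k ?y) = opFs r b (v ?k)"
        unfolding \<Psi>_single[OF kI] emb_scale using emb_single[of b r s "v ?k"] b emb_coeff_nonzero[of r s b]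
        by (simp del: scale_single)
      show "opFs r b (v (m, s)) \<in> \<Psi> ` P"
        by (rule image_eqI[of _ \<Psi> "single ?k ?y", OF sv[symmetric] sP])
    qed
    ultimately have "cvec.span (\<Union>k\<in>?I. (\<lambda>b. opFs r b (v k)) ` F_basis r (snd k)) \<subseteq> \<Psi> ` P"
      by (intro cvec.span_minimal)
    with span show "?W \<subseteq> \<Psi> ` P" by (rule order_trans)
  qed
  define T where "T k f = inv_into P \<Psi> f k" for k f
  have T\<Psi>: "T k (\<Psi> x) = x k" if "x \<in> P" for x k
    unfolding T_def using inv_into_f_f[OF inj that] by simp
  have T_ex: "\<exists>x\<in>P. f = \<Psi> x" if "f \<in> ?W" for f using surj that by blast
  have T_F: "T k f \<in> ?F k" if k: "k \<in> ?I" and f: "f \<in> ?W" for k f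
  proof -
    obtain x where x: "x \<in> P" "f = \<Psi> x" using T_ex[OF f] by blast
    then show ?thesis using k T\<Psi>[OF x(1)] unfolding P_def by (auto dest: PiE_mem)
  qed
  have T_surj: "\<exists>f\<in>?W. T k f = y" if k: "k \<in> ?I" and y: "y \<in> ?F k" for k y
    using T\<Psi>[OF single_P[OF k y], of k] \<Psi>_W[of "single k y"] k by (intro bexI[of _ "\<Psi> (single k y)"]) (simp_all add: single_def)
  have T_lin: "linear_on ?W (T k)" if k: "k \<in> ?I" for k
    unfolding linear_on_def
  proof (intro conjI ballI allI)
    fix f g assume "f \<in> ?W" "g \<in> ?W"
    then obtain x y where xy: "x \<in> P" "f = \<Psi> x" "y \<in> P" "g = \<Psi> y" using T_ex by blast
    show "T k (f + g) = T k f + T k g"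
      using T\<Psi>[OF P_add[OF xy(1,3)], of k] k unfolding xy(2,4) \<Psi>_add T\<Psi>[OF xy(1)] T\<Psi>[OF xy(3)] by simp
  next
    fix c f assume "f \<in> ?W"
    then obtain x where x: "x \<in> P" "f = \<Psi> x" using T_ex by blast
    show "T k (scale c f) = scale c (T k f)"
      using T\<Psi>[OF P_scale[OF x(1), of c], of k] k unfolding x(2) \<Psi>_scale T\<Psi>[OF x(1)] by simp
  qed
  have T_bij: "bij_betw (\<lambda>f. \<lambda>k\<in>?I. T k f) ?W (PiE ?I ?F)"
  proof -
    have eq: "(\<lambda>k\<in>?I. T k f) = inv_into P \<Psi> f" if f: "f \<in> ?W" for f
    proof -
      obtain x where x: "x \<in> P" "f = \<Psi> x" using T_ex[OF f] by blast
      have "(\<lambda>k\<in>?I. x k) = x" using x(1) unfolding P_def by (auto simp: PiE_iff extensional_restrict)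
      then show ?thesis unfolding T_def x(2) inv_into_f_f[OF inj x(1)] .
    qed
    have "bij_betw \<Psi> P ?W" using inj surj by (simp add: bij_betw_def)
    then have "bij_betw (inv_into P \<Psi>) ?W P" by (rule bij_betw_inv_into)
    then show ?thesis unfolding P_def[symmetric] by (subst bij_betw_cong[where g = "inv_into P \<Psi>"]) (rule eq)
  qed
  have T_equiv: "T k (poly_act r (\<phi> x) f) = F_act l r z (snd k) x (T k f)"
    if x: "x \<in> carrier (K_tilde l r)" and k: "k \<in> ?I" and f: "f \<in> ?W" for x k f
  proof -
    obtain w h where wh: "x = (w, h)" by fastforce
    have h: "h \<in> SL2_pow r" using x K_tilde_carrier by (simp add: wh)
    obtain y where y: "y \<in> P" "f = \<Psi> y" using T_ex[OF f] by blast
    let ?c = "\<Prod>j\<in>{1..l}. w j powi z j"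
    let ?y = "\<lambda>k\<in>?I. scale ?c (F_lin r (snd k) h (y k))"
    have yP: "?y \<in> P"
      unfolding P_def by (auto simp: PiE_iff intro: F_space_scale F_lin_in)
    have "poly_act r (\<phi> x) f = scale ?c (poly_act r h f)"
      unfolding wh using f by (intro char x[unfolded wh]) auto
    also have "poly_act r h f = (\<Sum>k\<in>?I. emb r (snd k) (v k) (F_lin r (snd k) h (y k)))"
      unfolding y(2) \<Psi>_def poly_act_sum
    proof (intro sum.cong refl)
      fix k assume k: "k \<in> ?I"
      have "y k \<in> ?F k" using y(1) k unfolding P_def by (auto dest: PiE_mem)
      then show "poly_act r h (emb r (snd k) (v k) (y k)) = emb r (snd k) (v k) (F_lin r (snd k) h (y k))"
        by (intro emb_equivariant[OF r hw[OF k] vCV[OF k] h])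
    qed
    also have "scale ?c \<dots> = \<Psi> ?y"
      unfolding \<Psi>_def cvec.scale_sum_right by (intro sum.cong refl) (simp add: emb_scale)
    finally have "T k (poly_act r (\<phi> x) f) = ?y k" using T\<Psi>[OF yP] by simp
    also have "\<dots> = F_act l r z (snd k) x (T k f)"
      using k unfolding wh F_act_eq y(2) T\<Psi>[OF y(1)] by simp
    finally show ?thesis .
  qed
  \<comment> \<open>A kernel element acts on the harmonic polynomials as the identity of K, hence
    trivially on every component.\<close>
  have ker: "F_act l r z (snd k) x y = y"
    if k: "k \<in> ?I" and x: "x \<in> kernel (K_tilde l r) K \<phi>" and y: "y \<in> ?F k" for k x y
  proof -
    obtain f where f: "f \<in> ?W" "T k f = y" using T_surj[OF k y] by blast
    have x1: "x \<in> carrier (K_tilde l r)" "\<phi> x = \<one>\<^bsub>K\<^esub>" using x by (auto simp: kernel_def)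
    have "F_act l r z (snd k) x y = T k (poly_act r \<one>\<^bsub>K\<^esub> f)"
      using T_equiv[OF x1(1) k f(1)] x1(2) f(2) by simp
    also have "poly_act r \<one>\<^bsub>K\<^esub> f = f" using rep f(1) unfolding representation_def by blast
    finally show ?thesis using f(2) by simp
  qed
  define \<sigma> where "\<sigma> s = descend (K_tilde l r) \<phi> (F_act l r z s)" for s
  \<comment> \<open>\<open>descend\<close> uses some preimage under \<phi>; equivariance of T holds
    for every preimage, so the choice is absorbed.\<close>
  have pre: "\<exists>x\<in>carrier (K_tilde l r). \<phi> x = g \<and> (\<forall>s. \<sigma> s g = F_act l r z s x)" if g: "g \<in> carrier K" for g
  proof -
    have "g \<in> \<phi> ` carrier (K_tilde l r)" using g \<phi> by simp
    then have "inv_into (carrier (K_tilde l r)) \<phi> g \<in> carrier (K_tilde l r)"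
      "\<phi> (inv_into (carrier (K_tilde l r)) \<phi> g) = g"
      by (rule inv_into_into, rule f_inv_into_f)
    then show ?thesis unfolding \<sigma>_def descend_def by blast
  qed
  have T_\<sigma>: "T k (poly_act r g f) = \<sigma> (snd k) g (T k f)" if g: "g \<in> carrier K" and "k \<in> ?I" "f \<in> ?W" for g k f
  proof -
    obtain x where "x \<in> carrier (K_tilde l r)" "\<phi> x = g" "\<sigma> (snd k) g = F_act l r z (snd k) x" using pre[OF g] by blast
    then show ?thesis using T_equiv[of x k f] that by simp
  qed
  have act_W: "poly_act r g f \<in> ?W" if "g \<in> carrier K" "f \<in> ?W" for g f
    using rep that unfolding representation_def by blast
  have \<sigma>_F: "\<sigma> s g y \<in> F_space r s" if g: "g \<in> carrier K" for s g y
  proof -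
    obtain x where x: "\<sigma> s g = F_act l r z s x" using pre[OF g] by blast
    obtain w h where "x = (w, h)" by fastforce
    then show ?thesis unfolding x by (simp add: F_act_eq F_space_scale F_lin_in)
  qed
  have \<sigma>_rep: "representation K (?F k) (\<sigma> (snd k))" if k: "k \<in> ?I" for k
    unfolding representation_def
  proof (intro conjI ballI)
    show "group K" by (rule K(1))
    show "cvec.subspace (?F k)" by (rule subspace_F_space)
    show "\<sigma> (snd k) g ` ?F k \<subseteq> ?F k" if "g \<in> carrier K" for g using \<sigma>_F[OF that] by blast
    show "linear_on (?F k) (\<sigma> (snd k) g)" if g: "g \<in> carrier K" for g
    proof -
      obtain x where x: "\<sigma> (snd k) g = F_act l r z (snd k) x" using pre[OF g] by blast
      obtain w h where "x = (w, h)" by fastforce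
      then show ?thesis
        unfolding x linear_on_def by (simp add: F_act_eq F_lin_add F_lin_scale cvec.scale_right_distrib mult.commute)
    qed
    show "\<sigma> (snd k) \<one>\<^bsub>K\<^esub> y = y" if y: "y \<in> ?F k" for y
    proof -
      obtain f where f: "f \<in> ?W" "T k f = y" using T_surj[OF k y] by blast
      have one: "\<one>\<^bsub>K\<^esub> \<in> carrier K" by (rule group.is_monoid[OF K(1), THEN monoid.one_closed])
      have "poly_act r \<one>\<^bsub>K\<^esub> f = f" using rep f(1) unfolding representation_def by blast
      then show ?thesis using T_\<sigma>[OF one k f(1)] f(2) by simp
    qed
    show "\<sigma> (snd k) (g \<otimes>\<^bsub>K\<^esub> h) y = \<sigma> (snd k) g (\<sigma> (snd k) h y)"
      if g: "g \<in> carrier K" and h: "h \<in> carrier K" and y: "y \<in> ?F k" for g h y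
    proof -
      obtain f where f: "f \<in> ?W" "T k f = y" using T_surj[OF k y] by blast
      have gh: "g \<otimes>\<^bsub>K\<^esub> h \<in> carrier K" using group.is_monoid[OF K(1)] g h by (simp add: monoid.m_closed)
      have "poly_act r (g \<otimes>\<^bsub>K\<^esub> h) f = poly_act r g (poly_act r h f)"
        using rep f(1) g h unfolding representation_def by blast
      then show ?thesis
        using T_\<sigma>[OF gh k f(1)] T_\<sigma>[OF g k act_W[OF h f(1)]] T_\<sigma>[OF h k f(1)] f(2) by simp
    qed
  qed
  have \<sigma>_irr: "irreducible_representation K (?F k) (\<sigma> (snd k))" if k: "k \<in> ?I" for k
    unfolding irreducible_representation_def
  proof (intro conjI allI impI)
    show "representation K (?F k) (\<sigma> (snd k))" by (rule \<sigma>_rep[OF k])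
    have "Poly_Mapping.single (\<lambda>i\<in>{1..r}. 0) 1 \<in> ?F k" by (simp add: F_space_def F_basis_def)
    moreover have "Poly_Mapping.single (\<lambda>i\<in>{1..r}. 0 :: nat) (1::complex) \<noteq> 0"
      by (rule notI, drule arg_cong[where f = "\<lambda>p. lookup p (\<lambda>i\<in>{1..r}. 0)"]) simp
    ultimately show "?F k \<noteq> {0}" by blast
    fix U assume U: "cvec.subspace U \<and> U \<subseteq> ?F k \<and> (\<forall>g\<in>carrier K. \<sigma> (snd k) g ` U \<subseteq> U)"
    have "F_lin r (snd k) h u \<in> U" if h: "h \<in> SL2_pow r" and u: "u \<in> U" for h u
    proof -
      \<comment> \<open>Elements of SL_2^r are lifted with trivial torus part, where
        \<open>F_act\<close> reduces to \<open>F_lin\<close>.\<close>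
      let ?x = "(\<lambda>i\<in>{1..l}. 1, h)"
      have x: "?x \<in> carrier (K_tilde l r)" using h K_tilde_carrier by simp
      then have g: "\<phi> ?x \<in> carrier K" using \<phi> by blast
      obtain f where f: "f \<in> ?W" "T k f = u" using T_surj[OF k] U u by blast
      have "F_lin r (snd k) h u = F_act l r z (snd k) ?x u" by (simp add: F_act_eq)
      also have "\<dots> = \<sigma> (snd k) (\<phi> ?x) u"
        using T_equiv[OF x k f(1)] T_\<sigma>[OF g k f(1)] f(2) by simp
      also have "\<dots> \<in> U" using U u g by blast
      finally show ?thesis .
    qed
    then show "U = {0} \<or> U = ?F k"
      using U by (intro F_irreducible[OF r hw[OF k] vnz[OF k] vCV[OF k]]) auto
  qed
  have "irreducible_decomposition K ?W (poly_act r) ?I (\<lambda>(m, s). F_space r s) (\<lambda>(m, s). \<sigma> s)"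
    unfolding irreducible_decomposition_def isomorphic_to_direct_sum_def
  proof (intro conjI rep fin exI[of _ T] ballI)
    have cp: "(case k of (m, s) \<Rightarrow> F_space r s) = ?F k" "(case k of (m, s) \<Rightarrow> \<sigma> s) = \<sigma> (snd k)"
      for k :: "(nat \<Rightarrow> nat) \<times> (nat \<Rightarrow> nat)" by (simp_all add: case_prod_beta)
    show "irreducible_representation K (case k of (m, s) \<Rightarrow> F_space r s) (case k of (m, s) \<Rightarrow> \<sigma> s)" if "k \<in> ?I" for k
      unfolding cp by (rule \<sigma>_irr[OF that])
    show "linear_on ?W (T k)" if "k \<in> ?I" for k by (rule T_lin[OF that])
    show "T k (poly_act r g f) = (case k of (m, s) \<Rightarrow> \<sigma> s) g (T k f)" if "k \<in> ?I" "g \<in> carrier K" "f \<in> ?W" for k g f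
      unfolding cp by (rule T_\<sigma>[OF that(2,1,3)])
    show "bij_betw (\<lambda>f. \<lambda>k\<in>?I. T k f) ?W (\<Pi>\<^sub>E k\<in>?I. case k of (m, s) \<Rightarrow> F_space r s)"
      unfolding cp by (rule T_bij)
  qed
  moreover have "\<forall>(m, s)\<in>?I. \<forall>x\<in>kernel (K_tilde l r) K \<phi>. \<forall>v\<in>F_space r s. F_act l r z s x v = v"
  proof
    fix k assume k: "k \<in> ?I"
    obtain m s where ms: "k = (m, s)" by fastforce
    show "case k of (m, s) \<Rightarrow> \<forall>x\<in>kernel (K_tilde l r) K \<phi>. \<forall>v\<in>F_space r s. F_act l r z s x v = v"
      unfolding ms case_prod_conv using ker[OF k] unfolding ms snd_conv by (intro ballI)
  qed
  ultimately show ?thesis unfolding W \<sigma>_def by (intro conjI)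
qed

end

section \<open>The central characters of the two coverings\<close>

lemma powi_prod: "(\<Prod>a\<in>A. f a) powi k = (\<Prod>a\<in>A. f a powi k)" for f :: "'a \<Rightarrow> complex"
  by (induction A rule: infinite_finite_induct) (auto simp: power_int_mult_distrib)

lemma char_GL:
  assumes r: "r \<ge> 2" and x: "(w, h) \<in> carrier (K_tilde r r)" and f: "f \<in> CV_graded r n"
  shows "poly_act r (phi_GL r (w, h)) f = scale (\<Prod>j\<in>{1..r}. w j powi (int (n j) - int (n (prv r j)))) (poly_act r h f)"
proof -
  have "w i \<noteq> 0" "invertible (h i)" if "i \<in> {1..r}" for i
    using x that by (auto simp: K_tilde_def Cstar_def SL2_def PiE_iff invertible_det_nz)
  then show ?thesis
    unfolding phi_GL_def case_prod_conv
    by (subst poly_act_scalar[OF r _ _ f]) (simp_all add: scalar_char_def del: atLeastAtMost_iff)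
qed

text \<open>The last scalar is the product of the inverses of the w_j, so d_r is subtracted from
  every exponent d_j; this is the additional part - n_r + n_(r-1) of z.\<close>

lemma char_S:
  assumes r: "r \<ge> 2" and x: "(w, h) \<in> carrier (K_tilde (r - 1) r)" and f: "f \<in> CV_graded r n"
  shows "poly_act r (phi_S r (w, h)) f = scale (\<Prod>j\<in>{1..r-1}. w j powi
    (int (n j) - int (n (prv r j)) - int (n r) + int (n (prv r r)))) (poly_act r h f)"
proof -
  define u where "u i = (if i < r then w i else (\<Prod>j\<in>{1..r-1}. inverse (w j)))" for i
  define d where "d i = int (n i) - int (n (prv r i))" for i
  have w: "w i \<noteq> 0" if "i \<in> {1..r-1}" for i
    using x that by (auto simp: K_tilde_def Cstar_def PiE_iff)
  have h: "invertible (h i)" if "i \<in> {1..r}" for i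
    using x that by (auto simp: K_tilde_def SL2_def PiE_iff invertible_det_nz)
  have u: "u i \<noteq> 0" if "i \<in> {1..r}" for i
    using that w by (auto simp: u_def)
  have "poly_act r (phi_S r (w, h)) f = scale (scalar_char r u (\<lambda>i. int (n i))) (poly_act r h f)"
    unfolding phi_S_def case_prod_conv u_def[symmetric] by (rule poly_act_scalar[OF r u h f])
  also have "scalar_char r u (\<lambda>i. int (n i)) = u r powi d r * (\<Prod>i\<in>{1..r-1}. u i powi d i)"
    unfolding scalar_char_def d_def using r by (intro prod_split_last) simp
  also have "(\<Prod>i\<in>{1..r-1}. u i powi d i) = (\<Prod>i\<in>{1..r-1}. w i powi d i)"
    using r by (intro prod.cong refl) (auto simp: u_def)
  also have "u r powi d r = (\<Prod>i\<in>{1..r-1}. inverse (w i) powi d r)"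
    by (simp add: u_def powi_prod)
  also have "\<dots> * (\<Prod>i\<in>{1..r-1}. w i powi d i) = (\<Prod>i\<in>{1..r-1}. w i powi (d i - d r))"
    unfolding prod.distrib[symmetric]
    by (intro prod.cong refl) (simp add: power_int_diff w power_int_inverse divide_inverse mult.commute)
  also have "\<dots> = (\<Prod>j\<in>{1..r-1}. w j powi (int (n j) - int (n (prv r j)) - int (n r) + int (n (prv r r))))"
    by (intro prod.cong refl arg_cong2[where f = "(powi)"]) (simp add: d_def)
  finally show ?thesis .
qed

theorem theorem1:
  fixes r :: nat
  assumes "r \<ge> 2"
  shows
    "(\<forall>n :: nat \<Rightarrow> nat.
        let K = S_GL2_pow r;
            z = (\<lambda>i. int (n i) - int (n (prv r i)) - int (n r) + int (n (prv r r)));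
            I = (SIGMA m : boundary r (Lambda_big r n). boundary r (lambda_small r m))
        in (\<forall>(m, s)\<in>I. \<forall>x\<in>kernel (K_tilde (r - 1) r) K (phi_S r). \<forall>v\<in>F_space r s.
              F_act (r - 1) r z s x v = v) \<and>
           irreducible_decomposition K (harmonic_graded K r n) (poly_act r) I
             (\<lambda>(m, s). F_space r s)
             (\<lambda>(m, s). descend (K_tilde (r - 1) r) (phi_S r) (F_act (r - 1) r z s))) \<and>
     (\<forall>n :: nat \<Rightarrow> nat.
        let K = GL2_pow r;
            z = (\<lambda>i. int (n i) - int (n (prv r i)));
            I = (SIGMA m : boundary r (Lambda_big r n). boundary r (lambda_small r m))
        in (\<forall>(m, s)\<in>I. \<forall>x\<in>kernel (K_tilde r r) K (phi_GL r). \<forall>v\<in>F_space r s.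
              F_act r r z s x v = v) \<and>
           irreducible_decomposition K (harmonic_graded K r n) (poly_act r) I
             (\<lambda>(m, s). F_space r s)
             (\<lambda>(m, s). descend (K_tilde r r) (phi_GL r) (F_act r r z s)))"
proof (intro conjI allI)
  have S_GL: "carrier (S_GL2_pow r) \<subseteq> carrier (GL2_pow r)" by (auto simp: S_GL2_pow_def)
  have r1: "r \<ge> 1" using assms by simp
  fix n :: "nat \<Rightarrow> nat"
  show "let K = S_GL2_pow r;
            z = (\<lambda>i. int (n i) - int (n (prv r i)) - int (n r) + int (n (prv r r)));
            I = (SIGMA m : boundary r (Lambda_big r n). boundary r (lambda_small r m))
        in (\<forall>(m, s)\<in>I. \<forall>x\<in>kernel (K_tilde (r - 1) r) K (phi_S r). \<forall>v\<in>F_space r s.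
              F_act (r - 1) r z s x v = v) \<and>
           irreducible_decomposition K (harmonic_graded K r n) (poly_act r) I
             (\<lambda>(m, s). F_space r s)
             (\<lambda>(m, s). descend (K_tilde (r - 1) r) (phi_S r) (F_act (r - 1) r z s))"
    unfolding Let_def
    by (rule harmonic_decomposition[OF assms group_S_GL2_pow order_refl S_GL S_GL2_pow_simps phi_S_surj[OF r1]])
      (rule char_S[OF assms])
  show "let K = GL2_pow r;
            z = (\<lambda>i. int (n i) - int (n (prv r i)));
            I = (SIGMA m : boundary r (Lambda_big r n). boundary r (lambda_small r m))
        in (\<forall>(m, s)\<in>I. \<forall>x\<in>kernel (K_tilde r r) K (phi_GL r). \<forall>v\<in>F_space r s.
              F_act r r z s x v = v) \<and>
           irreducible_decomposition K (harmonic_graded K r n) (poly_act r) I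
             (\<lambda>(m, s). F_space r s)
             (\<lambda>(m, s). descend (K_tilde r r) (phi_GL r) (F_act r r z s))"
    unfolding Let_def
    by (rule harmonic_decomposition[OF assms group_GL2_pow S_GL order_refl refl refl phi_GL_surj])
      (rule char_GL[OF assms])
qed

end
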